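(* Let $R>0$. The operators $I_R^+$ and $I_R^-$ coincide on the discrete series component of $\mathcal H(\mathbb H_{\mathbb R}^+)$. Moreover, for $l=-1,-\frac32,-2,\dots$ and $m,n\in\mathbb Z+l$ with $m,n\ge-l$ or $m,n\le l$, both operators $I_R^\pm$ send $$N(Z)^{-2l-1}t^l_{n\,\underline m}(Z)\mapsto\begin{cases}-N(W)^{-2l-1}t^l_{n\,\underline m}(W)&\text{if }N(W)\le R^2,\\-R^{-2(2l+1)}t^l_{n\,\underline m}(W)&\text{if }N(W)\ge R^2,\end{cases}$$ $$t^l_{n\,\underline m}(Z)\mapsto\begin{cases}R^{2(2l+1)}N(W)^{-2l-1}t^l_{n\,\underline m}(W)&\text{if }N(W)\le R^2,\\t^l_{n\,\underline m}(W)&\text{if }N(W)\ge R^2,\end{cases}\qquad W\in\mathbb H_{\mathbb R}^+.$$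
   Context: $\mathbb H_{\mathbb C}$ is the algebra of complex $2\times2$ matrices $Z=(z_{ij})$, $N(Z)=\det Z$, $\|Z\|^2=\frac12\sum|z_{ij}|^2$. $\mathbb H_{\mathbb R}=\{Z: z_{22}=\overline{z_{11}},\,z_{21}=\overline{z_{12}}\}\cong\mathbb R^4$, with real coordinates $z_{11}=x^0-ix^3$, $z_{12}=x^1+ix^2$. $\mathbb H_{\mathbb R}^+=\{X\in\mathbb H_{\mathbb R}:N(X)>0\}$, $H_R=\{X\in\mathbb H_{\mathbb R}:N(X)=R^2\}$, $dS$ is the Euclidean surface measure on $H_R$. $\square_{2,2}=\partial_{x^0}^2-\partial_{x^1}^2-\partial_{x^2}^2+\partial_{x^3}^2$; $\widetilde{\deg}=1+\sum_{i=0}^3x^i\partial_{x^i}$. $\mathcal S(\mathbb H_{\mathbb R}^+)$ is the space of smooth functions $f$ on $\mathbb H_{\mathbb R}^+$ such that for each $a\in\mathcal U(\mathfrak{gl}(2,\mathbb R))\otimes\mathcal U(\mathfrak{gl}(2,\mathbb R))$ (acting by differentiating $f(X)\mapsto f(p^{-1}Xq)$, $p,q\in\mathbb H_{\mathbb R}^+$), $n\in\mathbb N$, $\rho>1$, there is a constant $C$ with $|a\cdot f(X)|\le C(1+|\log\|X\||)^{-n}/\|X\|$ whenever $\rho^{-2}\le N(X)\le\rho^2$; it is a Fréchet space with the corresponding seminorms. $\mathcal H(\mathbb H_{\mathbb R}^+)=\{\phi\in\mathcal S(\mathbb H_{\mathbb R}^+):\square_{2,2}\phi=0\}$. For $\phi\in\mathcal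 H(\mathbb H_{\mathbb R}^+)$ and $W\in\mathbb H_{\mathbb R}^+$, $$(I_R^\pm\phi)(W)=\lim_{\epsilon\to0^+}\frac1{2\pi^2}\int_{X\in H_R}\frac{(\widetilde{\deg}\phi)(X)}{N(X-W)\pm i\epsilon}\,\frac{dS}{\|X\|}.$$ For $l\in\{-1,-\frac32,\dots\}$ and $m,n\in\mathbb Z+l$, $Z\in\mathbb H_{\mathbb R}^+$, $$t^l_{n\,\underline m}(Z)=\frac1{2\pi i}\oint_{|s|=1}(sz_{11}+z_{21})^{l-m}(sz_{12}+z_{22})^{l+m}s^{-l+n}\frac{ds}s.$$ The discrete series component of $\mathcal H(\mathbb H_{\mathbb R}^+)$ is the closed span of the functions $t^l_{n\,\underline m}(Z)$ and $N(Z)^{-2l-1}t^l_{n\,\underline m}(Z)$ with $l\in\{-1,-\frac32,-2,\dots\}$, $m,n\in\mathbb Z+l$, and either $m,n\ge-l$ or $m,n\le l$. *)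

theory Defs
  imports "HOL-Complex_Analysis.Complex_Analysis"
begin

no_notation fps_nth (infixl "$" 75)

section \<open>Split quaternions\<close>

text \<open>
  The space \<open>\<bbbH>\<^sub>\<real>\<close> is represented by its real coordinates \<open>(x\<^sup>0, x\<^sup>1, x\<^sup>2, x\<^sup>3)\<close>. In the
  index type \<^typ>\<open>4\<close> the numerals are read modulo 4, so its elements are \<open>0, 1, 2, 3\<close> and the
  coordinate \<open>x\<^sup>i\<close> of \<open>X\<close> is literally \<open>X $ i\<close>.
\<close>

definition qmat :: "real^4 \<Rightarrow> complex^2^2" where
  "qmat X = vector [vector [Complex (X$0) (- X$3), Complex (X$1) (X$2)],
                    vector [Complex (X$1) (- X$2), Complex (X$0) (X$3)]]"

definition qcoord :: "complex^2^2 \<Rightarrow> real^4" where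
  "qcoord Z = (\<chi> i. if i = 0 then Re (Z$1$1) else if i = 1 then Re (Z$1$2)
                    else if i = 2 then Im (Z$1$2) else - Im (Z$1$1))"

definition qmult :: "real^4 \<Rightarrow> real^4 \<Rightarrow> real^4" where
  "qmult A B = qcoord (qmat A ** qmat B)"

text \<open>The determinant is real on \<open>\<bbbH>\<^sub>\<real>\<close>; see \<open>det_qmat\<close> below.\<close>

definition qN :: "real^4 \<Rightarrow> real" where
  "qN X = Re (det (qmat X))"

definition HRplus :: "(real^4) set" where
  "HRplus = {X. qN X > 0}"

definition hyperboloid :: "real \<Rightarrow> (real^4) set" where
  "hyperboloid R = {X. qN X = R\<^sup>2}"

lemma distinct_index_4 [simp]:
  "(1::4) \<noteq> 0" "(2::4) \<noteq> 0" "(3::4) \<noteq> 0" "(2::4) \<noteq> 1" "(3::4) \<noteq> 1" "(3::4) \<noteq> 2"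
  "(0::4) \<noteq> 1" "(0::4) \<noteq> 2" "(0::4) \<noteq> 3" "(1::4) \<noteq> 2" "(1::4) \<noteq> 3" "(2::4) \<noteq> 3"
  by simp_all

lemma four_eq_zero: "(4::4) = 0"
  by simp

lemma index_4_cases: "(\<forall>i::4. P i) \<longleftrightarrow> P 0 \<and> P 1 \<and> P 2 \<and> P 3"
  using forall_4[of P] by (auto simp: four_eq_zero)

lemma sum_index_4: "sum f (UNIV::4 set) = f 0 + f 1 + f 2 + f 3"
  using sum_4[of f] by (simp add: four_eq_zero ac_simps)

lemma qmat_nth:
  "qmat X $ 1 $ 1 = Complex (X$0) (- X$3)" "qmat X $ 1 $ 2 = Complex (X$1) (X$2)"
  "qmat X $ 2 $ 1 = Complex (X$1) (- X$2)" "qmat X $ 2 $ 2 = Complex (X$0) (X$3)"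
  by (simp_all add: qmat_def)

lemma qcoord_qmat [simp]: "qcoord (qmat X) = X"
  by (simp add: vec_eq_iff index_4_cases qcoord_def qmat_nth)

lemma range_qmat: "range qmat = {Z. Z$2$2 = cnj (Z$1$1) \<and> Z$2$1 = cnj (Z$1$2)}"
proof (intro equalityI subsetI)
  fix Z assume "Z \<in> {Z :: complex^2^2. Z$2$2 = cnj (Z$1$1) \<and> Z$2$1 = cnj (Z$1$2)}"
  hence "Z = qmat (qcoord Z)"
    by (simp add: vec_eq_iff forall_2 qmat_nth qcoord_def complex_eq_iff)
  thus "Z \<in> range qmat" by blast
qed (auto simp: qmat_nth complex_eq_iff)

lemma qmat_qmult: "qmat (qmult A B) = qmat A ** qmat B"
proof -
  have "qmat A ** qmat B \<in> range qmat"
    unfolding range_qmat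
    by (simp add: matrix_matrix_mult_def sum_2 qmat_nth complex_eq_iff algebra_simps)
  thus ?thesis by (auto simp: qmult_def)
qed

lemma qN_eq: "qN X = (X$0)\<^sup>2 - (X$1)\<^sup>2 - (X$2)\<^sup>2 + (X$3)\<^sup>2"
  by (simp add: qN_def det_2 qmat_nth power2_eq_square)

lemma det_qmat: "det (qmat X) = complex_of_real (qN X)"
  by (simp add: qN_eq det_2 qmat_nth power2_eq_square complex_eq_iff)

lemma norm_eq_matrix_norm:
  "(norm X)\<^sup>2 = (1/2) * (\<Sum>i\<in>UNIV. \<Sum>j\<in>UNIV. (cmod (qmat X $ i $ j))\<^sup>2)"
proof -
  have "(norm X)\<^sup>2 = (X$0)\<^sup>2 + (X$1)\<^sup>2 + (X$2)\<^sup>2 + (X$3)\<^sup>2"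
    unfolding power2_norm_eq_inner
    by (simp add: inner_vec_def sum_index_4 power2_eq_square)
  thus ?thesis
    by (simp add: sum_2 qmat_nth cmod_power2)
qed


section \<open>Differential operators\<close>

definition partial :: "4 \<Rightarrow> (real^4 \<Rightarrow> complex) \<Rightarrow> real^4 \<Rightarrow> complex" where
  "partial i f X = frechet_derivative f (at X) (axis i 1)"

text \<open>Smoothness on an open set: partial derivatives of all orders exist and are differentiable.\<close>

definition smooth_on :: "(real^4) set \<Rightarrow> (real^4 \<Rightarrow> complex) \<Rightarrow> bool" where
  "smooth_on S f \<longleftrightarrow> (\<forall>is. \<forall>X\<in>S. foldr partial is f differentiable (at X))"

definition box22 :: "(real^4 \<Rightarrow> complex) \<Rightarrow> real^4 \<Rightarrow> complex" where
  "box22 f X = partial 0 (partial 0 f) X - partial 1 (partial 1 f) X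
             - partial 2 (partial 2 f) X + partial 3 (partial 3 f) X"

definition deg_tilde :: "(real^4 \<Rightarrow> complex) \<Rightarrow> real^4 \<Rightarrow> complex" where
  "deg_tilde f X = f X + (\<Sum>i\<in>UNIV. complex_of_real (X$i) * partial i f X)"

text \<open>
  The group \<open>\<bbbH>\<^sub>\<real>\<^sup>+\<close> is open in \<open>\<bbbH>\<^sub>\<real>\<close>, so its Lie algebra \<open>gl(2,\<real>)\<close> is \<open>\<bbbH>\<^sub>\<real>\<close> itself. Differentiating
  \<open>f(p\<inverse>Xq)\<close> at \<open>p = q = 1\<close> in the direction \<open>(A, 0)\<close>, respectively \<open>(0, B)\<close>, gives the derivative of
  \<open>f\<close> at \<open>X\<close> in the direction \<open>-AX\<close>, respectively \<open>XB\<close>.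
\<close>

definition left_action :: "real^4 \<Rightarrow> (real^4 \<Rightarrow> complex) \<Rightarrow> real^4 \<Rightarrow> complex" where
  "left_action A f X = frechet_derivative f (at X) (- qmult A X)"

definition right_action :: "real^4 \<Rightarrow> (real^4 \<Rightarrow> complex) \<Rightarrow> real^4 \<Rightarrow> complex" where
  "right_action B f X = frechet_derivative f (at X) (qmult X B)"

text \<open>
  The operators by which the elements of \<open>U(gl(2,\<real>)) \<otimes> U(gl(2,\<real>))\<close> act: the unital associative
  algebra of operators generated by the two infinitesimal actions.
\<close>

inductive_set enveloping_ops :: "((real^4 \<Rightarrow> complex) \<Rightarrow> real^4 \<Rightarrow> complex) set" where
  one: "(\<lambda>f. f) \<in> enveloping_ops"
| left: "left_action A \<in> enveloping_ops"
| right: "right_action B \<in> enveloping_ops"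
| scale: "D \<in> enveloping_ops \<Longrightarrow> (\<lambda>f X. (c::real) *\<^sub>R D f X) \<in> enveloping_ops"
| add: "D \<in> enveloping_ops \<Longrightarrow> E \<in> enveloping_ops \<Longrightarrow> (\<lambda>f X. D f X + E f X) \<in> enveloping_ops"
| mult: "D \<in> enveloping_ops \<Longrightarrow> E \<in> enveloping_ops \<Longrightarrow> (\<lambda>f. D (E f)) \<in> enveloping_ops"


section \<open>The spaces of functions\<close>

text \<open>
  Functions on \<open>\<bbbH>\<^sub>\<real>\<^sup>+\<close> are total functions whose values outside \<^term>\<open>HRplus\<close> are irrelevant. All
  conditions below and the seminorms depend only on the restriction to \<^term>\<open>HRplus\<close>.
\<close>

definition shell :: "real \<Rightarrow> (real^4) set" where
  "shell \<rho> = {X \<in> HRplus. 1 / \<rho>\<^sup>2 \<le> qN X \<and> qN X \<le> \<rho>\<^sup>2}"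

definition S_space :: "(real^4 \<Rightarrow> complex) set" where
  "S_space = {f. smooth_on HRplus f \<and>
     (\<forall>D\<in>enveloping_ops. \<forall>n::nat. \<forall>\<rho>>1. \<exists>C. \<forall>X\<in>shell \<rho>.
        cmod (D f X) \<le> C / ((1 + \<bar>ln (norm X)\<bar>) ^ n * norm X))}"

definition S_seminorm ::
    "((real^4 \<Rightarrow> complex) \<Rightarrow> real^4 \<Rightarrow> complex) \<Rightarrow> nat \<Rightarrow> real \<Rightarrow> (real^4 \<Rightarrow> complex) \<Rightarrow> real" where
  "S_seminorm D n \<rho> f =
     (SUP X\<in>shell \<rho>. (1 + \<bar>ln (norm X)\<bar>) ^ n * norm X * cmod (D f X))"

definition H_space :: "(real^4 \<Rightarrow> complex) set" where
  "H_space = {\<phi> \<in> S_space. \<forall>X\<in>HRplus. box22 \<phi> X = 0}"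

definition complex_span :: "('a \<Rightarrow> complex) set \<Rightarrow> ('a \<Rightarrow> complex) set" where
  "complex_span G = {\<lambda>X. \<Sum>g\<in>T. c g * g X | T c. finite T \<and> T \<subseteq> G}"

text \<open>Closure in \<^term>\<open>H_space\<close> for the locally convex topology given by the seminorms.\<close>

definition H_closure :: "(real^4 \<Rightarrow> complex) set \<Rightarrow> (real^4 \<Rightarrow> complex) set" where
  "H_closure V = {\<phi> \<in> H_space. \<forall>F. finite F \<and> F \<subseteq> enveloping_ops \<times> UNIV \<times> {1<..} \<longrightarrow>
     (\<forall>e>0. \<exists>\<psi>\<in>V. \<forall>(D, n, \<rho>)\<in>F. S_seminorm D n \<rho> (\<lambda>X. \<phi> X - \<psi> X) < e)}"


section \<open>The discrete series component\<close>

text \<open>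
  The indices \<open>l\<close>, \<open>m\<close>, \<open>n\<close> are reals (integers or half-integers). The exponents \<open>l - m\<close>, \<open>l + m\<close>
  and \<open>n - l\<close> are integers for the admissible indices, so the floors are exact.
\<close>

definition t_fun :: "real \<Rightarrow> real \<Rightarrow> real \<Rightarrow> real^4 \<Rightarrow> complex" where
  "t_fun l n m X = (let Z = qmat X in
     1 / (2 * of_real pi * \<i>) *
     contour_integral (circlepath 0 1)
       (\<lambda>s. (s * Z$1$1 + Z$2$1) powi \<lfloor>l - m\<rfloor> * (s * Z$1$2 + Z$2$2) powi \<lfloor>l + m\<rfloor>
            * s powi \<lfloor>- l + n\<rfloor> / s))"

definition N_t_fun :: "real \<Rightarrow> real \<Rightarrow> real \<Rightarrow> real^4 \<Rightarrow> complex" where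
  "N_t_fun l n m X = complex_of_real (qN X powr (- 2 * l - 1)) * t_fun l n m X"

definition ds_index :: "real \<Rightarrow> real \<Rightarrow> real \<Rightarrow> bool" where
  "ds_index l m n \<longleftrightarrow> (\<exists>k::nat. l = - 1 - real k / 2) \<and> m - l \<in> \<int> \<and> n - l \<in> \<int> \<and>
     (m \<ge> - l \<and> n \<ge> - l \<or> m \<le> l \<and> n \<le> l)"

definition discrete_series :: "(real^4 \<Rightarrow> complex) set" where
  "discrete_series = H_closure (complex_span
     ({t_fun l n m | l n m. ds_index l m n} \<union> {N_t_fun l n m | l n m. ds_index l m n}))"


section \<open>Surface measure\<close>

text \<open>
  The Euclidean surface measure of an injectively parametrized surface \<open>\<gamma> ` U\<close>: the image of
  Lebesgue measure on \<open>U\<close> with density the square root of the Gram determinant of the partial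
  derivatives of \<open>\<gamma>\<close>.
\<close>

definition gram :: "(real^'k \<Rightarrow> 'a::euclidean_space) \<Rightarrow> real^'k \<Rightarrow> real^'k^'k" where
  "gram \<gamma> u = (\<chi> i j. frechet_derivative \<gamma> (at u) (axis i 1) \<bullet> frechet_derivative \<gamma> (at u) (axis j 1))"

definition surface_measure :: "(real^'k \<Rightarrow> 'a::euclidean_space) \<Rightarrow> (real^'k) set \<Rightarrow> 'a measure" where
  "surface_measure \<gamma> U =
     distr (density lborel (\<lambda>u. indicator U u * ennreal (sqrt (det (gram \<gamma> u))))) borel \<gamma>"

definition hyp_param :: "real \<Rightarrow> real^3 \<Rightarrow> real^4" where
  "hyp_param R u = (let r = sqrt (R\<^sup>2 + (u$1)\<^sup>2 + (u$2)\<^sup>2) in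
     \<chi> i. if i = 0 then r * cos (u$3) else if i = 1 then u$1
          else if i = 2 then u$2 else r * sin (u$3))"

definition hyp_domain :: "(real^3) set" where
  "hyp_domain = {u. 0 \<le> u$3 \<and> u$3 < 2 * pi}"

lemma hyp_param_bij:
  assumes "R > 0"
  shows "bij_betw (hyp_param R) hyp_domain (hyperboloid R)"
proof (rule bij_betw_imageI)
  have pos: "R\<^sup>2 + a\<^sup>2 + b\<^sup>2 > 0" for a b :: real
    using assms by (simp add: add_pos_nonneg)
  show "inj_on (hyp_param R) hyp_domain"
  proof (rule inj_onI)
    fix u v assume u: "u \<in> hyp_domain" and v: "v \<in> hyp_domain"
      and eq: "hyp_param R u = hyp_param R v"
    define r where "r = sqrt (R\<^sup>2 + (u$1)\<^sup>2 + (u$2)\<^sup>2)"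
    have comp: "hyp_param R u $ i = hyp_param R v $ i" for i using eq by simp
    have 12: "u$1 = v$1" "u$2 = v$2"
      using comp[of 1] comp[of 2] by (simp_all add: hyp_param_def Let_def)
    have r: "r > 0" using pos by (simp add: r_def)
    have "cos (u$3) = cos (v$3)" "sin (u$3) = sin (v$3)"
      using comp[of 0] comp[of 3] 12 r by (simp_all add: hyp_param_def Let_def r_def)
    then obtain k :: int where k: "u$3 = v$3 + 2 * pi * k"
      using sin_cos_eq_iff[of "u$3" "v$3"] by auto
    have "2 * pi * real_of_int k < 2 * pi * 1" "2 * pi * (- 1) < 2 * pi * real_of_int k"
      using u v k by (simp_all only: hyp_domain_def mem_Collect_eq) linarith+
    hence "real_of_int k < 1" "- 1 < real_of_int k"
      by (simp_all only: mult_less_cancel_left_pos pi_gt_zero zero_less_mult_iff zero_less_numeral simp_thms)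
    hence "k = 0" by linarith
    hence "u$3 = v$3" using k by simp
    with 12 show "u = v" by (simp add: vec_eq_iff forall_3)
  qed
  show "hyp_param R ` hyp_domain = hyperboloid R"
  proof (intro equalityI subsetI)
    fix X assume "X \<in> hyp_param R ` hyp_domain"
    then obtain u where X: "X = hyp_param R u" by blast
    define s where "s = R\<^sup>2 + (u$1)\<^sup>2 + (u$2)\<^sup>2"
    have "qN X = s * ((cos (u$3))\<^sup>2 + (sin (u$3))\<^sup>2) - (u$1)\<^sup>2 - (u$2)\<^sup>2"
      using pos[of "u$1" "u$2"]
      by (simp add: X qN_eq hyp_param_def Let_def power_mult_distrib s_def algebra_simps del: sin_cos_squared_add sin_cos_squared_add2)
    thus "X \<in> hyperboloid R" by (simp add: hyperboloid_def s_def)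
  next
    fix X assume X: "X \<in> hyperboloid R"
    define r where "r = sqrt (R\<^sup>2 + (X$1)\<^sup>2 + (X$2)\<^sup>2)"
    have r: "r > 0" using pos by (simp add: r_def)
    have "(X$0)\<^sup>2 + (X$3)\<^sup>2 = r\<^sup>2"
      using X pos[of "X$1" "X$2"] by (simp add: hyperboloid_def qN_eq r_def)
    hence "(X$0 / r)\<^sup>2 + (X$3 / r)\<^sup>2 = 1"
      using r by (simp add: power_divide add_divide_distrib[symmetric])
    then obtain t where t: "0 \<le> t" "t < 2 * pi" "X$0 / r = cos t" "X$3 / r = sin t"
      using sincos_total_2pi by metis
    define u :: "real^3" where "u = vector [X$1, X$2, t]"
    have "hyp_param R u = X"
      using t(3,4) r
      by (simp add: vec_eq_iff index_4_cases hyp_param_def Let_def u_def divide_eq_eq mult.commute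
          flip: r_def)
    moreover have "u \<in> hyp_domain" using t by (simp add: hyp_domain_def u_def)
    ultimately show "X \<in> hyp_param R ` hyp_domain" by blast
  qed
qed

lemma hyp_gram:
  assumes "R > 0"
  shows "det (gram (hyp_param R) u) = (norm (hyp_param R u))\<^sup>2"
proof -
  define a b t where "a = u$1" "b = u$2" "t = u$3"
  define r where "r = sqrt (R\<^sup>2 + a\<^sup>2 + b\<^sup>2)"
  have s: "R\<^sup>2 + a\<^sup>2 + b\<^sup>2 > 0" using assms by (simp add: add_pos_nonneg)
  hence r: "r > 0" "r\<^sup>2 = R\<^sup>2 + a\<^sup>2 + b\<^sup>2" by (simp_all add: r_def)
  define D :: "real^3 \<Rightarrow> real^4" where "D h = (\<chi> i.
      if i = 0 then (a * h$1 + b * h$2) / r * cos t - r * sin t * h$3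
      else if i = 1 then h$1 else if i = 2 then h$2
      else (a * h$1 + b * h$2) / r * sin t + r * cos t * h$3)" for h
  have nth: "((\<lambda>u::real^3. u$i) has_derivative (\<lambda>h. h$i)) (at u)" for i
    by (rule bounded_linear_imp_has_derivative) (rule bounded_linear_vec_nth)
  define S where "S v = sqrt (R\<^sup>2 + (v$1)\<^sup>2 + (v$2)\<^sup>2)" for v :: "real^3"
  have Su: "S u = r" by (simp add: S_def r_def a_b_t_def)
  have q: "(S has_derivative (\<lambda>h. (a * h$1 + b * h$2) / r)) (at u)"
    unfolding S_def using s r by (auto intro!: derivative_eq_intros nth simp: a_b_t_def r_def fun_eq_iff field_simps)
  have "(hyp_param R has_derivative D) (at u)"
  proof -
    have "((\<lambda>u. hyp_param R u $ i) has_derivative (\<lambda>h. D h $ i)) (at u)" for i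
    proof -
      have "\<forall>i. ((\<lambda>u. hyp_param R u $ i) has_derivative (\<lambda>h. D h $ i)) (at u)"
        unfolding index_4_cases hyp_param_def Let_def D_def S_def[symmetric]
        by (auto intro!: derivative_eq_intros nth q simp: Su a_b_t_def fun_eq_iff algebra_simps)
      thus ?thesis by blast
    qed
    thus ?thesis
      by (subst has_derivative_componentwise_within) (auto simp: Basis_vec_def inner_axis)
  qed
  hence fd: "frechet_derivative (hyp_param R) (at u) = D"
    by (metis frechet_derivative_at)
  have u: "u$1 = a" "u$2 = b" "u$3 = t" by (simp_all add: a_b_t_def)
  have g: "gram (hyp_param R) u $ i $ j = D (axis i 1) \<bullet> D (axis j 1)" for i j
    by (simp add: gram_def fd)
  have ip: "x \<bullet> y = x$0 * y$0 + x$1 * y$1 + x$2 * y$2 + x$3 * y$3" for x y :: "real^4"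
    by (simp add: inner_vec_def sum_index_4)
  have sc: "sin t * sin t + cos t * cos t = 1"
    using sin_cos_squared_add[of t] by (simp add: power2_eq_square)
  define p q where "p = a / r" and "q = b / r"
  have D1: "D (axis 1 1) = (\<chi> i. if i = 0 then p * cos t else if i = 1 then 1 else if i = 2 then 0 else p * sin t)"
    and D2: "D (axis 2 1) = (\<chi> i. if i = 0 then q * cos t else if i = 1 then 0 else if i = 2 then 1 else q * sin t)"
    and D3: "D (axis 3 1) = (\<chi> i. if i = 0 then - r * sin t else if i = 1 then 0 else if i = 2 then 0 else r * cos t)"
    by (simp_all add: D_def axis_def vec_eq_iff p_def q_def)
  have inn: "D (axis 1 1) \<bullet> D (axis 1 1) = p\<^sup>2 + 1" "D (axis 2 1) \<bullet> D (axis 2 1) = q\<^sup>2 + 1"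
    "D (axis 3 1) \<bullet> D (axis 3 1) = r\<^sup>2" "D (axis 1 1) \<bullet> D (axis 2 1) = p * q"
    "D (axis 1 1) \<bullet> D (axis 3 1) = 0" "D (axis 2 1) \<bullet> D (axis 3 1) = 0"
    unfolding D1 D2 D3 ip using sc by (simp_all add: power2_eq_square) algebra+
  have inn': "D (axis 2 1) \<bullet> D (axis 1 1) = p * q"
    "D (axis 3 1) \<bullet> D (axis 1 1) = 0" "D (axis 3 1) \<bullet> D (axis 2 1) = 0"
    using inn by (simp_all add: inner_commute)
  have "det (gram (hyp_param R) u) = r\<^sup>2 * (1 + p\<^sup>2 + q\<^sup>2)"
    unfolding det_3 g inn inn'
    by (simp add: power2_eq_square algebra_simps)
  also have "\<dots> = r\<^sup>2 + a\<^sup>2 + b\<^sup>2"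
    using r(1) by (simp add: p_def q_def power_divide field_simps)
  also have "\<dots> = (norm (hyp_param R u))\<^sup>2"
    unfolding power2_norm_eq_inner ip hyp_param_def Let_def u r_def[symmetric]
    using sc by simp algebra
  finally show ?thesis .
qed

definition dS :: "real \<Rightarrow> (real^4) measure" where
  "dS R = surface_measure (hyp_param R) hyp_domain"


section \<open>The operators\<close>

text \<open>
  The parameter \<open>\<sigma>\<close> is \<open>1\<close> or \<open>-1\<close> and stands for the sign in \<open>N(X - W) \<plusminus> i\<epsilon>\<close>. The predicate
  \<open>I_converges\<close> says that the integrals exist absolutely and that the limit exists; only then is the
  value of \<open>I_op\<close> meaningful.
\<close>

definition I_integrand ::
    "real \<Rightarrow> real \<Rightarrow> (real^4 \<Rightarrow> complex) \<Rightarrow> real^4 \<Rightarrow> real^4 \<Rightarrow> complex" where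
  "I_integrand \<sigma> \<epsilon> \<phi> W X =
     deg_tilde \<phi> X / (complex_of_real (qN (X - W)) + of_real \<sigma> * \<i> * of_real \<epsilon>) / of_real (norm X)"

definition I_eps :: "real \<Rightarrow> real \<Rightarrow> (real^4 \<Rightarrow> complex) \<Rightarrow> real^4 \<Rightarrow> real \<Rightarrow> complex" where
  "I_eps \<sigma> R \<phi> W \<epsilon> =
     1 / (2 * of_real pi ^ 2) * (LINT X:hyperboloid R|dS R. I_integrand \<sigma> \<epsilon> \<phi> W X)"

definition I_converges :: "real \<Rightarrow> real \<Rightarrow> (real^4 \<Rightarrow> complex) \<Rightarrow> real^4 \<Rightarrow> bool" where
  "I_converges \<sigma> R \<phi> W \<longleftrightarrow>
     (\<forall>\<epsilon>>0. set_integrable (dS R) (hyperboloid R) (I_integrand \<sigma> \<epsilon> \<phi> W)) \<and>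
     (\<exists>L. (I_eps \<sigma> R \<phi> W \<longlongrightarrow> L) (at_right 0))"

definition I_op :: "real \<Rightarrow> real \<Rightarrow> (real^4 \<Rightarrow> complex) \<Rightarrow> real^4 \<Rightarrow> complex" where
  "I_op \<sigma> R \<phi> W = Lim (at_right 0) (I_eps \<sigma> R \<phi> W)"

abbreviation I_plus :: "real \<Rightarrow> (real^4 \<Rightarrow> complex) \<Rightarrow> real^4 \<Rightarrow> complex" where
  "I_plus \<equiv> I_op 1"

abbreviation I_minus :: "real \<Rightarrow> (real^4 \<Rightarrow> complex) \<Rightarrow> real^4 \<Rightarrow> complex" where
  "I_minus \<equiv> I_op (- 1)"

end

theory Submission
  imports Defs
begin

text \<open>
  On \<open>H\<^sub>R\<close> the operator \<open>deg\<close> multiplies \<open>t\<close> by \<open>2l + 1\<close> and \<open>N\<^sup>-\<^sup>2\<^sup>l\<^sup>-\<^sup>1 t\<close>, which is a constant multiple of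
  \<open>t\<close> there, by \<open>-(2l + 1)\<close>. So one integral of \<open>t\<close> against the kernel decides both cases. The measure
  \<open>dS/\<parallel>X\<parallel>\<close> is invariant under all linear maps preserving \<open>N\<close>, in particular under left and right
  multiplication by elements of norm one, which reduces to \<open>W = w \<cdot> 1\<close> with \<open>w > 0\<close>; there
  \<open>N(X - W) = R\<^sup>2 + w\<^sup>2 - 2w Re z\<^sub>1\<^sub>1\<close> depends on \<open>z\<^sub>1\<^sub>1\<close> only. The \<open>t\<close> are the Taylor coefficients in
  \<open>\<eta>, q\<close> of \<open>(z\<^sub>1\<^sub>1 + \<eta> z\<^sub>2\<^sub>1 + q (z\<^sub>1\<^sub>2 + \<eta> z\<^sub>2\<^sub>2))\<close> to the power \<open>2l\<close>, up to factors and complex conjugation;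
  averaging over the phase of \<open>z\<^sub>1\<^sub>2\<close> leaves a power of \<open>z\<^sub>1\<^sub>1\<close>. Its integral over the angle is a
  residue, and the distr_lborel_cmod_power2 integral that remains has an explicit antiderivative, a power of the root of
  the kernel inside the unit disc. As \<open>\<epsilon> \<rightarrow> 0\<close> this root tends to a limit that does not depend on the
  sign of \<open>\<epsilon>\<close> and is given by different formulas for \<open>w \<le> R\<close> and \<open>w \<ge> R\<close>.

  The closure is reached by a bound of the integrals by finitely many seminorms, uniformly in \<open>\<epsilon>\<close>:
  subtract the value at the singular angle and control the difference by the derivative along the
  rotation of \<open>z\<^sub>1\<^sub>1\<close>, which is a combination of left and right invariant fields.
\<close>

section \<open>Lebesgue measure on the complex plane\<close>

text \<open>The invariance of the measure comes from Lebesgue measure on \<open>real^4\<close>: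
  linear maps preserving \<open>qN\<close> have determinant 1 or -1, and slicing the cone
  \<open>qN > 0\<close> by the values of \<open>qN\<close> returns the hyperboloids. The estimates
  are borderline. In the plane of \<open>z_11 = x + i y\<close> the decay \<open>1 / |z_11|\<close>
  and the kernel together have the order \<open>1 / (|x| |z_11|)\<close>, which just fails to be
  integrable; two powers of the logarithm for each real coordinate repair this, and so the exponent
  4 arises. On a circle of large radius the kernel for \<open>\<epsilon> = 0\<close> has two zeros,
  so no bound by absolute values is uniform in \<open>\<epsilon>\<close>; the subtraction leaves an
  inverse square root singularity in the radius, which is integrable. The antiderivative rests on a
  differential equation: with \<open>T = |z_11|^2\<close>, the small root \<open>y\<close> of
  \<open>w T y^2 - G y + w\<close> and the square root \<open>D\<close> of its discriminant satisfy
  \<open>y' = w y^2 / D\<close>, so \<open>y^k / D\<close> is the derivative of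
  \<open>y^(k-1) / (w (k - 1))\<close>. Here \<open>k = -2l \<ge> 2\<close>. The factor
  \<open>1 - k\<close> produced by the degree operator cancels this denominator.\<close>

lemma prod_index_4: "prod f (UNIV::4 set) = f 0 * f 1 * f 2 * f 3"
proof -
  have "(UNIV::4 set) = {0, 1, 2, 3}" using UNIV_4 by (auto simp: four_eq_zero)
  hence "prod f UNIV = prod f {0, 1, 2, 3}" by (rule arg_cong)
  thus ?thesis by (simp add: mult_ac)
qed

lemma lborel_complex_prod:
  "(lborel :: (real^4) measure) =
     distr (lborel :: (complex \<times> complex) measure) borel
       (\<lambda>(a, b). \<chi> i. if i = 0 then Re a else if i = 1 then Re b else if i = 2 then Im b else - Im a)"
proof (rule lborel_eqI)
  fix l u :: "real^4" assume lu: "\<And>b. b \<in> Basis \<Longrightarrow> l \<bullet> b \<le> u \<bullet> b"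
  let ?f = "(\<lambda>(a, b). \<chi> i. if i = 0 then Re a else if i = 1 then Re b else if i = 2 then Im b else - Im a) :: complex \<times> complex \<Rightarrow> real^4"
  have lu': "l $ i \<le> u $ i" for i using lu[of "axis i 1"] by (auto simp: Basis_vec_def inner_axis)
  have [measurable]: "?f \<in> borel_measurable borel"
    unfolding case_prod_beta
    proof (intro borel_measurable_continuous_onI continuous_on_vec_lambda)
    fix i :: 4
    consider "i = 0" | "i = 1" | "i = 2" | "i \<noteq> 0 \<and> i \<noteq> 1 \<and> i \<noteq> 2" by blast
    thus "continuous_on UNIV (\<lambda>x::complex \<times> complex. if i = 0 then Re (fst x) else if i = 1 then Re (snd x)
                    else if i = 2 then Im (snd x) else - Im (fst x))"
      by cases (simp_all, (intro continuous_intros)+)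
  qed
  \<comment> \<open>The last coordinate is \<open>- Im a\<close>, so the interval from
    \<open>l$3\<close> to \<open>u$3\<close> appears negated and with its ends exchanged.\<close>
  have "emeasure (distr lborel borel ?f) (box l u) 
     = emeasure (lborel :: (complex \<times> complex) measure) (box (Complex (l$0) (-u$3), Complex (l$1) (l$2)) (Complex (u$0) (-l$3), Complex (u$1) (u$2)))"
    by (subst emeasure_distr) (auto intro!: arg_cong[where f="emeasure lborel"] simp: mem_box Basis_prod_def Basis_complex_def Basis_vec_def inner_axis index_4_cases)
  also have "\<dots> = (\<Prod>i\<in>UNIV. u$i - l$i)"
    using lu'[of 0] lu'[of 1] lu'[of 2] lu'[of 3]
    by (subst emeasure_lborel_box) (auto simp: Basis_prod_def Basis_complex_def prod_index_4 mult_ac)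
  also have "(\<Prod>i\<in>UNIV. u$i - l$i) = (\<Prod>b\<in>Basis. (u - l) \<bullet> b)"
    by (simp add: Basis_vec_def UNION_singleton_eq_range prod.reindex inj_on_def axis_eq_axis inner_axis)
  finally show "emeasure (distr lborel borel ?f) (box l u) = (\<Prod>b\<in>Basis. (u - l) \<bullet> b)" .
qed simp

text \<open>The disc of radius \<open>sqrt a\<close> has area \<open>pi * a\<close>, so the squared
  modulus has constant density; comparing the two measures on closed half-lines is enough.\<close>

lemma distr_lborel_cmod_power2: "distr lborel borel (\<lambda>z::complex. (cmod z)\<^sup>2) = density lborel (\<lambda>t. ennreal pi * indicator {0..} t)"
proof (rule measure_eqI_generator_eq[where E="range (\<lambda>a. {..a::real})" and \<Omega>=UNIV and A="\<lambda>n::nat. {..real n}"])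
  show "Int_stable (range (\<lambda>a. {..a::real}))"
    by (auto simp: Int_stable_def)
  have eq: "emeasure (distr lborel borel (\<lambda>z::complex. (cmod z)\<^sup>2)) {..a} = ennreal (pi * max a 0)" for a
  proof (cases "a \<ge> 0")
    case True
    have "(\<lambda>z::complex. (cmod z)\<^sup>2) -` {..a} = cball 0 (sqrt a)"
      using True by (auto simp: real_le_rsqrt real_sqrt_le_iff dest: real_sqrt_le_mono real_le_rsqrt)
        (metis norm_ge_zero power_mono real_sqrt_pow2)
    thus ?thesis using True
      by (simp add: emeasure_distr emeasure_cball unit_ball_vol_2 mult.commute)
  next
    case False
    hence "(\<lambda>z::complex. (cmod z)\<^sup>2) -` {..a} = {}"
      by (auto simp: not_le) (smt (verit) zero_le_power2)
    thus ?thesis using False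
      by (simp add: emeasure_distr)
  qed
  have eq2: "emeasure (density lborel (\<lambda>t. ennreal pi * indicator {0..} t)) {..a::real} = ennreal (pi * max a 0)" for a
  proof -
    have "emeasure (density lborel (\<lambda>t. ennreal pi * indicator {0..} t)) {..a::real}
       = (\<integral>\<^sup>+t. ennreal pi * indicator {0..a} t \<partial>lborel)"
      by (subst emeasure_density) (auto intro!: nn_integral_cong split: split_indicator)
    also have "\<dots> = ennreal pi * emeasure lborel {0..a}"
      by (subst nn_integral_cmult) auto
    also have "\<dots> = ennreal (pi * max a 0)"
      by (cases "a \<ge> 0") (auto simp: ennreal_mult')
    finally show ?thesis .
  qed
  show "emeasure (distr lborel borel (\<lambda>z::complex. (cmod z)\<^sup>2)) X = emeasure (density lborel (\<lambda>t. ennreal pi * indicator {0..} t)) X" 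
    if "X \<in> range (\<lambda>a. {..a::real})" for X
    using that by (auto simp: eq eq2)
  show "sets (distr lborel borel (\<lambda>z::complex. (cmod z)\<^sup>2)) = sigma_sets UNIV (range (\<lambda>a. {..a::real}))"
    by (simp add: borel_eq_atMost)
  show "sets (density lborel (\<lambda>t. ennreal pi * indicator {0..} t)) = sigma_sets UNIV (range (\<lambda>a. {..a::real}))"
    by (simp add: borel_eq_atMost)
  show "(\<Union>i. {..real i}) = UNIV" using real_arch_simple by auto
  show "emeasure (distr lborel borel (\<lambda>z::complex. (cmod z)\<^sup>2)) {..real i} \<noteq> \<infinity>" for i
    by (simp add: eq)
qed auto

text \<open>Preimages of boxes are images under the inverse map \<open>M\<close>, whose determinant
  also has modulus 1. The scaling law for linear images speaks of \<open>lebesgue\<close>, which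
  agrees with \<open>lborel\<close> on Borel sets.\<close>

lemma lborel_linear_image:
  fixes L :: "real^'n::{finite,wellorder} \<Rightarrow> real^'n::_"
  assumes L: "linear L" "\<bar>det (matrix L)\<bar> = 1"
  shows "distr lborel borel L = lborel"
proof (rule sym, rule lborel_eqI)
  fix l u :: "real^'n::{finite,wellorder}" assume lu: "\<And>b. b \<in> Basis \<Longrightarrow> l \<bullet> b \<le> u \<bullet> b"
  have "det (matrix L) \<noteq> 0" using L by auto
  then obtain M where M: "linear M" "\<And>x. M (L x) = x" "\<And>x. L (M x) = x"
    by (metis L(1) det_nz_iff_inj inj_linear_imp_inv_linear linear_injective_isomorphism linear_injective_left_inverse)
  have "matrix L ** matrix M = mat 1"
    using M L matrix_compose[of M L] by (simp add: o_def matrix_id_mat_1[unfolded id_def])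
  hence dM: "\<bar>det (matrix M)\<bar> = 1"
    using L det_mul[of "matrix L" "matrix M"] by (simp add: abs_mult flip: abs_mult)
      (metis abs_mult abs_one mult_1)
  have [measurable]: "L \<in> borel_measurable borel"
    using L(1) by (simp add: borel_measurable_continuous_onI linear_continuous_on linear_conv_bounded_linear)
  have vi: "L -` box l u = M ` box l u" using M by (auto simp: image_iff) metis
  have "emeasure (distr lborel borel L) (box l u) = emeasure lborel (L -` box l u)"
    by (simp add: emeasure_distr)
  also have "\<dots> = emeasure lebesgue (L -` box l u)"
  proof -
    have "L -` box l u \<in> sets borel"
      using measurable_sets[of L borel borel "box l u"] by simp
    thus ?thesis by simp
  qed
  also have "\<dots> = emeasure lebesgue (M ` box l u)" by (simp only: vi)
  also have "\<dots> = ennreal (measure lebesgue (M ` box l u))"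
    using M by (intro emeasure_eq_measure2) (auto intro: measurable_linear_image)
  also have "\<dots> = ennreal (measure lebesgue (box l u))"
    using measure_linear_image[OF M(1), of "box l u"] dM by simp
  also have "\<dots> = emeasure lebesgue (box l u)"
    by (intro emeasure_eq_measure2[symmetric]) auto
  also have "\<dots> = (\<Prod>b\<in>Basis. (u - l) \<bullet> b)"
    using lu by simp
  finally show "emeasure (distr lborel borel L) (box l u) = (\<Prod>b\<in>Basis. (u - l) \<bullet> b)" .
qed simp

lemma lborel_complex_vec:
  "(lborel :: complex measure) = distr (lborel::(real^2) measure) borel (\<lambda>v. Complex (v$1) (v$2))"
proof (rule lborel_eqI)
  fix l u :: complex assume lu: "\<And>b. b \<in> Basis \<Longrightarrow> l \<bullet> b \<le> u \<bullet> b"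
  have le: "Re l \<le> Re u" "Im l \<le> Im u" using lu[of 1] lu[of \<i>] by (auto simp: Basis_complex_def)
  have [measurable]: "(\<lambda>v. Complex (v$1) (v$2)) \<in> borel_measurable (borel :: (real^2) measure)"
    unfolding Complex_eq by measurable
  let ?l = "vector [Re l, Im l] :: real^2" and ?u = "vector [Re u, Im u] :: real^2"
  have "emeasure (distr (lborel::(real^2) measure) borel (\<lambda>v. Complex (v$1) (v$2))) (box l u) 
     = emeasure lborel (box ?l ?u)"
    by (subst emeasure_distr) (auto intro!: arg_cong[where f="emeasure lborel"] simp: mem_box Basis_complex_def Basis_vec_def inner_axis forall_2)
  also have "\<dots> = (\<Prod>b\<in>Basis. (?u - ?l) \<bullet> b)"
  proof (rule emeasure_lborel_box)
    have "?l $ i \<le> ?u $ i" for i using le exhaust_2[of i] by auto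
    thus "?l \<bullet> b \<le> ?u \<bullet> b" if "b \<in> Basis" for b
      using that by (auto simp: Basis_vec_def inner_axis)
  qed
  also have "(\<Prod>b\<in>Basis. (?u - ?l) \<bullet> b) = (\<Prod>i\<in>UNIV. ?u$i - ?l$i)"
    by (simp add: Basis_vec_def UNION_singleton_eq_range prod.reindex inj_on_def axis_eq_axis inner_axis)
  also have "\<dots> = (\<Prod>b\<in>Basis. (u - l) \<bullet> b)"
    by (simp add: UNIV_2 Basis_complex_def)
  finally show "emeasure (distr (lborel::(real^2) measure) borel (\<lambda>v. Complex (v$1) (v$2))) (box l u) = (\<Prod>b\<in>Basis. (u - l) \<bullet> b)" .
qed simp

text \<open>Multiplication by \<open>c\<close> is a linear map of \<open>real^2\<close> with
  determinant \<open>|c|^2 = 1\<close>.\<close>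

lemma lborel_complex_rotate:
  fixes c :: complex assumes c: "cmod c = 1"
  shows "distr lborel borel (\<lambda>z. c * z) = lborel"
proof -
  define L :: "real^2 \<Rightarrow> real^2" where "L v = vector [Re c * v$1 - Im c * v$2, Im c * v$1 + Re c * v$2]" for v
  have lin: "linear L"
    by (rule linearI) (simp_all add: L_def vec_eq_iff forall_2 algebra_simps)
  have "det (matrix L) = (Re c)\<^sup>2 + (Im c)\<^sup>2"
    by (simp add: det_2 matrix_def L_def axis_def power2_eq_square)
  hence "\<bar>det (matrix L)\<bar> = 1" using c by (simp add: cmod_def)
  note LL = lborel_linear_image[OF lin this]
  let ?e = "\<lambda>v::real^2. Complex (v$1) (v$2)"
  have [measurable]: "?e \<in> borel_measurable borel"
    unfolding Complex_eq by measurable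
  have [measurable]: "L \<in> borel_measurable borel"
    using lin by (simp add: borel_measurable_continuous_onI linear_continuous_on linear_conv_bounded_linear)
  have "distr lborel borel (\<lambda>z. c * z) = distr lborel borel (\<lambda>v. c * ?e v)"
    by (subst lborel_complex_vec, subst distr_distr) (auto simp: o_def)
  also have "(\<lambda>v. c * ?e v) = ?e \<circ> L"
    by (auto simp: fun_eq_iff L_def complex_eq_iff)
  also have "distr lborel borel (?e \<circ> L) = distr (distr lborel borel L) borel ?e"
    by (subst distr_distr) auto
  also have "\<dots> = lborel" by (simp add: LL flip: lborel_complex_vec)
  finally show ?thesis .
qed

section \<open>Polar coordinates by averaging over rotations\<close>

lemma nn_integral_periodic_shift:
  fixes h :: "real \<Rightarrow> ennreal"
  assumes [measurable]: "h \<in> borel_measurable borel" and per: "\<And>x. h (x + p) = h x"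
    and c: "0 \<le> c" "c < p"
  shows "(\<integral>\<^sup>+x. h (x - c) * indicator {0..<p} x \<partial>lborel) = (\<integral>\<^sup>+x. h x * indicator {0..<p} x \<partial>lborel)"
proof -
  have "(\<integral>\<^sup>+x. h (x - c) * indicator {0..<p} x \<partial>lborel) = (\<integral>\<^sup>+x. h x * indicator {-c..<p-c} x \<partial>lborel)"
    by (subst nn_integral_real_affine[where c=1 and t="c"]) (auto intro!: nn_integral_cong split: split_indicator)
  also have "\<dots> = (\<integral>\<^sup>+x. (h x * indicator {-c..<0} x + h x * indicator {0..<p-c} x) \<partial>lborel)"
    using c by (intro nn_integral_cong) (auto split: split_indicator)
  also have "\<dots> = (\<integral>\<^sup>+x. h x * indicator {-c..<0} x \<partial>lborel) + (\<integral>\<^sup>+x. h x * indicator {0..<p-c} x \<partial>lborel)"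
    by (rule nn_integral_add) auto
  also have "(\<integral>\<^sup>+x. h x * indicator {-c..<0} x \<partial>lborel) = (\<integral>\<^sup>+x. h (x - p) * indicator {p-c..<p} x \<partial>lborel)"
    by (subst nn_integral_real_affine[where c=1 and t="-p"]) (auto intro!: nn_integral_cong split: split_indicator)
  also have "\<dots> = (\<integral>\<^sup>+x. h x * indicator {p-c..<p} x \<partial>lborel)"
    using per[of "x - p" for x] by simp
  also have "\<dots> + (\<integral>\<^sup>+x. h x * indicator {0..<p-c} x \<partial>lborel) =
     (\<integral>\<^sup>+x. (h x * indicator {p-c..<p} x + h x * indicator {0..<p-c} x) \<partial>lborel)"
    by (rule nn_integral_add[symmetric]) auto
  also have "\<dots> = (\<integral>\<^sup>+x. h x * indicator {0..<p} x \<partial>lborel)"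
    using c by (intro nn_integral_cong) (auto split: split_indicator)
  finally show ?thesis .
qed

lemma borel_measurable_cis [measurable]: "cis \<in> borel_measurable borel"
  by (intro borel_measurable_continuous_onI continuous_intros)

text \<open>Lebesgue measure is invariant under rotations, so the integrand may be averaged over all
  of them; the average depends only on the squared modulus, whose distribution is known. The
  variable \<open>s\<close> is the squared radius, hence a factor 2 in place of a Jacobian, and the
  angle runs clockwise because \<open>Im z_11 = - x^3\<close> in the parametrization of the
  hyperboloid.\<close>

lemma nn_integral_polar:
  fixes f :: "complex \<Rightarrow> ennreal"
  assumes [measurable]: "f \<in> borel_measurable borel"
  shows "2 * (\<integral>\<^sup>+z. f z \<partial>lborel) =
     (\<integral>\<^sup>+s. (\<integral>\<^sup>+\<theta>. f (of_real (sqrt s) * cis (-\<theta>)) * indicator {0..<2*pi} \<theta> \<partial>lborel) * indicator {0..} s \<partial>lborel)"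
proof -
  define A where "A s = (\<integral>\<^sup>+\<theta>. f (of_real (sqrt s) * cis (-\<theta>)) * indicator {0..<2*pi} \<theta> \<partial>lborel)" for s
  have [measurable]: "A \<in> borel_measurable borel" unfolding A_def by measurable
  have rot: "(\<integral>\<^sup>+z. f z \<partial>lborel) = (\<integral>\<^sup>+z. f (cis (-\<alpha>) * z) \<partial>lborel)" for \<alpha>
    by (subst lborel_complex_rotate[of "cis (-\<alpha>)", symmetric]) (auto simp: nn_integral_distr)
  \<comment> \<open>Rotating \<open>z\<close> through a full turn starts at its argument
    \<open>c\<close>; by periodicity the starting angle does not matter.\<close>
  have inner: "(\<integral>\<^sup>+\<alpha>. f (cis (-\<alpha>) * z) * indicator {0..<2*pi} \<alpha> \<partial>lborel) = A ((cmod z)\<^sup>2)" for z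
  proof -
    define c where "c = Arg2pi z"
    have z: "z = of_real (cmod z) * cis c" unfolding c_def using Arg2pi_eq[of z] by (simp add: cis_conv_exp)
    have c: "0 \<le> c" "c < 2*pi" using Arg2pi_ge_0 Arg2pi_lt_2pi by (auto simp: c_def)
    have "(\<integral>\<^sup>+\<alpha>. f (cis (-\<alpha>) * z) * indicator {0..<2*pi} \<alpha> \<partial>lborel) 
      = (\<integral>\<^sup>+\<alpha>. (\<lambda>\<theta>. f (of_real (cmod z) * cis (-\<theta>))) (\<alpha> - c) * indicator {0..<2*pi} \<alpha> \<partial>lborel)"
    proof -
      have "cis (-\<alpha>) * z = of_real (cmod z) * cis (- (\<alpha> - c))" for \<alpha>
        by (metis (no_types, opaque_lifting) z cis_mult mult.left_commute uminus_add_conv_diff minus_diff_eq)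
      thus ?thesis by simp
    qed
    also have "\<dots> = A ((cmod z)\<^sup>2)"
    proof -
      have "cis (- (x + 2 * pi)) = cis (- x)" for x
        using sin_periodic[of x] cos_periodic[of x] by (simp add: complex_eq_iff del: minus_add_distrib minus_add sin_periodic cos_periodic) 
      hence "(\<integral>\<^sup>+\<alpha>. (\<lambda>\<theta>. f (of_real (cmod z) * cis (-\<theta>))) (\<alpha> - c) * indicator {0..<2*pi} \<alpha> \<partial>lborel)
        = (\<integral>\<^sup>+\<alpha>. (\<lambda>\<theta>. f (of_real (cmod z) * cis (-\<theta>))) \<alpha> * indicator {0..<2*pi} \<alpha> \<partial>lborel)"
        using c by (intro nn_integral_periodic_shift) simp_all
      thus ?thesis by (simp add: A_def)
    qed
    finally show ?thesis .
  qed
  have "ennreal (2*pi) * (\<integral>\<^sup>+z. f z \<partial>lborel) = (\<integral>\<^sup>+\<alpha>. (\<integral>\<^sup>+z. f z \<partial>lborel) * indicator {0..<2*pi} \<alpha> \<partial>(lborel :: real measure))"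
    by (subst nn_integral_cmult) (auto simp: mult.commute)
  also have "\<dots> = (\<integral>\<^sup>+\<alpha>. (\<integral>\<^sup>+z. f (cis (-\<alpha>) * z) * indicator {0..<2*pi} \<alpha> \<partial>lborel) \<partial>(lborel :: real measure))"
    by (subst nn_integral_multc) (auto simp flip: rot)
  also have "\<dots> = (\<integral>\<^sup>+z. (\<integral>\<^sup>+\<alpha>. f (cis (-\<alpha>) * z) * indicator {0..<2*pi} \<alpha> \<partial>(lborel :: real measure)) \<partial>lborel)"
    by (rule lborel_pair.Fubini') simp
  also have "\<dots> = (\<integral>\<^sup>+z. A ((cmod z)\<^sup>2) \<partial>lborel)" by (simp add: inner)
  also have "\<dots> = (\<integral>\<^sup>+t. A t \<partial>distr lborel borel (\<lambda>z::complex. (cmod z)\<^sup>2))"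
    by (subst nn_integral_distr) auto
  also have "\<dots> = (\<integral>\<^sup>+t. ennreal pi * (A t * indicator {0..} t) \<partial>lborel)"
    by (subst distr_lborel_cmod_power2, subst nn_integral_density) (auto intro!: nn_integral_cong simp: mult_ac)
  also have "\<dots> = ennreal pi * (\<integral>\<^sup>+t. A t * indicator {0..} t \<partial>lborel)"
    by (rule nn_integral_cmult) simp
  finally have "ennreal pi * (2 * (\<integral>\<^sup>+z. f z \<partial>lborel)) = ennreal pi * (\<integral>\<^sup>+t. A t * indicator {0..} t \<partial>lborel)"
    by (simp add: ennreal_mult mult_ac)
  thus ?thesis unfolding A_def by (simp add: ennreal_mult_cancel_left)
qed

section \<open>Complex coordinates and the hyperboloid\<close>

text \<open>The entries \<open>z_11\<close> and \<open>z_12\<close>. The second row of the matrix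
  consists of their conjugates, so these two complex numbers serve as coordinates
  throughout.\<close>

definition za :: "real^4 \<Rightarrow> complex" where "za X = Complex (X$0) (- X$3)"
definition zb :: "real^4 \<Rightarrow> complex" where "zb X = Complex (X$1) (X$2)"
definition quat :: "complex \<Rightarrow> complex \<Rightarrow> real^4" where
  "quat a b = (\<chi> i. if i = 0 then Re a else if i = 1 then Re b else if i = 2 then Im b else - Im a)"

lemma za_quat [simp]: "za (quat a b) = a" and zb_quat [simp]: "zb (quat a b) = b"
  by (simp_all add: za_def zb_def quat_def)

lemma quat_za_zb [simp]: "quat (za X) (zb X) = X"
  by (simp add: za_def zb_def quat_def vec_eq_iff index_4_cases)

lemma quat_eqI: "za X = za Y \<Longrightarrow> zb X = zb Y \<Longrightarrow> X = Y"
  by (metis quat_za_zb)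

lemma qN_za_zb: "qN X = (cmod (za X))\<^sup>2 - (cmod (zb X))\<^sup>2"
  by (simp add: qN_eq za_def zb_def cmod_power2)

lemma norm_za_zb: "(norm X)\<^sup>2 = (cmod (za X))\<^sup>2 + (cmod (zb X))\<^sup>2"
  by (simp add: norm_eq_matrix_norm sum_2 qmat_nth za_def zb_def cmod_power2)

lemma qmat_za_zb: "qmat X $ 1 $ 1 = za X" "qmat X $ 1 $ 2 = zb X" "qmat X $ 2 $ 1 = cnj (zb X)" "qmat X $ 2 $ 2 = cnj (za X)"
  by (simp_all add: qmat_nth za_def zb_def complex_eq_iff)

lemma za_qmult: "za (qmult A B) = za A * za B + zb A * cnj (zb B)"
  and zb_qmult: "zb (qmult A B) = za A * zb B + zb A * cnj (za B)"
proof -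
  have "qmat (qmult A B) $ 1 $ j = (qmat A ** qmat B) $ 1 $ j" for j by (simp only: qmat_qmult)
  from this[of 1] this[of 2] show "za (qmult A B) = za A * za B + zb A * cnj (zb B)" "zb (qmult A B) = za A * zb B + zb A * cnj (za B)"
    by (simp_all add: matrix_matrix_mult_def sum_2 qmat_za_zb)
qed

lemma za_linear [simp]: "za (X + Y) = za X + za Y" "za (X - Y) = za X - za Y" "za (c *\<^sub>R X) = of_real c * za X" "za (- X) = - za X" "za 0 = 0"
  and zb_linear [simp]: "zb (X + Y) = zb X + zb Y" "zb (X - Y) = zb X - zb Y" "zb (c *\<^sub>R X) = of_real c * zb X" "zb (- X) = - zb X" "zb 0 = 0"
  by (simp_all add: za_def zb_def complex_eq_iff)

lemma continuous_on_za [continuous_intros]: "continuous_on S f \<Longrightarrow> continuous_on S (\<lambda>x. za (f x))"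
  and continuous_on_zb [continuous_intros]: "continuous_on S f \<Longrightarrow> continuous_on S (\<lambda>x. zb (f x))"
  unfolding za_def zb_def Complex_eq by (intro continuous_intros; simp)+

lemma continuous_on_quat [continuous_intros]:
  assumes "continuous_on S f" "continuous_on S g" shows "continuous_on S (\<lambda>x. quat (f x) (g x))"
  unfolding quat_def
proof (intro continuous_on_vec_lambda)
  fix i :: 4
  consider "i = 0" | "i = 1" | "i = 2" | "i \<noteq> 0 \<and> i \<noteq> 1 \<and> i \<noteq> 2" by blast
  thus "continuous_on S (\<lambda>x. if i = 0 then Re (f x) else if i = 1 then Re (g x)
                    else if i = 2 then Im (g x) else - Im (f x))"
    using assms by cases (simp_all, (intro continuous_intros; simp)+)
qed

lemma borel_measurable_za [measurable]: "za \<in> borel_measurable borel"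
  and borel_measurable_zb [measurable]: "zb \<in> borel_measurable borel"
  by (intro borel_measurable_continuous_onI continuous_intros)+

lemma borel_measurable_quat [measurable (raw)]:
  assumes [measurable]: "f \<in> borel_measurable M" "g \<in> borel_measurable M"
  shows "(\<lambda>x. quat (f x) (g x)) \<in> borel_measurable M"
proof -
  have "(\<lambda>p. quat (fst p) (snd p)) \<in> borel_measurable borel"
    by (intro borel_measurable_continuous_onI continuous_intros)
  from measurable_compose[of "\<lambda>x. (f x, g x)", OF _ this] show ?thesis by simp
qed

lemma borel_measurable_quat_pair [measurable]: "(\<lambda>p. quat (fst p) (snd p)) \<in> borel_measurable borel"
  by (intro borel_measurable_continuous_onI continuous_intros)

lemma borel_measurable_qN [measurable]: "qN \<in> borel_measurable borel"
  unfolding qN_za_zb[abs_def] by measurable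

text \<open>\<open>hyp_param\<close> with its first two parameters joined to the complex number
  \<open>v = z_12\<close>. The phase is \<open>- \<theta>\<close> because
  \<open>Im z_11 = - x^3\<close>.\<close>

definition hypc :: "real \<Rightarrow> complex \<Rightarrow> real \<Rightarrow> real^4" where
  "hypc R v \<theta> = quat (of_real (sqrt (R\<^sup>2 + (cmod v)\<^sup>2)) * cis (-\<theta>)) v"

lemma borel_measurable_hypc [measurable (raw)]:
  assumes [measurable]: "f \<in> borel_measurable M" "g \<in> borel_measurable M"
  shows "(\<lambda>x. hypc R (f x) (g x)) \<in> borel_measurable M"
  unfolding hypc_def by measurable

text \<open>The measure \<open>dS/\<parallel>X\<parallel>\<close> on \<open>H\<^sub>R\<close>: dividing by the norm cancels the Gram density, and Lebesgue measure in \<open>z\<^sub>1\<^sub>2\<close> and the angle remains.\<close>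

definition Mh :: "real \<Rightarrow> (real^4) measure" where
  "Mh R = distr (density (lborel \<Otimes>\<^sub>M lborel) (\<lambda>p. indicator {0..<2*pi} (snd p))) borel
     (\<lambda>p. hypc R (fst p) (snd p))"

lemma sets_Mh [simp, measurable_cong]: "sets (Mh R) = sets borel" by (simp add: Mh_def)
lemma space_Mh [simp]: "space (Mh R) = UNIV" by (simp add: Mh_def)

lemma qN_hypc [simp]: "qN (hypc R v \<theta>) = R\<^sup>2"
  by (simp add: hypc_def qN_za_zb norm_mult abs_of_nonneg)

lemma za_hypc: "za (hypc R v \<theta>) = of_real (sqrt (R\<^sup>2 + (cmod v)\<^sup>2)) * cis (-\<theta>)"
  and zb_hypc: "zb (hypc R v \<theta>) = v"
  by (simp_all add: hypc_def)

lemma nn_integral_Mh: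
  assumes [measurable]: "f \<in> borel_measurable borel"
  shows "(\<integral>\<^sup>+X. f X \<partial>Mh R) = (\<integral>\<^sup>+v. (\<integral>\<^sup>+\<theta>. f (hypc R v \<theta>) * indicator {0..<2*pi} \<theta> \<partial>lborel) \<partial>lborel)"
proof -
  have "(\<integral>\<^sup>+X. f X \<partial>Mh R) = (\<integral>\<^sup>+p. f (hypc R (fst p) (snd p)) * indicator {0..<2*pi} (snd p) \<partial>(lborel \<Otimes>\<^sub>M lborel))"
    unfolding Mh_def
    by (subst nn_integral_distr, measurable, subst nn_integral_density) (auto simp: mult.commute)
  also have "\<dots> = (\<integral>\<^sup>+v. (\<integral>\<^sup>+\<theta>. f (hypc R v \<theta>) * indicator {0..<2*pi} \<theta> \<partial>lborel) \<partial>lborel)"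
    by (subst lborel.nn_integral_fst[symmetric]) auto
  finally show ?thesis .
qed

lemma borel_measurable_vec3 [measurable]:
  "(\<lambda>p::complex \<times> real. vector [Re (fst p), Im (fst p), snd p] :: real^3) \<in> borel_measurable borel"
proof -
  have eq: "(\<lambda>p::complex \<times> real. vector [Re (fst p), Im (fst p), snd p] :: real^3) = (\<lambda>p. \<chi> i. if i = 1 then Re (fst p) else if i = 2 then Im (fst p) else snd p)"
    by (auto simp: fun_eq_iff vec_eq_iff forall_3)
  have "continuous_on UNIV (\<lambda>p::complex \<times> real. (\<chi> i. if i = 1 then Re (fst p) else if i = 2 then Im (fst p) else snd p) :: real^3)"
  proof (intro continuous_on_vec_lambda)
    fix i :: 3
    consider "i = 1" | "i = 2" | "i \<noteq> 1 \<and> i \<noteq> 2" by blast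
    thus "continuous_on UNIV (\<lambda>p::complex \<times> real. if i = 1 then Re (fst p) else if i = 2 then Im (fst p) else snd p)"
      by cases (simp_all, (intro continuous_intros)+)
  qed
  thus ?thesis unfolding eq by (rule borel_measurable_continuous_onI)
qed

lemma lborel_complex_real:
  "(lborel :: (real^3) measure) =
     distr (lborel :: (complex \<times> real) measure) borel (\<lambda>p. vector [Re (fst p), Im (fst p), snd p])"
proof (rule lborel_eqI)
  fix l u :: "real^3" assume lu: "\<And>b. b \<in> Basis \<Longrightarrow> l \<bullet> b \<le> u \<bullet> b"
  let ?f = "\<lambda>p::complex \<times> real. vector [Re (fst p), Im (fst p), snd p] :: real^3"
  have lu': "l $ i \<le> u $ i" for i using lu[of "axis i 1"] by (auto simp: Basis_vec_def inner_axis)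
  have "emeasure (distr lborel borel ?f) (box l u)
     = emeasure lborel (box (Complex (l$1) (l$2), l$3) (Complex (u$1) (u$2), u$3))"
    by (subst emeasure_distr) (auto intro!: arg_cong[where f="emeasure lborel"] simp: mem_box Basis_prod_def Basis_complex_def Basis_vec_def inner_axis forall_3)
  also have "\<dots> = (\<Prod>i\<in>UNIV. u$i - l$i)"
  proof (subst emeasure_lborel_box)
    let ?l = "(Complex (l$1) (l$2), l$3)" and ?u = "(Complex (u$1) (u$2), u$3)"
    show "?l \<bullet> b \<le> ?u \<bullet> b" if "b \<in> Basis" for b
      using that lu' by (auto simp: Basis_prod_def Basis_complex_def)
    have B: "(Basis :: (complex \<times> real) set) = {(1, 0), (\<i>, 0), (0, 1)}"
      by (auto simp: Basis_prod_def Basis_complex_def)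
    have "(\<Prod>b\<in>Basis. (?u - ?l) \<bullet> b) = (\<Prod>i\<in>UNIV. u$i - l$i)"
      unfolding B UNIV_3 by simp
    thus "ennreal (\<Prod>b\<in>Basis. (?u - ?l) \<bullet> b) = ennreal (\<Prod>i\<in>UNIV. u$i - l$i)" by (rule arg_cong)
  qed
  also have "(\<Prod>i\<in>UNIV. u$i - l$i) = (\<Prod>b\<in>Basis. (u - l) \<bullet> b)"
    by (simp add: Basis_vec_def UNION_singleton_eq_range prod.reindex inj_on_def axis_eq_axis inner_axis)
  finally show "emeasure (distr lborel borel ?f) (box l u) = (\<Prod>b\<in>Basis. (u - l) \<bullet> b)" .
qed simp

lemma hyp_param_hypc: "hyp_param R (vector [Re v, Im v, \<theta>]) = hypc R v \<theta>"
  by (simp add: hyp_param_def hypc_def quat_def vec_eq_iff index_4_cases Let_def cmod_power2 add.assoc)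

lemma borel_measurable_hyp_param [measurable]: "hyp_param R \<in> borel_measurable borel"
proof -
  have "hyp_param R u = hypc R (Complex (u$1) (u$2)) (u$3)" for u
  proof -
    have "vector [u$1, u$2, u$3] = u" by (simp add: vec_eq_iff forall_3)
    thus ?thesis using hyp_param_hypc[of R "Complex (u$1) (u$2)" "u$3"] by simp
  qed
  hence eq: "hyp_param R = (\<lambda>u. hypc R (Complex (u$1) (u$2)) (u$3))" by auto
  show ?thesis unfolding eq Complex_eq by measurable
qed

lemma hyp_domain_sets [measurable]: "hyp_domain \<in> sets borel"
  unfolding hyp_domain_def by measurable

lemma dS_eq_density:
  assumes "R > 0"
  shows "dS R = density (Mh R) (\<lambda>X. ennreal (norm X))"
proof (rule measure_eqI)
  fix B assume "B \<in> sets (dS R)"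
  hence [measurable]: "B \<in> sets borel" by (simp add: dS_def surface_measure_def)
  have "dS R = distr (density lborel (\<lambda>u. indicator hyp_domain u * ennreal (norm (hyp_param R u)))) borel (hyp_param R)"
    using assms by (simp add: dS_def surface_measure_def hyp_gram real_sqrt_abs)
  hence "emeasure (dS R) B = emeasure (density lborel (\<lambda>u. indicator hyp_domain u * ennreal (norm (hyp_param R u)))) (hyp_param R -` B)"
    by (simp only:, subst emeasure_distr) simp_all
  also have "\<dots> = (\<integral>\<^sup>+u. indicator hyp_domain u * ennreal (norm (hyp_param R u)) * indicator B (hyp_param R u) \<partial>lborel)"
    by (subst emeasure_density) (use measurable_sets[of "hyp_param R" borel borel B] in \<open>auto intro!: nn_integral_cong simp: indicator_def\<close>)
  also have "\<dots> = (\<integral>\<^sup>+p. ennreal (norm (hypc R (fst p) (snd p))) * indicator B (hypc R (fst p) (snd p)) * indicator {0..<2*pi} (snd p) \<partial>lborel)"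
    by (subst lborel_complex_real, subst nn_integral_distr, measurable)
      (auto intro!: nn_integral_cong simp: hyp_param_hypc hyp_domain_def indicator_def)
  also have "\<dots> = emeasure (density (Mh R) (\<lambda>X. ennreal (norm X))) B"
    unfolding Mh_def lborel_prod[symmetric]
    by (subst emeasure_density, measurable, subst nn_integral_distr, measurable, subst nn_integral_density)
      (auto simp: mult_ac intro!: nn_integral_cong)
  finally show "emeasure (dS R) B = emeasure (density (Mh R) (\<lambda>X. ennreal (norm X))) B" .
qed (simp add: dS_def surface_measure_def)

section \<open>Invariance of the measure on the hyperboloid\<close>

text \<open>For fixed \<open>z_12 = b\<close>, polar coordinates in \<open>z_11\<close> with squared
  radius \<open>s = T + |b|^2\<close> describe the level set \<open>qN = T\<close>, and a shift of
  \<open>s\<close> by \<open>|b|^2\<close> exchanges the radius for \<open>T\<close>. This ties the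
  hyperboloids to Lebesgue measure on the whole space, whose behaviour under linear maps is
  known.\<close>

lemma nn_integral_disintegrate:
  assumes [measurable]: "f \<in> borel_measurable borel"
  shows "2 * (\<integral>\<^sup>+X. f X * indicator {X. 0 < qN X} X \<partial>lborel) =
     (\<integral>\<^sup>+T. (\<integral>\<^sup>+X. f X \<partial>Mh (sqrt T)) * indicator {0<..} T \<partial>lborel)"
proof -
  define g where "g a b = f (quat a b) * indicator {0<..} ((cmod a)\<^sup>2 - (cmod b)\<^sup>2)" for a b
  have gm [measurable (raw)]: "(\<lambda>x. g (p x) (q x)) \<in> borel_measurable M" if [measurable]: "p \<in> borel_measurable M" "q \<in> borel_measurable M" for p q M
    unfolding g_def by measurable
  have eq: "(\<lambda>(a, b). \<chi> i. if i = 0 then Re a else if i = 1 then Re b else if i = 2 then Im b else - Im a) = (\<lambda>p. quat (fst p) (snd p))"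
    by (auto simp: quat_def fun_eq_iff)
  have "(\<integral>\<^sup>+X. f X * indicator {X. 0 < qN X} X \<partial>lborel) = (\<integral>\<^sup>+p. f (quat (fst p) (snd p)) * indicator {X. 0 < qN X} (quat (fst p) (snd p)) \<partial>lborel)"
    unfolding lborel_complex_prod eq by (rule nn_integral_distr) measurable
  also have "\<dots> = (\<integral>\<^sup>+p. g (fst p) (snd p) \<partial>(lborel \<Otimes>\<^sub>M lborel))"
    unfolding lborel_prod by (intro nn_integral_cong) (simp add: g_def qN_za_zb indicator_def)
  finally have "2 * (\<integral>\<^sup>+X. f X * indicator {X. 0 < qN X} X \<partial>lborel) = 2 * (\<integral>\<^sup>+p. g (fst p) (snd p) \<partial>(lborel \<Otimes>\<^sub>M lborel))"
    by simp
  also have "\<dots> = 2 * (\<integral>\<^sup>+b. (\<integral>\<^sup>+a. g a b \<partial>lborel) \<partial>lborel)"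
    by (subst lborel_pair.nn_integral_snd[symmetric]) (simp_all add: case_prod_beta)
  also have "\<dots> = (\<integral>\<^sup>+b. 2 * (\<integral>\<^sup>+a. g a b \<partial>lborel) \<partial>lborel)"
    by (rule nn_integral_cmult[symmetric]) measurable
  also have "\<dots> = (\<integral>\<^sup>+b. (\<integral>\<^sup>+s. (\<integral>\<^sup>+\<theta>. g (of_real (sqrt s) * cis (-\<theta>)) b * indicator {0..<2*pi} \<theta> \<partial>lborel) * indicator {0..} s \<partial>lborel) \<partial>lborel)"
    by (subst nn_integral_polar) auto
  also have "\<dots> = (\<integral>\<^sup>+b. (\<integral>\<^sup>+T. (\<integral>\<^sup>+\<theta>. f (hypc (sqrt T) b \<theta>) * indicator {0..<2*pi} \<theta> \<partial>lborel) * indicator {0<..} T \<partial>lborel) \<partial>lborel)"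
  proof (rule nn_integral_cong)
    fix b :: complex
    have "(\<integral>\<^sup>+s. (\<integral>\<^sup>+\<theta>. g (of_real (sqrt s) * cis (-\<theta>)) b * indicator {0..<2*pi} \<theta> \<partial>lborel) * indicator {0..} s \<partial>lborel)
       = (\<integral>\<^sup>+T. (\<integral>\<^sup>+\<theta>. g (of_real (sqrt (T + (cmod b)\<^sup>2)) * cis (-\<theta>)) b * indicator {0..<2*pi} \<theta> \<partial>lborel) * indicator {0..} (T + (cmod b)\<^sup>2) \<partial>lborel)"
      by (subst nn_integral_real_affine[where c=1 and t="(cmod b)\<^sup>2"]) (auto simp: add.commute)
    also have "\<dots> = (\<integral>\<^sup>+T. (\<integral>\<^sup>+\<theta>. f (hypc (sqrt T) b \<theta>) * indicator {0..<2*pi} \<theta> \<partial>lborel) * indicator {0<..} T \<partial>lborel)"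
    proof (intro nn_integral_cong)
      fix T :: real
      consider "T > 0" | "T \<le> 0" "T + (cmod b)\<^sup>2 \<ge> 0" | "T + (cmod b)\<^sup>2 < 0" by linarith
      thus "(\<integral>\<^sup>+\<theta>. g (of_real (sqrt (T + (cmod b)\<^sup>2)) * cis (-\<theta>)) b * indicator {0..<2*pi} \<theta> \<partial>lborel) * indicator {0..} (T + (cmod b)\<^sup>2)
        = (\<integral>\<^sup>+\<theta>. f (hypc (sqrt T) b \<theta>) * indicator {0..<2*pi} \<theta> \<partial>lborel) * indicator {0<..} T"
      proof cases
        case 1
        hence "T + (cmod b)\<^sup>2 \<ge> 0" by (simp add: add_nonneg_nonneg)
        thus ?thesis using 1 by (simp add: g_def hypc_def norm_mult)
      next
        case 3
        hence "T < 0" by (smt (verit) zero_le_power2)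
        thus ?thesis using 3 by simp
      qed (simp add: g_def norm_mult)
    qed
    finally show "(\<integral>\<^sup>+s. (\<integral>\<^sup>+\<theta>. g (of_real (sqrt s) * cis (-\<theta>)) b * indicator {0..<2*pi} \<theta> \<partial>lborel) * indicator {0..} s \<partial>lborel) = \<dots>" .
  qed
  also have "\<dots> = (\<integral>\<^sup>+T. (\<integral>\<^sup>+b. (\<integral>\<^sup>+\<theta>. f (hypc (sqrt T) b \<theta>) * indicator {0..<2*pi} \<theta> \<partial>lborel) * indicator {0<..} T \<partial>lborel) \<partial>lborel)"
    unfolding hypc_def by (rule lborel_pair.Fubini') measurable
  also have "\<dots> = (\<integral>\<^sup>+T. (\<integral>\<^sup>+X. f X \<partial>Mh (sqrt T)) * indicator {0<..} T \<partial>lborel)"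
    by (intro nn_integral_cong) (simp add: nn_integral_Mh nn_integral_multc)
  finally show ?thesis .
qed

text \<open>The symmetric bilinear form belonging to the quadratic form \<open>qN\<close>.\<close>

definition qform :: "real^4 \<Rightarrow> real^4 \<Rightarrow> real" where
  "qform X Y = X$0 * Y$0 - X$1 * Y$1 - X$2 * Y$2 + X$3 * Y$3"

text \<open>By polarization \<open>L\<close> preserves \<open>qform\<close>, so its matrix satisfies
  \<open>L^T \<eta> L = \<eta>\<close>, and determinants give \<open>det^2 = 1\<close>.\<close>

lemma det_qN_preserving:
  fixes L :: "real^4 \<Rightarrow> real^4"
  assumes L: "linear L" and N: "\<And>X. qN (L X) = qN X"
  shows "\<bar>det (matrix L)\<bar> = 1"
proof -
  have pol: "2 * qform X Y = qN (X + Y) - qN X - qN Y" for X Y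
    by (simp add: qform_def qN_eq power2_eq_square algebra_simps)
  have b: "qform (L X) (L Y) = qform X Y" for X Y
    using pol[of "L X" "L Y"] pol[of X Y] N by (simp flip: linear_add[OF L])
  define e :: "4 \<Rightarrow> real" where "e i = (if i = 1 \<or> i = 2 then -1 else 1)" for i
  define \<eta> :: "real^4^4" where "\<eta> = (\<chi> i j. if i = j then e i else 0)"
  have qf: "qform X Y = (\<Sum>k\<in>UNIV. e k * X$k * Y$k)" for X Y
    by (simp add: sum_index_4 e_def qform_def)
  have "transpose (matrix L) ** \<eta> ** matrix L = \<eta>"
  proof -
    have "(transpose (matrix L) ** \<eta> ** matrix L) $ i $ j = \<eta> $ i $ j" for i j
    proof -
      have 1: "(transpose (matrix L) ** \<eta>) $ i $ k = e k * L (axis i 1) $ k" for k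
        by (simp add: matrix_matrix_mult_def transpose_def matrix_def \<eta>_def if_distrib[of "\<lambda>x. _ * x"] sum.delta cong: if_cong)
      have "(transpose (matrix L) ** \<eta> ** matrix L) $ i $ j = (\<Sum>k\<in>UNIV. (transpose (matrix L) ** \<eta>) $ i $ k * matrix L $ k $ j)"
        by (simp add: matrix_matrix_mult_def)
      also have "\<dots> = qform (L (axis i 1)) (L (axis j 1))"
        unfolding qf 1 by (simp add: matrix_def)
      also have "\<dots> = qform (axis i 1) (axis j 1)" by (rule b)
      also have "\<dots> = \<eta> $ i $ j"
        by (simp add: qf \<eta>_def axis_def if_distrib[of "\<lambda>x. _ * x"] if_distrib[of "\<lambda>x. x * _"] cong: if_cong)
      finally show ?thesis .
    qed
    thus ?thesis by (simp add: vec_eq_iff)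
  qed
  hence "det (matrix L) * det \<eta> * det (matrix L) = det \<eta>"
    by (metis det_mul det_transpose)
  moreover have "det \<eta> \<noteq> 0"
    by (subst det_diagonal) (auto simp: \<eta>_def e_def prod_index_4)
  ultimately have "(det (matrix L))\<^sup>2 = 1" by (simp add: power2_eq_square)
  thus ?thesis by (metis abs_one abs_square_eq_1 power2_eq_1_iff abs_minus_cancel)
qed

lemma AE_Mh:
  assumes "\<And>v \<theta>. P (hypc R v \<theta>)" and [measurable]: "Measurable.pred borel P"
  shows "AE X in Mh R. P X"
  unfolding Mh_def by (subst AE_distr_iff) (use assms in \<open>auto simp: AE_density\<close>)

text \<open>Dilation by \<open>c = sqrt T / R\<close> carries one hyperboloid to the other; it
  leaves the angle alone and scales area in the plane of \<open>v\<close> by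
  \<open>c^2\<close>.\<close>

lemma nn_integral_Mh_scale:
  assumes R: "R > 0" "T > 0" and f[measurable]: "f \<in> borel_measurable borel"
    and hom: "\<And>c X. c > 0 \<Longrightarrow> f (c *\<^sub>R X) = f X"
  shows "(\<integral>\<^sup>+X. f X \<partial>Mh (sqrt T)) = ennreal (T / R\<^sup>2) * (\<integral>\<^sup>+X. f X \<partial>Mh R)"
proof -
  define c where "c = sqrt T / R"
  have c: "c > 0" and c2: "T / R\<^sup>2 = c\<^sup>2" and T: "T = c\<^sup>2 * R\<^sup>2"
    using R by (auto simp: c_def power_divide)
  define F where "F v = (\<integral>\<^sup>+\<theta>. f (hypc (sqrt T) v \<theta>) * indicator {0..<2*pi} \<theta> \<partial>lborel)" for v
  have [measurable]: "F \<in> borel_measurable borel" unfolding F_def by measurable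
  have h: "hypc (sqrt T) (c *\<^sub>R v) \<theta> = c *\<^sub>R hypc R v \<theta>" for v \<theta>
  proof -
    have "sqrt ((sqrt T)\<^sup>2 + (cmod (c *\<^sub>R v))\<^sup>2) = sqrt (c\<^sup>2 * (R\<^sup>2 + (cmod v)\<^sup>2))"
      using R by (simp add: T power_mult_distrib algebra_simps)
    also have "\<dots> = c * sqrt (R\<^sup>2 + (cmod v)\<^sup>2)" using c by (simp add: real_sqrt_mult)
    finally have s: "sqrt ((sqrt T)\<^sup>2 + (cmod (c *\<^sub>R v))\<^sup>2) = c * sqrt (R\<^sup>2 + (cmod v)\<^sup>2)" .
    show ?thesis by (intro quat_eqI) (simp_all add: za_hypc zb_hypc s[unfolded scaleR_conv_of_real] scaleR_conv_of_real[where 'a=complex] del: real_sqrt_pow2)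
  qed
  have "(\<integral>\<^sup>+X. f X \<partial>Mh (sqrt T)) = (\<integral>\<^sup>+v. F v \<partial>lborel)"
    by (simp add: nn_integral_Mh F_def)
  also have "\<dots> = (\<integral>\<^sup>+v. F v \<partial>density (distr lborel borel (\<lambda>x. 0 + c *\<^sub>R x)) (\<lambda>_. ennreal (\<bar>c\<bar> ^ DIM(complex))))"
    using c by (subst lborel_affine[of c 0]) auto
  also have "\<dots> = (\<integral>\<^sup>+v. ennreal (c\<^sup>2) * F (c *\<^sub>R v) \<partial>lborel)"
    using c by (subst nn_integral_density, simp, simp, subst nn_integral_distr) (auto simp: power2_eq_square)
  also have "\<dots> = ennreal (c\<^sup>2) * (\<integral>\<^sup>+v. F (c *\<^sub>R v) \<partial>lborel)"
    by (rule nn_integral_cmult) simp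
  also have "(\<integral>\<^sup>+v. F (c *\<^sub>R v) \<partial>lborel) = (\<integral>\<^sup>+X. f X \<partial>Mh R)"
    using c by (simp add: F_def h hom nn_integral_Mh)
  finally show ?thesis by (simp add: c2)
qed

text \<open>\<open>f\<close> is extended from the hyperboloid to the cone with degree of homogeneity
  0 and cut off to the shell \<open>1 < qN < 2\<close>. Twice the Lebesgue integral of the result
  equals a constant \<open>c\<close> times the integral of \<open>f\<close> over the hyperboloid,
  and the Lebesgue integral does not change when \<open>X\<close> is replaced by
  \<open>L X\<close>.\<close>

lemma nn_integral_Mh_invariant:
  assumes R: "R > 0" and L: "linear L" "\<And>X. qN (L X) = qN X" and [measurable]: "f \<in> borel_measurable borel"
  shows "(\<integral>\<^sup>+X. f (L X) \<partial>Mh R) = (\<integral>\<^sup>+X. f X \<partial>Mh R)"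
proof -
  have [measurable]: "L \<in> borel_measurable borel"
    using L(1) by (simp add: borel_measurable_continuous_onI linear_continuous_on linear_conv_bounded_linear)
  define c where "c = (\<integral>\<^sup>+T. ennreal (T / R\<^sup>2) * indicator {1<..<2} T \<partial>lborel)"
  have main: "2 * (\<integral>\<^sup>+X. (f ((R / sqrt (qN X)) *\<^sub>R X) * indicator {1<..<2} (qN X)) * indicator {X. 0 < qN X} X \<partial>lborel)
     = c * (\<integral>\<^sup>+X. f X \<partial>Mh R)" if [measurable]: "f \<in> borel_measurable borel" for f :: "real^4 \<Rightarrow> ennreal"
  proof -
    define g where "g X = f ((R / sqrt (qN X)) *\<^sub>R X)" for X
    have [measurable]: "g \<in> borel_measurable borel" unfolding g_def by measurable
    have hom: "g (t *\<^sub>R X) = g X" if "t > 0" for t X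
    proof -
      have "qN (t *\<^sub>R X) = t\<^sup>2 * qN X" by (simp add: qN_eq power_mult_distrib algebra_simps)
      hence "sqrt (qN (t *\<^sub>R X)) = t * sqrt (qN X)" using that by (simp add: real_sqrt_mult)
      thus ?thesis using that by (simp add: g_def)
    qed
    have gf: "(\<integral>\<^sup>+X. g X \<partial>Mh R) = (\<integral>\<^sup>+X. f X \<partial>Mh R)"
      using R by (simp add: nn_integral_Mh g_def)
    have "2 * (\<integral>\<^sup>+X. (g X * indicator {1<..<2} (qN X)) * indicator {X. 0 < qN X} X \<partial>lborel)
      = (\<integral>\<^sup>+T. (\<integral>\<^sup>+X. g X * indicator {1<..<2} (qN X) \<partial>Mh (sqrt T)) * indicator {0<..} T \<partial>lborel)"
      by (rule nn_integral_disintegrate) measurable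
    also have "\<dots> = (\<integral>\<^sup>+T. ennreal (T / R\<^sup>2) * indicator {1<..<2} T * (\<integral>\<^sup>+X. f X \<partial>Mh R) \<partial>lborel)"
    proof (rule nn_integral_cong)
      fix T :: real
      show "(\<integral>\<^sup>+X. g X * indicator {1<..<2} (qN X) \<partial>Mh (sqrt T)) * indicator {0<..} T = ennreal (T / R\<^sup>2) * indicator {1<..<2} T * (\<integral>\<^sup>+X. f X \<partial>Mh R)"
      proof (cases "T > 0")
        case True
        have "(\<integral>\<^sup>+X. g X * indicator {1<..<2} (qN X) \<partial>Mh (sqrt T)) = (\<integral>\<^sup>+X. g X * indicator {1<..<2} T \<partial>Mh (sqrt T))"
          by (intro nn_integral_cong_AE AE_Mh) (use True in auto)
        also have "\<dots> = (\<integral>\<^sup>+X. g X \<partial>Mh (sqrt T)) * indicator {1<..<2} T"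
          by (rule nn_integral_multc) simp
        also have "(\<integral>\<^sup>+X. g X \<partial>Mh (sqrt T)) = ennreal (T / R\<^sup>2) * (\<integral>\<^sup>+X. f X \<partial>Mh R)"
          using nn_integral_Mh_scale[OF R True _ hom] by (simp add: gf)
        finally show ?thesis using True by (simp add: mult_ac)
      qed (auto simp: indicator_def)
    qed
    also have "\<dots> = c * (\<integral>\<^sup>+X. f X \<partial>Mh R)"
      unfolding c_def by (rule nn_integral_multc) simp
    finally show ?thesis unfolding g_def .
  qed
  have "c * (\<integral>\<^sup>+X. f (L X) \<partial>Mh R) = 2 * (\<integral>\<^sup>+X. (f (L ((R / sqrt (qN X)) *\<^sub>R X)) * indicator {1<..<2} (qN X)) * indicator {X. 0 < qN X} X \<partial>lborel)"
    by (subst main[symmetric]) auto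
  also have "\<dots> = 2 * (\<integral>\<^sup>+X. (f ((R / sqrt (qN (L X))) *\<^sub>R L X) * indicator {1<..<2} (qN (L X))) * indicator {X. 0 < qN X} (L X) \<partial>lborel)"
    by (simp add: L linear_scale[OF L(1)] indicator_def)
  also have "\<dots> = 2 * (\<integral>\<^sup>+X. (f ((R / sqrt (qN X)) *\<^sub>R X) * indicator {1<..<2} (qN X)) * indicator {X. 0 < qN X} X \<partial>distr lborel borel L)"
    by (subst nn_integral_distr) auto
  also have "distr lborel borel L = lborel"
    by (rule lborel_linear_image[OF L(1) det_qN_preserving[OF L]])
  also note main[of f]
  finally have eq: "c * (\<integral>\<^sup>+X. f (L X) \<partial>Mh R) = c * (\<integral>\<^sup>+X. f X \<partial>Mh R)" by simp
  \<comment> \<open>Cancelling \<open>c\<close> in \<open>ennreal\<close> requires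
    \<open>0 < c < \<infinity>\<close>; this is the purpose of the cut-off to a bounded shell of
    positive width.\<close>
  have "c \<noteq> 0"
  proof
    assume "c = 0"
    hence "AE T in lborel. ennreal (T / R\<^sup>2) * indicator {1<..<2} T = 0"
      unfolding c_def by (subst (asm) nn_integral_0_iff_AE) auto
    hence "AE T in lborel. T \<notin> {1<..<2::real}"
      by (rule eventually_mono) (use R in \<open>auto simp: indicator_def divide_simps split: if_splits\<close>)
    hence "emeasure lborel {1<..<2::real} = 0"
      by (subst (asm) AE_iff_measurable[where N="{1<..<2}"]) auto
    thus False by simp
  qed
  moreover have "c \<noteq> \<infinity>"
  proof -
    have "c \<le> (\<integral>\<^sup>+T. ennreal (2 / R\<^sup>2) * indicator {1<..<2::real} T \<partial>lborel)"
      unfolding c_def by (intro nn_integral_mono) (auto simp: indicator_def intro!: ennreal_leI divide_right_mono)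
    also have "\<dots> = ennreal (2 / R\<^sup>2) * emeasure lborel {1<..<2::real}"
      by (subst nn_integral_cmult) auto
    also have "\<dots> < \<infinity>" by (simp add: ennreal_mult_less_top)
    finally show ?thesis by auto
  qed
  ultimately show ?thesis using eq by (simp add: ennreal_mult_cancel_left)
qed

lemma distr_Mh_invariant:
  assumes R: "R > 0" and L: "linear L" "\<And>X. qN (L X) = qN X"
  shows "distr (Mh R) borel L = Mh R"
proof (rule measure_eqI)
  have [measurable]: "L \<in> borel_measurable borel"
    using L(1) by (simp add: borel_measurable_continuous_onI linear_continuous_on linear_conv_bounded_linear)
  fix A assume "A \<in> sets (distr (Mh R) borel L)"
  hence [measurable]: "A \<in> sets borel" by simp
  have "emeasure (distr (Mh R) borel L) A = (\<integral>\<^sup>+X. indicator A X \<partial>distr (Mh R) borel L)" by simp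
  also have "\<dots> = (\<integral>\<^sup>+X. indicator A (L X) \<partial>Mh R)"
    by (rule nn_integral_distr) auto
  also have "\<dots> = emeasure (Mh R) A" by (subst nn_integral_Mh_invariant[OF R L]) auto
  finally show "emeasure (distr (Mh R) borel L) A = emeasure (Mh R) A" .
qed simp

section \<open>Integrability against the kernel\<close>

text \<open>The decay imposed by the seminorms with exponent \<open>n = 4\<close>, which is enough for all integrals below.\<close>

definition wt :: "real \<Rightarrow> real" where "wt r = 1 / ((1 + \<bar>ln r\<bar>) ^ 4 * r)"

lemma borel_measurable_wt [measurable]: "wt \<in> borel_measurable borel"
  unfolding wt_def[abs_def] by measurable

lemma wt_nonneg: "r \<ge> 0 \<Longrightarrow> wt r \<ge> 0" by (simp add: wt_def)

text \<open>On the half-line this is the derivative of \<open>- 1 / (1 + ln (1 + x))\<close>, hence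
  integrable, which \<open>1 / (1 + x)\<close> alone is not.\<close>

definition logwt :: "real \<Rightarrow> real" where "logwt x = 1 / ((1 + \<bar>x\<bar>) * (1 + ln (1 + \<bar>x\<bar>))\<^sup>2)"

lemma borel_measurable_logwt [measurable]: "logwt \<in> borel_measurable borel"
  unfolding logwt_def[abs_def] by measurable

lemma logwt_nonneg: "logwt x \<ge> 0"
  by (simp add: logwt_def)

lemma nn_integral_logwt_half: "(\<integral>\<^sup>+x. ennreal (logwt x) * indicator {0..} x \<partial>lborel) = 1"
proof -
  have "(\<integral>\<^sup>+x. ennreal (logwt x) * indicator {0..} x \<partial>lborel) = ennreal (0 - (- 1 / (1 + ln (1 + 0::real))))"
  proof (rule nn_integral_FTC_atLeast)
    fix x :: real assume x: "0 \<le> x"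
    hence "1 + ln (1 + x) > 0" by (smt (verit) ln_ge_zero)
    thus "((\<lambda>x. - 1 / (1 + ln (1 + x))) has_real_derivative logwt x) (at x)"
      using x by (auto intro!: derivative_eq_intros simp: logwt_def field_simps power2_eq_square)
  next
    have "filterlim (\<lambda>x::real. 1 + ln (1 + x)) at_top at_top"
      by (intro filterlim_tendsto_add_at_top[OF tendsto_const] filterlim_compose[OF ln_at_top] filterlim_ident)
    thus "((\<lambda>x::real. - 1 / (1 + ln (1 + x))) \<longlongrightarrow> 0) at_top"
      by (rule tendsto_divide_0[OF tendsto_const filterlim_at_top_imp_at_infinity])
  qed (auto simp: logwt_nonneg)
  thus ?thesis by simp
qed

lemma nn_integral_logwt: "(\<integral>\<^sup>+x. ennreal (logwt x) \<partial>lborel) < \<infinity>"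
proof -
  have "(\<integral>\<^sup>+x. ennreal (logwt x) * indicator {..0} x \<partial>lborel) = (\<integral>\<^sup>+x. ennreal (logwt x) * indicator {0..} x \<partial>lborel)"
    by (subst nn_integral_real_affine[where c="-1" and t=0]) (auto simp: logwt_def indicator_def intro!: nn_integral_cong)
  hence 1: "(\<integral>\<^sup>+x. ennreal (logwt x) * indicator {..0} x \<partial>lborel) = 1" by (simp add: nn_integral_logwt_half)
  have "(\<integral>\<^sup>+x. ennreal (logwt x) \<partial>lborel) \<le> (\<integral>\<^sup>+x. ennreal (logwt x) * indicator {0..} x + ennreal (logwt x) * indicator {..0} x \<partial>lborel)"
    by (intro nn_integral_mono) (auto simp: indicator_def)
  also have "\<dots> = 1 + 1" by (subst nn_integral_add) (simp_all add: 1 nn_integral_logwt_half)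
  also have "\<dots> < \<infinity>" by simp
  finally show ?thesis .
qed

text \<open>For \<open>r \<ge> R\<close> the quantities \<open>1 + |x|\<close> and
  \<open>1 + |y|\<close> are at most a multiple of \<open>r\<close>, and likewise for the
  logarithms. Two of the four logarithmic powers in \<open>wt\<close> go to each coordinate and the
  factor \<open>r\<close> goes to \<open>y\<close>. Nothing is left to pay for the factor
  \<open>1 + |x|\<close> in \<open>logwt x\<close>, so it stays on the right and has to be supplied
  by the kernel.\<close>

lemma wt_le_logwt:
  assumes R: "R > 0" and r: "r \<ge> R" "\<bar>x\<bar> \<le> r" "\<bar>y\<bar> \<le> r"
  shows "wt r \<le> (1 + ln (1 + 1/R)) ^ 4 * (1 + 1/R) * ((1 + \<bar>x\<bar>) * logwt x * logwt y)"
proof -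
  define K where "K = 1 + ln (1 + 1/R)"
  have K: "K \<ge> 1" using R by (simp add: K_def)
  have r0: "r > 0" using R r by simp
  have one: "1 + \<bar>t\<bar> \<le> (1 + 1/R) * r" if "\<bar>t\<bar> \<le> r" for t
  proof -
    have "1 \<le> r / R" using R r by simp
    moreover have "(1 + 1/R) * r = r + r / R" by (simp add: algebra_simps)
    ultimately show ?thesis using that by linarith
  qed
  have lnb: "1 + ln (1 + \<bar>t\<bar>) \<le> K * (1 + \<bar>ln r\<bar>)" if "\<bar>t\<bar> \<le> r" for t
  proof -
    have "ln (1 + \<bar>t\<bar>) \<le> ln ((1 + 1/R) * r)"
      using one[OF that] by (intro ln_mono) auto
    also have "\<dots> = ln (1 + 1/R) + ln r" using R r0 by (intro ln_mult_pos) (auto simp: add_pos_pos)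
    also have "\<dots> \<le> K - 1 + K * \<bar>ln r\<bar>" 
      using K by (auto simp: K_def intro!: add_mono order_trans[OF abs_ge_self] mult_right_mono[of 1 K "\<bar>ln r\<bar>", simplified])
    finally show ?thesis by (simp add: algebra_simps)
  qed
  have pos: "1 + ln (1 + \<bar>t\<bar>) > 0" for t :: real by (smt (verit) ln_ge_zero)
  have "(1 + ln (1 + \<bar>x\<bar>))\<^sup>2 * ((1 + \<bar>y\<bar>) * (1 + ln (1 + \<bar>y\<bar>))\<^sup>2) \<le> (K * (1 + \<bar>ln r\<bar>))\<^sup>2 * (((1 + 1/R) * r) * (K * (1 + \<bar>ln r\<bar>))\<^sup>2)"
    using lnb[OF r(2)] lnb[OF r(3)] one[OF r(3)] pos[of x] pos[of y] R r0 K
    by (intro mult_mono power_mono) (auto intro!: mult_nonneg_nonneg)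
  also have "\<dots> = K ^ 4 * (1 + 1/R) * ((1 + \<bar>ln r\<bar>) ^ 4 * r)"
    by (simp add: power_mult_distrib power4_eq_xxxx power2_eq_square)
  finally have *: "(1 + ln (1 + \<bar>x\<bar>))\<^sup>2 * ((1 + \<bar>y\<bar>) * (1 + ln (1 + \<bar>y\<bar>))\<^sup>2) \<le> K ^ 4 * (1 + 1/R) * ((1 + \<bar>ln r\<bar>) ^ 4 * r)" .
  have P: "(1 + \<bar>ln r\<bar>) ^ 4 * r > 0" using r0 by simp
  have "(1 + \<bar>x\<bar>) * logwt x * logwt y = 1 / ((1 + ln (1 + \<bar>x\<bar>))\<^sup>2 * ((1 + \<bar>y\<bar>) * (1 + ln (1 + \<bar>y\<bar>))\<^sup>2))"
    by (simp add: logwt_def)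
  moreover have "0 < (1 + ln (1 + \<bar>x\<bar>))\<^sup>2 * ((1 + \<bar>y\<bar>) * (1 + ln (1 + \<bar>y\<bar>))\<^sup>2)"
    using pos[of x] pos[of y] by simp
  moreover have "1 / p \<le> k * (1 / a)" if "0 < a" "0 < p" "a \<le> k * p" for a p k :: real
    using that by (simp add: field_simps)
  ultimately show ?thesis using * P
    unfolding wt_def K_def[symmetric] by simp
qed

text \<open>The imaginary part keeps the kernel above \<open>\<epsilon>\<close> and the real part
  makes it grow linearly in \<open>x\<close>. Together they supply the factor \<open>1 + |x|\<close>
  that \<open>wt_le_logwt\<close> leaves open.\<close>

lemma kernel_lower:
  assumes "w > 0" "\<epsilon> > 0" "\<bar>\<sigma>\<bar> = (1::real)"
  shows "1 + \<bar>x\<bar> \<le> ((1 + \<bar>C\<bar> / (2*w)) / \<epsilon> + 1 / (2*w)) * cmod (Complex (C - 2*w*x) (\<sigma> * \<epsilon>))"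
proof -
  define N where "N = cmod (Complex (C - 2*w*x) (\<sigma> * \<epsilon>))"
  have 1: "\<epsilon> \<le> N" using abs_Im_le_cmod[of "Complex (C - 2*w*x) (\<sigma> * \<epsilon>)"] assms by (simp add: N_def abs_mult)
  have 2: "\<bar>C - 2*w*x\<bar> \<le> N" using abs_Re_le_cmod[of "Complex (C - 2*w*x) (\<sigma> * \<epsilon>)"] by (simp add: N_def)
  have "\<bar>2*w*x\<bar> \<le> \<bar>C\<bar> + N" using 2 by linarith
  hence "\<bar>x\<bar> \<le> (\<bar>C\<bar> + N) / (2*w)" using assms by (simp add: field_simps abs_mult)
  hence "1 + \<bar>x\<bar> \<le> (1 + \<bar>C\<bar> / (2*w)) * 1 + N / (2*w)" by (simp add: add_divide_distrib)
  also have "\<dots> \<le> (1 + \<bar>C\<bar> / (2*w)) * (N / \<epsilon>) + N / (2*w)"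
    using 1 assms by (intro add_right_mono mult_left_mono) auto
  finally show ?thesis by (simp add: N_def algebra_simps)
qed

lemma lborel_complex_Complex:
  "(lborel :: complex measure) = distr (lborel \<Otimes>\<^sub>M lborel) borel (\<lambda>p. Complex (fst p) (snd p))"
  unfolding lborel_prod
proof (rule lborel_eqI)
  fix l u :: complex assume lu: "\<And>b. b \<in> Basis \<Longrightarrow> l \<bullet> b \<le> u \<bullet> b"
  have le: "Re l \<le> Re u" "Im l \<le> Im u" using lu[of 1] lu[of \<i>] by (auto simp: Basis_complex_def)
  have [measurable]: "(\<lambda>p::real \<times> real. Complex (fst p) (snd p)) \<in> borel_measurable borel"
    unfolding Complex_eq borel_prod[symmetric] by measurable
  have "emeasure (distr lborel borel (\<lambda>p::real \<times> real. Complex (fst p) (snd p))) (box l u) 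
     = emeasure lborel (box (Re l, Im l) (Re u, Im u))"
    by (subst emeasure_distr) (auto intro!: arg_cong[where f="emeasure lborel"] simp: mem_box Basis_complex_def Basis_prod_def)
  also have "\<dots> = (\<Prod>b\<in>Basis. ((Re u, Im u) - (Re l, Im l)) \<bullet> b)"
    using le by (intro emeasure_lborel_box) (auto simp: Basis_prod_def)
  also have "(\<Prod>b\<in>Basis. ((Re u, Im u) - (Re l, Im l)) \<bullet> b) = (\<Prod>b\<in>Basis. (u - l) \<bullet> b)"
  proof -
    have B: "(Basis :: (real \<times> real) set) = {(1, 0), (0, 1)}" by (auto simp: Basis_prod_def)
    show ?thesis unfolding B Basis_complex_def by simp
  qed
  finally show "emeasure (distr lborel borel (\<lambda>p::real \<times> real. Complex (fst p) (snd p))) (box l u) = (\<Prod>b\<in>Basis. (u - l) \<bullet> b)" .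
qed simp

lemma nn_integral_radial:
  assumes [measurable]: "G \<in> borel_measurable borel" and "R > 0"
  shows "(\<integral>\<^sup>+v. G (R\<^sup>2 + (cmod v)\<^sup>2) \<partial>lborel) = ennreal pi * (\<integral>\<^sup>+s. G s * indicator {R\<^sup>2..} s \<partial>lborel)"
proof -
  have "(\<integral>\<^sup>+v. G (R\<^sup>2 + (cmod v)\<^sup>2) \<partial>lborel) = (\<integral>\<^sup>+t. G (R\<^sup>2 + t) \<partial>distr lborel borel (\<lambda>z::complex. (cmod z)\<^sup>2))"
    by (subst nn_integral_distr) auto
  also have "\<dots> = (\<integral>\<^sup>+t. ennreal pi * (G (R\<^sup>2 + t) * indicator {0..} t) \<partial>lborel)"
    by (subst distr_lborel_cmod_power2, subst nn_integral_density) (auto intro!: nn_integral_cong simp: mult_ac)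
  also have "\<dots> = ennreal pi * (\<integral>\<^sup>+t. G (R\<^sup>2 + t) * indicator {0..} t \<partial>lborel)"
    by (rule nn_integral_cmult) simp
  also have "(\<integral>\<^sup>+t. G (R\<^sup>2 + t) * indicator {0..} t \<partial>lborel) = (\<integral>\<^sup>+s. G s * indicator {R\<^sup>2..} s \<partial>lborel)"
    by (subst nn_integral_real_affine[where c=1 and t="-R\<^sup>2"]) (auto intro!: nn_integral_cong simp: indicator_def)
  finally show ?thesis .
qed

text \<open>Since \<open>|z_11|^2 = R^2 + |v|^2\<close>, the squared radii in the planes of
  \<open>v\<close> and of \<open>z_11\<close> differ by a constant, and the phase of
  \<open>v\<close>, on which the integrand does not depend, contributes
  \<open>2 * pi\<close>.\<close>

lemma nn_integral_Mh_za:
  assumes [measurable]: "h \<in> borel_measurable borel" and R: "R > 0"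
  shows "(\<integral>\<^sup>+X. h (za X) \<partial>Mh R) = ennreal (2 * pi) * (\<integral>\<^sup>+z. h z * indicator {R..} (cmod z) \<partial>lborel)"
proof -
  define G where "G s = (\<integral>\<^sup>+\<theta>. h (of_real (sqrt s) * cis (-\<theta>)) * indicator {0..<2*pi} \<theta> \<partial>lborel)" for s
  have [measurable]: "G \<in> borel_measurable borel" unfolding G_def by measurable
  have "(\<integral>\<^sup>+X. h (za X) \<partial>Mh R) = (\<integral>\<^sup>+v. G (R\<^sup>2 + (cmod v)\<^sup>2) \<partial>lborel)"
    by (simp add: nn_integral_Mh za_hypc G_def)
  also have "\<dots> = ennreal pi * (\<integral>\<^sup>+s. G s * indicator {R\<^sup>2..} s \<partial>lborel)"
    by (rule nn_integral_radial[OF _ R]) simp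
  also have "(\<integral>\<^sup>+s. G s * indicator {R\<^sup>2..} s \<partial>lborel) = 2 * (\<integral>\<^sup>+z. h z * indicator {R..} (cmod z) \<partial>lborel)"
  proof (subst nn_integral_polar, measurable, rule nn_integral_cong)
    fix s :: real
    have "s \<ge> R\<^sup>2 \<longleftrightarrow> s \<ge> 0 \<and> sqrt s \<ge> R"
      using R by (metis less_eq_real_def order_trans real_le_rsqrt real_sqrt_le_iff real_sqrt_pow2 sqrt_le_D zero_le_power2 real_sqrt_abs abs_of_pos)
    thus "G s * indicator {R\<^sup>2..} s = (\<integral>\<^sup>+\<theta>. h (of_real (sqrt s) * cis (-\<theta>)) * indicator {R..} (cmod (of_real (sqrt s) * cis (-\<theta>))) * indicator {0..<2*pi} \<theta> \<partial>lborel) * indicator {0..} s"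
      unfolding G_def by (auto simp: norm_mult indicator_def)
  qed
  finally show ?thesis by (simp add: ennreal_mult mult_ac)
qed

text \<open>A bound for fixed \<open>\<epsilon>\<close>, which secures the existence of the
  integrals only. In the plane of \<open>z_11\<close> the integrand is dominated by a product of
  integrable functions of the two real coordinates.\<close>

lemma nn_integral_kernel_finite:
  assumes R: "R > 0" and w: "w > 0" "\<epsilon> > 0" "\<bar>\<sigma>\<bar> = (1::real)"
  shows "(\<integral>\<^sup>+X. ennreal (wt (cmod (za X)) / cmod (Complex (C - 2*w*Re (za X)) (\<sigma> * \<epsilon>))) \<partial>Mh R) < \<infinity>"
proof -
  define K1 where "K1 = (1 + ln (1 + 1/R)) ^ 4 * (1 + 1/R)"
  define K2 where "K2 = (1 + \<bar>C\<bar> / (2*w)) / \<epsilon> + 1 / (2*w)"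
  have K: "K1 \<ge> 0" "K2 > 0" using R w by (auto simp: K1_def K2_def intro!: add_nonneg_pos)
  define h where "h z = wt (cmod z) / cmod (Complex (C - 2*w*Re z) (\<sigma> * \<epsilon>))" for z
  have [measurable]: "h \<in> borel_measurable borel" unfolding h_def Complex_eq by measurable
  have [measurable]: "(\<lambda>p. Complex (fst p) (snd p)) \<in> borel_measurable (lborel \<Otimes>\<^sub>M lborel)"
    unfolding Complex_eq by measurable
  have "(\<integral>\<^sup>+z. ennreal (h z) * indicator {R..} (cmod z) \<partial>lborel)
     \<le> (\<integral>\<^sup>+z. ennreal (K1 * K2) * (ennreal (logwt (Re z)) * ennreal (logwt (Im z))) \<partial>lborel)"
  proof (rule nn_integral_mono)
    fix z :: complex
    have "h z \<le> K1 * K2 * (logwt (Re z) * logwt (Im z))" if "cmod z \<ge> R"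
    proof -
      define N where "N = cmod (Complex (C - 2*w*Re z) (\<sigma> * \<epsilon>))"
      have N: "1 + \<bar>Re z\<bar> \<le> K2 * N" using kernel_lower[OF w] by (simp add: K2_def N_def)
      hence N0: "N > 0" using K by (smt (verit) mult_nonneg_nonpos N_def norm_ge_zero)
      have "wt (cmod z) \<le> K1 * ((1 + \<bar>Re z\<bar>) * logwt (Re z) * logwt (Im z))"
        unfolding K1_def by (rule wt_le_logwt[OF R that]) (auto intro: abs_Re_le_cmod abs_Im_le_cmod)
      also have "\<dots> \<le> K1 * ((K2 * N) * logwt (Re z) * logwt (Im z))"
        using K N by (intro mult_left_mono mult_right_mono) (auto simp: logwt_nonneg)
      finally show ?thesis using N0 unfolding h_def N_def[symmetric] by (simp add: divide_simps mult_ac)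
    qed
    thus "ennreal (h z) * indicator {R..} (cmod z) \<le> ennreal (K1 * K2) * (ennreal (logwt (Re z)) * ennreal (logwt (Im z)))"
      using K by (auto simp: indicator_def logwt_nonneg simp flip: ennreal_mult intro!: ennreal_leI)
  qed
  also have "\<dots> = ennreal (K1 * K2) * (\<integral>\<^sup>+z. ennreal (logwt (Re z)) * ennreal (logwt (Im z)) \<partial>lborel)"
    by (rule nn_integral_cmult) measurable
  also have "(\<integral>\<^sup>+z. ennreal (logwt (Re z)) * ennreal (logwt (Im z)) \<partial>lborel) = (\<integral>\<^sup>+p. ennreal (logwt (fst p)) * ennreal (logwt (snd p)) \<partial>(lborel \<Otimes>\<^sub>M lborel))"
    by (subst lborel_complex_Complex, subst nn_integral_distr) simp_all
  also have "\<dots> = (\<integral>\<^sup>+x. (\<integral>\<^sup>+y. ennreal (logwt x) * ennreal (logwt y) \<partial>lborel) \<partial>lborel)"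
    by (subst lborel.nn_integral_fst[symmetric]) simp_all
  also have "\<dots> = (\<integral>\<^sup>+x. ennreal (logwt x) \<partial>lborel) * (\<integral>\<^sup>+y. ennreal (logwt y) \<partial>lborel)"
    by (simp add: nn_integral_cmult nn_integral_multc)
  also have "ennreal (K1 * K2) * \<dots> < \<infinity>"
    using nn_integral_logwt by (simp add: ennreal_mult_less_top)
  finally have fin: "(\<integral>\<^sup>+z. ennreal (h z) * indicator {R..} (cmod z) \<partial>lborel) < \<infinity>" .
  have "(\<integral>\<^sup>+X. ennreal (h (za X)) \<partial>Mh R) = ennreal (2 * pi) * (\<integral>\<^sup>+z. ennreal (h z) * indicator {R..} (cmod z) \<partial>lborel)"
    by (rule nn_integral_Mh_za[OF _ R]) simp
  also have "\<dots> < \<infinity>" using fin by (simp add: ennreal_mult_less_top)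
  finally show ?thesis unfolding h_def .
qed

lemma kernel_integrable:
  fixes f :: "real^4 \<Rightarrow> complex"
  assumes R: "R > 0" and w: "w > 0" "\<epsilon> > 0" "\<bar>\<sigma>\<bar> = (1::real)"
    and [measurable]: "f \<in> borel_measurable borel" and f: "AE X in Mh R. cmod (f X) \<le> S * wt (cmod (za X))"
  shows "integrable (Mh R) (\<lambda>X. f X / Complex (C - 2*w*Re (za X)) (\<sigma> * \<epsilon>))"
proof (rule Bochner_Integration.integrable_bound)
  have [measurable]: "(\<lambda>X. Complex (C - 2*w*Re (za X)) (\<sigma> * \<epsilon>)) \<in> borel_measurable borel"
    unfolding Complex_eq by measurable
  have "integrable (Mh R) (\<lambda>X. wt (cmod (za X)) / cmod (Complex (C - 2*w*Re (za X)) (\<sigma> * \<epsilon>)))"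
    using nn_integral_kernel_finite[OF R w] by (intro integrableI_nonneg) (auto simp: wt_nonneg)
  thus "integrable (Mh R) (\<lambda>X. S * (wt (cmod (za X)) / cmod (Complex (C - 2*w*Re (za X)) (\<sigma> * \<epsilon>))))" by (rule integrable_mult_right)
  show "(\<lambda>X. f X / Complex (C - 2*w*Re (za X)) (\<sigma> * \<epsilon>)) \<in> borel_measurable (Mh R)" by simp
  show "AE X in Mh R. norm (f X / Complex (C - 2*w*Re (za X)) (\<sigma> * \<epsilon>)) \<le> norm (S * (wt (cmod (za X)) / cmod (Complex (C - 2*w*Re (za X)) (\<sigma> * \<epsilon>))))"
    using f by eventually_elim (auto simp: norm_divide abs_mult wt_nonneg intro!: divide_right_mono order_trans[OF _ abs_ge_self] order_trans[OF _ mult_right_mono[OF abs_ge_self]])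
qed

section \<open>The circle integral of the kernel\<close>

text \<open>With \<open>z = cis \<theta>\<close> one has \<open>2 cos \<theta> = z + 1 / z\<close>,
  so the denominator factors as \<open>- (z - \<mu>) (z - 1 / \<mu>) / z\<close>. Only
  \<open>\<mu>\<close> lies inside the unit circle, and Cauchy's formula applies to the remaining
  holomorphic factor \<open>f\<close>.\<close>

lemma has_integral_cis_kernel:
  fixes \<mu> :: complex
  assumes \<mu>: "\<mu> \<noteq> 0" "cmod \<mu> < 1"
  shows "((\<lambda>\<theta>. cis \<theta> ^ k / (\<mu> + 1 / \<mu> - of_real (2 * cos \<theta>))) has_integral (2 * pi * \<mu> ^ k / (1 / \<mu> - \<mu>))) {0..2*pi}"
proof -
  define f where "f z = z ^ k / (z - 1 / \<mu>)" for z
  have n1: "cmod (1 / \<mu>) > 1" using \<mu> by (simp add: norm_divide)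
  have "((\<lambda>u. f u / (u - \<mu>)) has_contour_integral (2 * of_real pi * \<i>) * f \<mu>) (circlepath 0 1)"
  proof (rule Cauchy_integral_circlepath_simple)
    show "f holomorphic_on cball 0 1" unfolding f_def
      using n1 by (intro holomorphic_intros) auto
  qed (use \<mu> in auto)
  hence "((\<lambda>t. f (cis t) / (cis t - \<mu>) * \<i> * cis t) has_integral (2 * of_real pi * \<i>) * f \<mu>) {0..2*pi}"
    unfolding circlepath_def by (subst (asm) has_contour_integral_part_circlepath_iff) auto
  \<comment> \<open>The differential \<open>dz = i z dt\<close> brings one factor \<open>i\<close>;
    the second one produces the sign that appears in the factorization \<open>fac\<close>.\<close>
  hence "((\<lambda>t. \<i> * (f (cis t) / (cis t - \<mu>) * \<i> * cis t)) has_integral \<i> * ((2 * of_real pi * \<i>) * f \<mu>)) {0..2*pi}"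
    by (rule has_integral_mult_right)
  moreover have "\<i> * (f (cis t) / (cis t - \<mu>) * \<i> * cis t) = cis t ^ k / (\<mu> + 1 / \<mu> - of_real (2 * cos t))" for t
  proof -
    have c: "of_real (2 * cos t) = cis t + 1 / cis t"
      by (simp add: complex_eq_iff cis_divide[symmetric] flip: cis_inverse divide_inverse inverse_eq_divide)
    have nz: "cis t - \<mu> \<noteq> 0" "cis t - 1 / \<mu> \<noteq> 0"
      using \<mu> n1 by (metis eq_iff_diff_eq_0 norm_cis less_irrefl)+
    have fac: "(cis t - 1 / \<mu>) * (cis t - \<mu>) = - (cis t * (\<mu> + 1 / \<mu> - of_real (2 * cos t)))"
      unfolding c using \<mu> by (simp add: field_simps)
    have nz2: "\<mu> + 1 / \<mu> - of_real (2 * cos t) \<noteq> 0" using fac nz by auto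
    have "\<i> * (f (cis t) / (cis t - \<mu>) * \<i> * cis t) = - (cis t ^ k * cis t) / ((cis t - 1 / \<mu>) * (cis t - \<mu>))"
    proof -
      have "\<i> * (f (cis t) / (cis t - \<mu>) * \<i> * cis t) = (\<i> * \<i>) * (cis t ^ k * cis t) / ((cis t - 1 / \<mu>) * (cis t - \<mu>))"
        unfolding f_def by (simp only: times_divide_eq_left times_divide_eq_right divide_divide_eq_left mult_ac)
      thus ?thesis by simp
    qed
    also have "\<dots> = cis t ^ k / (\<mu> + 1 / \<mu> - of_real (2 * cos t))"
      unfolding fac using nz2 by (simp only: minus_divide_divide mult.commute[of "cis t"] mult_divide_mult_cancel_right cis_neq_zero simp_thms)
    finally show ?thesis .
  qed
  moreover have "\<i> * ((2 * of_real pi * \<i>) * f \<mu>) = 2 * pi * \<mu> ^ k / (1 / \<mu> - \<mu>)"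
  proof -
    have "1 / \<mu> - \<mu> \<noteq> 0" using n1 \<mu> by auto
    moreover have "\<mu> - 1 / \<mu> = - (1 / \<mu> - \<mu>)" by simp
    moreover have "\<i> * ((2 * of_real pi * \<i>) * (x / y)) = (\<i> * \<i>) * (2 * of_real pi * x) / y" for x y :: complex
      by (simp only: times_divide_eq_left times_divide_eq_right mult_ac)
    ultimately show ?thesis unfolding f_def by (simp only: minus_divide_right[symmetric] divide_minus_right) simp
  qed
  ultimately show ?thesis by simp
qed

text \<open>A square root of the discriminant of \<open>w * T * y^2 - G * y + w\<close>. In the
  application \<open>G\<close> has real part \<open>R^2 + w^2\<close> and imaginary part
  \<open>\<sigma> * \<epsilon>\<close>, and \<open>T\<close> is \<open>|z_11|^2\<close>.\<close>

definition kernel_disc :: "real \<Rightarrow> complex \<Rightarrow> real \<Rightarrow> complex" where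
  "kernel_disc w G T = csqrt (G\<^sup>2 - of_real (4 * w\<^sup>2 * T))"

text \<open>The root of \<open>w T y\<^sup>2 - G y + w = 0\<close> that is smaller in modulus; \<open>csqrt\<close> has nonnegative real part, so the denominator does not cancel.\<close>

definition kernel_root :: "real \<Rightarrow> complex \<Rightarrow> real \<Rightarrow> complex" where
  "kernel_root w G T = of_real (2 * w) / (G + kernel_disc w G T)"

text \<open>Write \<open>D\<close> for the root. Since
  \<open>|G + D|^2 - |G - D|^2 = 4 Re (G * cnj D)\<close>, it all rests on the sign of this real
  part. The imaginary part of \<open>D^2\<close> gives \<open>Re D * Im D = Re G * Im G\<close>, so
  \<open>Im D\<close> has the sign of \<open>Im G\<close> once \<open>Re D > 0\<close>. For real
  \<open>G\<close> the hypothesis makes the discriminant positive and \<open>D\<close> a positive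
  real number.\<close>

lemma kernel_disc_facts:
  assumes G: "Re G > 0" and d: "Im G \<noteq> 0 \<or> (Re G)\<^sup>2 > 4 * w\<^sup>2 * T"
  shows "Re (kernel_disc w G T) > 0" "kernel_disc w G T \<noteq> 0" "Re (G * cnj (kernel_disc w G T)) > 0"
    "(kernel_disc w G T)\<^sup>2 = G\<^sup>2 - of_real (4 * w\<^sup>2 * T)"
    "G + kernel_disc w G T \<noteq> 0" "cmod (G - kernel_disc w G T) < cmod (G + kernel_disc w G T)"
    "(G - kernel_disc w G T) * (G + kernel_disc w G T) = of_real (4 * w\<^sup>2 * T)"
proof -
  let ?D = "kernel_disc w G T"
  show D2: "?D\<^sup>2 = G\<^sup>2 - of_real (4 * w\<^sup>2 * T)" by (simp add: kernel_disc_def)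
  show pr: "(G - ?D) * (G + ?D) = of_real (4 * w\<^sup>2 * T)"
    using D2 by (simp add: power2_eq_square algebra_simps)
  have im: "Re ?D * Im ?D = Re G * Im G"
    using arg_cong[OF D2, of Im] by (simp add: power2_eq_square mult.commute)
  have ge: "Re ?D \<ge> 0" unfolding kernel_disc_def by (rule Re_csqrt)
  have both: "Re ?D > 0 \<and> Re G * Re ?D + Im G * Im ?D > 0"
  proof (cases "Im G = 0")
    case False
    hence nz: "Re ?D * Im ?D \<noteq> 0" using im G by simp
    hence p: "Re ?D > 0" using ge by (cases "Re ?D = 0") auto
    have "Re ?D * (Im G * Im ?D) = Re G * (Im G)\<^sup>2" using im by (simp add: power2_eq_square algebra_simps)
    also have "\<dots> > 0" using False G by simp
    finally have "Im G * Im ?D > 0" using p by (simp add: zero_less_mult_iff)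
    thus ?thesis using p G by (simp add: add_pos_pos)
  next
    case True
    hence lt: "(Re G)\<^sup>2 > 4 * w\<^sup>2 * T" using d by simp
    have "G\<^sup>2 - of_real (4 * w\<^sup>2 * T) = of_real ((Re G)\<^sup>2 - 4 * w\<^sup>2 * T)"
      using True by (simp add: complex_eq_iff power2_eq_square)
    hence "?D = of_real (sqrt ((Re G)\<^sup>2 - 4 * w\<^sup>2 * T))"
      unfolding kernel_disc_def using lt csqrt_of_real_nonneg[of "of_real ((Re G)\<^sup>2 - 4 * w\<^sup>2 * T)"] by simp
    thus ?thesis using True lt G by simp
  qed
  show "Re ?D > 0" using both by simp
  thus "?D \<noteq> 0" by auto
  show R: "Re (G * cnj ?D) > 0" using both by simp
  have "(cmod (G + ?D))\<^sup>2 - (cmod (G - ?D))\<^sup>2 = 4 * Re (G * cnj ?D)"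
    unfolding cmod_power2 by (simp add: power2_eq_square algebra_simps)
  hence "(cmod (G - ?D))\<^sup>2 < (cmod (G + ?D))\<^sup>2" using R by linarith
  thus lt: "cmod (G - ?D) < cmod (G + ?D)" by (rule power2_less_imp_less) simp
  thus "G + ?D \<noteq> 0" by (metis norm_ge_zero norm_zero not_le)
qed

text \<open>With \<open>\<mu> = sqrt T * y\<close>, where \<open>y\<close> is the small root,
  division by \<open>w * sqrt T\<close> brings the denominator to the form
  \<open>\<mu> + 1 / \<mu> - 2 cos \<theta>\<close>. The relation
  \<open>(G - D) (G + D) = 4 w^2 T\<close> gives
  \<open>|\<mu>|^2 = |G - D| / |G + D| < 1\<close>.\<close>

lemma circle_kernel_integral:
  assumes w: "w > 0" "T > 0" and G: "Re G > 0" and d: "Im G \<noteq> 0 \<or> (Re G)\<^sup>2 > 4 * w\<^sup>2 * T"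
  shows "cmod (of_real (sqrt T) * kernel_root w G T) < 1"
    "((\<lambda>\<theta>. cis \<theta> ^ k / (G - of_real (2 * w * sqrt T * cos \<theta>))) has_integral
        (2 * pi * (of_real (sqrt T) * kernel_root w G T) ^ k / kernel_disc w G T)) {0..2*pi}"
proof -
  note D = kernel_disc_facts[OF G d]
  define D' where "D' = kernel_disc w G T"
  define r where "r = sqrt T"
  have r: "r > 0" "r\<^sup>2 = T" using w by (simp_all add: r_def)
  define \<mu> where "\<mu> = of_real r * kernel_root w G T"
  have \<mu>: "\<mu> = of_real (2 * w * r) / (G + D')" by (simp add: \<mu>_def kernel_root_def D'_def)
  have nz: "\<mu> \<noteq> 0" using D(5) w r by (simp add: \<mu> D'_def)
  have pr: "(G - D') * (G + D') = of_real ((2*w*r)\<^sup>2)"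
    using D(7) by (simp add: D'_def power_mult_distrib r)
  have "cmod \<mu> ^ 2 = cmod (G - D') * cmod (G + D') / cmod (G + D') ^ 2"
  proof -
    have "cmod (G - D') * cmod (G + D') = (2*w*r)\<^sup>2"
      using arg_cong[OF pr, of cmod] by (simp only: norm_mult norm_of_real) simp
    thus ?thesis using w r by (simp add: \<mu> norm_divide power_divide norm_mult)
  qed
  also have "\<dots> = cmod (G - D') / cmod (G + D')" using D(5) by (simp add: power2_eq_square D'_def)
  also have "\<dots> < 1" using D(5,6) by (simp add: D'_def divide_simps)
  finally have lt: "cmod \<mu> < 1" by (simp add: power_less_one_iff abs_square_less_1)
  have inv: "1 / \<mu> = (G + D') / of_real (2*w*r)" by (simp add: \<mu>)
  have mu2: "\<mu> = (G - D') / of_real (2*w*r)"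
    using pr D(5) w r by (simp add: \<mu> D'_def divide_simps power2_eq_square)
  have wr: "of_real (w * r) \<noteq> (0::complex)" using w r by simp
  have s: "\<mu> + 1 / \<mu> = G / of_real (w * r)" unfolding inv unfolding mu2 using w r by (simp add: field_simps)
  have t: "1 / \<mu> - \<mu> = D' / of_real (w * r)" unfolding inv unfolding mu2 using w r by (simp add: field_simps)
  have "((\<lambda>\<theta>. (cis \<theta> ^ k / (\<mu> + 1 / \<mu> - of_real (2 * cos \<theta>))) / of_real (w * r)) has_integral
      (2 * pi * \<mu> ^ k / (1 / \<mu> - \<mu>)) / of_real (w * r)) {0..2*pi}"
    by (rule has_integral_divide[OF has_integral_cis_kernel[OF nz lt]])
  moreover have e1: "(2 * pi * \<mu> ^ k / (1 / \<mu> - \<mu>)) / of_real (w * r) = 2 * pi * \<mu> ^ k / D'"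
    unfolding t using wr by simp
  moreover have e2: "(cis \<theta> ^ k / (\<mu> + 1 / \<mu> - of_real (2 * cos \<theta>))) / of_real (w * r) = cis \<theta> ^ k / (G - of_real (2 * w * r * cos \<theta>))" for \<theta>
  proof -
    have "(G / of_real (w * r) - of_real (2 * cos \<theta>)) * of_real (w * r) = G - of_real (2 * w * r * cos \<theta>)"
      using wr by (simp add: algebra_simps)
    thus ?thesis unfolding s by (metis divide_divide_eq_left)
  qed
  ultimately show "((\<lambda>\<theta>. cis \<theta> ^ k / (G - of_real (2 * w * sqrt T * cos \<theta>))) has_integral
        (2 * pi * (of_real (sqrt T) * kernel_root w G T) ^ k / kernel_disc w G T)) {0..2*pi}"
    by (simp only: e1 e2) (simp only: \<mu>_def r_def D'_def)
  show "cmod (of_real (sqrt T) * kernel_root w G T) < 1" using lt by (simp add: \<mu>_def r_def)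
qed

text \<open>The differential equation behind the radial antiderivative. The imaginary part
  \<open>2 Re G * Im G\<close> of \<open>G^2\<close> does not vanish, which keeps the radicand off
  the branch cut of \<open>csqrt\<close> for every \<open>T\<close>.\<close>

lemma kernel_root_deriv:
  assumes w: "w > 0" and G: "Re G > 0" "Im G \<noteq> 0"
  shows "((\<lambda>T. kernel_root w G T) has_vector_derivative (of_real w * (kernel_root w G T)\<^sup>2 / kernel_disc w G T)) (at T)"
proof -
  have d: "Im G \<noteq> 0 \<or> (Re G)\<^sup>2 > 4 * w\<^sup>2 * T" using G by simp
  note D = kernel_disc_facts[OF G(1) d]
  define D' where "D' = kernel_disc w G T"
  have np: "G\<^sup>2 - of_real (4 * w\<^sup>2 * T) \<notin> \<real>\<^sub>\<le>\<^sub>0"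
    using G by (simp add: complex_nonpos_Reals_iff power2_eq_square)
  have 1: "((\<lambda>T. of_real (2*w) / (G + csqrt (G\<^sup>2 - of_real (4 * w\<^sup>2) * T))) has_field_derivative
     of_real w * (kernel_root w G T)\<^sup>2 / kernel_disc w G T) (at (of_real T))"
  proof -
    have gen: "((\<lambda>T. c / (G + S T)) has_field_derivative - (c * S') / (G + S z)\<^sup>2) (at z)"
      if "(S has_field_derivative S') (at z)" "G + S z \<noteq> 0" for S S' z and c :: complex
      using that by (auto intro!: derivative_eq_intros simp: power2_eq_square)
    have e: "csqrt (G\<^sup>2 - of_real (4 * w\<^sup>2) * of_real T) = kernel_disc w G T" by (simp add: kernel_disc_def)
    have np': "G\<^sup>2 - of_real (4 * w\<^sup>2) * of_real T \<notin> \<real>\<^sub>\<le>\<^sub>0" using np by simp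
    have "((\<lambda>T. csqrt (G\<^sup>2 - of_real (4 * w\<^sup>2) * T)) has_field_derivative (- of_real (2 * w\<^sup>2) / kernel_disc w G T)) (at (of_real T))"
      by (rule derivative_eq_intros refl np' | simp only: e)+ (use D(2) in \<open>simp add: field_simps\<close>)
    hence "((\<lambda>T. of_real (2*w) / (G + csqrt (G\<^sup>2 - of_real (4 * w\<^sup>2) * T))) has_field_derivative
       - (of_real (2*w) * (- of_real (2 * w\<^sup>2) / kernel_disc w G T)) / (G + kernel_disc w G T)\<^sup>2) (at (of_real T))"
      using gen D(5) unfolding e[symmetric] by blast
    moreover have "- (of_real (2*w) * (- of_real (2 * w\<^sup>2) / kernel_disc w G T)) / (G + kernel_disc w G T)\<^sup>2 = of_real w * (kernel_root w G T)\<^sup>2 / kernel_disc w G T"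
      by (simp add: kernel_root_def power_divide power2_eq_square mult_ac)
    ultimately show ?thesis by simp
  qed
  have "((\<lambda>T. (\<lambda>T. of_real (2*w) / (G + csqrt (G\<^sup>2 - of_real (4 * w\<^sup>2) * T))) (of_real T)) has_vector_derivative
     of_real w * (kernel_root w G T)\<^sup>2 / kernel_disc w G T) (at T)"
    by (rule has_vector_derivative_real_field[OF 1])
  thus ?thesis unfolding kernel_root_def kernel_disc_def by simp
qed

section \<open>Bounds uniform in \<open>\<epsilon>\<close>\<close>

text \<open>Jordan's inequality with the weaker constant \<open>1/2\<close>, from
  \<open>t * cos t \<le> sin t\<close> at half the angle and the double-angle formulas.\<close>

lemma sin_ge_half: assumes "0 \<le> x" "x \<le> pi / 2" shows "x / 2 \<le> sin x"
proof -
  have tan: "t * cos t \<le> sin t" if "0 \<le> t" "t \<le> pi" for t :: real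
  proof -
    have "(\<lambda>t. sin t - t * cos t) 0 \<le> (\<lambda>t. sin t - t * cos t) t"
    proof (rule DERIV_nonneg_imp_nondecreasing[OF that(1)])
      fix s assume s: "0 \<le> s" "s \<le> t"
      have "((\<lambda>t. sin t - t * cos t) has_real_derivative s * sin s) (at s)"
        by (auto intro!: derivative_eq_intros)
      moreover have "s * sin s \<ge> 0" using s that by (auto intro!: mult_nonneg_nonneg sin_ge_zero)
      ultimately show "\<exists>y. ((\<lambda>t. sin t - t * cos t) has_real_derivative y) (at s) \<and> 0 \<le> y" by blast
    qed
    thus ?thesis by simp
  qed
  have c: "cos (x/2) \<ge> 0" using assms by (intro cos_ge_zero) auto
  have "x / 2 \<le> x * (1 + cos x) / 2"
    using assms cos_ge_zero[of x] by (simp add: field_simps)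
  also have "1 + cos x = 2 * (cos (x/2))\<^sup>2" using cos_double_cos[of "x/2"] by simp
  also have "x * (2 * (cos (x/2))\<^sup>2) / 2 = 2 * (x/2 * cos (x/2)) * cos (x/2)" by (simp add: power2_eq_square)
  also have "\<dots> \<le> 2 * sin (x/2) * cos (x/2)"
    using tan[of "x/2"] assms c by (intro mult_right_mono mult_left_mono) auto
  also have "\<dots> = sin x" using sin_double[of "x/2"] by simp
  finally show ?thesis .
qed

text \<open>The difference is \<open>2 sin ((\<phi> + \<theta>) / 2) sin ((\<theta> - \<phi>) /
  2)\<close>; the first sine is at least \<open>sin \<phi> / 2\<close> and the second at least a
  quarter of the distance in modulus. The estimate is used with the singular angle as
  \<open>\<phi>\<close>.\<close>

lemma cos_diff_lower:
  assumes "0 \<le> \<theta>" "\<theta> \<le> pi" "0 \<le> \<phi>" "\<phi> \<le> pi"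
  shows "sin \<phi> * \<bar>\<theta> - \<phi>\<bar> / 4 \<le> \<bar>cos \<phi> - cos \<theta>\<bar>"
proof -
  have nn: "sin (\<theta>/2) \<ge> 0" "cos (\<theta>/2) \<ge> 0" "sin (\<phi>/2) \<ge> 0" "cos (\<phi>/2) \<ge> 0"
    using assms by (auto intro!: sin_ge_zero cos_ge_zero)
  \<comment> \<open>In the first quadrant sine and cosine dominate their squares, which add up to
    1.\<close>
  have sc: "sin (\<theta>/2) + cos (\<theta>/2) \<ge> 1"
  proof -
    have "1 = (sin (\<theta>/2))\<^sup>2 + (cos (\<theta>/2))\<^sup>2" by simp
    also have "\<dots> \<le> sin (\<theta>/2) + cos (\<theta>/2)"
      using nn by (intro add_mono) (auto simp: power2_eq_square intro!: mult_left_le)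
    finally show ?thesis .
  qed
  have "sin \<phi> / 2 = sin (\<phi>/2) * cos (\<phi>/2) * 1" using sin_double[of "\<phi>/2"] by simp
  also have "\<dots> \<le> sin (\<phi>/2) * cos (\<phi>/2) * (sin (\<theta>/2) + cos (\<theta>/2))"
    using nn sc by (intro mult_left_mono) auto
  also have "\<dots> = sin (\<theta>/2) * (sin (\<phi>/2) * cos (\<phi>/2)) + cos (\<theta>/2) * (sin (\<phi>/2) * cos (\<phi>/2))"
    by (simp add: algebra_simps)
  also have "\<dots> \<le> sin (\<theta>/2) * cos (\<phi>/2) + cos (\<theta>/2) * sin (\<phi>/2)"
    using nn by (intro add_mono mult_left_mono mult_left_le mult_left_le_one_le) auto
  also have "\<dots> = sin ((\<theta> + \<phi>) / 2)" by (simp add: sin_add add_divide_distrib)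
  finally have 1: "sin \<phi> / 2 \<le> sin ((\<theta> + \<phi>) / 2)" .
  have 2: "\<bar>\<theta> - \<phi>\<bar> / 4 \<le> \<bar>sin ((\<theta> - \<phi>) / 2)\<bar>"
  proof -
    have "\<bar>\<theta> - \<phi>\<bar> / 2 / 2 \<le> sin (\<bar>\<theta> - \<phi>\<bar> / 2)" using assms by (intro sin_ge_half) auto
    also have "\<dots> \<le> \<bar>sin ((\<theta> - \<phi>) / 2)\<bar>"
    proof (cases "\<theta> \<ge> \<phi>")
      case False
      hence "\<bar>\<theta> - \<phi>\<bar> / 2 = - ((\<theta> - \<phi>) / 2)" by (simp add: field_simps)
      thus ?thesis by (simp only: sin_minus abs_ge_minus_self)
    qed simp
    finally show ?thesis by simp
  qed
  have "cos \<phi> - cos \<theta> = 2 * sin ((\<phi> + \<theta>) / 2) * sin ((\<theta> - \<phi>) / 2)" by (rule cos_diff_cos)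
  hence "\<bar>cos \<phi> - cos \<theta>\<bar> = 2 * \<bar>sin ((\<theta> + \<phi>) / 2)\<bar> * \<bar>sin ((\<theta> - \<phi>) / 2)\<bar>"
    by (simp add: abs_mult add.commute)
  moreover have "sin \<phi> / 2 * (\<bar>\<theta> - \<phi>\<bar> / 4) \<le> \<bar>sin ((\<theta> + \<phi>) / 2)\<bar> * \<bar>sin ((\<theta> - \<phi>) / 2)\<bar>"
    using 1 2 assms by (intro mult_mono) (auto intro!: sin_ge_zero)
  ultimately show ?thesis by simp
qed

text \<open>The cosine is symmetric about \<open>pi\<close>, so both halves of the circle carry the
  same kernel, and each contains at most one zero of its real part.\<close>

lemma has_integral_reflect_half:
  fixes f :: "real \<Rightarrow> complex"
  assumes "(f has_integral I) {pi..2*pi}"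
  shows "((\<lambda>x. f (2*pi - x)) has_integral I) {0..pi}"
proof -
  have "((\<lambda>x. f ((-1) *\<^sub>R x + 2*pi)) has_integral I) ((\<lambda>x. (1 / (-1)) *\<^sub>R x + - ((1 / (-1)) *\<^sub>R (2*pi))) ` cbox pi (2*pi))"
    using has_integral_affinity[of f I pi "2*pi" "-1" "2*pi"] assms by simp
  moreover have "(\<lambda>x. (1 / (-1)) *\<^sub>R x + - ((1 / (-1)) *\<^sub>R (2*pi))) ` cbox pi (2*pi) = {0..pi}"
    by (auto simp: image_iff intro!: bexI[of _ "2*pi - _"])
  ultimately show ?thesis by (simp add: algebra_simps)
qed

text \<open>By symmetry this is half of the full circle integral, namely \<open>pi / D\<close>, with
  \<open>w = 1/2\<close> and \<open>T = b^2\<close> so that \<open>2 * w * sqrt T = b\<close>. The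
  bound follows from \<open>|D|^2 = |G - b| |G + b| \<ge> (b - C) (b + C)\<close>.\<close>

lemma half_circle_kernel_integral:
  assumes b: "0 < C" "C < b" and \<eta>: "\<eta> \<noteq> 0"
  shows "cmod (integral {0..pi} (\<lambda>\<theta>. 1 / (Complex C \<eta> - of_real (b * cos \<theta>)))) \<le> pi / sqrt (b\<^sup>2 - C\<^sup>2)"
proof -
  define f where "f \<theta> = 1 / (Complex C \<eta> - of_real (b * cos \<theta>))" for \<theta>
  have nz: "Complex C \<eta> - of_real (b * cos \<theta>) \<noteq> 0" for \<theta> using \<eta> by (simp add: complex_eq_iff)
  have cont: "continuous_on S f" for S unfolding f_def using nz by (intro continuous_intros) auto
  have int: "f integrable_on {a..d}" for a d by (rule integrable_continuous_real[OF cont])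
  define D where "D = kernel_disc (1/2) (Complex C \<eta>) (b\<^sup>2)"
  have "(f has_integral 2 * pi / D) {0..2*pi}"
    using circle_kernel_integral(2)[of "1/2" "b\<^sup>2" "Complex C \<eta>" 0] b \<eta> by (simp add: f_def[abs_def] D_def)
  hence full: "integral {0..2*pi} f = 2 * pi / D" by (rule integral_unique)
  have "integral {pi..2*pi} f = integral {0..pi} (\<lambda>x. f (2*pi - x))"
    using has_integral_reflect_half[OF integrable_integral[OF int]] by (simp add: integral_unique)
  also have "(\<lambda>x. f (2*pi - x)) = f" by (auto simp: f_def cos_diff)
  finally have "integral {pi..2*pi} f = integral {0..pi} f" .
  moreover have "integral {0..pi} f + integral {pi..2*pi} f = integral {0..2*pi} f"
    by (rule Henstock_Kurzweil_Integration.integral_combine) (use int in auto)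
  ultimately have "2 * integral {0..pi} f = 2 * (pi / D)" using full by simp
  hence h: "integral {0..pi} f = pi / D" by (simp only: mult_cancel_left) simp
  have D2: "D\<^sup>2 = (Complex C \<eta> - of_real b) * (Complex C \<eta> + of_real b)"
    unfolding D_def by (subst kernel_disc_facts(4)) (use b \<eta> in \<open>auto simp: algebra_simps power2_eq_square\<close>)
  have "b\<^sup>2 - C\<^sup>2 = (b - C) * (b + C)" by (simp add: power2_eq_square algebra_simps)
  also have "\<dots> \<le> cmod (Complex C \<eta> - of_real b) * cmod (Complex C \<eta> + of_real b)"
    using abs_Re_le_cmod[of "Complex C \<eta> - of_real b"] abs_Re_le_cmod[of "Complex C \<eta> + of_real b"] b
    by (intro mult_mono) auto
  also have "\<dots> = (cmod D)\<^sup>2" using D2 by (metis norm_mult norm_power)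
  finally have "sqrt (b\<^sup>2 - C\<^sup>2) \<le> cmod D" using real_le_lsqrt by (simp add: real_le_lsqrt)
  moreover have "b\<^sup>2 - C\<^sup>2 > 0" using b by (simp add: power_strict_mono)
  ultimately show ?thesis using h unfolding f_def[abs_def]
    by (simp add: norm_divide frac_le)
qed

text \<open>The real part of the kernel vanishes at \<open>\<phi> = arccos (C / b)\<close>, where
  \<open>b * sin \<phi> = sqrt (b^2 - C^2)\<close>. After subtraction of \<open>F \<phi>\<close> the
  Lipschitz bound cancels the zero and the integrand is at most
  \<open>4 * M / sqrt (b^2 - C^2)\<close>; the constant \<open>F \<phi>\<close> is integrated
  exactly. The two contributions are \<open>4 * pi\<close> and \<open>pi\<close>, hence the
  5.\<close>

lemma half_circle_uniform_bound:
  fixes F :: "real \<Rightarrow> complex"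
  assumes b: "0 < C" "C < b" and \<eta>: "\<eta> \<noteq> 0"
    and F: "continuous_on {0..pi} F" "\<And>\<theta>. \<theta> \<in> {0..pi} \<Longrightarrow> cmod (F \<theta>) \<le> M"
      "\<And>\<theta> \<phi>. \<theta> \<in> {0..pi} \<Longrightarrow> \<phi> \<in> {0..pi} \<Longrightarrow> cmod (F \<theta> - F \<phi>) \<le> M * \<bar>\<theta> - \<phi>\<bar>"
  shows "cmod (integral {0..pi} (\<lambda>\<theta>. F \<theta> / (Complex C \<eta> - of_real (b * cos \<theta>)))) \<le> 5 * pi * M / sqrt (b\<^sup>2 - C\<^sup>2)"
proof -
  have b0: "b > 0" using b by simp
  define \<phi> where "\<phi> = arccos (C / b)"
  have cb: "-1 \<le> C / b" "C / b \<le> 1" using b by (auto simp: field_simps)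
  have \<phi>: "0 \<le> \<phi>" "\<phi> \<le> pi" and cos\<phi>: "cos \<phi> = C / b" unfolding \<phi>_def using cb arccos by auto
  define s where "s = sqrt (b\<^sup>2 - C\<^sup>2)"
  have s0: "s > 0" using b by (simp add: s_def power_strict_mono)
  have "sin \<phi> = sqrt (1 - (C/b)\<^sup>2)" unfolding \<phi>_def using cb by (rule sin_arccos)
  also have "1 - (C/b)\<^sup>2 = (b\<^sup>2 - C\<^sup>2) / b\<^sup>2" using b0 by (simp add: power_divide diff_divide_distrib)
  finally have sin\<phi>: "b * sin \<phi> = s" using b0 by (simp add: s_def real_sqrt_divide)
  have M0: "M \<ge> 0" using F(2)[of 0] by (metis atLeastAtMost_iff norm_ge_zero order.trans order_refl pi_ge_zero)
  define k where "k \<theta> = 1 / (Complex C \<eta> - of_real (b * cos \<theta>))" for \<theta>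
  have nz: "Complex C \<eta> - of_real (b * cos \<theta>) \<noteq> 0" for \<theta> using \<eta> by (simp add: complex_eq_iff)
  have contk: "continuous_on {0..pi} k" unfolding k_def using nz by (intro continuous_intros) auto
  have bound: "cmod ((F \<theta> - F \<phi>) * k \<theta>) \<le> 4 * M / s" if t: "\<theta> \<in> {0..pi}" for \<theta>
  proof (cases "\<theta> = \<phi>")
    case False
    have "s * \<bar>\<theta> - \<phi>\<bar> / 4 = b * (sin \<phi> * \<bar>\<theta> - \<phi>\<bar> / 4)" by (simp flip: sin\<phi>)
    also have "\<dots> \<le> b * \<bar>cos \<phi> - cos \<theta>\<bar>"
      using b0 cos_diff_lower[of \<theta> \<phi>] t \<phi> by (intro mult_left_mono) auto
    also have "\<dots> = \<bar>Re (Complex C \<eta> - of_real (b * cos \<theta>))\<bar>"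
    proof -
      have "C - b * cos \<theta> = b * (C / b - cos \<theta>)" using b0 by (simp add: algebra_simps)
      thus ?thesis using b0 by (simp add: cos\<phi> abs_mult)
    qed
    also have "\<dots> \<le> cmod (Complex C \<eta> - of_real (b * cos \<theta>))" by (rule abs_Re_le_cmod)
    finally have l: "s * \<bar>\<theta> - \<phi>\<bar> / 4 \<le> cmod (Complex C \<eta> - of_real (b * cos \<theta>))" .
    have "cmod ((F \<theta> - F \<phi>) * k \<theta>) = cmod (F \<theta> - F \<phi>) / cmod (Complex C \<eta> - of_real (b * cos \<theta>))"
      by (simp add: k_def norm_mult norm_divide)
    also have "\<dots> \<le> (M * \<bar>\<theta> - \<phi>\<bar>) / (s * \<bar>\<theta> - \<phi>\<bar> / 4)"
      using False s0 M0 l F(3)[OF t, of \<phi>] \<phi> by (intro frac_le) auto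
    also have "\<dots> = 4 * M / s" using False by simp
    finally show ?thesis .
  qed (use M0 s0 in simp)
  have "integral {0..pi} (\<lambda>\<theta>. F \<theta> / (Complex C \<eta> - of_real (b * cos \<theta>))) = integral {0..pi} (\<lambda>\<theta>. (F \<theta> - F \<phi>) * k \<theta> + F \<phi> * k \<theta>)"
    by (simp add: k_def flip: add_divide_distrib)
  also have "\<dots> = integral {0..pi} (\<lambda>\<theta>. (F \<theta> - F \<phi>) * k \<theta>) + integral {0..pi} (\<lambda>\<theta>. F \<phi> * k \<theta>)"
    by (intro integral_add integrable_continuous_real continuous_intros contk F)
  also have "integral {0..pi} (\<lambda>\<theta>. F \<phi> * k \<theta>) = F \<phi> * integral {0..pi} k" by simp
  finally have "cmod (integral {0..pi} (\<lambda>\<theta>. F \<theta> / (Complex C \<eta> - of_real (b * cos \<theta>)))) \<le> cmod (integral {0..pi} (\<lambda>\<theta>. (F \<theta> - F \<phi>) * k \<theta>)) + cmod (F \<phi>) * cmod (integral {0..pi} k)"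
    by (simp only: norm_triangle_ineq flip: norm_mult)
  also have "\<dots> \<le> 4 * M / s * pi + M * (pi / s)"
  proof (intro add_mono mult_mono)
    have "cmod (integral {0..pi} (\<lambda>\<theta>. (F \<theta> - F \<phi>) * k \<theta>)) \<le> 4 * M / s * (pi - 0)"
      by (rule integral_bound) (use bound in \<open>auto intro!: continuous_intros contk F\<close>)
    thus "cmod (integral {0..pi} (\<lambda>\<theta>. (F \<theta> - F \<phi>) * k \<theta>)) \<le> 4 * M / s * pi" by simp
    show "cmod (integral {0..pi} k) \<le> pi / s"
      using half_circle_kernel_integral[OF b \<eta>] by (simp add: k_def[abs_def] s_def)
  qed (use F \<phi> M0 in auto)
  finally show ?thesis by (simp add: s_def field_simps)
qed

text \<open>For \<open>C < b\<close> the two half-circles are added. For \<open>C > b\<close> the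
  real part of the kernel never vanishes, and the absolute value is majorized by an integral that
  equals \<open>2 * pi / sqrt (C^2 - b^2)\<close>.\<close>

lemma circle_uniform_bound:
  fixes F :: "real \<Rightarrow> complex"
  assumes b: "0 < C" "0 < b" "C \<noteq> b" and \<eta>: "\<eta> \<noteq> 0"
    and F: "continuous_on {0..2*pi} F" "\<And>\<theta>. \<theta> \<in> {0..2*pi} \<Longrightarrow> cmod (F \<theta>) \<le> M"
      "\<And>\<theta> \<phi>. \<theta> \<in> {0..2*pi} \<Longrightarrow> \<phi> \<in> {0..2*pi} \<Longrightarrow> cmod (F \<theta> - F \<phi>) \<le> M * \<bar>\<theta> - \<phi>\<bar>"
  shows "cmod (integral {0..2*pi} (\<lambda>\<theta>. F \<theta> / (Complex C \<eta> - of_real (b * cos \<theta>)))) \<le> 10 * pi * M / sqrt \<bar>b\<^sup>2 - C\<^sup>2\<bar>"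
proof -
  define g where "g \<theta> = F \<theta> / (Complex C \<eta> - of_real (b * cos \<theta>))" for \<theta>
  have nz: "Complex C \<eta> - of_real (b * cos \<theta>) \<noteq> 0" for \<theta> using \<eta> by (simp add: complex_eq_iff)
  have cont: "continuous_on {0..2*pi} g" unfolding g_def using nz by (intro continuous_intros F) auto
  have M0: "M \<ge> 0" using F(2)[of 0] by (metis atLeastAtMost_iff norm_ge_zero order.trans order_refl pi_ge_zero mult_nonneg_nonneg zero_le_numeral)
  show ?thesis
  proof (cases "C < b")
    case True
    have int: "g integrable_on {pi..2*pi}" "g integrable_on {0..2*pi}"
      by (auto intro!: integrable_continuous_real continuous_on_subset[OF cont])
    have "integral {pi..2*pi} g = integral {0..pi} (\<lambda>x. g (2*pi - x))"
      using has_integral_reflect_half[OF integrable_integral[OF int(1)]] by (simp add: integral_unique)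
    also have "(\<lambda>x. g (2*pi - x)) = (\<lambda>\<theta>. F (2*pi - \<theta>) / (Complex C \<eta> - of_real (b * cos \<theta>)))"
      by (auto simp: g_def cos_diff)
    finally have "cmod (integral {pi..2*pi} g) \<le> 5 * pi * M / sqrt (b\<^sup>2 - C\<^sup>2)"
    proof (simp only:, intro half_circle_uniform_bound[OF b(1) True \<eta>])
      show "continuous_on {0..pi} (\<lambda>\<theta>. F (2*pi - \<theta>))"
        by (rule continuous_on_compose2[OF F(1)]) (auto intro!: continuous_intros)
      show "cmod (F (2*pi - \<theta>)) \<le> M" if "\<theta> \<in> {0..pi}" for \<theta> using F(2)[of "2*pi - \<theta>"] that by auto
      show "cmod (F (2*pi - \<theta>) - F (2*pi - \<phi>)) \<le> M * \<bar>\<theta> - \<phi>\<bar>" if "\<theta> \<in> {0..pi}" "\<phi> \<in> {0..pi}" for \<theta> \<phi>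
        using F(3)[of "2*pi - \<theta>" "2*pi - \<phi>"] that by (auto simp: abs_minus_commute)
    qed
    moreover have "cmod (integral {0..pi} g) \<le> 5 * pi * M / sqrt (b\<^sup>2 - C\<^sup>2)"
      unfolding g_def by (intro half_circle_uniform_bound[OF b(1) True \<eta>] continuous_on_subset[OF F(1)] F(2,3)) auto
    moreover have "integral {0..pi} g + integral {pi..2*pi} g = integral {0..2*pi} g"
      by (rule Henstock_Kurzweil_Integration.integral_combine) (use int in auto)
    ultimately have "cmod (integral {0..2*pi} g) \<le> 5 * pi * M / sqrt (b\<^sup>2 - C\<^sup>2) + 5 * pi * M / sqrt (b\<^sup>2 - C\<^sup>2)"
      by (metis norm_triangle_le add_mono)
    moreover have "b\<^sup>2 - C\<^sup>2 > 0" using True b by (simp add: power_strict_mono)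
    ultimately show ?thesis by (simp add: g_def[abs_def] mult_ac)
  next
    case False
    hence lt: "b < C" using b by simp
    hence sq: "b\<^sup>2 < C\<^sup>2" using b by (simp add: power_strict_mono)
    define D where "D = kernel_disc (1/2) (of_real C) (b\<^sup>2)"
    have D2: "D\<^sup>2 = of_real (C\<^sup>2 - b\<^sup>2)"
      unfolding D_def by (subst kernel_disc_facts(4)) (use b sq in \<open>auto simp: power2_eq_square\<close>)
    have pos: "C - b * cos \<theta> > 0" for \<theta>
      using lt b mult_left_mono[OF cos_le_one[of \<theta>], of b] by linarith
    have Ic: "((\<lambda>\<theta>. complex_of_real (1 / (C - b * cos \<theta>))) has_integral 2 * pi / D) {0..2*pi}"
      using circle_kernel_integral(2)[of "1/2" "b\<^sup>2" "of_real C" 0] b sq by (simp add: D_def power_divide)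
    hence I: "((\<lambda>\<theta>. M * (1 / (C - b * cos \<theta>))) has_integral M * Re (2 * pi / D)) {0..2*pi}"
      using has_integral_mult_right[OF has_integral_linear[OF Ic bounded_linear_Re, unfolded o_def Re_complex_of_real], of M] by simp
    have "cmod (integral {0..2*pi} g) \<le> integral {0..2*pi} (\<lambda>\<theta>. M * (1 / (C - b * cos \<theta>)))"
    proof (rule integral_norm_bound_integral)
      show "g integrable_on {0..2*pi}" by (rule integrable_continuous_real[OF cont])
      show "(\<lambda>\<theta>. M * (1 / (C - b * cos \<theta>))) integrable_on {0..2*pi}" using I by blast
      fix \<theta> assume t: "\<theta> \<in> {0..2*pi}"
      have "cmod (g \<theta>) = cmod (F \<theta>) / cmod (Complex C \<eta> - of_real (b * cos \<theta>))" by (simp add: g_def norm_divide)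
      also have "\<dots> \<le> M / (C - b * cos \<theta>)"
        using M0 F(2)[OF t] pos[of \<theta>] abs_Re_le_cmod[of "Complex C \<eta> - of_real (b * cos \<theta>)"] by (intro frac_le) auto
      finally show "cmod (g \<theta>) \<le> M * (1 / (C - b * cos \<theta>))" by simp
    qed
    also have "\<dots> = M * Re (2 * pi / D)" using I by (rule integral_unique)
    also have "\<dots> \<le> M * (2 * pi / sqrt (C\<^sup>2 - b\<^sup>2))"
    proof (rule mult_left_mono[OF _ M0])
      have "cmod D ^ 2 = C\<^sup>2 - b\<^sup>2" using arg_cong[OF D2, of cmod] sq by (simp only: norm_power norm_of_real)
      hence "cmod D = sqrt (C\<^sup>2 - b\<^sup>2)" by (metis norm_ge_zero real_sqrt_unique)
      thus "Re (2 * pi / D) \<le> 2 * pi / sqrt (C\<^sup>2 - b\<^sup>2)"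
        using complex_Re_le_cmod[of "2 * pi / D"] by (simp add: norm_divide norm_mult)
    qed
    also have "\<dots> \<le> 10 * pi * M / sqrt \<bar>b\<^sup>2 - C\<^sup>2\<bar>"
      using sq M0 by (simp add: divide_right_mono)
    finally show ?thesis by (simp add: g_def[abs_def])
  qed
qed

section \<open>Iterated integrals over the hyperboloid and the radial majorant\<close>

lemma Mh_real_density: "Mh R = distr (density (lborel \<Otimes>\<^sub>M lborel) (\<lambda>p. ennreal (indicator {0..<2*pi} (snd p)))) borel
     (\<lambda>p. hypc R (fst p) (snd p))"
  by (simp add: Mh_def ennreal_indicator)

lemma Mh_Fubini:
  fixes F :: "real^4 \<Rightarrow> complex"
  assumes int: "integrable (Mh R) F"
  shows "(\<integral>X. F X \<partial>Mh R) = (\<integral>v. (\<integral>\<theta>. indicator {0..<2*pi} \<theta> *\<^sub>R F (hypc R v \<theta>) \<partial>lborel) \<partial>lborel)"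
    and "integrable lborel (\<lambda>v. \<integral>\<theta>. indicator {0..<2*pi} \<theta> *\<^sub>R F (hypc R v \<theta>) \<partial>lborel)"
proof -
  have [measurable]: "F \<in> borel_measurable borel" using borel_measurable_integrable[OF int] by simp
  let ?g = "\<lambda>p. indicator {0..<2*pi} (snd p) *\<^sub>R F (hypc R (fst p) (snd p))"
  have "integrable (density (lborel \<Otimes>\<^sub>M lborel) (\<lambda>p. ennreal (indicator {0..<2*pi} (snd p)))) (\<lambda>p. F (hypc R (fst p) (snd p)))"
    using int unfolding Mh_real_density by (subst (asm) integrable_distr_eq) auto
  hence i: "integrable (lborel \<Otimes>\<^sub>M lborel) ?g"
    by (subst (asm) integrable_density) auto
  have "(\<integral>X. F X \<partial>Mh R) = (\<integral>p. F (hypc R (fst p) (snd p)) \<partial>density (lborel \<Otimes>\<^sub>M lborel) (\<lambda>p. ennreal (indicator {0..<2*pi} (snd p))))"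
    unfolding Mh_real_density by (subst integral_distr) auto
  also have "\<dots> = (\<integral>p. ?g p \<partial>(lborel \<Otimes>\<^sub>M lborel))"
    by (subst integral_density) auto
  also have "\<dots> = (\<integral>v. (\<integral>\<theta>. indicator {0..<2*pi} \<theta> *\<^sub>R F (hypc R v \<theta>) \<partial>lborel) \<partial>lborel)"
    using lborel_pair.integral_fst'[OF i] by simp
  finally show "(\<integral>X. F X \<partial>Mh R) = \<dots>" .
  show "integrable lborel (\<lambda>v. \<integral>\<theta>. indicator {0..<2*pi} \<theta> *\<^sub>R F (hypc R v \<theta>) \<partial>lborel)"
    using lborel_pair.integrable_fst'[OF i] by simp
qed

lemma lborel_integral_circle:
  fixes g :: "real \<Rightarrow> complex"
  assumes "continuous_on {0..2*pi} g"
  shows "(\<integral>\<theta>. indicator {0..<2*pi} \<theta> *\<^sub>R g \<theta> \<partial>lborel) = integral {0..2*pi} g"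
proof -
  have m: "set_integrable lborel {0..2*pi} g" by (rule borel_integrable_atLeastAtMost'[OF assms])
  have "set_integrable lborel {0..<2*pi} g" by (rule set_integrable_subset[OF m]) auto
  hence [measurable]: "(\<lambda>\<theta>. indicator {0..<2*pi} \<theta> *\<^sub>R g \<theta>) \<in> borel_measurable lborel" 
     "(\<lambda>\<theta>. indicator {0..2*pi} \<theta> *\<^sub>R g \<theta>) \<in> borel_measurable lborel"
    using m unfolding set_integrable_def by (auto intro: borel_measurable_integrable)
  have "(\<integral>\<theta>. indicator {0..<2*pi} \<theta> *\<^sub>R g \<theta> \<partial>lborel) = (\<integral>\<theta>. indicator {0..2*pi} \<theta> *\<^sub>R g \<theta> \<partial>lborel)"
  proof (rule integral_cong_AE)
    show "AE \<theta> in lborel. indicator {0..<2*pi} \<theta> *\<^sub>R g \<theta> = indicator {0..2*pi} \<theta> *\<^sub>R g \<theta>"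
      using AE_lborel_singleton[of "2*pi"] by eventually_elim (auto simp: indicator_def)
  qed auto
  also have "\<dots> = integral {0..2*pi} g"
    using set_borel_integral_eq_integral(2)[OF m] by (simp add: set_lebesgue_integral_def)
  finally show ?thesis .
qed

lemma nn_integral_inverse_sqrt:
  assumes "a > 0"
  shows "(\<integral>\<^sup>+x. ennreal (\<bar>x - c\<bar> powr (-1/2)) * indicator {c-a..c+a} x \<partial>lborel) < \<infinity>"
proof -
  have half: "(\<integral>\<^sup>+x. ennreal (\<bar>x\<bar> powr (-1/2)) * indicator {0..a} x \<partial>lborel) < \<infinity>"
  proof -
    have "((\<lambda>x. x powr (-1/2)) has_integral a powr (-1/2+1) / (-1/2+1)) {0..a}"
      using assms by (intro has_integral_powr_from_0) auto
    hence "(\<integral>\<^sup>+x. ennreal (indicator {0..a} x * x powr (-1/2)) \<partial>lborel) = ennreal (a powr (-1/2+1) / (-1/2+1))"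
      by (intro nn_integral_has_integral_lebesgue) auto
    moreover have "(\<integral>\<^sup>+x. ennreal (\<bar>x\<bar> powr (-1/2)) * indicator {0..a} x \<partial>lborel) = (\<integral>\<^sup>+x. ennreal (indicator {0..a} x * x powr (-1/2)) \<partial>lborel)"
      by (intro nn_integral_cong) (auto simp: indicator_def)
    ultimately show ?thesis by simp
  qed
  have half': "(\<integral>\<^sup>+x. ennreal (\<bar>x\<bar> powr (-1/2)) * indicator {-a..0} x \<partial>lborel) = (\<integral>\<^sup>+x. ennreal (\<bar>x\<bar> powr (-1/2)) * indicator {0..a} x \<partial>lborel)"
    by (subst nn_integral_real_affine[where c="-1" and t=0]) (auto simp: indicator_def intro!: nn_integral_cong)
  have "(\<integral>\<^sup>+x. ennreal (\<bar>x - c\<bar> powr (-1/2)) * indicator {c-a..c+a} x \<partial>lborel) = (\<integral>\<^sup>+x. ennreal (\<bar>x\<bar> powr (-1/2)) * indicator {-a..a} x \<partial>lborel)"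
    by (subst nn_integral_real_affine[where c="1" and t=c]) (auto simp: indicator_def intro!: nn_integral_cong)
  also have "\<dots> \<le> (\<integral>\<^sup>+x. (ennreal (\<bar>x\<bar> powr (-1/2)) * indicator {-a..0} x + ennreal (\<bar>x\<bar> powr (-1/2)) * indicator {0..a} x) \<partial>lborel)"
    by (intro nn_integral_mono) (auto simp: indicator_def)
  also have "\<dots> = (\<integral>\<^sup>+x. ennreal (\<bar>x\<bar> powr (-1/2)) * indicator {-a..0} x \<partial>lborel) + (\<integral>\<^sup>+x. ennreal (\<bar>x\<bar> powr (-1/2)) * indicator {0..a} x \<partial>lborel)"
    by (rule nn_integral_add) auto
  also have "\<dots> < \<infinity>" using half unfolding half' by simp
  finally show ?thesis .
qed

text \<open>The denominator vanishes like a square root at \<open>T0 = C^2 / (4 * w^2)\<close>,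
  which is integrable. For \<open>T \<ge> 2 * T0\<close> it is of the order of
  \<open>r = sqrt T\<close>, and \<open>wt r / r\<close> is at most a multiple of
  \<open>logwt T\<close>.\<close>

lemma nn_integral_radial_singular:
  assumes R: "R > 0" and w: "w > 0" "C > 0"
  shows "(\<integral>\<^sup>+T. ennreal (wt (sqrt T) / sqrt \<bar>4 * w\<^sup>2 * T - C\<^sup>2\<bar>) * indicator {R\<^sup>2..} T \<partial>lborel) < \<infinity>"
proof -
  define T0 where "T0 = C\<^sup>2 / (4 * w\<^sup>2)"
  have T0: "T0 > 0" using w by (simp add: T0_def)
  define K1 where "K1 = (1 + ln (1 + 1/R)) ^ 4 * (1 + 1/R)"
  have K1: "K1 \<ge> 0" using R by (simp add: K1_def)
  have sq: "sqrt \<bar>4 * w\<^sup>2 * T - C\<^sup>2\<bar> = 2 * w * sqrt \<bar>T - T0\<bar>" for T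
  proof -
    have "4 * w\<^sup>2 * T - C\<^sup>2 = (2 * w)\<^sup>2 * (T - T0)" using w by (simp add: T0_def algebra_simps power_mult_distrib)
    thus ?thesis using w by (simp add: abs_mult real_sqrt_mult)
  qed
  have wt1: "wt r \<le> K1 * logwt r" if "r \<ge> R" for r
    using wt_le_logwt[OF R that, of 0 r] that R by (simp add: K1_def logwt_def)
  \<comment> \<open>The 8 is a 2 from \<open>sqrt |T - T0| \<ge> r / 2\<close> times a 4 from
    squaring \<open>1 + ln (1 + T) \<le> 2 * (1 + ln (1 + r))\<close>.\<close>
  define K2 where "K2 = 8 * (1 + 1/R\<^sup>2) * K1 / (2 * w)"
  have K2: "K2 \<ge> 0" using K1 w by (simp add: K2_def)
  define K3 where "K3 = K1 / (2*w)"
  have K3: "K3 \<ge> 0" using K1 w by (simp add: K3_def)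
  \<comment> \<open>The interval is \<open>{0..2 * T0}\<close>, written in the shape of
    \<open>nn_integral_inverse_sqrt\<close> with centre and radius \<open>T0\<close>.\<close>
  have bd: "wt (sqrt T) / sqrt \<bar>4 * w\<^sup>2 * T - C\<^sup>2\<bar> \<le> K2 * logwt T + K3 * (\<bar>T - T0\<bar> powr (-1/2) * indicator {T0-T0..T0+T0} T)" if T: "T \<ge> R\<^sup>2" for T
  proof -
    define r where "r = sqrt T"
    have "T > 0" using T R by (meson less_le_trans zero_less_power)
    hence r: "r \<ge> R" "T = r\<^sup>2" "r > 0" using T by (auto simp: r_def real_le_rsqrt)
    have lr: "1 + ln (1 + r) \<ge> 1" using r by simp
    show ?thesis
    proof (cases "T \<ge> 2 * T0")
      case True
      have "r / 2 \<le> sqrt \<bar>T - T0\<bar>"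
      proof (rule real_le_rsqrt)
        have "r\<^sup>2 / 4 \<le> T - T0" using True T0 r by linarith
        also have "\<dots> \<le> \<bar>T - T0\<bar>" by (rule abs_ge_self)
        finally show "(r/2)\<^sup>2 \<le> \<bar>T - T0\<bar>" by (simp add: power_divide)
      qed
      hence "wt r / (2 * w * sqrt \<bar>T - T0\<bar>) \<le> (K1 * logwt r) / (2 * w * (r / 2))"
        using wt1[OF r(1)] r w K1 by (intro frac_le mult_left_mono) (auto simp: logwt_nonneg intro!: mult_nonneg_nonneg)
      also have "\<dots> = 2 * K1 / (2*w) * (logwt r / r)" using r by (simp add: field_simps)
      also have "2 * K1 / (2*w) * (logwt r / r) \<le> 2 * K1 / (2*w) * (4 * (1 + 1/R\<^sup>2) * logwt T)"
      proof (rule mult_left_mono)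
        have "1 \<le> T / R\<^sup>2" using T R by simp
        hence "1 + T \<le> (1 + 1/R\<^sup>2) * (r * r)" using r(2) by (simp add: algebra_simps power2_eq_square)
        also have "\<dots> \<le> (1 + 1/R\<^sup>2) * (r * (1 + r))" using r by (intro mult_left_mono) auto
        finally have a: "1 + T \<le> (1 + 1/R\<^sup>2) * (r * (1 + r))" .
        have "1 + T \<le> (1 + r)\<^sup>2" using r by (simp add: power2_eq_square algebra_simps)
        hence "ln (1 + T) \<le> ln ((1 + r)\<^sup>2)" using r by (intro ln_mono) (auto simp: add_pos_nonneg)
        also have "\<dots> = 2 * ln (1 + r)" using r by (simp add: ln_realpow)
        finally have b: "1 + ln (1 + T) \<le> 2 * (1 + ln (1 + r))" by simp
        have pT: "T > 0" using r by simp
        hence lT: "1 + ln (1 + T) > 0" by (smt (verit) ln_ge_zero)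
        have "(1 + T) * (1 + ln (1 + T))\<^sup>2 \<le> ((1 + 1/R\<^sup>2) * (r * (1 + r))) * (2 * (1 + ln (1 + r)))\<^sup>2"
          using a b lT pT r by (intro mult_mono power_mono) auto
        also have "\<dots> = 4 * (1 + 1/R\<^sup>2) * (r * ((1 + r) * (1 + ln (1 + r))\<^sup>2))"
        proof -
          have "(a * (r * b)) * (2 * c)\<^sup>2 = 4 * a * (r * (b * c\<^sup>2))" for a b c :: real
            by (simp add: power_mult_distrib)
          thus ?thesis .
        qed
        finally have c: "(1 + T) * (1 + ln (1 + T))\<^sup>2 \<le> 4 * (1 + 1/R\<^sup>2) * (r * ((1 + r) * (1 + ln (1 + r))\<^sup>2))" .
        have gen: "1 / p \<le> k * (1 / a)" if "0 < a" "0 < p" "a \<le> k * p" for a p k :: real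
          using that by (simp add: field_simps)
        have "1 / (r * ((1 + r) * (1 + ln (1 + r))\<^sup>2)) \<le> 4 * (1 + 1/R\<^sup>2) * (1 / ((1 + T) * (1 + ln (1 + T))\<^sup>2))"
        proof (rule gen[OF _ _ c])
          show "0 < (1 + T) * (1 + ln (1 + T))\<^sup>2" using lT pT by (intro mult_pos_pos zero_less_power) linarith+
          show "0 < r * ((1 + r) * (1 + ln (1 + r))\<^sup>2)" using lr r(3) by (intro mult_pos_pos zero_less_power) linarith+
        qed
        thus "logwt r / r \<le> 4 * (1 + 1/R\<^sup>2) * logwt T" using r pT by (simp add: logwt_def mult_ac)
        show "0 \<le> 2 * K1 / (2*w)" using K1 w by simp
      qed
      also have "2 * K1 / (2*w) * (4 * (1 + 1/R\<^sup>2) * logwt T) = K2 * logwt T"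
      proof -
        have "2 * a / (2*w) * (4 * b * c) = 8 * b * a / (2*w) * c" for a b c :: real by simp
        thus ?thesis unfolding K2_def .
      qed
      finally have "wt (sqrt T) / sqrt \<bar>4 * w\<^sup>2 * T - C\<^sup>2\<bar> \<le> K2 * logwt T" 
        unfolding sq r_def[symmetric] .
      thus ?thesis using K3 by (intro order_trans[OF _ add_increasing2]) (auto intro!: mult_nonneg_nonneg)
    next
      case False
      have "logwt r \<le> 1" 
      proof -
        have "1 * 1 \<le> (1 + \<bar>r\<bar>) * (1 + ln (1 + \<bar>r\<bar>))\<^sup>2" using r lr by (intro mult_mono) auto
        thus ?thesis by (simp add: logwt_def)
      qed
      hence "wt r \<le> K1" using wt1[OF r(1)] K1 mult_left_mono[of "logwt r" 1 K1] by simp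
      hence "wt r / (2 * w * sqrt \<bar>T - T0\<bar>) \<le> K1 / (2 * w * sqrt \<bar>T - T0\<bar>)"
        using w by (intro divide_right_mono) auto
      also have "\<dots> = K3 * \<bar>T - T0\<bar> powr (-1/2)"
        by (simp add: K3_def powr_minus_divide powr_half_sqrt)
      also have "\<dots> = K3 * (\<bar>T - T0\<bar> powr (-1/2) * indicator {T0-T0..T0+T0} T)"
        using False r by (simp add: indicator_def)
      finally have "wt (sqrt T) / sqrt \<bar>4 * w\<^sup>2 * T - C\<^sup>2\<bar> \<le> K3 * (\<bar>T - T0\<bar> powr (-1/2) * indicator {T0-T0..T0+T0} T)"
        unfolding sq r_def[symmetric] .
      thus ?thesis using K2 by (intro order_trans[OF _ add_increasing]) (auto intro!: mult_nonneg_nonneg logwt_nonneg)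
    qed
  qed
  have "(\<integral>\<^sup>+T. ennreal (wt (sqrt T) / sqrt \<bar>4 * w\<^sup>2 * T - C\<^sup>2\<bar>) * indicator {R\<^sup>2..} T \<partial>lborel)
    \<le> (\<integral>\<^sup>+T. (ennreal K2 * ennreal (logwt T) + ennreal K3 * (ennreal (\<bar>T - T0\<bar> powr (-1/2)) * indicator {T0-T0..T0+T0} T)) \<partial>lborel)"
  proof (rule nn_integral_mono)
    fix T :: real
    have "ennreal K2 * ennreal (logwt T) + ennreal K3 * (ennreal (\<bar>T - T0\<bar> powr (-1/2)) * indicator {T0-T0..T0+T0} T)
      = ennreal (K2 * logwt T + K3 * (\<bar>T - T0\<bar> powr (-1/2) * indicator {T0-T0..T0+T0} T))"
      using K2 K3 by (simp add: ennreal_mult logwt_nonneg indicator_def)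
    thus "ennreal (wt (sqrt T) / sqrt \<bar>4 * w\<^sup>2 * T - C\<^sup>2\<bar>) * indicator {R\<^sup>2..} T \<le> ennreal K2 * ennreal (logwt T) + ennreal K3 * (ennreal (\<bar>T - T0\<bar> powr (-1/2)) * indicator {T0-T0..T0+T0} T)"
      using bd[of T] by (cases "T \<ge> R\<^sup>2") (auto intro!: ennreal_leI)
  qed
  also have "\<dots> = ennreal K2 * (\<integral>\<^sup>+T. ennreal (logwt T) \<partial>lborel) + ennreal K3 * (\<integral>\<^sup>+T. ennreal (\<bar>T - T0\<bar> powr (-1/2)) * indicator {T0-T0..T0+T0} T \<partial>lborel)"
    by (simp add: nn_integral_add nn_integral_cmult)
  also have "\<dots> < \<infinity>"
    using nn_integral_logwt nn_integral_inverse_sqrt[OF T0, of T0] by (simp add: ennreal_mult_less_top)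
  finally show ?thesis .
qed

lemma AE_radial_ne: "AE v in lborel. R\<^sup>2 + (cmod v)\<^sup>2 \<noteq> c"
proof -
  have "AE t in density lborel (\<lambda>t. ennreal pi * indicator {0..} t). t \<noteq> c - R\<^sup>2"
    by (subst AE_density) (auto intro: AE_mp[OF AE_lborel_singleton[of "c - R\<^sup>2"]])
  hence "AE t in distr lborel borel (\<lambda>z::complex. (cmod z)\<^sup>2). t \<noteq> c - R\<^sup>2" unfolding distr_lborel_cmod_power2 .
  hence "AE v::complex in lborel. (cmod v)\<^sup>2 \<noteq> c - R\<^sup>2"
    by (subst (asm) AE_distr_iff) auto
  thus ?thesis by eventually_elim auto
qed

text \<open>The circle bound is integrated over \<open>v\<close>. The constant precedes
  \<open>f\<close>, \<open>S\<close>, \<open>\<sigma>\<close> and \<open>\<epsilon>\<close> in the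
  quantifiers, which is the uniformity that the closure needs. The circles with
  \<open>C = 2 * w * r\<close>, where the bound is infinite, form a null set of
  \<open>v\<close>.\<close>

lemma uniform_bound:
  assumes R: "R > 0" and w: "w > 0" "C > 0"
  shows "\<exists>K\<ge>0. \<forall>f S \<sigma> \<epsilon>. f \<in> borel_measurable borel \<longrightarrow> S \<ge> 0 \<longrightarrow>
     (\<forall>v \<theta>. cmod (f (hypc R v \<theta>)) \<le> S * wt (sqrt (R\<^sup>2 + (cmod v)\<^sup>2))) \<longrightarrow>
     (\<forall>v \<theta> \<phi>. cmod (f (hypc R v \<theta>) - f (hypc R v \<phi>)) \<le> S * wt (sqrt (R\<^sup>2 + (cmod v)\<^sup>2)) * \<bar>\<theta> - \<phi>\<bar>) \<longrightarrow>
     \<bar>\<sigma>\<bar> = 1 \<longrightarrow> \<epsilon> > 0 \<longrightarrow>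
     cmod (\<integral>X. f X / Complex (C - 2*w*Re (za X)) (\<sigma> * \<epsilon>) \<partial>Mh R) \<le> K * S"
proof -
  define B where "B v = wt (sqrt (R\<^sup>2 + (cmod v)\<^sup>2)) / sqrt \<bar>4 * w\<^sup>2 * (R\<^sup>2 + (cmod v)\<^sup>2) - C\<^sup>2\<bar>" for v
  have [measurable]: "B \<in> borel_measurable borel" unfolding B_def by measurable
  have B0: "B v \<ge> 0" for v by (simp add: B_def wt_nonneg)
  have Bint: "integrable lborel B"
  proof (rule integrableI_nonneg)
    have "(\<integral>\<^sup>+v. ennreal (B v) \<partial>lborel) = ennreal pi * (\<integral>\<^sup>+T. ennreal (wt (sqrt T) / sqrt \<bar>4 * w\<^sup>2 * T - C\<^sup>2\<bar>) * indicator {R\<^sup>2..} T \<partial>lborel)"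
      unfolding B_def by (rule nn_integral_radial[OF _ R]) measurable
    also have "\<dots> < \<infinity>" using nn_integral_radial_singular[OF assms] by (simp add: ennreal_mult_less_top)
    finally show "(\<integral>\<^sup>+v. ennreal (B v) \<partial>lborel) < \<infinity>" .
  qed (auto simp: B0)
  show ?thesis
  proof (intro exI[of _ "10 * pi * (\<integral>v. B v \<partial>lborel)"] conjI allI impI)
    show "0 \<le> 10 * pi * (\<integral>v. B v \<partial>lborel)" by (simp add: B0 integral_nonneg_AE)
    fix f :: "real^4 \<Rightarrow> complex" and S \<sigma> \<epsilon> :: real
    assume [measurable]: "f \<in> borel_measurable borel" and S: "S \<ge> 0"
      and b1: "\<forall>v \<theta>. cmod (f (hypc R v \<theta>)) \<le> S * wt (sqrt (R\<^sup>2 + (cmod v)\<^sup>2))"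
      and b2: "\<forall>v \<theta> \<phi>. cmod (f (hypc R v \<theta>) - f (hypc R v \<phi>)) \<le> S * wt (sqrt (R\<^sup>2 + (cmod v)\<^sup>2)) * \<bar>\<theta> - \<phi>\<bar>"
      and \<sigma>: "\<bar>\<sigma>\<bar> = 1" and \<epsilon>: "\<epsilon> > 0"
    have nz: "\<sigma> * \<epsilon> \<noteq> 0" using \<sigma> \<epsilon> by auto
    define F where "F X = f X / Complex (C - 2*w*Re (za X)) (\<sigma> * \<epsilon>)" for X
    have "integrable (Mh R) F" unfolding F_def
    proof (rule kernel_integrable[OF R w(1) \<epsilon> \<sigma>])
      show "AE X in Mh R. cmod (f X) \<le> S * wt (cmod (za X))"
        by (rule AE_Mh) (use b1 in \<open>auto simp: za_hypc norm_mult abs_of_nonneg\<close>)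
    qed simp
    note Fub = Mh_Fubini[OF this]
    have ib: "cmod (\<integral>\<theta>. indicator {0..<2*pi} \<theta> *\<^sub>R F (hypc R v \<theta>) \<partial>lborel) \<le> 10 * pi * S * B v"
      if ne: "R\<^sup>2 + (cmod v)\<^sup>2 \<noteq> C\<^sup>2 / (4 * w\<^sup>2)" for v
    proof -
      define r where "r = sqrt (R\<^sup>2 + (cmod v)\<^sup>2)"
      have r: "r > 0" "r\<^sup>2 = R\<^sup>2 + (cmod v)\<^sup>2" using R by (auto simp: r_def add_pos_nonneg)
      have Feq: "F (hypc R v \<theta>) = f (hypc R v \<theta>) / (Complex C (\<sigma> * \<epsilon>) - of_real (2 * w * r * cos \<theta>))" for \<theta>
      proof -
        have "Complex (C - 2*w*Re (za (hypc R v \<theta>))) (\<sigma> * \<epsilon>) = Complex C (\<sigma> * \<epsilon>) - of_real (2 * w * r * cos \<theta>)"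
          by (simp add: complex_eq_iff za_hypc r_def)
        thus ?thesis by (simp add: F_def)
      qed
      have contf: "continuous_on {0..2*pi} (\<lambda>\<theta>. f (hypc R v \<theta>))"
      proof (rule lipschitz_on_continuous_on[of "S * wt r"])
        show "(S * wt r)-lipschitz_on {0..2*pi} (\<lambda>\<theta>. f (hypc R v \<theta>))"
          using b2 S r by (intro lipschitz_onI) (auto simp: dist_norm r_def wt_nonneg)
      qed
      have nz': "Complex C (\<sigma> * \<epsilon>) - of_real (2 * w * r * cos \<theta>) \<noteq> 0" for \<theta> using nz by (simp add: complex_eq_iff)
      have "(\<integral>\<theta>. indicator {0..<2*pi} \<theta> *\<^sub>R F (hypc R v \<theta>) \<partial>lborel) = integral {0..2*pi} (\<lambda>\<theta>. F (hypc R v \<theta>))"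
        unfolding Feq using nz' by (intro lborel_integral_circle continuous_intros contf) auto
      also have "cmod \<dots> \<le> 10 * pi * (S * wt r) / sqrt \<bar>(2*w*r)\<^sup>2 - C\<^sup>2\<bar>"
        unfolding Feq
      proof (rule circle_uniform_bound)
        show "C \<noteq> 2 * w * r"
        proof
          assume "C = 2 * w * r"
          hence "C\<^sup>2 / (4 * w\<^sup>2) = r\<^sup>2" using w by (simp add: power_mult_distrib)
          thus False using ne r by simp
        qed
      qed (use b1 b2 w r nz contf in \<open>auto simp: r_def\<close>)
      also have "\<dots> = 10 * pi * S * B v"
        by (simp add: B_def power_mult_distrib r mult_ac flip: r_def)
      finally show ?thesis .
    qed
    have "cmod (\<integral>X. F X \<partial>Mh R) \<le> (\<integral>v. cmod (\<integral>\<theta>. indicator {0..<2*pi} \<theta> *\<^sub>R F (hypc R v \<theta>) \<partial>lborel) \<partial>lborel)"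
      unfolding Fub(1) by (rule integral_norm_bound)
    also have "\<dots> \<le> (\<integral>v. 10 * pi * S * B v \<partial>lborel)"
    proof (rule integral_mono_AE)
      show "AE v in lborel. cmod (\<integral>\<theta>. indicator {0..<2*pi} \<theta> *\<^sub>R F (hypc R v \<theta>) \<partial>lborel) \<le> 10 * pi * S * B v"
        using AE_radial_ne[of R "C\<^sup>2 / (4 * w\<^sup>2)"] by eventually_elim (rule ib)
    qed (use Fub(2) Bint in \<open>auto intro: integrable_norm\<close>)
    also have "\<dots> = 10 * pi * (\<integral>v. B v \<partial>lborel) * S" by simp
    finally show "cmod (\<integral>X. f X / Complex (C - 2*w*Re (za X)) (\<sigma> * \<epsilon>) \<partial>Mh R) \<le> 10 * pi * (\<integral>v. B v \<partial>lborel) * S"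
      by (simp add: F_def)
  qed
qed

section \<open>Integrals of powers of \<open>za\<close>\<close>

lemma power_split2: "k \<ge> 2 \<Longrightarrow> x ^ k = x ^ (k - 2) * (x::'a::monoid_mult)\<^sup>2"
  by (metis le_add_diff_inverse2 power_add)

text \<open>The fourth power of the logarithm grows more slowly than \<open>r\<close>, so a second
  power of \<open>1 / r\<close> beats it; the powers beyond the second are bounded because
  \<open>r \<ge> R\<close>.\<close>

lemma inverse_power_le_wt:
  assumes R: "R > 0" and k: "k \<ge> 2"
  shows "\<exists>S\<ge>0. \<forall>r\<ge>R. 1 / r ^ k \<le> S * wt r"
proof -
  \<comment> \<open>For \<open>r \<ge> 1\<close> the estimate
    \<open>ln r = 4 ln (r^(1/4)) \<le> 4 (r^(1/4) - 1)\<close> gives \<open>256 = 4^4\<close>; the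
    second term covers \<open>R \<le> r < 1\<close>.\<close>
  define S0 where "S0 = 256 + (1 + \<bar>ln R\<bar>) ^ 4 / R"
  have S0: "S0 \<ge> 0" using R by (simp add: S0_def)
  have log: "(1 + \<bar>ln r\<bar>) ^ 4 \<le> S0 * r" if r: "r \<ge> R" for r
  proof (cases "r \<ge> 1")
    case True
    define q where "q = r powr (1/4)"
    have q: "q \<ge> 1" "q ^ 4 = r" using True by (auto simp: q_def ge_one_powr_ge_zero powr_powr simp flip: powr_realpow')
    have "ln r = 4 * ln q" using True by (simp add: q_def ln_powr)
    also have "ln q \<le> q - 1" using q by (intro ln_le_minus_one) auto
    finally have "1 + \<bar>ln r\<bar> \<le> 4 * q" using True q by simp
    hence "(1 + \<bar>ln r\<bar>) ^ 4 \<le> (4 * q) ^ 4" by (intro power_mono) auto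
    also have "\<dots> = 256 * r" by (simp add: power_mult_distrib q)
    also have "\<dots> \<le> S0 * r" using R True by (intro mult_right_mono) (auto simp: S0_def)
    finally show ?thesis .
  next
    case False
    hence "\<bar>ln r\<bar> \<le> \<bar>ln R\<bar>" using r R by (simp add: abs_if ln_le_zero_iff)
    hence "(1 + \<bar>ln r\<bar>) ^ 4 \<le> (1 + \<bar>ln R\<bar>) ^ 4 * 1" by (simp add: power_mono)
    also have "\<dots> \<le> (1 + \<bar>ln R\<bar>) ^ 4 * (r / R)" using r R by (intro mult_left_mono) auto
    also have "\<dots> \<le> S0 * r" using r R by (simp add: S0_def algebra_simps)
    finally show ?thesis .
  qed
  show ?thesis
  proof (intro exI[of _ "S0 / R ^ (k - 2)"] conjI allI impI)
    show "S0 / R ^ (k - 2) \<ge> 0" using S0 R by simp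
    fix r assume r: "R \<le> r"
    hence r0: "r > 0" using R by simp
    have "r ^ k = r ^ (k - 2) * r\<^sup>2" using k by (rule power_split2)
    moreover have "R ^ (k - 2) \<le> r ^ (k - 2)" using r R by (intro power_mono) auto
    ultimately have "R ^ (k - 2) * (r * r) \<le> r ^ k" using r0 by (simp add: power2_eq_square)
    hence "(1 + \<bar>ln r\<bar>) ^ 4 * (R ^ (k - 2) * r) \<le> (S0 * r) * (r ^ k / r)"
      using log[OF r] r0 R S0 by (intro mult_mono) (auto simp: field_simps)
    hence *: "((1 + \<bar>ln r\<bar>) ^ 4 * r) * R ^ (k - 2) \<le> S0 * r ^ k" using r0 by (simp add: mult_ac)
    have gen: "1 / p \<le> s / q * (1 / a)" if "0 < a" "0 < p" "0 < q" "a * q \<le> s * p" for a p q s :: real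
      using that by (simp add: field_simps)
    show "1 / r ^ k \<le> S0 / R ^ (k - 2) * wt r"
      unfolding wt_def by (rule gen[OF _ _ _ *]) (use r0 R in auto)
  qed
qed

lemma integral_radial:
  fixes g :: "real \<Rightarrow> complex"
  assumes [measurable]: "g \<in> borel_measurable borel" and int: "integrable lborel (\<lambda>v. g (R\<^sup>2 + (cmod v)\<^sup>2))"
  shows "set_integrable lborel {R\<^sup>2..} g"
    and "(\<integral>v. g (R\<^sup>2 + (cmod v)\<^sup>2) \<partial>lborel) = of_real pi * (LINT T:{R\<^sup>2..}|lborel. g T)"
proof -
  have rad: "distr lborel borel (\<lambda>z::complex. (cmod z)\<^sup>2) = density lborel (\<lambda>t. ennreal (pi * indicator {0..} t))"
    unfolding distr_lborel_cmod_power2 by (auto intro!: density_cong simp: indicator_def)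
  have "integrable (distr lborel borel (\<lambda>z::complex. (cmod z)\<^sup>2)) (\<lambda>t. g (R\<^sup>2 + t))"
    using int by (subst integrable_distr_eq) auto
  hence 1: "integrable lborel (\<lambda>t. (pi * indicator {0..} t) *\<^sub>R g (R\<^sup>2 + t))"
    unfolding rad by (subst (asm) integrable_density) auto
  have "integrable lborel (\<lambda>t. (1/pi) *\<^sub>R ((pi * indicator {0..} t) *\<^sub>R g (R\<^sup>2 + t)))"
    by (rule integrable_scaleR_right[OF 1])
  hence 2: "integrable lborel (\<lambda>t. indicator {R\<^sup>2..} (R\<^sup>2 + 1 * t) *\<^sub>R g (R\<^sup>2 + 1 * t))"
    by (rule Bochner_Integration.integrable_cong[THEN iffD1, rotated -1]) (auto simp: indicator_def)
  thus "set_integrable lborel {R\<^sup>2..} g"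
    unfolding set_integrable_def by (subst (asm) lborel_integrable_real_affine_iff) auto
  have "(\<integral>v. g (R\<^sup>2 + (cmod v)\<^sup>2) \<partial>lborel) = (\<integral>t. g (R\<^sup>2 + t) \<partial>distr lborel borel (\<lambda>z::complex. (cmod z)\<^sup>2))"
    by (subst integral_distr) auto
  also have "\<dots> = (\<integral>t. (pi * indicator {0..} t) *\<^sub>R g (R\<^sup>2 + t) \<partial>lborel)"
    unfolding rad by (subst integral_density) auto
  also have "\<dots> = (\<integral>t. of_real pi * (indicator {R\<^sup>2..} (R\<^sup>2 + 1 * t) *\<^sub>R g (R\<^sup>2 + 1 * t)) \<partial>lborel)"
    by (intro Bochner_Integration.integral_cong) (auto simp: indicator_def scaleR_conv_of_real)
  also have "\<dots> = of_real pi * (\<integral>t. indicator {R\<^sup>2..} (R\<^sup>2 + 1 * t) *\<^sub>R g (R\<^sup>2 + 1 * t) \<partial>lborel)"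
    by (rule integral_mult_right_zero)
  also have "(\<integral>t. indicator {R\<^sup>2..} (R\<^sup>2 + 1 * t) *\<^sub>R g (R\<^sup>2 + 1 * t) \<partial>lborel) = (LINT T:{R\<^sup>2..}|lborel. g T)"
    unfolding set_lebesgue_integral_def using lborel_integral_real_affine[of 1 "\<lambda>t. indicator {R\<^sup>2..} t *\<^sub>R g t" "R\<^sup>2"] by simp
  finally show "(\<integral>v. g (R\<^sup>2 + (cmod v)\<^sup>2) \<partial>lborel) = of_real pi * (LINT T:{R\<^sup>2..}|lborel. g T)" .
qed

lemma continuous_kernel_disc:
  assumes "Re G > 0" "Im G \<noteq> 0"
  shows "isCont (kernel_disc w G) T"
proof -
  have "G\<^sup>2 - of_real (4 * w\<^sup>2 * T) \<notin> \<real>\<^sub>\<le>\<^sub>0"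
    using assms by (simp add: complex_nonpos_Reals_iff power2_eq_square)
  thus ?thesis unfolding kernel_disc_def by (intro isCont_o2[OF _ continuous_at_csqrt] continuous_intros)
qed

text \<open>The antiderivative \<open>F\<close> is the power \<open>k - 1\<close> of the root,
  scaled. It vanishes at infinity because the root is at most \<open>1 / sqrt T\<close> in modulus
  and \<open>k - 1 \<ge> 1\<close>, so only the value at \<open>R^2\<close> survives.\<close>

lemma kernel_root_power_integral:
  assumes R: "R > 0" and w: "w > 0" and G: "Re G > 0" "Im G \<noteq> 0" and k: "k \<ge> 2"
    and int: "set_integrable lborel {R\<^sup>2..} (\<lambda>T. kernel_root w G T ^ k / kernel_disc w G T)"
  shows "(LINT T:{R\<^sup>2..}|lborel. kernel_root w G T ^ k / kernel_disc w G T) = - (kernel_root w G (R\<^sup>2) ^ (k - 1) / of_real (w * real (k - 1)))"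
proof -
  define f where "f T = kernel_root w G T ^ k / kernel_disc w G T" for T
  define F where "F T = kernel_root w G T ^ (k - 1) / of_real (w * real (k - 1))" for T
  have d: "Im G \<noteq> 0 \<or> (Re G)\<^sup>2 > 4 * w\<^sup>2 * T" for T using G by simp
  have Fd: "(F has_vector_derivative f T) (at T)" for T
  proof -
    have "((\<lambda>T. kernel_root w G T ^ (k - 1)) has_vector_derivative 
       of_real w * (kernel_root w G T)\<^sup>2 / kernel_disc w G T * (of_nat (k - 1) * kernel_root w G T ^ (k - 1 - 1))) (at T)"
    proof -
      have pw: "((\<lambda>z. z ^ (k - 1)) has_field_derivative of_nat (k - 1) * kernel_root w G T ^ (k - 1 - 1)) (at (kernel_root w G T))"
        by (auto intro!: derivative_eq_intros) 
      show ?thesis using field_vector_diff_chain_at[OF kernel_root_deriv[OF w G] pw] unfolding o_def .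
    qed
    hence "(F has_vector_derivative of_real w * (kernel_root w G T)\<^sup>2 / kernel_disc w G T * (of_nat (k - 1) * kernel_root w G T ^ (k - 1 - 1)) / of_real (w * real (k - 1))) (at T)"
      unfolding F_def by (rule has_vector_derivative_divide)
    also have "of_real w * (kernel_root w G T)\<^sup>2 / kernel_disc w G T * (of_nat (k - 1) * kernel_root w G T ^ (k - 1 - 1)) / of_real (w * real (k - 1)) = f T"
    proof -
      have "kernel_root w G T ^ k = (kernel_root w G T)\<^sup>2 * kernel_root w G T ^ (k - 1 - 1)"
        using power_split2[OF k, of "kernel_root w G T"] by (simp add: mult.commute numeral_2_eq_2)
      thus ?thesis using w k kernel_disc_facts(2)[OF G(1) d] by (simp add: f_def field_simps)
    qed
    finally show ?thesis .
  qed
  have Fc: "isCont F T" for T using Fd has_vector_derivative_continuous by blast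
  have yc: "isCont (kernel_root w G) T" for T using kernel_root_deriv[OF w G] has_vector_derivative_continuous by blast
  have fc: "isCont f T" for T
    unfolding f_def using kernel_disc_facts(2)[OF G(1) d] by (intro continuous_intros yc continuous_kernel_disc G) auto
  have "(LBINT T=ereal (R\<^sup>2)..\<infinity>. f T) = 0 - F (R\<^sup>2)"
  proof (rule interval_integral_FTC_integrable)
    show "set_integrable lborel (einterval (ereal (R\<^sup>2)) \<infinity>) f"
      using int unfolding f_def by (rule set_integrable_subset) (auto simp: einterval_def)
    have "(F \<longlongrightarrow> F (R\<^sup>2)) (at_right (R\<^sup>2))"
      using Fc[of "R\<^sup>2"] by (simp add: isCont_def filterlim_at_split)
    thus "((F \<circ> real_of_ereal) \<longlongrightarrow> F (R\<^sup>2)) (at_right (ereal (R\<^sup>2)))"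
      by (simp add: at_right_ereal filterlim_filtermap o_def)
    have "(F \<longlongrightarrow> 0) at_top"
    proof (rule Lim_null_comparison)
      have yb: "cmod (kernel_root w G T) \<le> 1 / sqrt T" if "T > 0" for T
        using circle_kernel_integral(1)[OF w that G(1) d] that by (simp add: norm_mult field_simps)
      show "\<forall>\<^sub>F T in at_top. norm (F T) \<le> (1 / sqrt T) ^ (k - 1) / (w * real (k - 1))"
        using eventually_gt_at_top[of 0]
      proof eventually_elim
        case (elim T)
        thus ?case using yb[of T] w by (auto simp: F_def norm_divide norm_power norm_mult intro!: divide_right_mono power_mono)
      qed
      have "((\<lambda>T. 1 / sqrt T) \<longlongrightarrow> 0) at_top"
        by (intro tendsto_divide_0[OF tendsto_const] filterlim_at_top_imp_at_infinity sqrt_at_top)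
      hence "((\<lambda>T. (1 / sqrt T) ^ (k - 1)) \<longlongrightarrow> 0 ^ (k - 1)) at_top" by (rule tendsto_power)
      moreover have "(0::real) ^ (k - 1) = 0" using k by (simp add: zero_power)
      ultimately have "((\<lambda>T. (1 / sqrt T) ^ (k - 1)) \<longlongrightarrow> 0) at_top" by (simp only:)
      from tendsto_divide[OF this tendsto_const, of "w * real (k - 1)"]
      show "((\<lambda>T. (1 / sqrt T) ^ (k - 1) / (w * real (k - 1))) \<longlongrightarrow> 0) at_top" using w k by simp
    qed
    thus "((F \<circ> real_of_ereal) \<longlongrightarrow> 0) (at_left \<infinity>)"
      by (simp add: at_left_PInf filterlim_filtermap o_def)
  qed (use Fd fc in auto)
  moreover have "(LBINT T=ereal (R\<^sup>2)..\<infinity>. f T) = (LINT T:{R\<^sup>2..}|lborel. f T)"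
  proof -
    have [measurable]: "f \<in> borel_measurable borel"
      by (intro borel_measurable_continuous_onI continuous_at_imp_continuous_on) (simp add: fc)
    have "(LBINT T=ereal (R\<^sup>2)..\<infinity>. f T) = (LINT T:{R\<^sup>2<..}|lborel. f T)"
      by (simp add: interval_lebesgue_integral_def einterval_def greaterThan_def)
    also have "\<dots> = (LINT T:{R\<^sup>2..}|lborel. f T)"
      unfolding set_lebesgue_integral_def
    proof (rule integral_cong_AE)
      show "AE T in lborel. indicator {R\<^sup>2<..} T *\<^sub>R f T = indicator {R\<^sup>2..} T *\<^sub>R f T"
        using AE_lborel_singleton[of "R\<^sup>2"] by eventually_elim (auto simp: indicator_def)
    qed measurable
    finally show ?thesis .
  qed
  ultimately show ?thesis by (simp add: f_def F_def)
qed

text \<open>On the circle with \<open>|z_11|^2 = T\<close>, the function \<open>1 / za^k\<close> is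
  \<open>T^(-k/2) * cis \<theta> ^ k\<close>, and the residue contributes \<open>T^(k/2)\<close>, so
  the angular integral is free of explicit powers of \<open>T\<close> and the radial antiderivative
  applies.\<close>

lemma za_power_integral:
  assumes R: "R > 0" and w: "w > 0" and C: "C > 0" and k: "k \<ge> 2" and \<epsilon>: "\<epsilon> > 0" "\<bar>\<sigma>\<bar> = (1::real)"
  shows "(\<integral>X. (1 / za X ^ k) / Complex (C - 2*w*Re (za X)) (\<sigma> * \<epsilon>) \<partial>Mh R) =
     - (2 * of_real pi ^ 2 * kernel_root w (Complex C (\<sigma> * \<epsilon>)) (R\<^sup>2) ^ (k - 1) / of_real (w * real (k - 1)))"
proof -
  define G where "G = Complex C (\<sigma> * \<epsilon>)"
  have G: "Re G > 0" "Im G \<noteq> 0" using C \<epsilon> by (auto simp: G_def)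
  define F where "F X = (1 / za X ^ k) / Complex (C - 2*w*Re (za X)) (\<sigma> * \<epsilon>)" for X
  obtain S where S: "S \<ge> 0" "\<And>r. r \<ge> R \<Longrightarrow> 1 / r ^ k \<le> S * wt r" using inverse_power_le_wt[OF R k] by blast
  have int: "integrable (Mh R) F" unfolding F_def
  proof (rule kernel_integrable[OF R w \<epsilon>(1,2)])
    have "R \<le> sqrt (R\<^sup>2 + (cmod v)\<^sup>2)" for v by (rule real_le_rsqrt) simp
    thus "AE X in Mh R. cmod (1 / za X ^ k) \<le> S * wt (cmod (za X))"
      by (intro AE_Mh) (use S(2) in \<open>auto simp: za_hypc norm_mult norm_divide norm_power abs_of_nonneg\<close>)
  qed simp
  define g where "g T = 2 * of_real pi * (kernel_root w G T ^ k / kernel_disc w G T)" for T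
  have inner: "(\<integral>\<theta>. indicator {0..<2*pi} \<theta> *\<^sub>R F (hypc R v \<theta>) \<partial>lborel) = g (R\<^sup>2 + (cmod v)\<^sup>2)" for v
  proof -
    define T where "T = R\<^sup>2 + (cmod v)\<^sup>2"
    have T: "T > 0" using R by (simp add: T_def add_pos_nonneg)
    have nz: "G - of_real (2 * w * sqrt T * cos \<theta>) \<noteq> 0" for \<theta> using G by (auto simp: complex_eq_iff)
    have Feq: "F (hypc R v \<theta>) = (1 / of_real (sqrt T) ^ k) * (cis \<theta> ^ k / (G - of_real (2 * w * sqrt T * cos \<theta>)))" for \<theta>
    proof -
      have "Complex (C - 2*w*Re (za (hypc R v \<theta>))) (\<sigma> * \<epsilon>) = G - of_real (2 * w * sqrt T * cos \<theta>)"
        by (simp add: complex_eq_iff za_hypc T_def G_def)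
      moreover have "1 / za (hypc R v \<theta>) ^ k = (1 / of_real (sqrt T) ^ k) * cis \<theta> ^ k"
      proof -
        have c: "cis (-\<theta>) = 1 / cis \<theta>" by (metis cis_inverse inverse_eq_divide)
        show ?thesis unfolding za_hypc T_def[symmetric] c by (simp add: power_mult_distrib power_divide)
      qed
      ultimately show ?thesis by (simp add: F_def)
    qed
    have "(\<integral>\<theta>. indicator {0..<2*pi} \<theta> *\<^sub>R F (hypc R v \<theta>) \<partial>lborel) = integral {0..2*pi} (\<lambda>\<theta>. F (hypc R v \<theta>))"
      unfolding Feq using nz by (intro lborel_integral_circle continuous_intros) auto
    also have "\<dots> = (1 / of_real (sqrt T) ^ k) * (2 * pi * (of_real (sqrt T) * kernel_root w G T) ^ k / kernel_disc w G T)"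
      unfolding Feq using G by (intro integral_unique has_integral_mult_right circle_kernel_integral(2)[OF w T]) auto
    also have "\<dots> = g T" using T by (simp add: g_def power_mult_distrib)
    finally show ?thesis by (simp add: T_def)
  qed
  have gm: "g \<in> borel_measurable borel"
  proof (intro borel_measurable_continuous_onI continuous_at_imp_continuous_on ballI)
    fix T
    have yc: "isCont (kernel_root w G) T" using kernel_root_deriv[OF w G] has_vector_derivative_continuous by blast
    show "isCont g T" unfolding g_def using kernel_disc_facts(2)[OF G(1)] G by (intro continuous_intros yc continuous_kernel_disc) auto
  qed
  note Fub = Mh_Fubini[OF int, unfolded inner]
  note rad = integral_radial[OF gm Fub(2)]
  have "set_integrable lborel {R\<^sup>2..} (\<lambda>T. (1 / (2 * of_real pi)) * g T)"
    using rad(1) by (rule set_integrable_mult_right)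
  hence si: "set_integrable lborel {R\<^sup>2..} (\<lambda>T. kernel_root w G T ^ k / kernel_disc w G T)" by (simp add: g_def)
  have "(\<integral>X. F X \<partial>Mh R) = of_real pi * (LINT T:{R\<^sup>2..}|lborel. g T)" unfolding Fub(1) by (rule rad(2))
  also have "(LINT T:{R\<^sup>2..}|lborel. g T) = 2 * of_real pi * (LINT T:{R\<^sup>2..}|lborel. kernel_root w G T ^ k / kernel_disc w G T)"
    unfolding g_def by (rule set_integral_mult_right)
  also have "(LINT T:{R\<^sup>2..}|lborel. kernel_root w G T ^ k / kernel_disc w G T) = - (kernel_root w G (R\<^sup>2) ^ (k - 1) / of_real (w * real (k - 1)))"
    by (rule kernel_root_power_integral[OF R w G k si])
  finally show ?thesis by (simp add: F_def G_def power2_eq_square)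
qed

text \<open>In the limit the discriminant is
  \<open>(R^2 + w^2)^2 - 4 w^2 R^2 = (R^2 - w^2)^2\<close>, and \<open>csqrt\<close> tends to
  \<open>|R^2 - w^2|\<close> whatever the sign of the imaginary part. The absolute value is the
  origin of the two cases of the theorem.\<close>

lemma tendsto_kernel_root:
  assumes R: "R > 0" and w: "w > 0"
  shows "((\<lambda>\<epsilon>. kernel_root w (Complex (R\<^sup>2 + w\<^sup>2) (\<sigma> * \<epsilon>)) (R\<^sup>2)) \<longlongrightarrow> of_real (if w \<ge> R then 1 / w else w / R\<^sup>2)) (at_right 0)"
proof -
  define G where "G \<epsilon> = Complex (R\<^sup>2 + w\<^sup>2) (\<sigma> * \<epsilon>)" for \<epsilon>
  have Glim: "(G \<longlongrightarrow> of_real (R\<^sup>2 + w\<^sup>2)) (at_right 0)"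
  proof -
    have "(G \<longlongrightarrow> Complex (R\<^sup>2 + w\<^sup>2) (\<sigma> * 0)) (at_right 0)"
      unfolding G_def by (intro tendsto_intros)
    thus ?thesis by (simp add: complex_of_real_def)
  qed
  define h where "h \<epsilon> = (G \<epsilon>)\<^sup>2 - of_real (4 * w\<^sup>2 * R\<^sup>2)" for \<epsilon>
  have e: "of_real ((R\<^sup>2 + w\<^sup>2)\<^sup>2) - of_real (4 * w\<^sup>2 * R\<^sup>2) = (of_real ((R\<^sup>2 - w\<^sup>2)\<^sup>2) :: complex)"
    by (simp add: power2_eq_square algebra_simps)
  have hlim: "(h \<longlongrightarrow> of_real ((R\<^sup>2 - w\<^sup>2)\<^sup>2)) (at_right 0)"
    unfolding h_def e[symmetric] of_real_power[of "R\<^sup>2 + w\<^sup>2"] by (intro tendsto_intros Glim)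
  have D: "((\<lambda>\<epsilon>. csqrt (h \<epsilon>)) \<longlongrightarrow> of_real \<bar>R\<^sup>2 - w\<^sup>2\<bar>) (at_right 0)"
  proof (cases "R\<^sup>2 = w\<^sup>2")
    \<comment> \<open>The radicand tends to 0, an end point of the branch cut, where the argument
      has to go through \<open>|csqrt h| = sqrt |h|\<close>.\<close>
    case True
    have "((\<lambda>\<epsilon>. sqrt (cmod (h \<epsilon>))) \<longlongrightarrow> sqrt (cmod (of_real ((R\<^sup>2 - w\<^sup>2)\<^sup>2)))) (at_right 0)"
      by (intro tendsto_intros hlim)
    hence "((\<lambda>\<epsilon>. cmod (csqrt (h \<epsilon>))) \<longlongrightarrow> 0) (at_right 0)" using True by (simp add: norm_csqrt)
    hence "((\<lambda>\<epsilon>. csqrt (h \<epsilon>)) \<longlongrightarrow> 0) (at_right 0)" by (rule tendsto_norm_zero_cancel)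
    thus ?thesis using True by simp
  next
    case False
    hence "of_real ((R\<^sup>2 - w\<^sup>2)\<^sup>2) \<notin> (\<real>\<^sub>\<le>\<^sub>0 :: complex set)" by (simp add: complex_nonpos_Reals_iff)
    hence "((\<lambda>\<epsilon>. csqrt (h \<epsilon>)) \<longlongrightarrow> csqrt (of_real ((R\<^sup>2 - w\<^sup>2)\<^sup>2))) (at_right 0)"
      using continuous_at_csqrt hlim isCont_tendsto_compose by blast
    moreover have "csqrt (of_real ((R\<^sup>2 - w\<^sup>2)\<^sup>2)) = of_real \<bar>R\<^sup>2 - w\<^sup>2\<bar>"
      using csqrt_of_real_nonneg[of "of_real ((R\<^sup>2 - w\<^sup>2)\<^sup>2)"] by simp
    ultimately show ?thesis by simp
  qed
  have pos: "R\<^sup>2 + w\<^sup>2 + \<bar>R\<^sup>2 - w\<^sup>2\<bar> > 0" using R w by (intro add_pos_nonneg) auto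
  hence ne: "of_real (R\<^sup>2 + w\<^sup>2) + of_real \<bar>R\<^sup>2 - w\<^sup>2\<bar> \<noteq> (0 :: complex)"
    by (metis of_real_add of_real_eq_0_iff less_irrefl)
  have "((\<lambda>\<epsilon>. of_real (2 * w) / (G \<epsilon> + csqrt (h \<epsilon>))) \<longlongrightarrow> of_real (2 * w) / (of_real (R\<^sup>2 + w\<^sup>2) + of_real \<bar>R\<^sup>2 - w\<^sup>2\<bar>)) (at_right 0)"
    by (intro tendsto_intros Glim D ne)
  also have "of_real (2 * w) / (of_real (R\<^sup>2 + w\<^sup>2) + of_real \<bar>R\<^sup>2 - w\<^sup>2\<bar>) = (of_real (if w \<ge> R then 1 / w else w / R\<^sup>2) :: complex)"
  proof -
    have "2 * w / (R\<^sup>2 + w\<^sup>2 + \<bar>R\<^sup>2 - w\<^sup>2\<bar>) = (if w \<ge> R then 1 / w else w / R\<^sup>2)"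
    proof (cases "w \<ge> R")
      case True
      hence "R\<^sup>2 \<le> w\<^sup>2" using R by (simp add: power_mono)
      thus ?thesis using True w by (simp add: power2_eq_square)
    next
      case False
      hence "w\<^sup>2 \<le> R\<^sup>2" using w by (simp add: power_mono)
      thus ?thesis using False R by simp
    qed
    hence "of_real (2 * w / (R\<^sup>2 + w\<^sup>2 + \<bar>R\<^sup>2 - w\<^sup>2\<bar>)) = (of_real (if w \<ge> R then 1 / w else w / R\<^sup>2) :: complex)"
      by (rule arg_cong)
    thus ?thesis by (simp only: of_real_add of_real_divide)
  qed
  finally show ?thesis by (simp add: kernel_root_def kernel_disc_def h_def G_def)
qed

section \<open>Taylor coefficients of the generating function\<close>

lemma higher_deriv_inverse_linear:
  fixes A B :: complex
  assumes S: "open S" "\<And>q. q \<in> S \<Longrightarrow> A + q * B \<noteq> 0" and q: "q \<in> S"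
  shows "(deriv ^^ j) (\<lambda>q. 1 / (A + q * B) ^ k) q = (-1) ^ j * pochhammer (of_nat k) j * B ^ j / (A + q * B) ^ (k + j)"
  using q
proof (induction j arbitrary: q)
  case (Suc j)
  have nz: "A + q * B \<noteq> 0" using S Suc.prems by blast
  have "(deriv ^^ Suc j) (\<lambda>q. 1 / (A + q * B) ^ k) q = deriv (\<lambda>q. (-1) ^ j * pochhammer (of_nat k) j * B ^ j / (A + q * B) ^ (k + j)) q"
    unfolding funpow.simps o_def
    by (rule deriv_cong_ev[OF _ refl]) (use eventually_nhds_in_open[OF S(1) Suc.prems] Suc.IH in \<open>auto elim: eventually_mono\<close>)
  also have "\<dots> = (-1) ^ Suc j * pochhammer (of_nat k) (Suc j) * B ^ Suc j / (A + q * B) ^ (k + Suc j)"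
  proof (rule DERIV_imp_deriv)
    define c where "c = (-1) ^ j * pochhammer (of_nat k) j * B ^ j"
    have "((\<lambda>q. (A + q * B) ^ (k + j)) has_field_derivative (of_nat (k + j) * (A + q * B) ^ (k + j - 1) * B)) (at q)"
      by (auto intro!: derivative_eq_intros)
    hence "((\<lambda>q. c / (A + q * B) ^ (k + j)) has_field_derivative - c * (of_nat (k + j) * (A + q * B) ^ (k + j - 1) * B) / ((A + q * B) ^ (k + j) * (A + q * B) ^ (k + j))) (at q)"
      using nz by (auto intro!: derivative_eq_intros)
    also have "- c * (of_nat (k + j) * (A + q * B) ^ (k + j - 1) * B) / ((A + q * B) ^ (k + j) * (A + q * B) ^ (k + j)) = (-1) ^ Suc j * pochhammer (of_nat k) (Suc j) * B ^ Suc j / (A + q * B) ^ (k + Suc j)"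
    proof (cases "k + j")
      case (Suc i)
      have *: "of_nat k + of_nat j = (of_nat (Suc i) :: complex)" using Suc by (metis of_nat_add)
      have "- c * (of_nat (k + j) * z ^ (k + j - 1) * B) / (z ^ (k + j) * z ^ (k + j)) = - c * of_nat (k + j) * B / z ^ (k + Suc j)" if "z \<noteq> 0" for z
        using that Suc by (simp add: divide_simps)
      thus ?thesis using nz by (simp add: c_def pochhammer_Suc mult_ac)
    qed (auto simp: c_def)
    finally show "((\<lambda>q. (-1) ^ j * pochhammer (of_nat k) j * B ^ j / (A + q * B) ^ (k + j)) has_field_derivative \<dots>) (at q)"
      unfolding c_def .
  qed
  finally show ?case .
qed simp

text \<open>The subtractions are truncated: for \<open>j > n\<close> the factor with
  \<open>i = n\<close> annihilates the product, so the exponent \<open>n - j = 0\<close> does no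
  harm.\<close>

lemma higher_deriv_power_linear:
  fixes b c :: complex
  shows "(deriv ^^ j) (\<lambda>z. (b + z * c) ^ n) z = (\<Prod>i<j. of_nat (n - i)) * c ^ j * (b + z * c) ^ (n - j)"
proof (induction j arbitrary: z)
  case (Suc j)
  have "(deriv ^^ Suc j) (\<lambda>z. (b + z * c) ^ n) z = deriv (\<lambda>z. (\<Prod>i<j. of_nat (n - i)) * c ^ j * (b + z * c) ^ (n - j)) z"
  proof -
    have "(deriv ^^ j) (\<lambda>z. (b + z * c) ^ n) = (\<lambda>z. (\<Prod>i<j. of_nat (n - i)) * c ^ j * (b + z * c) ^ (n - j))"
      using Suc.IH by (rule ext)
    thus ?thesis by (simp only: funpow.simps o_def)
  qed
  also have "\<dots> = (\<Prod>i<Suc j. of_nat (n - i)) * c ^ Suc j * (b + z * c) ^ (n - Suc j)"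
    by (rule DERIV_imp_deriv) (auto intro!: derivative_eq_intros)
  finally show ?case .
qed simp

text \<open>Cauchy's formula for the Taylor coefficients in the angle variable. Division by
  \<open>cis t ^ j\<close> alone leaves the factor \<open>r^j\<close> on the other side.\<close>

lemma has_integral_Cauchy_coeff:
  fixes h :: "complex \<Rightarrow> complex"
  assumes r: "r > 0" and h: "h holomorphic_on S" "open S" "cball 0 r \<subseteq> S"
  shows "((\<lambda>t. h (of_real r * cis t) / cis t ^ j) has_integral (2 * of_real pi * of_real r ^ j / fact j * (deriv ^^ j) h 0)) {0..2*pi}"
proof -
  have "((\<lambda>u. h u / (u - 0) ^ Suc j) has_contour_integral (of_real (2 * pi) * \<i>) / fact j * (deriv ^^ j) h 0) (circlepath 0 r)"
    by (rule Cauchy_has_contour_integral_higher_derivative_circlepath)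
      (use h r holomorphic_on_subset holomorphic_on_imp_continuous_on continuous_on_subset ball_subset_cball in \<open>force+\<close>)
  hence "((\<lambda>t. h (of_real r * cis t) / (of_real r * cis t) ^ Suc j * r * \<i> * cis t) has_integral ((2 * of_real pi * \<i>) / fact j * (deriv ^^ j) h 0)) {0..2*pi}"
    unfolding circlepath_def by (subst (asm) has_contour_integral_part_circlepath_iff) auto
  hence "((\<lambda>t. (of_real r ^ j / \<i>) * (h (of_real r * cis t) / (of_real r * cis t) ^ Suc j * r * \<i> * cis t)) has_integral
     (of_real r ^ j / \<i>) * ((2 * of_real pi * \<i>) / fact j * (deriv ^^ j) h 0)) {0..2*pi}"
    by (rule has_integral_mult_right)
  moreover have "(of_real r ^ j / \<i>) * (h (of_real r * cis t) / (of_real r * cis t) ^ Suc j * r * \<i> * cis t) = h (of_real r * cis t) / cis t ^ j" for t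
  proof -
    have "\<i> * (y * \<i>) = - y" for y by (simp add: mult.commute[of y])
    thus ?thesis using r by (simp add: power_mult_distrib divide_simps)
  qed
  moreover have "(of_real r ^ j / \<i>) * ((2 * of_real pi * \<i>) / fact j * (deriv ^^ j) h 0) = 2 * of_real pi * of_real r ^ j / fact j * (deriv ^^ j) h 0"
    by (simp add: field_simps)
  ultimately show ?thesis by simp
qed

text \<open>The coefficient of \<open>q\<^sup>\<beta>\<close> in \<open>1 / glin \<eta> q X ^ k\<close>, without the binomial coefficient of \<open>-k\<close> over \<open>\<beta>\<close>.\<close>

definition hgen :: "nat \<Rightarrow> nat \<Rightarrow> complex \<Rightarrow> real^4 \<Rightarrow> complex" where
  "hgen k \<beta> \<eta> X = (zb X + \<eta> * cnj (za X)) ^ \<beta> / (za X + \<eta> * cnj (zb X)) ^ (k + \<beta>)"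

text \<open>The coefficient of \<open>\<eta>\<^sup>\<alpha>\<close> in \<open>hgen\<close>, by the Leibniz rule. This is \<open>t\<close> with \<open>k = -2l\<close>, \<open>\<beta> = m + l\<close>, \<open>\<alpha> = n + l\<close>.\<close>

definition tpos :: "nat \<Rightarrow> nat \<Rightarrow> nat \<Rightarrow> real^4 \<Rightarrow> complex" where
  "tpos k \<alpha> \<beta> X = (\<Sum>i = 0..\<alpha>. of_nat (\<alpha> choose i) *
     ((-1) ^ i * pochhammer (of_nat (k + \<beta>)) i * cnj (zb X) ^ i / za X ^ (k + \<beta> + i)) *
     ((\<Prod>j<\<alpha> - i. of_nat (\<beta> - j)) * cnj (za X) ^ (\<alpha> - i) * zb X ^ (\<beta> - (\<alpha> - i)))) / fact \<alpha>"

lemma HRplus_iff: "X \<in> HRplus \<longleftrightarrow> cmod (zb X) < cmod (za X)"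
  by (auto simp: HRplus_def qN_za_zb power2_less_imp_less intro: power_strict_mono)

lemma HRplus_za_nz: "X \<in> HRplus \<Longrightarrow> za X \<noteq> 0"
  by (auto simp: HRplus_iff)

text \<open>On the cone \<open>|zb| < |za|\<close>, so the denominator of \<open>hgen\<close> has no
  zero on the closed unit disc, nor on an open neighbourhood of it.\<close>

lemma hgen_domain:
  assumes X: "X \<in> HRplus"
  obtains S where "open S" "cball 0 1 \<subseteq> S" "\<And>\<eta>. \<eta> \<in> S \<Longrightarrow> za X + \<eta> * cnj (zb X) \<noteq> 0"
proof
  define S where "S = (\<lambda>\<eta>. za X + \<eta> * cnj (zb X)) -` (- {0})"
  show "open S" unfolding S_def by (intro open_vimage continuous_intros)
  show "cball 0 1 \<subseteq> S"
  proof
    fix \<eta> :: complex assume "\<eta> \<in> cball 0 1"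
    hence "cmod (\<eta> * cnj (zb X)) \<le> cmod (zb X)" by (simp add: norm_mult mult_left_le_one_le)
    hence "cmod (\<eta> * cnj (zb X)) < cmod (za X)" using X by (simp add: HRplus_iff)
    thus "\<eta> \<in> S" unfolding S_def by (auto simp: add_eq_0_iff)
  qed
  show "za X + \<eta> * cnj (zb X) \<noteq> 0" if "\<eta> \<in> S" for \<eta> using that by (auto simp: S_def)
qed

lemma higher_deriv_hgen:
  assumes X: "X \<in> HRplus"
  shows "(deriv ^^ \<alpha>) (\<lambda>\<eta>. hgen k \<beta> \<eta> X) 0 / fact \<alpha> = tpos k \<alpha> \<beta> X"
proof -
  obtain S where S: "open S" "cball 0 1 \<subseteq> S" "\<And>\<eta>. \<eta> \<in> S \<Longrightarrow> za X + \<eta> * cnj (zb X) \<noteq> 0"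
    using hgen_domain[OF X] by blast
  have 0: "0 \<in> S" using S by auto
  have eq: "(\<lambda>\<eta>. hgen k \<beta> \<eta> X) = (\<lambda>\<eta>. (1 / (za X + \<eta> * cnj (zb X)) ^ (k + \<beta>)) * (zb X + \<eta> * cnj (za X)) ^ \<beta>)"
    by (auto simp: hgen_def)
  have d1: "(deriv ^^ i) (\<lambda>\<eta>. 1 / (za X + \<eta> * cnj (zb X)) ^ (k + \<beta>)) 0 = (-1) ^ i * pochhammer (of_nat (k + \<beta>)) i * cnj (zb X) ^ i / za X ^ (k + \<beta> + i)" for i
    using higher_deriv_inverse_linear[OF S(1) S(3) 0, of i "k + \<beta>"] by simp
  have "(deriv ^^ \<alpha>) (\<lambda>\<eta>. hgen k \<beta> \<eta> X) 0 = (\<Sum>i = 0..\<alpha>. of_nat (\<alpha> choose i) * (deriv ^^ i) (\<lambda>\<eta>. 1 / (za X + \<eta> * cnj (zb X)) ^ (k + \<beta>)) 0 *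
     (deriv ^^ (\<alpha> - i)) (\<lambda>\<eta>. (zb X + \<eta> * cnj (za X)) ^ \<beta>) 0)"
    unfolding eq using S 0 by (intro higher_deriv_mult[of _ S]) (auto intro!: holomorphic_intros)
  also have "\<dots> / fact \<alpha> = tpos k \<alpha> \<beta> X"
    unfolding d1 higher_deriv_power_linear tpos_def by simp
  finally show ?thesis .
qed

text \<open>The radius is left free: \<open>r = 1\<close> matches the contour that defines
  \<open>t_fun\<close>, while \<open>r = 1/4\<close> lies inside the region where
  \<open>hgen\<close> is reproduced.\<close>

lemma tpos_integral:
  assumes X: "X \<in> HRplus" and r: "0 < r" "r \<le> 1"
  shows "((\<lambda>t. hgen k \<beta> (of_real r * cis t) X / cis t ^ \<alpha>) has_integral (2 * of_real pi * of_real r ^ \<alpha> * tpos k \<alpha> \<beta> X)) {0..2*pi}"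
proof -
  obtain S where S: "open S" "cball 0 1 \<subseteq> S" "\<And>\<eta>. \<eta> \<in> S \<Longrightarrow> za X + \<eta> * cnj (zb X) \<noteq> 0"
    using hgen_domain[OF X] by blast
  have "((\<lambda>t. (\<lambda>\<eta>. hgen k \<beta> \<eta> X) (of_real r * cis t) / cis t ^ \<alpha>) has_integral (2 * of_real pi * of_real r ^ \<alpha> / fact \<alpha> * (deriv ^^ \<alpha>) (\<lambda>\<eta>. hgen k \<beta> \<eta> X) 0)) {0..2*pi}"
  proof (rule has_integral_Cauchy_coeff[OF r(1) _ S(1)])
    show "(\<lambda>\<eta>. hgen k \<beta> \<eta> X) holomorphic_on S" unfolding hgen_def using S by (intro holomorphic_intros) auto
    show "cball 0 r \<subseteq> S" using S r by auto
  qed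
  thus ?thesis using higher_deriv_hgen[OF X, of \<alpha> k \<beta>] by (simp add: field_simps)
qed

text \<open>The substitution \<open>s = 1 / \<eta>\<close> on the unit circle turns the defining
  integral into the Cauchy integral for the coefficient of \<open>\<eta>^\<alpha>\<close> in
  \<open>hgen\<close>. All powers of \<open>s\<close> combine to \<open>s^\<alpha>\<close>, and the
  reversal of orientation is the passage from \<open>t\<close> to \<open>2 * pi - t\<close>.\<close>

lemma t_fun_eq_tpos:
  assumes X: "X \<in> HRplus" and ix: "l = - real k / 2" "m = real \<beta> - l" "n = real \<alpha> - l"
  shows "t_fun l n m X = tpos k \<alpha> \<beta> X"
proof -
  have fl: "\<lfloor>l - m\<rfloor> = - int (k + \<beta>)" "\<lfloor>l + m\<rfloor> = int \<beta>" "\<lfloor>- l + n\<rfloor> = int (\<alpha> + k)" "\<lfloor>n - l\<rfloor> = int (\<alpha> + k)"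
    using ix by (auto intro!: floor_unique)
  define F where "F s = (s * za X + cnj (zb X)) powi (- int (k + \<beta>)) * (s * zb X + cnj (za X)) powi int \<beta> * s powi int (\<alpha> + k) / s" for s
  have t: "t_fun l n m X = 1 / (2 * of_real pi * \<i>) * contour_integral (circlepath 0 1) F"
    unfolding t_fun_def Let_def qmat_za_zb fl F_def ..
  define g where "g t = hgen k \<beta> (cis t) X / cis t ^ \<alpha>" for t
  have g: "(g has_integral (2 * of_real pi * tpos k \<alpha> \<beta> X)) {0..2*pi}"
    using tpos_integral[OF X, of 1 k \<beta> \<alpha>] by (simp add: g_def[abs_def])
  have "((\<lambda>t. \<i> * g (2*pi - t)) has_integral \<i> * (2 * of_real pi * tpos k \<alpha> \<beta> X)) {0..2*pi}"
  proof (rule has_integral_mult_right)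
    have "((\<lambda>x. g ((-1) *\<^sub>R x + 2*pi)) has_integral (2 * of_real pi * tpos k \<alpha> \<beta> X)) ((\<lambda>x. (1 / (-1)) *\<^sub>R x + - ((1 / (-1)) *\<^sub>R (2*pi))) ` cbox 0 (2*pi))"
      using has_integral_affinity[of g "2 * of_real pi * tpos k \<alpha> \<beta> X" 0 "2*pi" "-1" "2*pi"] g by simp
    moreover have "(\<lambda>x. (1 / (-1)) *\<^sub>R x + - ((1 / (-1)) *\<^sub>R (2*pi))) ` cbox 0 (2*pi) = {0..2*pi}"
      by (auto simp: image_iff intro!: bexI[of _ "2*pi - _"])
    ultimately show "((\<lambda>t. g (2*pi - t)) has_integral (2 * of_real pi * tpos k \<alpha> \<beta> X)) {0..2*pi}"
      by (simp add: algebra_simps)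
  qed
  moreover have "\<i> * g (2*pi - t) = F (0 + of_real 1 * cis t) * of_real 1 * \<i> * cis t" for t
  proof -
    define s where "s = cis t"
    have s: "s \<noteq> 0" by (simp add: s_def)
    have c: "cis (2*pi - t) = 1 / s" by (simp add: s_def flip: cis_divide)
    have e1: "za X + 1 / s * cnj (zb X) = (s * za X + cnj (zb X)) / s" and e2: "zb X + 1 / s * cnj (za X) = (s * zb X + cnj (za X)) / s"
      using s by (simp_all add: field_simps)
    define P Q where "P = s * za X + cnj (zb X)" and "Q = s * zb X + cnj (za X)"
    have "hgen k \<beta> (1 / s) X / (1 / s) ^ \<alpha> = (Q / s) ^ \<beta> / (P / s) ^ (k + \<beta>) * s ^ \<alpha>"
      unfolding hgen_def e1 e2 P_def Q_def power_one_over by simp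
    also have "\<dots> = Q ^ \<beta> / P ^ (k + \<beta>) * (s ^ (k + \<beta>) / s ^ \<beta>) * s ^ \<alpha>" by (simp add: power_divide)
    also have "s ^ (k + \<beta>) / s ^ \<beta> = s ^ k" using s by (simp add: power_add)
    finally have "hgen k \<beta> (1 / s) X / (1 / s) ^ \<alpha> = Q ^ \<beta> / P ^ (k + \<beta>) * s ^ k * s ^ \<alpha>" .
    moreover have "F s * s = Q ^ \<beta> / P ^ (k + \<beta>) * s ^ k * s ^ \<alpha>"
      using s unfolding F_def P_def[symmetric] Q_def[symmetric]
      by (simp only: power_int_minus power_int_of_nat) (simp add: power_add divide_inverse mult_ac)
    ultimately show ?thesis unfolding g_def c by (simp add: s_def mult_ac)
  qed
  ultimately have "((\<lambda>t. F (0 + of_real 1 * cis t) * of_real 1 * \<i> * cis t) has_integral \<i> * (2 * of_real pi * tpos k \<alpha> \<beta> X)) {0..2*pi}"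
    by simp
  hence "(F has_contour_integral \<i> * (2 * of_real pi * tpos k \<alpha> \<beta> X)) (circlepath 0 1)"
    unfolding circlepath_def by (subst has_contour_integral_part_circlepath_iff) auto
  hence "contour_integral (circlepath 0 1) F = \<i> * (2 * of_real pi * tpos k \<alpha> \<beta> X)" by (rule contour_integral_unique)
  thus ?thesis unfolding t by simp
qed

text \<open>On the unit circle \<open>cnj s = 1 / s\<close>, so conjugation exchanges the two linear
  factors up to powers of \<open>s\<close>. This reduces the indices \<open>m, n \<le> l\<close> to
  those with \<open>m, n \<ge> - l\<close>.\<close>

lemma t_fun_cnj:
  assumes ix: "l - m = of_int p" "l + m = of_int q" "- l + n = of_int e"
  shows "t_fun l n m X = cnj (t_fun l (-n) (-m) X)"
proof -
  define a b where "a = za X" and "b = zb X"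
  define G where "G p q e s = (s * a + cnj b) powi p * (s * b + cnj a) powi q * s powi e / s" for p q e s
  define s where "s x = exp (2 * of_real pi * \<i> * of_real x)" for x :: real
  have sn: "cmod (s x) = 1" for x by (simp add: s_def norm_exp_eq_Re)
  have param: "contour_integral (circlepath 0 1) F = integral {0..1} (\<lambda>x. F (s x) * (2 * of_real pi * \<i> * s x))" for F
    by (simp only: contour_integral_integral vector_derivative_circlepath) (simp add: circlepath s_def mult_ac)
  have "\<lfloor>l + n\<rfloor> = \<lfloor>of_int (q + p + e) :: real\<rfloor>" using ix by (intro arg_cong[where f=floor]) simp
  hence ln: "\<lfloor>- l + - n\<rfloor> = - p - q - e" using ix by (intro floor_unique) auto
  have fl: "\<lfloor>l - m\<rfloor> = p" "\<lfloor>l + m\<rfloor> = q" "\<lfloor>- l + n\<rfloor> = e" "\<lfloor>l - - m\<rfloor> = q" "\<lfloor>l + - m\<rfloor> = p"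
    using ix by auto
  have pt: "cnj (G q p (- p - q - e) (s x) * (2 * of_real pi * \<i> * s x)) = - (G p q e (s x) * (2 * of_real pi * \<i> * s x))" for x
  proof -
    define z where "z = s x"
    have nz: "cmod z = 1" using sn[of x] by (simp add: z_def)
    have zc: "z * cnj z = 1" using complex_norm_square[of z] nz by simp
    have z: "z \<noteq> 0" using nz by auto
    have cz: "cnj z = 1 / z" using z zc by (simp add: field_simps)
    have e1: "cnj a / z + b = (z * b + cnj a) / z" and e2: "cnj b / z + a = (z * a + cnj b) / z"
      using z by (simp_all add: field_simps)
    have "cnj (G q p (- p - q - e) z * (2 * of_real pi * \<i> * z)) = ((z * b + cnj a) / z) powi q * ((z * a + cnj b) / z) powi p * (1 / z) powi (- p - q - e) * (- (2 * of_real pi * \<i>))"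
      using z by (simp add: G_def cz e1 e2)
    also have "\<dots> = (z * b + cnj a) powi q * (z * a + cnj b) powi p * (- (2 * of_real pi * \<i>)) * (z powi (p + q + e) / (z powi q * z powi p))"
      using z by (simp add: power_int_divide_distrib power_int_diff power_int_add power_int_minus field_simps)
    also have "z powi (p + q + e) / (z powi q * z powi p) = z powi e"
      using z by (simp add: power_int_add)
    finally show ?thesis using z by (simp add: G_def z_def[symmetric] mult_ac)
  qed
  have "cnj (t_fun l (-n) (-m) X) = cnj (1 / (2 * of_real pi * \<i>)) * cnj (integral {0..1} (\<lambda>x. G q p (- p - q - e) (s x) * (2 * of_real pi * \<i> * s x)))"
    unfolding t_fun_def Let_def qmat_za_zb fl ln param G_def a_def b_def by simp
  also have "cnj (integral {0..1} (\<lambda>x. G q p (- p - q - e) (s x) * (2 * of_real pi * \<i> * s x))) = integral {0..1} (\<lambda>x. cnj (G q p (- p - q - e) (s x) * (2 * of_real pi * \<i> * s x)))"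
    by (rule Henstock_Kurzweil_Integration.integral_cnj)
  also have "\<dots> = - integral {0..1} (\<lambda>x. G p q e (s x) * (2 * of_real pi * \<i> * s x))"
    unfolding pt by (rule Henstock_Kurzweil_Integration.integral_neg)
  also have "cnj (1 / (2 * of_real pi * \<i>)) * \<dots> = t_fun l n m X"
    unfolding t_fun_def Let_def qmat_za_zb fl param G_def a_def b_def by simp
  finally show ?thesis ..
qed

section \<open>Transport by quaternion multiplication\<close>

text \<open>The logarithms differ by at most \<open>ln c\<close>, so comparable arguments have
  comparable weights. It is applied both to \<open>norm X\<close> against \<open>|za X|\<close> and
  to \<open>X\<close> against its product with a fixed element.\<close>

lemma wt_compare:
  assumes c: "c \<ge> 1" and r: "r1 > 0" "r2 > 0" "r1 \<le> c * r2" "r2 \<le> c * r1"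
  shows "wt r1 \<le> c * (1 + ln c) ^ 4 * wt r2"
proof -
  have lc: "ln c \<ge> 0" using c by simp
  have "ln r2 \<le> ln (c * r1)" using r c by (intro ln_mono) auto
  hence 1: "ln r2 \<le> ln c + ln r1" using c r by (simp add: ln_mult_pos)
  have "ln r1 \<le> ln (c * r2)" using r c by (intro ln_mono) auto
  hence 2: "ln r1 \<le> ln c + ln r2" using c r by (simp add: ln_mult_pos)
  have "\<bar>ln r2\<bar> \<le> ln c + \<bar>ln r1\<bar>" using 1 2 lc by linarith
  also have "\<dots> \<le> ln c + \<bar>ln r1\<bar> + ln c * \<bar>ln r1\<bar>" using lc by simp
  finally have "1 + \<bar>ln r2\<bar> \<le> (1 + ln c) * (1 + \<bar>ln r1\<bar>)" by (simp add: algebra_simps)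
  hence "(1 + \<bar>ln r2\<bar>) ^ 4 * r2 \<le> ((1 + ln c) * (1 + \<bar>ln r1\<bar>)) ^ 4 * (c * r1)"
    using r by (intro mult_mono power_mono) auto
  also have "\<dots> = c * (1 + ln c) ^ 4 * ((1 + \<bar>ln r1\<bar>) ^ 4 * r1)"
    by (simp add: power_mult_distrib)
  finally have *: "(1 + \<bar>ln r2\<bar>) ^ 4 * r2 \<le> c * (1 + ln c) ^ 4 * ((1 + \<bar>ln r1\<bar>) ^ 4 * r1)" .
  have gen: "1 / p \<le> k * (1 / a)" if "0 < a" "0 < p" "a \<le> k * p" for a p k :: real
    using that by (simp add: field_simps)
  show ?thesis unfolding wt_def
    by (rule gen[OF _ _ *]) (use r in auto)
qed

lemma qN_qmult: "qN (qmult A B) = qN A * qN B"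
proof -
  have "complex_of_real (qN (qmult A B)) = complex_of_real (qN A * qN B)"
    by (simp add: qmat_qmult det_mul flip: det_qmat)
  thus ?thesis by (simp only: of_real_eq_iff)
qed

lemma linear_qmult_left: "linear (qmult A)" and linear_qmult_right: "linear (\<lambda>X. qmult X B)"
  by (rule linearI; intro quat_eqI; simp add: za_qmult zb_qmult algebra_simps)+

definition qone :: "real^4" where "qone = quat 1 0"

lemma qone_simps [simp]: "za qone = 1" "zb qone = 0" "qmult A qone = A" "qmult qone A = A"
proof -
  show "za qone = 1" "zb qone = 0" by (simp_all add: qone_def)
  thus "qmult A qone = A" "qmult qone A = A" by (auto intro!: quat_eqI simp: za_qmult zb_qmult)
qed

text \<open>The adjugate matrix, which is the inverse when \<open>qN p = 1\<close>.\<close>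

definition qconj :: "real^4 \<Rightarrow> real^4" where "qconj p = quat (cnj (za p)) (- zb p)"

lemma za_zb_qconj [simp]: "za (qconj p) = cnj (za p)" "zb (qconj p) = - zb p"
  by (simp_all add: qconj_def)

lemma qN_qconj [simp]: "qN (qconj p) = qN p" by (simp add: qN_za_zb)

lemma qconj_qconj [simp]: "qconj (qconj p) = p" by (intro quat_eqI) auto

lemma qN_complex: "of_real (qN p) = za p * cnj (za p) - zb p * cnj (zb p)"
  by (simp add: qN_za_zb flip: complex_norm_square)

lemma qmult_qconj_left: "qmult (qconj p) (qmult p Y) = qN p *\<^sub>R Y"
  by (intro quat_eqI) (simp_all add: za_qmult zb_qmult qN_complex algebra_simps)

lemma qmult_qconj_right: "qmult (qmult Y p) (qconj p) = qN p *\<^sub>R Y"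
  by (intro quat_eqI) (simp_all add: za_qmult zb_qmult qN_complex algebra_simps)

lemma qmult_assoc: "qmult (qmult A B) C = qmult A (qmult B C)"
  by (intro quat_eqI) (simp_all add: za_qmult zb_qmult algebra_simps)

text \<open>Bounds the effect of multiplication by \<open>p\<close> on the cone, where
  \<open>|za|\<close> alone measures the size of an element.\<close>

definition qnorm1 :: "real^4 \<Rightarrow> real" where "qnorm1 p = cmod (za p) + cmod (zb p)"

lemma qnorm1_qconj [simp]: "qnorm1 (qconj p) = qnorm1 p" by (simp add: qnorm1_def)

lemma za_qmult_bound:
  assumes "cmod (zb Y) \<le> cmod (za Y)"
  shows "cmod (za (qmult p Y)) \<le> qnorm1 p * cmod (za Y)" "cmod (zb (qmult p Y)) \<le> qnorm1 p * cmod (za Y)"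
    "cmod (za (qmult Y p)) \<le> qnorm1 p * cmod (za Y)" "cmod (zb (qmult Y p)) \<le> qnorm1 p * cmod (za Y)"
proof -
  have t: "cmod (u * x + v * y) \<le> (cmod u + cmod v) * M" if "cmod x \<le> M" "cmod y \<le> M" for u v x y M
  proof -
    have "cmod (u * x + v * y) \<le> cmod u * cmod x + cmod v * cmod y"
      by (metis norm_mult norm_triangle_ineq)
    also have "\<dots> \<le> cmod u * M + cmod v * M" using that by (intro add_mono mult_left_mono) auto
    finally show ?thesis by (simp add: algebra_simps)
  qed
  show "cmod (za (qmult p Y)) \<le> qnorm1 p * cmod (za Y)"
    using t[of "za Y" "cmod (za Y)" "cnj (zb Y)" "za p" "zb p"] assms by (simp add: za_qmult qnorm1_def)
  show "cmod (zb (qmult p Y)) \<le> qnorm1 p * cmod (za Y)"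
    using t[of "zb Y" "cmod (za Y)" "cnj (za Y)" "za p" "zb p"] assms by (simp add: zb_qmult qnorm1_def)
  show "cmod (za (qmult Y p)) \<le> qnorm1 p * cmod (za Y)"
    using t[of "za Y" "cmod (za Y)" "zb Y" "za p" "cnj (zb p)"] assms by (simp add: za_qmult qnorm1_def mult.commute)
  show "cmod (zb (qmult Y p)) \<le> qnorm1 p * cmod (za Y)"
    using t[of "zb Y" "cmod (za Y)" "za Y" "cnj (za p)" "zb p"] assms by (simp add: zb_qmult qnorm1_def mult.commute add.commute)
qed

lemma zb_le_za: "qN X > 0 \<Longrightarrow> cmod (zb X) \<le> cmod (za X)"
  using HRplus_iff[of X] by (simp add: HRplus_def)

lemma za_ge_R:
  assumes "qN X = R\<^sup>2" "R > 0" shows "cmod (za X) \<ge> R"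
proof (rule power2_le_imp_le)
  have "(cmod (za X))\<^sup>2 = R\<^sup>2 + (cmod (zb X))\<^sup>2" using assms by (simp add: qN_za_zb)
  thus "R\<^sup>2 \<le> (cmod (za X))\<^sup>2" by simp
qed simp

text \<open>The reverse inequalities are the direct ones for multiplication by the inverse
  \<open>qconj p\<close>, which has the same \<open>qnorm1\<close>.\<close>

lemma qmult_compare:
  assumes p: "qN p = 1" and Y: "qN Y > 0"
  shows "cmod (za (qmult p Y)) \<le> qnorm1 p * cmod (za Y)" "cmod (za Y) \<le> qnorm1 p * cmod (za (qmult p Y))"
    "cmod (za (qmult Y p)) \<le> qnorm1 p * cmod (za Y)" "cmod (za Y) \<le> qnorm1 p * cmod (za (qmult Y p))" "qnorm1 p \<ge> 1"
proof -
  show "cmod (za (qmult p Y)) \<le> qnorm1 p * cmod (za Y)" "cmod (za (qmult Y p)) \<le> qnorm1 p * cmod (za Y)"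
    using za_qmult_bound zb_le_za[OF Y] by auto
  have "cmod (za (qmult (qconj p) (qmult p Y))) \<le> qnorm1 (qconj p) * cmod (za (qmult p Y))"
    by (rule za_qmult_bound(1)) (simp add: zb_le_za qN_qmult p Y)
  thus "cmod (za Y) \<le> qnorm1 p * cmod (za (qmult p Y))" by (simp add: qmult_qconj_left p)
  have "cmod (za (qmult (qmult Y p) (qconj p))) \<le> qnorm1 (qconj p) * cmod (za (qmult Y p))"
    by (rule za_qmult_bound(3)) (simp add: zb_le_za qN_qmult p Y)
  thus "cmod (za Y) \<le> qnorm1 p * cmod (za (qmult Y p))" by (simp add: qmult_qconj_right p)
  have "1 \<le> cmod (za p)" using za_ge_R[of p 1] p by simp
  thus "qnorm1 p \<ge> 1" by (simp add: qnorm1_def add_increasing2)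
qed

section \<open>The kernel denominator and its transport to real multiples of the identity\<close>

definition ker :: "real \<Rightarrow> real \<Rightarrow> real^4 \<Rightarrow> real^4 \<Rightarrow> complex" where
  "ker \<sigma> \<epsilon> W X = Complex (qN (X - W)) (\<sigma> * \<epsilon>)"

lemma borel_measurable_ker [measurable]: "ker \<sigma> \<epsilon> W \<in> borel_measurable borel"
  unfolding ker_def[abs_def] Complex_eq by measurable

lemma qN_diff_qone: "qN (Y - w *\<^sub>R qone) = qN Y + w\<^sup>2 - 2 * w * Re (za Y)"
  by (simp only: qN_za_zb cmod_power2 za_linear zb_linear qone_simps) (simp add: power2_eq_square algebra_simps)

lemma AE_Mh_qN:
  assumes "\<And>X. qN X = R\<^sup>2 \<Longrightarrow> P X" "Measurable.pred borel P"
  shows "AE X in Mh R. P X"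
  using assms by (intro AE_Mh) auto

text \<open>Substituting \<open>L X\<close> for \<open>X\<close> preserves the measure, and
  \<open>qN (L X - W) = qN (X - w *\<^sub>R qone)\<close> depends on \<open>Re (za X)\<close> only.
  The map is left general: one-sided multiplication serves the estimates, two-sided multiplication
  the generating function.\<close>

lemma ker_transport:
  fixes f :: "real^4 \<Rightarrow> complex"
  assumes R: "R > 0" and L: "linear L" "\<And>X. qN (L X) = qN X" and W: "W = L (w *\<^sub>R qone)" and [measurable]: "f \<in> borel_measurable borel"
  shows "integrable (Mh R) (\<lambda>X. f X / ker \<sigma> \<epsilon> W X) \<longleftrightarrow> integrable (Mh R) (\<lambda>X. f (L X) / Complex (R\<^sup>2 + w\<^sup>2 - 2 * w * Re (za X)) (\<sigma> * \<epsilon>))"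
    and "(\<integral>X. f X / ker \<sigma> \<epsilon> W X \<partial>Mh R) = (\<integral>X. f (L X) / Complex (R\<^sup>2 + w\<^sup>2 - 2 * w * Re (za X)) (\<sigma> * \<epsilon>) \<partial>Mh R)"
proof -
  have [measurable]: "L \<in> borel_measurable borel"
    using L(1) by (simp add: borel_measurable_continuous_onI linear_continuous_on linear_conv_bounded_linear)
  have [measurable]: "(\<lambda>X. Complex (R\<^sup>2 + w\<^sup>2 - 2*w*Re (za X)) (\<sigma> * \<epsilon>)) \<in> borel_measurable borel"
    unfolding Complex_eq by measurable
  have ae: "AE X in Mh R. f (L X) / ker \<sigma> \<epsilon> W (L X) = f (L X) / Complex (R\<^sup>2 + w\<^sup>2 - 2 * w * Re (za X)) (\<sigma> * \<epsilon>)"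
  proof (rule AE_Mh_qN)
    fix X assume X: "qN X = R\<^sup>2"
    have "qN (L X - W) = qN (X - w *\<^sub>R qone)" unfolding W by (simp add: L(2) flip: linear_diff[OF L(1)])
    thus "f (L X) / ker \<sigma> \<epsilon> W (L X) = f (L X) / Complex (R\<^sup>2 + w\<^sup>2 - 2 * w * Re (za X)) (\<sigma> * \<epsilon>)"
      by (simp add: ker_def qN_diff_qone X)
  qed measurable
  have "integrable (Mh R) (\<lambda>X. f X / ker \<sigma> \<epsilon> W X) \<longleftrightarrow> integrable (distr (Mh R) borel L) (\<lambda>X. f X / ker \<sigma> \<epsilon> W X)"
    by (simp add: distr_Mh_invariant[OF R L])
  also have "\<dots> \<longleftrightarrow> integrable (Mh R) (\<lambda>X. f (L X) / ker \<sigma> \<epsilon> W (L X))" by (rule integrable_distr_eq) auto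
  also have "\<dots> \<longleftrightarrow> integrable (Mh R) (\<lambda>X. f (L X) / Complex (R\<^sup>2 + w\<^sup>2 - 2 * w * Re (za X)) (\<sigma> * \<epsilon>))"
    by (rule integrable_cong_AE[OF _ _ ae]) auto
  finally show "integrable (Mh R) (\<lambda>X. f X / ker \<sigma> \<epsilon> W X) \<longleftrightarrow> \<dots>" .
  have "(\<integral>X. f X / ker \<sigma> \<epsilon> W X \<partial>Mh R) = (\<integral>X. f X / ker \<sigma> \<epsilon> W X \<partial>distr (Mh R) borel L)"
    by (simp add: distr_Mh_invariant[OF R L])
  also have "\<dots> = (\<integral>X. f (L X) / ker \<sigma> \<epsilon> W (L X) \<partial>Mh R)" by (rule integral_distr) auto
  also have "\<dots> = (\<integral>X. f (L X) / Complex (R\<^sup>2 + w\<^sup>2 - 2 * w * Re (za X)) (\<sigma> * \<epsilon>) \<partial>Mh R)"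
    by (rule integral_cong_AE[OF _ _ ae]) auto
  finally show "(\<integral>X. f X / ker \<sigma> \<epsilon> W X \<partial>Mh R) = \<dots>" .
qed

definition qunit :: "real^4 \<Rightarrow> real^4" where "qunit W = (1 / sqrt (qN W)) *\<^sub>R W"

lemma qN_scaleR: "qN (c *\<^sub>R X) = c\<^sup>2 * qN X"
  by (simp add: qN_eq power_mult_distrib algebra_simps)

lemma qunit_facts:
  assumes "W \<in> HRplus"
  shows "qN (qunit W) = 1" "sqrt (qN W) > 0" "W = qmult (qunit W) (sqrt (qN W) *\<^sub>R qone)"
  using assms by (auto simp: HRplus_def qunit_def qN_scaleR power_divide linear_scale[OF linear_qmult_left])

definition wbounded :: "real \<Rightarrow> real \<Rightarrow> (real^4 \<Rightarrow> complex) \<Rightarrow> bool" where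
  "wbounded R S f \<longleftrightarrow> S \<ge> 0 \<and> (\<forall>X. qN X = R\<^sup>2 \<longrightarrow> cmod (f X) \<le> S * wt (cmod (za X)))"

lemma wbounded_transport:
  assumes R: "R > 0" and p: "qN p = 1" and f: "wbounded R S f"
  shows "wbounded R (S * (qnorm1 p * (1 + ln (qnorm1 p)) ^ 4)) (\<lambda>X. f (qmult p X))"
proof -
  have "0 \<le> S * (qnorm1 p * (1 + ln (qnorm1 p)) ^ 4)"
    using f qmult_compare(5)[OF p, of qone] by (auto simp: wbounded_def qN_za_zb)
  moreover have "cmod (f (qmult p X)) \<le> S * (qnorm1 p * (1 + ln (qnorm1 p)) ^ 4) * wt (cmod (za X))" if X: "qN X = R\<^sup>2" for X
  proof -
  have X0: "qN X > 0" using R X by simp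
  note c = qmult_compare[OF p X0]
  have z: "za X \<noteq> 0" "za (qmult p X) \<noteq> 0" using X0 p by (auto simp: HRplus_def qN_qmult intro!: HRplus_za_nz)
  have "cmod (f (qmult p X)) \<le> S * wt (cmod (za (qmult p X)))"
    using f X p by (simp add: wbounded_def qN_qmult)
  also have "\<dots> \<le> S * (qnorm1 p * (1 + ln (qnorm1 p)) ^ 4 * wt (cmod (za X)))"
    using f c z by (intro mult_left_mono wt_compare) (auto simp: wbounded_def)
  finally show ?thesis by simp
  qed
  ultimately show ?thesis unfolding wbounded_def by blast
qed

lemma ker_integrable:
  fixes f :: "real^4 \<Rightarrow> complex"
  assumes R: "R > 0" and W: "W \<in> HRplus" and \<epsilon>: "\<epsilon> > 0" "\<bar>\<sigma>\<bar> = (1::real)"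
    and [measurable]: "f \<in> borel_measurable borel" and f: "wbounded R S f"
  shows "integrable (Mh R) (\<lambda>X. f X / ker \<sigma> \<epsilon> W X)"
proof -
  note q = qunit_facts[OF W]
  have [measurable]: "qmult (qunit W) \<in> borel_measurable borel"
    using linear_qmult_left by (simp add: borel_measurable_continuous_onI linear_continuous_on linear_conv_bounded_linear)
  have b: "wbounded R (S * (qnorm1 (qunit W) * (1 + ln (qnorm1 (qunit W))) ^ 4)) (\<lambda>X. f (qmult (qunit W) X))"
    by (rule wbounded_transport[OF R q(1) f])
  show ?thesis
  proof (subst ker_transport(1)[OF R linear_qmult_left _ q(3)])
    show "integrable (Mh R) (\<lambda>X. f (qmult (qunit W) X) / Complex (R\<^sup>2 + (sqrt (qN W))\<^sup>2 - 2 * sqrt (qN W) * Re (za X)) (\<sigma> * \<epsilon>))"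
    proof (rule kernel_integrable[OF R q(2) \<epsilon>])
      show "AE X in Mh R. cmod (f (qmult (qunit W) X)) \<le> S * (qnorm1 (qunit W) * (1 + ln (qnorm1 (qunit W))) ^ 4) * wt (cmod (za X))"
        using b by (intro AE_Mh_qN) (auto simp: wbounded_def)
    qed simp
  qed (auto simp: qN_qmult q(1))
qed

lemma sigma_finite_Mh:
  assumes R: "R > 0"
  shows "sigma_finite_measure (Mh R)"
proof
  let ?A = "range (\<lambda>n::nat. {X. cmod (za X) \<le> real n})"
  have "emeasure (Mh R) {X. cmod (za X) \<le> real n} \<noteq> \<infinity>" for n :: nat
  proof -
    have "emeasure (Mh R) {X. cmod (za X) \<le> real n} = (\<integral>\<^sup>+X. indicator {X. cmod (za X) \<le> real n} X \<partial>Mh R)"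
      by (rule nn_integral_indicator[symmetric]) measurable
    also have "\<dots> = (\<integral>\<^sup>+X. indicator (cball 0 (real n)) (za X) \<partial>Mh R)"
      by (intro nn_integral_cong) (simp add: indicator_def)
    also have "\<dots> = ennreal (2 * pi) * (\<integral>\<^sup>+z. indicator (cball 0 (real n)) z * indicator {R..} (cmod z) \<partial>lborel)"
      by (rule nn_integral_Mh_za[OF _ R]) (auto intro: borel_measurable_indicator)
    also have "\<dots> \<le> ennreal (2 * pi) * (\<integral>\<^sup>+z. indicator (cball (0::complex) (real n)) z \<partial>lborel)"
      by (intro mult_left_mono nn_integral_mono) (auto simp: indicator_def)
    also have "\<dots> = ennreal (2 * pi) * emeasure lborel (cball (0::complex) (real n))"
      by (subst nn_integral_indicator) auto
    also have "\<dots> < \<infinity>" using emeasure_lborel_cball_finite[of "0::complex" "real n"] by (simp add: ennreal_mult_less_top)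
    finally show ?thesis by simp
  qed
  moreover have "\<Union> ?A = space (Mh R)" using real_arch_simple by auto
  ultimately show "\<exists>A. countable A \<and> A \<subseteq> sets (Mh R) \<and> \<Union> A = space (Mh R) \<and> (\<forall>a\<in>A. emeasure (Mh R) a \<noteq> \<infinity>)"
    by (intro exI[of _ ?A]) auto
qed

text \<open>The double integral is dominated by \<open>S\<close> times the weight over the kernel,
  on a bounded interval of \<open>t\<close>. It serves the averaging over phases as well as the
  extraction of Taylor coefficients in both variables.\<close>

lemma ker_Fubini:
  fixes \<Phi> :: "real \<Rightarrow> real^4 \<Rightarrow> complex"
  assumes R: "R > 0" and W: "W \<in> HRplus" and \<epsilon>: "\<epsilon> > 0" "\<bar>\<sigma>\<bar> = (1::real)"
    and m[measurable]: "(\<lambda>p. \<Phi> (fst p) (snd p)) \<in> borel_measurable (borel \<Otimes>\<^sub>M borel)" and f: "\<And>t. wbounded R S (\<Phi> t)"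
  shows "(\<integral>X. (\<integral>t. indicator {0..<2*pi} t *\<^sub>R \<Phi> t X \<partial>lborel) / ker \<sigma> \<epsilon> W X \<partial>Mh R) =
     (\<integral>t. indicator {0..<2*pi} t *\<^sub>R (\<integral>X. \<Phi> t X / ker \<sigma> \<epsilon> W X \<partial>Mh R) \<partial>lborel)"
proof -
  interpret sigma_finite_measure "Mh R" by (rule sigma_finite_Mh[OF R])
  interpret P: pair_sigma_finite "lborel :: real measure" "Mh R" ..
  define B where "B X = cmod (complex_of_real (wt (cmod (za X))) / ker \<sigma> \<epsilon> W X)" for X
  have [measurable]: "B \<in> borel_measurable borel" unfolding B_def by measurable
  have "wbounded R 1 (\<lambda>X. complex_of_real (wt (cmod (za X))))" by (auto simp: wbounded_def wt_nonneg)
  hence "integrable (Mh R) (\<lambda>X. complex_of_real (wt (cmod (za X))) / ker \<sigma> \<epsilon> W X)"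
    by (intro ker_integrable[OF R W \<epsilon>]) auto
  hence Bfin: "(\<integral>\<^sup>+X. ennreal (B X) \<partial>Mh R) < \<infinity>" by (simp add: integrable_iff_bounded B_def)
  define g where "g t X = indicator {0..<2*pi} t *\<^sub>R (\<Phi> t X / ker \<sigma> \<epsilon> W X)" for t X
  have S0: "S \<ge> 0" using f by (auto simp: wbounded_def)
  have "integrable (lborel \<Otimes>\<^sub>M Mh R) (\<lambda>(t, X). g t X)"
  proof (rule integrableI_bounded)
    have mm: "(\<lambda>p. \<Phi> (fst p) (snd p)) \<in> borel_measurable (lborel \<Otimes>\<^sub>M Mh R)"
      using m by (simp cong: measurable_cong_sets sets_pair_measure_cong)
    show gm: "(\<lambda>(t, X). g t X) \<in> borel_measurable (lborel \<Otimes>\<^sub>M Mh R)"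
      unfolding g_def case_prod_beta using mm by measurable
    have "(\<integral>\<^sup>+p. ennreal (norm (case p of (t, X) \<Rightarrow> g t X)) \<partial>(lborel \<Otimes>\<^sub>M Mh R)) = (\<integral>\<^sup>+t. (\<integral>\<^sup>+X. ennreal (norm (g t X)) \<partial>Mh R) \<partial>lborel)"
      using gm by (subst nn_integral_fst[symmetric]) auto
    also have "\<dots> \<le> (\<integral>\<^sup>+t. ennreal S * (\<integral>\<^sup>+X. ennreal (B X) \<partial>Mh R) * indicator {0..<2*pi} t \<partial>(lborel :: real measure))"
    proof (rule nn_integral_mono)
      fix t :: real
      have "(\<integral>\<^sup>+X. ennreal (norm (g t X)) \<partial>Mh R) \<le> (\<integral>\<^sup>+X. ennreal S * ennreal (B X) * indicator {0..<2*pi} t \<partial>Mh R)"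
      proof (rule nn_integral_mono_AE, rule AE_Mh_qN)
        fix X assume X: "qN X = R\<^sup>2"
        have "cmod (\<Phi> t X) \<le> S * wt (cmod (za X))" using f[of t] X by (simp add: wbounded_def)
        hence "cmod (\<Phi> t X / ker \<sigma> \<epsilon> W X) \<le> S * B X"
          by (simp add: B_def norm_divide divide_right_mono wt_nonneg)
        thus "ennreal (norm (g t X)) \<le> ennreal S * ennreal (B X) * indicator {0..<2*pi} t"
          using S0 by (auto simp: g_def indicator_def B_def simp flip: ennreal_mult intro!: ennreal_leI)
      next
        have "(\<lambda>X. (t, X)) \<in> borel \<rightarrow>\<^sub>M lborel \<Otimes>\<^sub>M Mh R" by measurable
        from measurable_compose[OF this gm] have [measurable]: "g t \<in> borel_measurable borel" by simp
        show "Measurable.pred borel (\<lambda>X. ennreal (norm (g t X)) \<le> ennreal S * ennreal (B X) * indicator {0..<2*pi} t)" by measurable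
      qed
      also have "\<dots> = ennreal S * (\<integral>\<^sup>+X. ennreal (B X) \<partial>Mh R) * indicator {0..<2*pi} t"
        by (simp add: nn_integral_cmult nn_integral_multc)
      finally show "(\<integral>\<^sup>+X. ennreal (norm (g t X)) \<partial>Mh R) \<le> \<dots>" .
    qed
    also have "\<dots> = ennreal S * (\<integral>\<^sup>+X. ennreal (B X) \<partial>Mh R) * ennreal (2 * pi)"
      by (subst nn_integral_cmult) auto
    also have "\<dots> < \<infinity>" using Bfin by (simp add: ennreal_mult_less_top)
    finally show "(\<integral>\<^sup>+p. ennreal (norm (case p of (t, X) \<Rightarrow> g t X)) \<partial>(lborel \<Otimes>\<^sub>M Mh R)) < \<infinity>" .
  qed
  from P.Fubini_integral[OF this]
  have eq: "(\<integral>X. (\<integral>t. g t X \<partial>lborel) \<partial>Mh R) = (\<integral>t. (\<integral>X. g t X \<partial>Mh R) \<partial>lborel)" .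
  have "(\<integral>t. g t X \<partial>lborel) = (\<integral>t. indicator {0..<2*pi} t *\<^sub>R \<Phi> t X \<partial>lborel) / ker \<sigma> \<epsilon> W X" for X
  proof -
    have "(\<integral>t. g t X \<partial>lborel) = (\<integral>t. (indicator {0..<2*pi} t *\<^sub>R \<Phi> t X) / ker \<sigma> \<epsilon> W X \<partial>lborel)"
      by (simp add: g_def scaleR_conv_of_real)
    also have "\<dots> = (\<integral>t. indicator {0..<2*pi} t *\<^sub>R \<Phi> t X \<partial>lborel) / ker \<sigma> \<epsilon> W X"
      by (rule integral_divide_zero)
    finally show ?thesis .
  qed
  thus ?thesis using eq by (simp add: g_def)
qed

lemma borel_measurable_cnj [measurable]: "cnj \<in> borel_measurable borel"
  by (intro borel_measurable_continuous_onI continuous_intros)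

text \<open>The value found in \<open>za_power_integral\<close> for \<open>C = R^2 + w^2\<close>,
  that is, the integral of \<open>1 / za^k\<close> against the kernel at \<open>w\<close> times the
  identity.\<close>

definition kernel_const :: "real \<Rightarrow> real \<Rightarrow> real \<Rightarrow> nat \<Rightarrow> real \<Rightarrow> complex" where
  "kernel_const R \<sigma> \<epsilon> k w = - (2 * of_real pi ^ 2 * kernel_root w (Complex (R\<^sup>2 + w\<^sup>2) (\<sigma> * \<epsilon>)) (R\<^sup>2) ^ (k - 1) / of_real (w * real (k - 1)))"

lemma wbounded_za_power:
  assumes R: "R > 0" and k: "k \<ge> 2"
  shows "\<exists>S0\<ge>0. \<forall>f C. C \<ge> 0 \<longrightarrow> (\<forall>X. qN X = R\<^sup>2 \<longrightarrow> cmod (f X) \<le> C / cmod (za X) ^ k) \<longrightarrow> wbounded R (C * S0) f"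
proof -
  obtain S0 where S0: "S0 \<ge> 0" "\<And>r. r \<ge> R \<Longrightarrow> 1 / r ^ k \<le> S0 * wt r" using inverse_power_le_wt[OF R k] by blast
  show ?thesis
  proof (intro exI[of _ S0] conjI allI impI S0(1))
    fix f :: "real^4 \<Rightarrow> complex" and C :: real
    assume C: "C \<ge> 0" and f: "\<forall>X. qN X = R\<^sup>2 \<longrightarrow> cmod (f X) \<le> C / cmod (za X) ^ k"
    have "cmod (f X) \<le> C * S0 * wt (cmod (za X))" if X: "qN X = R\<^sup>2" for X
    proof -
      have "cmod (f X) \<le> C * (1 / cmod (za X) ^ k)" using f X by simp
      also have "\<dots> \<le> C * (S0 * wt (cmod (za X)))"
        using C S0(2)[OF za_ge_R[OF X R]] by (rule mult_left_mono[rotated])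
      finally show ?thesis by simp
    qed
    thus "wbounded R (C * S0) f" using C S0(1) by (simp add: wbounded_def)
  qed
qed

lemma inverse_power_bound:
  fixes z :: complex and c r :: real
  assumes "c > 0" "r > 0" "c * r \<le> cmod z"
  shows "cmod (1 / z ^ k) \<le> (1 / c) ^ k / r ^ k"
proof -
  have p: "0 < c * r" using assms by simp
  hence z: "0 < cmod z" using assms by linarith
  have "cmod (1 / z ^ k) = 1 / cmod z ^ k" by (simp add: norm_divide norm_power)
  also have "\<dots> \<le> 1 / (c * r) ^ k"
    using assms p z by (intro divide_left_mono power_mono mult_pos_pos zero_less_power) linarith+
  also have "\<dots> = (1 / c) ^ k / r ^ k" by (simp add: power_mult_distrib power_one_over)
  finally show ?thesis .
qed

section \<open>The reproducing formula\<close>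

definition rot12 :: "real \<Rightarrow> real^4 \<Rightarrow> real^4" where
  "rot12 t X = quat (za X) (cis (-t) * zb X)"

lemma linear_rot12: "linear (rot12 t)"
  by (rule linearI; intro quat_eqI; simp add: rot12_def algebra_simps)

lemma qN_rot12: "qN (rot12 t X) = qN X"
  by (simp add: rot12_def qN_za_zb norm_mult)

text \<open>Averaging over the rotations of \<open>zb\<close>, which fix the kernel, removes the \<open>zb\<close>-term by the mean value property.\<close>

lemma phase_average:
  assumes R: "R > 0" and w: "w > 0" and \<epsilon>: "\<epsilon> > 0" "\<bar>\<sigma>\<bar> = (1::real)" and k: "k \<ge> 2" and st: "cmod t' < cmod s'"
  shows "(\<integral>X. (1 / (s' * za X + t' * cnj (zb X)) ^ k) / ker \<sigma> \<epsilon> (w *\<^sub>R qone) X \<partial>Mh R) = kernel_const R \<sigma> \<epsilon> k w / s' ^ k"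
proof -
  have W: "w *\<^sub>R qone \<in> HRplus" using w by (simp add: HRplus_iff)
  have s0: "s' \<noteq> 0" using st by auto
  define \<Phi> where "\<Phi> t X = 1 / (s' * za X + t' * cis t * cnj (zb X)) ^ k" for t X
  \<comment> \<open>On the cone \<open>|zb| \<le> |za|\<close>, so \<open>|t'| < |s'|\<close> keeps
    the linear form away from 0 for all \<open>u\<close> in the closed disc. This gives both the
    domination and the holomorphy in \<open>u\<close>.\<close>
  have low: "(cmod s' - cmod t') * cmod (za X) \<le> cmod (s' * za X + t' * u * cnj (zb X))" if "qN X = R\<^sup>2" "cmod u \<le> 1" for X u
  proof -
    have "cmod (zb X) \<le> cmod (za X)" using that R by (intro zb_le_za) simp
    hence "cmod (t' * u * cnj (zb X)) \<le> cmod t' * cmod (za X)"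
      using that by (simp add: norm_mult) (intro mult_mono mult_left_le mult_nonneg_nonneg; simp)
    moreover have "cmod (s' * za X) - cmod (t' * u * cnj (zb X)) \<le> cmod (s' * za X + t' * u * cnj (zb X))"
      using norm_triangle_ineq2[of "s' * za X" "- (t' * u * cnj (zb X))"] by simp
    ultimately show ?thesis by (simp add: norm_mult algebra_simps)
  qed
  obtain S0 where S0: "S0 \<ge> 0" "\<And>f C. C \<ge> 0 \<Longrightarrow> (\<And>X. qN X = R\<^sup>2 \<Longrightarrow> cmod (f X) \<le> C / cmod (za X) ^ k) \<Longrightarrow> wbounded R (C * S0) f"
    using wbounded_za_power[OF R k] by metis
  have wb: "wbounded R ((1 / (cmod s' - cmod t')) ^ k * S0) (\<Phi> t)" for t
  proof (rule S0(2))
    fix X assume X: "qN X = R\<^sup>2"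
    have "cmod (za X) > 0" using za_ge_R[OF X R] R by linarith
    thus "cmod (\<Phi> t X) \<le> (1 / (cmod s' - cmod t')) ^ k / cmod (za X) ^ k"
      unfolding \<Phi>_def using low[OF X, of "cis t"] st by (intro inverse_power_bound) auto
  qed (use st in simp)
  have m: "(\<lambda>p. \<Phi> (fst p) (snd p)) \<in> borel_measurable (borel \<Otimes>\<^sub>M borel)"
    unfolding \<Phi>_def by measurable
  note Fub = ker_Fubini[OF R W \<epsilon> m wb]
  have inner: "(\<integral>t. indicator {0..<2*pi} t *\<^sub>R \<Phi> t X \<partial>lborel) = 2 * of_real pi * (1 / s' ^ k) * (1 / za X ^ k)" if X: "qN X = R\<^sup>2" for X
  proof -
    have za: "cmod (za X) > 0" using za_ge_R[OF X R] R by linarith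
    define S where "S = (\<lambda>u. s' * za X + t' * u * cnj (zb X)) -` (- {0})"
    have S: "open S" "\<And>u. u \<in> S \<Longrightarrow> s' * za X + t' * u * cnj (zb X) \<noteq> 0"
      unfolding S_def by (auto intro!: open_vimage continuous_intros)
    have cb: "cball 0 1 \<subseteq> S"
    proof
      fix u :: complex assume "u \<in> cball 0 1"
      hence "(cmod s' - cmod t') * cmod (za X) \<le> cmod (s' * za X + t' * u * cnj (zb X))" by (intro low X) simp
      moreover have "(cmod s' - cmod t') * cmod (za X) > 0" using st za by simp
      ultimately show "u \<in> S" by (auto simp: S_def)
    qed
    define h where "h u = 1 / (s' * za X + t' * u * cnj (zb X)) ^ k" for u
    have "((\<lambda>t. h (of_real 1 * cis t) / cis t ^ 0) has_integral (2 * of_real pi * of_real 1 ^ 0 / fact 0 * (deriv ^^ 0) h 0)) {0..2*pi}"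
      by (rule has_integral_Cauchy_coeff[OF _ _ S(1) cb]) (use S in \<open>auto simp: h_def intro!: holomorphic_intros\<close>)
    hence "((\<lambda>t. \<Phi> t X) has_integral 2 * of_real pi * h 0) {0..2*pi}" by (simp add: h_def \<Phi>_def)
    hence I: "integral {0..2*pi} (\<lambda>t. \<Phi> t X) = 2 * of_real pi * h 0" by (rule integral_unique)
    have "(\<integral>t. indicator {0..<2*pi} t *\<^sub>R \<Phi> t X \<partial>lborel) = integral {0..2*pi} (\<lambda>t. \<Phi> t X)"
    proof (rule lborel_integral_circle)
      have "cis t \<in> S" for t using cb by auto
      thus "continuous_on {0..2*pi} (\<lambda>t. \<Phi> t X)" unfolding \<Phi>_def using S(2) by (intro continuous_intros) auto
    qed
    thus ?thesis unfolding I by (simp add: h_def power_mult_distrib)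
  qed
  have rot: "(\<integral>X. \<Phi> t X / ker \<sigma> \<epsilon> (w *\<^sub>R qone) X \<partial>Mh R) = (\<integral>X. \<Phi> 0 X / ker \<sigma> \<epsilon> (w *\<^sub>R qone) X \<partial>Mh R)" for t
  proof -
    have [measurable]: "rot12 t \<in> borel_measurable borel"
      using linear_rot12 by (simp add: borel_measurable_continuous_onI linear_continuous_on linear_conv_bounded_linear)
    have [measurable]: "\<Phi> 0 \<in> borel_measurable borel" unfolding \<Phi>_def by measurable
    have "(\<integral>X. \<Phi> 0 X / ker \<sigma> \<epsilon> (w *\<^sub>R qone) X \<partial>Mh R) = (\<integral>X. \<Phi> 0 X / ker \<sigma> \<epsilon> (w *\<^sub>R qone) X \<partial>distr (Mh R) borel (rot12 t))"
      by (simp add: distr_Mh_invariant[OF R linear_rot12 qN_rot12])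
    also have "\<dots> = (\<integral>X. \<Phi> 0 (rot12 t X) / ker \<sigma> \<epsilon> (w *\<^sub>R qone) (rot12 t X) \<partial>Mh R)"
      by (rule integral_distr) auto
    also have "\<dots> = (\<integral>X. \<Phi> t X / ker \<sigma> \<epsilon> (w *\<^sub>R qone) X \<partial>Mh R)"
    proof -
      have "\<Phi> 0 (rot12 t X) = \<Phi> t X" for X by (simp add: \<Phi>_def rot12_def cis_cnj mult_ac)
      moreover have "ker \<sigma> \<epsilon> (w *\<^sub>R qone) (rot12 t X) = ker \<sigma> \<epsilon> (w *\<^sub>R qone) X" for X
        by (simp add: ker_def qN_diff_qone qN_rot12) (simp add: rot12_def)
      ultimately show ?thesis by simp
    qed
    finally show ?thesis ..
  qed
  have [measurable]: "(\<lambda>X. \<integral>t. indicator {0..<2*pi} t *\<^sub>R \<Phi> t X \<partial>lborel) \<in> borel_measurable borel"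
    unfolding \<Phi>_def by measurable
  have "2 * of_real pi * (\<integral>X. \<Phi> 0 X / ker \<sigma> \<epsilon> (w *\<^sub>R qone) X \<partial>Mh R) =
     (\<integral>t. indicator {0..<2*pi} t *\<^sub>R (\<integral>X. \<Phi> t X / ker \<sigma> \<epsilon> (w *\<^sub>R qone) X \<partial>Mh R) \<partial>lborel)"
  proof -
    have "(\<integral>t. indicator {0..<2*pi} t *\<^sub>R (\<integral>X. \<Phi> t X / ker \<sigma> \<epsilon> (w *\<^sub>R qone) X \<partial>Mh R) \<partial>lborel) =
        (\<integral>t. indicator {0..<2*pi} t *\<^sub>R (\<integral>X. \<Phi> 0 X / ker \<sigma> \<epsilon> (w *\<^sub>R qone) X \<partial>Mh R) \<partial>(lborel :: real measure))"
      by (rule Bochner_Integration.integral_cong[OF refl], rule arg_cong, rule rot)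
    also have "\<dots> = 2 * of_real pi * (\<integral>X. \<Phi> 0 X / ker \<sigma> \<epsilon> (w *\<^sub>R qone) X \<partial>Mh R)"
      by (subst integral_scaleR_left) (auto simp: scaleR_conv_of_real)
    finally show ?thesis ..
  qed
  also have "\<dots> = (\<integral>X. (\<integral>t. indicator {0..<2*pi} t *\<^sub>R \<Phi> t X \<partial>lborel) / ker \<sigma> \<epsilon> (w *\<^sub>R qone) X \<partial>Mh R)"
    by (rule Fub[symmetric])
  also have "\<dots> = (\<integral>X. 2 * of_real pi * (1 / s' ^ k) * ((1 / za X ^ k) / Complex (R\<^sup>2 + w\<^sup>2 - 2*w*Re (za X)) (\<sigma> * \<epsilon>)) \<partial>Mh R)"
  proof (rule integral_cong_AE)
    have [measurable]: "(\<lambda>X. Complex (R\<^sup>2 + w\<^sup>2 - 2*w*Re (za X)) (\<sigma> * \<epsilon>)) \<in> borel_measurable borel"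
      unfolding Complex_eq by measurable
    show "AE X in Mh R. (\<integral>t. indicator {0..<2*pi} t *\<^sub>R \<Phi> t X \<partial>lborel) / ker \<sigma> \<epsilon> (w *\<^sub>R qone) X = 2 * of_real pi * (1 / s' ^ k) * ((1 / za X ^ k) / Complex (R\<^sup>2 + w\<^sup>2 - 2*w*Re (za X)) (\<sigma> * \<epsilon>))"
    proof (rule AE_Mh_qN)
      fix X assume "qN X = R\<^sup>2"
      thus "(\<integral>t. indicator {0..<2*pi} t *\<^sub>R \<Phi> t X \<partial>lborel) / ker \<sigma> \<epsilon> (w *\<^sub>R qone) X = 2 * of_real pi * (1 / s' ^ k) * ((1 / za X ^ k) / Complex (R\<^sup>2 + w\<^sup>2 - 2*w*Re (za X)) (\<sigma> * \<epsilon>))"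
        by (simp add: inner ker_def qN_diff_qone)
    qed measurable
  qed (auto simp: Complex_eq)
  also have "\<dots> = 2 * of_real pi * (1 / s' ^ k) * (\<integral>X. (1 / za X ^ k) / Complex (R\<^sup>2 + w\<^sup>2 - 2*w*Re (za X)) (\<sigma> * \<epsilon>) \<partial>Mh R)"
    by (rule integral_mult_right_zero)
  also have "(\<integral>X. (1 / za X ^ k) / Complex (R\<^sup>2 + w\<^sup>2 - 2*w*Re (za X)) (\<sigma> * \<epsilon>) \<partial>Mh R) = kernel_const R \<sigma> \<epsilon> k w"
    unfolding kernel_const_def using R w by (intro za_power_integral k \<epsilon>) (auto intro: add_pos_pos)
  finally have "2 * of_real pi * (\<integral>X. \<Phi> 0 X / ker \<sigma> \<epsilon> (w *\<^sub>R qone) X \<partial>Mh R) = 2 * of_real pi * (kernel_const R \<sigma> \<epsilon> k w / s' ^ k)"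
    by simp
  hence "(\<integral>X. \<Phi> 0 X / ker \<sigma> \<epsilon> (w *\<^sub>R qone) X \<partial>Mh R) = kernel_const R \<sigma> \<epsilon> k w / s' ^ k"
    by (simp only: mult_cancel_left) simp
  thus ?thesis by (simp add: \<Phi>_def)
qed

text \<open>For \<open>|\<eta>|, |q| < 1\<close> a multiple of \<open>za (A X B)\<close> with \<open>N(A) = N(B) = 1\<close>.\<close>

definition glin :: "complex \<Rightarrow> complex \<Rightarrow> real^4 \<Rightarrow> complex" where
  "glin \<eta> q X = za X + \<eta> * cnj (zb X) + q * (zb X + \<eta> * cnj (za X))"

text \<open>A map \<open>L X = p1 X p2\<close> with norm-one factors is chosen such that
  \<open>L\<close> takes \<open>w\<close> times the identity to \<open>W\<close> and the
  \<open>q\<close>-term of \<open>glin\<close> disappears after composition with \<open>L\<close>.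
  What remains is a form in \<open>za\<close> and \<open>cnj (zb)\<close> with
  \<open>|t'| < |s'|\<close>, to which the phase average applies.\<close>

lemma glin_reproduced:
  assumes R: "R > 0" and W: "W \<in> HRplus" and \<epsilon>: "\<epsilon> > 0" "\<bar>\<sigma>\<bar> = (1::real)" and k: "k \<ge> 2"
    and \<eta>: "cmod \<eta> < 1" and q: "cmod q < 1"
  shows "(\<integral>X. (1 / glin \<eta> q X ^ k) / ker \<sigma> \<epsilon> W X \<partial>Mh R) = kernel_const R \<sigma> \<epsilon> k (sqrt (qN W)) * of_real (sqrt (qN W)) ^ k * (1 / glin \<eta> q W ^ k)"
proof -
  define w where "w = sqrt (qN W)"
  note u = qunit_facts[OF W, folded w_def]
  define s where "s = sqrt (1 - (cmod q)\<^sup>2)"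
  have q2: "(cmod q)\<^sup>2 < 1" using q by (simp add: abs_square_less_1)
  have s: "s > 0" "s\<^sup>2 = 1 - (cmod q)\<^sup>2" using q2 by (auto simp: s_def)
  have "complex_of_real (s * s) = of_real (1 - (cmod q)\<^sup>2)" using s(2) by (simp only: power2_eq_square)
  hence sc: "of_real s * of_real s = 1 - q * cnj q"
    by (simp only: of_real_mult of_real_diff of_real_1 complex_norm_square)
  \<comment> \<open>The right factor has first row proportional to \<open>(1, - cnj q)\<close>,
    which cancels the \<open>q\<close>-term; \<open>1 / s\<close> makes its norm one. The left
    factor is then forced by \<open>p1 p2 = qunit W\<close>.\<close>
  define p2 where "p2 = (1 / s) *\<^sub>R quat 1 (- cnj q)"
  define p1 where "p1 = qmult (qunit W) (qconj p2)"
  have "qN (quat 1 (- cnj q)) = s\<^sup>2" by (simp add: qN_za_zb s(2))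
  hence N2: "qN p2 = 1" using s(1) by (simp only: p2_def qN_scaleR) (simp add: power_divide)
  have N1: "qN p1 = 1" by (simp add: p1_def qN_qmult N2 u(1))
  define L where "L X = qmult (qmult p1 X) p2" for X
  have linL: "linear L" unfolding L_def using linear_compose[OF linear_qmult_left linear_qmult_right] by (simp add: o_def)
  have NL: "qN (L X) = qN X" for X by (simp add: L_def qN_qmult N1 N2)
  have p12: "qmult p1 p2 = qunit W"
    using qmult_qconj_right[of "qunit W" "qconj p2"] by (simp add: p1_def N2)
  have "L (w *\<^sub>R qone) = qmult (qunit W) (w *\<^sub>R qone)"
    by (simp add: L_def linear_scale[OF linear_qmult_left] linear_scale[OF linear_qmult_right] p12)
  hence LW: "W = L (w *\<^sub>R qone)" by (rule trans[OF u(3) sym])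
  define s' where "s' = of_real s * (za p1 + \<eta> * cnj (zb p1))"
  define t' where "t' = of_real s * (zb p1 + \<eta> * cnj (za p1))"
  have gL: "glin \<eta> q (L X) = s' * za X + t' * cnj (zb X)" for X
  proof -
    define Y where "Y = qmult p1 X"
    define V where "V = za Y + \<eta> * cnj (zb Y)"
    define V' where "V' = zb Y + \<eta> * cnj (za Y)"
    have z2: "za p2 = of_real (1/s)" "zb p2 = - of_real (1/s) * cnj q" by (simp_all add: p2_def)
    have a: "za (L X) + \<eta> * cnj (zb (L X)) = of_real (1/s) * (V - q * V')"
      unfolding L_def Y_def[symmetric] V_def V'_def za_qmult zb_qmult z2 by (simp add: algebra_simps)
    have b: "zb (L X) + \<eta> * cnj (za (L X)) = of_real (1/s) * (V' - cnj q * V)"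
      unfolding L_def Y_def[symmetric] V_def V'_def za_qmult zb_qmult z2 by (simp add: algebra_simps)
    have "glin \<eta> q (L X) = of_real (1/s) * (1 - q * cnj q) * V"
      unfolding glin_def a b by (simp add: algebra_simps)
    also have "\<dots> = of_real s * V" using s by (simp flip: sc)
    also have "\<dots> = s' * za X + t' * cnj (zb X)"
      unfolding V_def Y_def za_qmult zb_qmult s'_def t'_def by (simp add: algebra_simps)
    finally show ?thesis .
  qed
  have lt: "cmod t' < cmod s'"
  proof -
    define a b where "a = za p1" and "b = zb p1"
    have "(cmod (a + \<eta> * cnj b))\<^sup>2 - (cmod (b + \<eta> * cnj a))\<^sup>2 = (1 - (cmod \<eta>)\<^sup>2) * ((cmod a)\<^sup>2 - (cmod b)\<^sup>2)"
      unfolding cmod_power2 by (simp add: power2_eq_square algebra_simps)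
    also have "\<dots> > 0" using \<eta> N1 by (simp add: a_def b_def qN_za_zb abs_square_less_1)
    finally have "(cmod (b + \<eta> * cnj a))\<^sup>2 < (cmod (a + \<eta> * cnj b))\<^sup>2" by simp
    hence "cmod (b + \<eta> * cnj a) < cmod (a + \<eta> * cnj b)" by (rule power2_less_imp_less) simp
    thus ?thesis using s by (simp add: s'_def t'_def norm_mult a_def b_def)
  qed
  \<comment> \<open>The power of \<open>s'\<close> left by the phase average is thereby recognized
    as the value of the form at \<open>W\<close>, at the price of a power of
    \<open>w\<close>.\<close>
  have gW: "glin \<eta> q W = s' * of_real w" by (subst LW) (simp add: gL)
  have s'0: "s' \<noteq> 0" using lt by auto
  have [measurable]: "(\<lambda>X. 1 / glin \<eta> q X ^ k) \<in> borel_measurable borel" unfolding glin_def by measurable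
  have m2: "(\<lambda>X. 1 / (s' * za X + t' * cnj (zb X)) ^ k) \<in> borel_measurable borel" by measurable
  have "(\<integral>X. (1 / glin \<eta> q X ^ k) / ker \<sigma> \<epsilon> W X \<partial>Mh R) = (\<integral>X. (1 / (s' * za X + t' * cnj (zb X)) ^ k) / Complex (R\<^sup>2 + w\<^sup>2 - 2 * w * Re (za X)) (\<sigma> * \<epsilon>) \<partial>Mh R)"
    by (subst ker_transport(2)[OF R linL NL LW]) (simp_all add: gL)
  also have "\<dots> = (\<integral>X. (1 / (s' * za X + t' * cnj (zb X)) ^ k) / ker \<sigma> \<epsilon> (w *\<^sub>R qone) X \<partial>Mh R)"
    by (rule ker_transport(2)[OF R, where L = "\<lambda>X. X", symmetric]) (auto intro: m2 linear_ident)
  also have "\<dots> = kernel_const R \<sigma> \<epsilon> k w / s' ^ k"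
    by (rule phase_average[OF R u(2) \<epsilon> k lt])
  also have "\<dots> = kernel_const R \<sigma> \<epsilon> k w * of_real w ^ k * (1 / glin \<eta> q W ^ k)"
    using u(2) s'0 by (simp add: gW power_mult_distrib)
  finally show ?thesis by (simp add: w_def)
qed

text \<open>The proportionality factor depends on \<open>W\<close> only through \<open>qN W\<close>
  and does not depend on \<open>f\<close>. The property is therefore linear in \<open>f\<close> and
  survives averaging.\<close>

definition reproduced :: "real \<Rightarrow> real \<Rightarrow> real \<Rightarrow> nat \<Rightarrow> (real^4 \<Rightarrow> complex) \<Rightarrow> bool" where
  "reproduced R \<sigma> \<epsilon> k f \<longleftrightarrow> (\<forall>W\<in>HRplus. (\<integral>X. f X / ker \<sigma> \<epsilon> W X \<partial>Mh R) =
     kernel_const R \<sigma> \<epsilon> k (sqrt (qN W)) * of_real (sqrt (qN W)) ^ k * f W)"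

text \<open>The factor \<open>\<kappa>\<close> comes out of the integral over \<open>t\<close>,
  since it is the same for every member of the family. The representation of \<open>f\<close> is
  asked for on \<open>HRplus\<close> only, which contains the hyperboloid and
  \<open>W\<close>.\<close>

lemma reproduced_circle_integral:
  fixes \<Phi> :: "real \<Rightarrow> real^4 \<Rightarrow> complex" and c :: complex
  assumes R: "R > 0" and \<epsilon>: "\<epsilon> > 0" "\<bar>\<sigma>\<bar> = (1::real)"
    and m[measurable]: "(\<lambda>p. \<Phi> (fst p) (snd p)) \<in> borel_measurable (borel \<Otimes>\<^sub>M borel)" and b: "\<And>t. wbounded R S (\<Phi> t)"
    and rep: "\<And>t. reproduced R \<sigma> \<epsilon> k (\<Phi> t)"
    and f: "f \<in> borel_measurable borel" "\<And>X. X \<in> HRplus \<Longrightarrow> c * f X = integral {0..2*pi} (\<lambda>t. \<Phi> t X)" "c \<noteq> 0"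
      "\<And>X. X \<in> HRplus \<Longrightarrow> continuous_on {0..2*pi} (\<lambda>t. \<Phi> t X)"
  shows "reproduced R \<sigma> \<epsilon> k f"
  unfolding reproduced_def
proof
  note [measurable] = f(1)
  fix W assume W: "W \<in> HRplus"
  define \<kappa> where "\<kappa> = kernel_const R \<sigma> \<epsilon> k (sqrt (qN W)) * of_real (sqrt (qN W)) ^ k"
  have circ: "(\<integral>t. indicator {0..<2*pi} t *\<^sub>R \<Phi> t X \<partial>lborel) = c * f X" if "X \<in> HRplus" for X
    using f(2,4)[OF that] by (simp add: lborel_integral_circle)
  have [measurable]: "(\<lambda>X. \<integral>t. indicator {0..<2*pi} t *\<^sub>R \<Phi> t X \<partial>lborel) \<in> borel_measurable borel"
  proof -
    have "(\<lambda>p. indicator {0..<2*pi} (snd p) *\<^sub>R \<Phi> (snd p) (fst p)) \<in> borel_measurable ((borel :: (real^4) measure) \<Otimes>\<^sub>M (lborel :: real measure))"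
      using measurable_compose[OF _ m, of "\<lambda>p. (snd p, fst p)" "(borel :: (real^4) measure) \<Otimes>\<^sub>M (lborel :: real measure)"] by simp
    thus ?thesis by (intro lborel.borel_measurable_lebesgue_integral) (simp add: case_prod_beta)
  qed
  have "c * (\<integral>X. f X / ker \<sigma> \<epsilon> W X \<partial>Mh R) = (\<integral>X. c * (f X / ker \<sigma> \<epsilon> W X) \<partial>Mh R)"
    by (rule integral_mult_right_zero[symmetric])
  also have "\<dots> = (\<integral>X. (\<integral>t. indicator {0..<2*pi} t *\<^sub>R \<Phi> t X \<partial>lborel) / ker \<sigma> \<epsilon> W X \<partial>Mh R)"
  proof (rule integral_cong_AE)
    show "AE X in Mh R. c * (f X / ker \<sigma> \<epsilon> W X) = (\<integral>t. indicator {0..<2*pi} t *\<^sub>R \<Phi> t X \<partial>lborel) / ker \<sigma> \<epsilon> W X"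
    proof (rule AE_Mh_qN)
      fix X assume "qN X = R\<^sup>2"
      hence "X \<in> HRplus" using R by (simp add: HRplus_def)
      thus "c * (f X / ker \<sigma> \<epsilon> W X) = (\<integral>t. indicator {0..<2*pi} t *\<^sub>R \<Phi> t X \<partial>lborel) / ker \<sigma> \<epsilon> W X"
        by (simp add: circ)
    qed measurable
  qed auto
  also have "\<dots> = (\<integral>t. indicator {0..<2*pi} t *\<^sub>R (\<integral>X. \<Phi> t X / ker \<sigma> \<epsilon> W X \<partial>Mh R) \<partial>lborel)"
    by (rule ker_Fubini[OF R W \<epsilon> m b])
  also have "\<dots> = (\<integral>t. \<kappa> * (indicator {0..<2*pi} t *\<^sub>R \<Phi> t W) \<partial>lborel)"
    using rep W by (intro Bochner_Integration.integral_cong) (auto simp: reproduced_def \<kappa>_def)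
  also have "\<dots> = \<kappa> * (\<integral>t. indicator {0..<2*pi} t *\<^sub>R \<Phi> t W \<partial>lborel)" by (rule integral_mult_right_zero)
  also have "\<dots> = c * (\<kappa> * f W)" by (simp add: circ[OF W])
  finally show "(\<integral>X. f X / ker \<sigma> \<epsilon> W X \<partial>Mh R) = kernel_const R \<sigma> \<epsilon> k (sqrt (qN W)) * of_real (sqrt (qN W)) ^ k * f W"
    using f(3) by (simp add: \<kappa>_def)
qed

text \<open>The radius \<open>1/4\<close> is small enough for both variables at once:
  \<open>1 - 1/4 = 3/4\<close>, \<open>1 + 1/4 = 5/4\<close> and
  \<open>3/4 - 1/4 * 5/4 = 7/16\<close>.\<close>

lemma linear_lower:
  assumes X: "X \<in> HRplus" and \<eta>: "cmod \<eta> \<le> 1/4"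
  shows "3/4 * cmod (za X) \<le> cmod (za X + \<eta> * cnj (zb X))" "cmod (zb X + \<eta> * cnj (za X)) \<le> 5/4 * cmod (za X)"
    "cmod q \<le> 1/4 \<Longrightarrow> 7/16 * cmod (za X) \<le> cmod (glin \<eta> q X)" "cmod (za X) > 0"
proof -
  have zb: "cmod (zb X) \<le> cmod (za X)" using X by (simp add: HRplus_iff)
  show "cmod (za X) > 0" using HRplus_za_nz[OF X] by simp
  have "cmod (\<eta> * cnj (zb X)) \<le> 1/4 * cmod (za X)" using zb \<eta> by (simp only: norm_mult complex_mod_cnj mult_mono norm_ge_zero zero_le_divide_1_iff zero_le_numeral)
  moreover have "cmod (za X) - cmod (\<eta> * cnj (zb X)) \<le> cmod (za X + \<eta> * cnj (zb X))"
    using norm_triangle_ineq2[of "za X" "- (\<eta> * cnj (zb X))"] by simp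
  ultimately show 1: "3/4 * cmod (za X) \<le> cmod (za X + \<eta> * cnj (zb X))" by linarith
  have "cmod (\<eta> * cnj (za X)) \<le> 1/4 * cmod (za X)" using mult_right_mono[OF \<eta>, of "cmod (za X)"] by (simp add: norm_mult)
  thus 2: "cmod (zb X + \<eta> * cnj (za X)) \<le> 5/4 * cmod (za X)"
    using norm_triangle_ineq[of "zb X" "\<eta> * cnj (za X)"] zb by linarith
  assume q: "cmod q \<le> 1/4"
  have "cmod (q * (zb X + \<eta> * cnj (za X))) \<le> 1/4 * (5/4 * cmod (za X))"
    unfolding norm_mult using q 2 by (intro mult_mono) auto
  moreover have "cmod (za X + \<eta> * cnj (zb X)) - cmod (q * (zb X + \<eta> * cnj (za X))) \<le> cmod (glin \<eta> q X)"
    unfolding glin_def using norm_triangle_ineq2[of "za X + \<eta> * cnj (zb X)" "- (q * (zb X + \<eta> * cnj (za X)))"] by simp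
  ultimately show "7/16 * cmod (za X) \<le> cmod (glin \<eta> q X)" using 1 by linarith
qed

text \<open>\<open>hgen\<close> is, up to the constant \<open>c\<close>, the coefficient of
  \<open>q^\<beta>\<close> in \<open>1 / glin^k\<close>, read off on the circle
  \<open>|q| = 1/4\<close>, where \<open>glin\<close> is bounded below.\<close>

lemma hgen_reproduced:
  assumes R: "R > 0" and \<epsilon>: "\<epsilon> > 0" "\<bar>\<sigma>\<bar> = (1::real)" and k: "k \<ge> 2" and \<eta>: "cmod \<eta> \<le> 1/4"
  shows "reproduced R \<sigma> \<epsilon> k (hgen k \<beta> \<eta>)"
proof -
  define \<Phi> where "\<Phi> t X = (1 / glin \<eta> (of_real (1/4) * cis t) X ^ k) / cis t ^ \<beta>" for t X
  \<comment> \<open>Besides the \<open>2 * pi * (1/4)^\<beta>\<close> of the Cauchy integral this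
    contains the binomial coefficient of \<open>-k\<close> over \<open>\<beta>\<close>, which is
    nonzero because \<open>k > 0\<close>.\<close>
  define c :: complex where "c = 2 * of_real pi * of_real (1/4) ^ \<beta> / fact \<beta> * ((-1) ^ \<beta> * pochhammer (of_nat k) \<beta>)"
  obtain S0 where S0: "S0 \<ge> 0" "\<And>f C. C \<ge> 0 \<Longrightarrow> (\<And>X. qN X = R\<^sup>2 \<Longrightarrow> cmod (f X) \<le> C / cmod (za X) ^ k) \<Longrightarrow> wbounded R (C * S0) f"
    using wbounded_za_power[OF R k] by metis
  show ?thesis
  proof (rule reproduced_circle_integral[OF R \<epsilon>, where \<Phi> = \<Phi> and c = c])
    show "(\<lambda>p. \<Phi> (fst p) (snd p)) \<in> borel_measurable (borel \<Otimes>\<^sub>M borel)"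
      unfolding \<Phi>_def glin_def by measurable
    show "wbounded R ((1 / (7/16)) ^ k * S0) (\<Phi> t)" for t
    proof (rule S0(2))
      fix X assume "qN X = R\<^sup>2"
      hence X: "X \<in> HRplus" using R by (simp add: HRplus_def)
      have "cmod (\<Phi> t X) = cmod (1 / glin \<eta> (of_real (1/4) * cis t) X ^ k)"
        by (simp add: \<Phi>_def norm_divide norm_power norm_mult)
      also have "\<dots> \<le> (1 / (7/16)) ^ k / cmod (za X) ^ k"
        by (rule inverse_power_bound) (use linear_lower(3)[OF X \<eta>, of "of_real (1/4) * cis t"] linear_lower(4)[OF X \<eta>] in \<open>auto simp: norm_mult\<close>)
      finally show "cmod (\<Phi> t X) \<le> (1 / (7/16)) ^ k / cmod (za X) ^ k" .
    qed simp
    show "reproduced R \<sigma> \<epsilon> k (\<Phi> t)" for t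
      unfolding reproduced_def
    proof
      fix W assume W: "W \<in> HRplus"
      have "(\<integral>X. \<Phi> t X / ker \<sigma> \<epsilon> W X \<partial>Mh R) = (\<integral>X. (1 / cis t ^ \<beta>) * ((1 / glin \<eta> (of_real (1/4) * cis t) X ^ k) / ker \<sigma> \<epsilon> W X) \<partial>Mh R)"
        by (simp add: \<Phi>_def mult_ac)
      also have "\<dots> = (1 / cis t ^ \<beta>) * (\<integral>X. (1 / glin \<eta> (of_real (1/4) * cis t) X ^ k) / ker \<sigma> \<epsilon> W X \<partial>Mh R)"
        by (rule integral_mult_right_zero)
      also have "\<dots> = kernel_const R \<sigma> \<epsilon> k (sqrt (qN W)) * of_real (sqrt (qN W)) ^ k * \<Phi> t W"
        using \<eta> by (subst glin_reproduced[OF R W \<epsilon> k]) (auto simp: norm_mult \<Phi>_def)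
      finally show "(\<integral>X. \<Phi> t X / ker \<sigma> \<epsilon> W X \<partial>Mh R) = \<dots>" .
    qed
    show "hgen k \<beta> \<eta> \<in> borel_measurable borel" unfolding hgen_def[abs_def] by measurable
    show "c \<noteq> 0" using k by (auto simp: c_def pochhammer_eq_0_iff of_nat_eq_0_iff simp del: of_nat_0 dest: arg_cong[of _ _ Re])
    fix X assume X: "X \<in> HRplus"
    define A B where "A = za X + \<eta> * cnj (zb X)" and "B = zb X + \<eta> * cnj (za X)"
    define S where "S = (\<lambda>q. A + q * B) -` (- {0})"
    have S: "open S" "\<And>q. q \<in> S \<Longrightarrow> A + q * B \<noteq> 0"
      unfolding S_def by (auto intro!: open_vimage continuous_intros)
    have gl: "glin \<eta> q X = A + q * B" for q by (simp add: glin_def A_def B_def)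
    have cb: "cball 0 (1/4) \<subseteq> S"
    proof
      fix q :: complex assume "q \<in> cball 0 (1/4)"
      hence "7/16 * cmod (za X) \<le> cmod (glin \<eta> q X)" by (intro linear_lower(3)[OF X \<eta>]) simp
      thus "q \<in> S" using linear_lower(4)[OF X \<eta>] by (auto simp: S_def gl)
    qed
    have "((\<lambda>t. (\<lambda>q. 1 / (A + q * B) ^ k) (of_real (1/4) * cis t) / cis t ^ \<beta>) has_integral (2 * of_real pi * of_real (1/4) ^ \<beta> / fact \<beta> * (deriv ^^ \<beta>) (\<lambda>q. 1 / (A + q * B) ^ k) 0)) {0..2*pi}"
      by (rule has_integral_Cauchy_coeff[OF _ _ S(1) cb]) (use S in \<open>auto intro!: holomorphic_intros\<close>)
    also have "(deriv ^^ \<beta>) (\<lambda>q. 1 / (A + q * B) ^ k) 0 = (-1) ^ \<beta> * pochhammer (of_nat k) \<beta> * B ^ \<beta> / (A + 0 * B) ^ (k + \<beta>)"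
      using cb by (intro higher_deriv_inverse_linear[OF S]) auto
    also have "2 * of_real pi * of_real (1/4) ^ \<beta> / fact \<beta> * ((-1) ^ \<beta> * pochhammer (of_nat k) \<beta> * B ^ \<beta> / (A + 0 * B) ^ (k + \<beta>)) = c * hgen k \<beta> \<eta> X"
      by (simp add: c_def hgen_def A_def B_def)
    finally have "((\<lambda>t. \<Phi> t X) has_integral c * hgen k \<beta> \<eta> X) {0..2*pi}"
      by (simp add: \<Phi>_def gl)
    thus "c * hgen k \<beta> \<eta> X = integral {0..2*pi} (\<lambda>t. \<Phi> t X)" by (simp add: integral_unique)
    have "of_real (1/4) * cis t \<in> S" for t using cb by (auto simp: norm_mult)
    hence "A + of_real (1/4) * cis t * B \<noteq> 0" for t using S(2) by blast
    thus "continuous_on {0..2*pi} (\<lambda>t. \<Phi> t X)"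
      unfolding \<Phi>_def gl by (intro continuous_intros) auto
  qed
qed

lemma borel_measurable_tpos [measurable]: "tpos k \<alpha> \<beta> \<in> borel_measurable borel"
  unfolding tpos_def[abs_def] by measurable

text \<open>The same extraction in the other variable: \<open>tpos\<close> is the coefficient of
  \<open>\<eta>^\<alpha>\<close> in \<open>hgen\<close>, and on the circle
  \<open>|\<eta>| = 1/4\<close> numerator and denominator of \<open>hgen\<close> are controlled by
  powers of \<open>|za|\<close> with net exponent \<open>-k\<close>.\<close>

lemma tpos_reproduced:
  assumes R: "R > 0" and \<epsilon>: "\<epsilon> > 0" "\<bar>\<sigma>\<bar> = (1::real)" and k: "k \<ge> 2"
  shows "reproduced R \<sigma> \<epsilon> k (tpos k \<alpha> \<beta>)"
proof -
  define \<Phi> where "\<Phi> t X = hgen k \<beta> (of_real (1/4) * cis t) X / cis t ^ \<alpha>" for t X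
  define c where "c = 2 * complex_of_real pi * of_real (1/4) ^ \<alpha>"
  obtain S0 where S0: "S0 \<ge> 0" "\<And>f C. C \<ge> 0 \<Longrightarrow> (\<And>X. qN X = R\<^sup>2 \<Longrightarrow> cmod (f X) \<le> C / cmod (za X) ^ k) \<Longrightarrow> wbounded R (C * S0) f"
    using wbounded_za_power[OF R k] by metis
  have \<eta>: "cmod (of_real (1/4) * cis t) \<le> 1/4" for t by (simp add: norm_mult)
  show ?thesis
  proof (rule reproduced_circle_integral[OF R \<epsilon>, where \<Phi> = \<Phi> and c = c])
    show "(\<lambda>p. \<Phi> (fst p) (snd p)) \<in> borel_measurable (borel \<Otimes>\<^sub>M borel)"
      unfolding \<Phi>_def hgen_def by measurable
    show "wbounded R ((5/4) ^ \<beta> * (1 / (3/4)) ^ (k + \<beta>) * S0) (\<Phi> t)" for t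
    proof (rule S0(2))
      fix X assume "qN X = R\<^sup>2"
      hence X: "X \<in> HRplus" using R by (simp add: HRplus_def)
      note l = linear_lower[OF X \<eta>[of t]]
      have "cmod (\<Phi> t X) = cmod (zb X + of_real (1/4) * cis t * cnj (za X)) ^ \<beta> * cmod (1 / (za X + of_real (1/4) * cis t * cnj (zb X)) ^ (k + \<beta>))"
        by (simp add: \<Phi>_def hgen_def norm_divide norm_mult norm_power)
      also have "\<dots> \<le> (5/4 * cmod (za X)) ^ \<beta> * ((1 / (3/4)) ^ (k + \<beta>) / cmod (za X) ^ (k + \<beta>))"
        using l by (intro mult_mono power_mono inverse_power_bound) auto
      also have "\<dots> = (5/4) ^ \<beta> * (1 / (3/4)) ^ (k + \<beta>) / cmod (za X) ^ k"
        using l(4) by (simp only: power_mult_distrib) (simp add: power_add)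
      finally show "cmod (\<Phi> t X) \<le> (5/4) ^ \<beta> * (1 / (3/4)) ^ (k + \<beta>) / cmod (za X) ^ k" .
    qed simp
    show "reproduced R \<sigma> \<epsilon> k (\<Phi> t)" for t
      unfolding reproduced_def
    proof
      fix W assume W: "W \<in> HRplus"
      have "(\<integral>X. \<Phi> t X / ker \<sigma> \<epsilon> W X \<partial>Mh R) = (\<integral>X. (1 / cis t ^ \<alpha>) * (hgen k \<beta> (of_real (1/4) * cis t) X / ker \<sigma> \<epsilon> W X) \<partial>Mh R)"
        by (simp add: \<Phi>_def mult_ac)
      also have "\<dots> = (1 / cis t ^ \<alpha>) * (\<integral>X. hgen k \<beta> (of_real (1/4) * cis t) X / ker \<sigma> \<epsilon> W X \<partial>Mh R)"
        by (rule integral_mult_right_zero)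
      also have "(\<integral>X. hgen k \<beta> (of_real (1/4) * cis t) X / ker \<sigma> \<epsilon> W X \<partial>Mh R) = kernel_const R \<sigma> \<epsilon> k (sqrt (qN W)) * of_real (sqrt (qN W)) ^ k * hgen k \<beta> (of_real (1/4) * cis t) W"
        using hgen_reproduced[OF R \<epsilon> k \<eta>] W unfolding reproduced_def by blast
      finally show "(\<integral>X. \<Phi> t X / ker \<sigma> \<epsilon> W X \<partial>Mh R) = kernel_const R \<sigma> \<epsilon> k (sqrt (qN W)) * of_real (sqrt (qN W)) ^ k * \<Phi> t W"
        by (simp add: \<Phi>_def)
    qed
    show "tpos k \<alpha> \<beta> \<in> borel_measurable borel" by measurable
    show "c \<noteq> 0" by (simp add: c_def)
    fix X assume X: "X \<in> HRplus"
    have "((\<lambda>t. \<Phi> t X) has_integral c * tpos k \<alpha> \<beta> X) {0..2*pi}"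
      using tpos_integral[OF X, of "1/4" k \<beta> \<alpha>] by (simp add: \<Phi>_def c_def)
    thus "c * tpos k \<alpha> \<beta> X = integral {0..2*pi} (\<lambda>t. \<Phi> t X)" by (simp add: integral_unique)
    have "za X + of_real (1/4) * cis t * cnj (zb X) \<noteq> 0" for t
      using linear_lower(1,4)[OF X \<eta>[of t]] by auto
    thus "continuous_on {0..2*pi} (\<lambda>t. \<Phi> t X)"
      unfolding \<Phi>_def hgen_def by (intro continuous_intros) auto
  qed
qed

section \<open>Decay of invariant derivatives\<close>

lemma open_HRplus: "open HRplus"
proof -
  have "HRplus = {X. cmod (zb X) < cmod (za X)}" by (auto simp: HRplus_iff)
  also have "open \<dots>" by (intro open_Collect_less continuous_intros)
  finally show ?thesis .
qed

lemma bounded_linear_za: "bounded_linear za" and bounded_linear_zb: "bounded_linear zb"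
  by (rule linear_conv_bounded_linear[THEN iffD1], rule linearI; simp add: scaleR_conv_of_real[where 'a=complex])+

definition invariant_field :: "(real^4 \<Rightarrow> real^4) \<Rightarrow> bool" where
  "invariant_field V \<longleftrightarrow> (\<exists>A. V = qmult A) \<or> (\<exists>B. V = (\<lambda>X. qmult X B))"

text \<open>Decay of order \<open>|za|\<^sup>d\<close> on the shell, together with one derivative along invariant fields.\<close>

definition tame :: "real \<Rightarrow> int \<Rightarrow> (real^4 \<Rightarrow> complex) \<Rightarrow> bool" where
  "tame \<rho> d f \<longleftrightarrow> (\<forall>X\<in>HRplus. f differentiable (at X)) \<and>
     (\<exists>C. \<forall>X\<in>shell \<rho>. cmod (f X) \<le> C * cmod (za X) powi d) \<and>
     (\<forall>V. invariant_field V \<longrightarrow> (\<exists>C. \<forall>X\<in>shell \<rho>. cmod (frechet_derivative f (at X) (V X)) \<le> C * cmod (za X) powi d))"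

lemma shell_HRplus: "X \<in> shell \<rho> \<Longrightarrow> X \<in> HRplus" by (simp add: shell_def)

lemma tameI:
  assumes der: "\<And>X. X \<in> HRplus \<Longrightarrow> (f has_derivative f' X) (at X)"
    and b0: "\<And>X. X \<in> shell \<rho> \<Longrightarrow> cmod (f X) \<le> C * cmod (za X) powi d"
    and b1: "\<And>V. invariant_field V \<Longrightarrow> \<exists>C. \<forall>X\<in>shell \<rho>. cmod (f' X (V X)) \<le> C * cmod (za X) powi d"
  shows "tame \<rho> d f"
  unfolding tame_def
proof (intro conjI allI impI ballI)
  show "f differentiable (at X)" if "X \<in> HRplus" for X using der[OF that] by (auto simp: differentiable_def)
  show "\<exists>C. \<forall>X\<in>shell \<rho>. cmod (f X) \<le> C * cmod (za X) powi d" using b0 by blast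
  fix V assume "invariant_field V"
  then obtain C where C: "\<forall>X\<in>shell \<rho>. cmod (f' X (V X)) \<le> C * cmod (za X) powi d" using b1 by blast
  have "frechet_derivative f (at X) = f' X" if "X \<in> shell \<rho>" for X
    using frechet_derivative_at[OF der[OF shell_HRplus[OF that]]] by simp
  thus "\<exists>C. \<forall>X\<in>shell \<rho>. cmod (frechet_derivative f (at X) (V X)) \<le> C * cmod (za X) powi d"
    using C by auto
qed

lemma tameD:
  assumes "tame \<rho> d f"
  shows "X \<in> HRplus \<Longrightarrow> (f has_derivative frechet_derivative f (at X)) (at X)"
    and "\<exists>C\<ge>0. \<forall>X\<in>shell \<rho>. cmod (f X) \<le> C * cmod (za X) powi d"
    and "invariant_field V \<Longrightarrow> \<exists>C\<ge>0. \<forall>X\<in>shell \<rho>. cmod (frechet_derivative f (at X) (V X)) \<le> C * cmod (za X) powi d"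
proof -
  have nn: "\<exists>C\<ge>0. \<forall>X\<in>shell \<rho>. g X \<le> C * cmod (za X) powi d" if C: "\<forall>X\<in>shell \<rho>. g X \<le> C * cmod (za X) powi d" for C and g :: "real^4 \<Rightarrow> real"
  proof (intro exI[of _ "\<bar>C\<bar>"] conjI ballI)
    fix X assume "X \<in> shell \<rho>"
    hence "g X \<le> C * cmod (za X) powi d" using C by blast
    also have "\<dots> \<le> \<bar>C\<bar> * cmod (za X) powi d" by (intro mult_right_mono) auto
    finally show "g X \<le> \<bar>C\<bar> * cmod (za X) powi d" .
  qed simp
  show "X \<in> HRplus \<Longrightarrow> (f has_derivative frechet_derivative f (at X)) (at X)"
    using assms by (auto simp: tame_def frechet_derivative_works)
  show "\<exists>C\<ge>0. \<forall>X\<in>shell \<rho>. cmod (f X) \<le> C * cmod (za X) powi d"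
  proof -
    obtain C where "\<forall>X\<in>shell \<rho>. cmod (f X) \<le> C * cmod (za X) powi d" using assms unfolding tame_def by blast
    from nn[OF this] show ?thesis .
  qed
  show "invariant_field V \<Longrightarrow> \<exists>C\<ge>0. \<forall>X\<in>shell \<rho>. cmod (frechet_derivative f (at X) (V X)) \<le> C * cmod (za X) powi d"
  proof -
    assume "invariant_field V"
    then obtain C where "\<forall>X\<in>shell \<rho>. cmod (frechet_derivative f (at X) (V X)) \<le> C * cmod (za X) powi d"
      using assms unfolding tame_def by blast
    from nn[OF this] show ?thesis .
  qed
qed

lemma tame_mult:
  assumes f: "tame \<rho> d f" and g: "tame \<rho> e g"
  shows "tame \<rho> (d + e) (\<lambda>X. f X * g X)"
proof -
  obtain C where C: "C \<ge> 0" "\<And>X. X \<in> shell \<rho> \<Longrightarrow> cmod (f X) \<le> C * cmod (za X) powi d" using tameD(2)[OF f] by blast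
  obtain E where E: "E \<ge> 0" "\<And>X. X \<in> shell \<rho> \<Longrightarrow> cmod (g X) \<le> E * cmod (za X) powi e" using tameD(2)[OF g] by blast
  have pw: "c * r powi d * (c' * r powi e) = c * c' * r powi (d + e)" if "r \<noteq> 0" for c c' r :: real
    using that by (simp add: power_int_add)
  have za: "cmod (za X) \<noteq> 0" if "X \<in> shell \<rho>" for X using HRplus_za_nz[OF shell_HRplus[OF that]] by simp
  have prod: "cmod (x * y) \<le> c * c' * cmod (za X) powi (d + e)"
    if "X \<in> shell \<rho>" "cmod x \<le> c * cmod (za X) powi d" "cmod y \<le> c' * cmod (za X) powi e" "c \<ge> 0" "c' \<ge> 0" for x y c c' X
    unfolding pw[OF za[OF that(1)], symmetric] norm_mult using that by (intro mult_mono) auto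
  show ?thesis
  proof (rule tameI)
    show "((\<lambda>X. f X * g X) has_derivative (\<lambda>h. f X * frechet_derivative g (at X) h + frechet_derivative f (at X) h * g X)) (at X)" if "X \<in> HRplus" for X
      by (rule has_derivative_mult[OF tameD(1)[OF f that] tameD(1)[OF g that]])
    show "cmod (f X * g X) \<le> C * E * cmod (za X) powi (d + e)" if "X \<in> shell \<rho>" for X
      using that C E by (intro prod) auto
    fix V assume V: "invariant_field V"
    obtain C' where C': "C' \<ge> 0" "\<And>X. X \<in> shell \<rho> \<Longrightarrow> cmod (frechet_derivative f (at X) (V X)) \<le> C' * cmod (za X) powi d" using tameD(3)[OF f V] by blast
    obtain E' where E': "E' \<ge> 0" "\<And>X. X \<in> shell \<rho> \<Longrightarrow> cmod (frechet_derivative g (at X) (V X)) \<le> E' * cmod (za X) powi e" using tameD(3)[OF g V] by blast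
    show "\<exists>C. \<forall>X\<in>shell \<rho>. cmod (f X * frechet_derivative g (at X) (V X) + frechet_derivative f (at X) (V X) * g X) \<le> C * cmod (za X) powi (d + e)"
    proof (intro exI ballI)
      fix X assume X: "X \<in> shell \<rho>"
      have "cmod (f X * frechet_derivative g (at X) (V X) + frechet_derivative f (at X) (V X) * g X) \<le> C * E' * cmod (za X) powi (d + e) + C' * E * cmod (za X) powi (d + e)"
        using X C E C' E' by (intro norm_triangle_mono prod) auto
      thus "cmod (f X * frechet_derivative g (at X) (V X) + frechet_derivative f (at X) (V X) * g X) \<le> (C * E' + C' * E) * cmod (za X) powi (d + e)"
        by (simp add: distrib_right)
    qed
  qed
qed

lemma tame_add:
  assumes f: "tame \<rho> d f" and g: "tame \<rho> d g"
  shows "tame \<rho> d (\<lambda>X. f X + g X)"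
proof -
  obtain C where C: "C \<ge> 0" "\<And>X. X \<in> shell \<rho> \<Longrightarrow> cmod (f X) \<le> C * cmod (za X) powi d" using tameD(2)[OF f] by blast
  obtain E where E: "E \<ge> 0" "\<And>X. X \<in> shell \<rho> \<Longrightarrow> cmod (g X) \<le> E * cmod (za X) powi d" using tameD(2)[OF g] by blast
  show ?thesis
  proof (rule tameI)
    show "((\<lambda>X. f X + g X) has_derivative (\<lambda>h. frechet_derivative f (at X) h + frechet_derivative g (at X) h)) (at X)" if "X \<in> HRplus" for X
      by (rule has_derivative_add[OF tameD(1)[OF f that] tameD(1)[OF g that]])
    show "cmod (f X + g X) \<le> (C + E) * cmod (za X) powi d" if "X \<in> shell \<rho>" for X
      unfolding distrib_right using that C E by (intro norm_triangle_mono) auto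
    fix V assume V: "invariant_field V"
    obtain C' where C': "\<And>X. X \<in> shell \<rho> \<Longrightarrow> cmod (frechet_derivative f (at X) (V X)) \<le> C' * cmod (za X) powi d" using tameD(3)[OF f V] by blast
    obtain E' where E': "\<And>X. X \<in> shell \<rho> \<Longrightarrow> cmod (frechet_derivative g (at X) (V X)) \<le> E' * cmod (za X) powi d" using tameD(3)[OF g V] by blast
    show "\<exists>C. \<forall>X\<in>shell \<rho>. cmod (frechet_derivative f (at X) (V X) + frechet_derivative g (at X) (V X)) \<le> C * cmod (za X) powi d"
    proof (intro exI ballI)
      fix X assume X: "X \<in> shell \<rho>"
      show "cmod (frechet_derivative f (at X) (V X) + frechet_derivative g (at X) (V X)) \<le> (C' + E') * cmod (za X) powi d"
        unfolding distrib_right by (rule norm_triangle_mono[OF C'[OF X] E'[OF X]])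
    qed
  qed
qed

lemma tame_cnj:
  assumes f: "tame \<rho> d f"
  shows "tame \<rho> d (\<lambda>X. cnj (f X))"
proof -
  obtain C where C: "C \<ge> 0" "\<And>X. X \<in> shell \<rho> \<Longrightarrow> cmod (f X) \<le> C * cmod (za X) powi d" using tameD(2)[OF f] by blast
  show ?thesis
  proof (rule tameI)
    show "((\<lambda>X. cnj (f X)) has_derivative (\<lambda>h. cnj (frechet_derivative f (at X) h))) (at X)" if "X \<in> HRplus" for X
      by (rule has_derivative_cnj[OF tameD(1)[OF f that]])
    show "cmod (cnj (f X)) \<le> C * cmod (za X) powi d" if "X \<in> shell \<rho>" for X using C(2)[OF that] by simp
    fix V assume "invariant_field V"
    from tameD(3)[OF f this] show "\<exists>C. \<forall>X\<in>shell \<rho>. cmod (cnj (frechet_derivative f (at X) (V X))) \<le> C * cmod (za X) powi d"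
      unfolding complex_mod_cnj by blast
  qed
qed

lemma tame_const: "tame \<rho> 0 (\<lambda>X. c)"
  by (rule tameI[where f' = "\<lambda>X h. 0" and C = "cmod c"]) auto

lemma tame_zero: "tame \<rho> d (\<lambda>X. 0)"
  by (rule tameI[where f' = "\<lambda>X h. 0" and C = 0]) (auto intro: exI[of _ 0])

lemma tame_power: "tame \<rho> d f \<Longrightarrow> tame \<rho> (d * int n) (\<lambda>X. f X ^ n)"
proof (induction n)
  case (Suc n)
  have "tame \<rho> (d + d * int n) (\<lambda>X. f X * f X ^ n)" by (rule tame_mult[OF Suc.prems Suc.IH[OF Suc.prems]])
  thus ?case by (simp add: algebra_simps)
qed (simp add: tame_const)

lemma tame_sum: "finite I \<Longrightarrow> (\<And>i. i \<in> I \<Longrightarrow> tame \<rho> d (f i)) \<Longrightarrow> tame \<rho> d (\<lambda>X. \<Sum>i\<in>I. f i X)"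
  by (induction I rule: finite_induct) (auto intro: tame_zero tame_add)

lemma tame_cong:
  assumes f: "tame \<rho> d f" and eq: "\<And>X. X \<in> HRplus \<Longrightarrow> f X = g X"
  shows "tame \<rho> d g"
proof -
  obtain C where C: "C \<ge> 0" "\<And>X. X \<in> shell \<rho> \<Longrightarrow> cmod (f X) \<le> C * cmod (za X) powi d" using tameD(2)[OF f] by blast
  show ?thesis
  proof (rule tameI)
    show "(g has_derivative frechet_derivative f (at X)) (at X)" if "X \<in> HRplus" for X
      by (rule has_derivative_transform_within_open[OF tameD(1)[OF f that] open_HRplus that eq])
    show "cmod (g X) \<le> C * cmod (za X) powi d" if "X \<in> shell \<rho>" for X
      using C(2)[OF that] eq[OF shell_HRplus[OF that]] by simp
  qed (use tameD(3)[OF f] in blast)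
qed

lemma invariant_field_bound:
  assumes "invariant_field V"
  shows "\<exists>C\<ge>0. \<forall>X\<in>HRplus. cmod (za (V X)) \<le> C * cmod (za X) \<and> cmod (zb (V X)) \<le> C * cmod (za X)"
proof -
  obtain p where p: "V = qmult p \<or> V = (\<lambda>X. qmult X p)" using assms by (auto simp: invariant_field_def)
  have "cmod (zb X) \<le> cmod (za X)" if "X \<in> HRplus" for X using that by (simp add: HRplus_iff)
  thus ?thesis using p za_qmult_bound by (intro exI[of _ "qnorm1 p"]) (auto simp: qnorm1_def)
qed

lemma tame_za: "tame \<rho> 1 za" and tame_zb: "tame \<rho> 1 zb"
proof -
  show "tame \<rho> 1 za"
    by (rule tameI[where f' = "\<lambda>X. za" and C = 1])
      (use invariant_field_bound shell_HRplus in \<open>auto intro: bounded_linear_imp_has_derivative bounded_linear_za, blast\<close>)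
  show "tame \<rho> 1 zb"
  proof (rule tameI[where f' = "\<lambda>X. zb" and C = 1])
    show "cmod (zb X) \<le> 1 * cmod (za X) powi 1" if "X \<in> shell \<rho>" for X
      using shell_HRplus[OF that] by (simp add: HRplus_iff)
  qed (use invariant_field_bound shell_HRplus in \<open>auto intro: bounded_linear_imp_has_derivative bounded_linear_zb, blast\<close>)
qed

lemma tame_inverse_za: "tame \<rho> (-1) (\<lambda>X. 1 / za X)"
proof (rule tameI[where f' = "\<lambda>X h. - (za h) / (za X * za X)" and C = 1])
  show "((\<lambda>X. 1 / za X) has_derivative (\<lambda>h. - (za h) / (za X * za X))) (at X)" if "X \<in> HRplus" for X
  proof -
    have "(za has_derivative za) (at X)" by (rule bounded_linear_imp_has_derivative[OF bounded_linear_za])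
    from has_derivative_divide[OF has_derivative_const this HRplus_za_nz[OF that], of 1]
    show ?thesis by (simp add: field_simps)
  qed
  show "cmod (1 / za X) \<le> 1 * cmod (za X) powi - 1" if "X \<in> shell \<rho>" for X
    by (simp add: norm_divide power_int_minus inverse_eq_divide)
  fix V assume "invariant_field V"
  then obtain C where C: "C \<ge> 0" "\<And>X. X \<in> HRplus \<Longrightarrow> cmod (za (V X)) \<le> C * cmod (za X)" using invariant_field_bound by blast
  show "\<exists>C. \<forall>X\<in>shell \<rho>. cmod (- (za (V X)) / (za X * za X)) \<le> C * cmod (za X) powi - 1"
  proof (intro exI[of _ C] ballI)
    fix X assume X: "X \<in> shell \<rho>"
    have z: "cmod (za X) > 0" using HRplus_za_nz[OF shell_HRplus[OF X]] by simp
    have "cmod (- (za (V X)) / (za X * za X)) = cmod (za (V X)) / (cmod (za X) * cmod (za X))" by (simp add: norm_divide norm_mult)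
    also have "\<dots> \<le> C * cmod (za X) / (cmod (za X) * cmod (za X))"
      using C(2)[OF shell_HRplus[OF X]] by (intro divide_right_mono) auto
    also have "\<dots> = C * cmod (za X) powi - 1" using z by (simp add: power_int_minus field_simps)
    finally show "cmod (- (za (V X)) / (za X * za X)) \<le> C * cmod (za X) powi - 1" .
  qed
qed

text \<open>The terms of the derivative are of order \<open>|za|^2\<close>, but along an invariant
  field with generator \<open>p\<close> they combine to \<open>2 Re (za p) * qN X\<close>, which is
  bounded on a shell. The cancellation is what gives degree 0.\<close>

lemma tame_qN: "tame \<rho> 0 (\<lambda>X. complex_of_real (qN X))"
proof (rule tameI[where C = "\<rho>\<^sup>2" and f' = "\<lambda>X h. of_real (2 * Re (za h * cnj (za X) - zb h * cnj (zb X)))"])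
  show "((\<lambda>X. complex_of_real (qN X)) has_derivative (\<lambda>h. of_real (2 * Re (za h * cnj (za X) - zb h * cnj (zb X))))) (at X)" for X
  proof -
    have a: "(za has_derivative za) (at X)" and b: "(zb has_derivative zb) (at X)"
      by (auto intro: bounded_linear_imp_has_derivative bounded_linear_za bounded_linear_zb)
    have "((\<lambda>X. za X * cnj (za X) - zb X * cnj (zb X)) has_derivative
       (\<lambda>h. (za X * cnj (za h) + za h * cnj (za X)) - (zb X * cnj (zb h) + zb h * cnj (zb X)))) (at X)"
      by (intro has_derivative_diff has_derivative_mult has_derivative_cnj a b)
    moreover have "(za X * cnj (za h) + za h * cnj (za X)) - (zb X * cnj (zb h) + zb h * cnj (zb X)) = of_real (2 * Re (za h * cnj (za X) - zb h * cnj (zb X)))" for h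
      by (simp add: complex_eq_iff)
    ultimately show ?thesis by (simp add: qN_complex)
  qed
  show "cmod (of_real (qN X)) \<le> \<rho>\<^sup>2 * cmod (za X) powi 0" if "X \<in> shell \<rho>" for X
    using that by (simp add: shell_def HRplus_def)
  fix V assume "invariant_field V"
  then obtain p where p: "V = qmult p \<or> V = (\<lambda>X. qmult X p)" by (auto simp: invariant_field_def)
  have E: "Re (za (V X) * cnj (za X) - zb (V X) * cnj (zb X)) = Re (za p) * qN X" for X
    using p
  proof
    assume "V = qmult p"
    hence "za (V X) * cnj (za X) - zb (V X) * cnj (zb X) = za p * of_real (qN X)"
      by (simp add: qN_complex za_qmult zb_qmult algebra_simps)
    thus ?thesis by simp
  next
    assume V: "V = (\<lambda>X. qmult X p)"
    define E where "E = za (V X) * cnj (za X) - zb (V X) * cnj (zb X)"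
    have "E + cnj E = of_real (2 * Re (za p)) * of_real (qN X)"
      unfolding complex_add_cnj[symmetric] by (simp add: E_def V qN_complex za_qmult zb_qmult algebra_simps)
    from arg_cong[OF this, of Re] have "Re E = Re (za p) * qN X" by simp
    thus ?thesis by (simp only: E_def)
  qed
  show "\<exists>C. \<forall>X\<in>shell \<rho>. cmod (of_real (2 * Re (za (V X) * cnj (za X) - zb (V X) * cnj (zb X)))) \<le> C * cmod (za X) powi 0"
    unfolding E norm_of_real
    by (intro exI[of _ "2 * \<bar>Re (za p)\<bar> * \<rho>\<^sup>2"]) (auto simp: abs_mult shell_def HRplus_def intro!: mult_left_mono)
qed

text \<open>Each term has degree \<open>i - (k + \<beta> + i) + (\<alpha> - i) + (\<beta> -
  (\<alpha> - i)) = - k\<close>. When \<open>\<alpha> - i > \<beta>\<close> the truncated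
  subtraction breaks this count, but then the coefficient is zero.\<close>

lemma tame_tpos: "tame \<rho> (- int k) (tpos k \<alpha> \<beta>)"
proof -
  have "tame \<rho> (- int k) (\<lambda>X. \<Sum>i = 0..\<alpha>. of_nat (\<alpha> choose i) *
     ((-1) ^ i * pochhammer (of_nat (k + \<beta>)) i * cnj (zb X) ^ i / za X ^ (k + \<beta> + i)) *
     ((\<Prod>j<\<alpha> - i. of_nat (\<beta> - j)) * cnj (za X) ^ (\<alpha> - i) * zb X ^ (\<beta> - (\<alpha> - i))))"
  proof (rule tame_sum)
    fix i assume i: "i \<in> {0..\<alpha>}"
    define c :: complex where "c = of_nat (\<alpha> choose i) * ((-1) ^ i * pochhammer (of_nat (k + \<beta>)) i) * (\<Prod>j<\<alpha> - i. of_nat (\<beta> - j))"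
    have eq: "of_nat (\<alpha> choose i) * ((-1) ^ i * pochhammer (of_nat (k + \<beta>)) i * cnj (zb X) ^ i / za X ^ (k + \<beta> + i)) *
     ((\<Prod>j<\<alpha> - i. of_nat (\<beta> - j)) * cnj (za X) ^ (\<alpha> - i) * zb X ^ (\<beta> - (\<alpha> - i)))
       = c * (cnj (zb X) ^ i * ((1 / za X) ^ (k + \<beta> + i) * (cnj (za X) ^ (\<alpha> - i) * zb X ^ (\<beta> - (\<alpha> - i)))))" for X
      by (simp add: c_def power_one_over field_simps)
    show "tame \<rho> (- int k) (\<lambda>X. of_nat (\<alpha> choose i) * ((-1) ^ i * pochhammer (of_nat (k + \<beta>)) i * cnj (zb X) ^ i / za X ^ (k + \<beta> + i)) *
     ((\<Prod>j<\<alpha> - i. of_nat (\<beta> - j)) * cnj (za X) ^ (\<alpha> - i) * zb X ^ (\<beta> - (\<alpha> - i))))"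
      unfolding eq
    proof (cases "\<alpha> - i \<le> \<beta>")
      case True
      have "tame \<rho> (0 + (1 * int i + ((-1) * int (k + \<beta> + i) + (1 * int (\<alpha> - i) + 1 * int (\<beta> - (\<alpha> - i))))))
         (\<lambda>X. c * (cnj (zb X) ^ i * ((1 / za X) ^ (k + \<beta> + i) * (cnj (za X) ^ (\<alpha> - i) * zb X ^ (\<beta> - (\<alpha> - i))))))"
        by (intro tame_mult tame_const tame_power tame_cnj tame_za tame_zb tame_inverse_za)
      also have "(0 + (1 * int i + ((-1) * int (k + \<beta> + i) + (1 * int (\<alpha> - i) + 1 * int (\<beta> - (\<alpha> - i)))))) = - int k"
        using True i by (simp add: of_nat_diff)
      finally show "tame \<rho> (- int k) (\<lambda>X. c * (cnj (zb X) ^ i * ((1 / za X) ^ (k + \<beta> + i) * (cnj (za X) ^ (\<alpha> - i) * zb X ^ (\<beta> - (\<alpha> - i))))))" .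
    next
      case False
      have "(\<Prod>j<\<alpha> - i. of_nat (\<beta> - j)) = (0::complex)"
        using False by (intro prod_zero bexI[of _ \<beta>]) auto
      hence "c = 0" by (simp add: c_def)
      thus "tame \<rho> (- int k) (\<lambda>X. c * (cnj (zb X) ^ i * ((1 / za X) ^ (k + \<beta> + i) * (cnj (za X) ^ (\<alpha> - i) * zb X ^ (\<beta> - (\<alpha> - i))))))"
        by (simp add: tame_zero)
    qed
  qed simp
  from tame_mult[OF tame_const[of \<rho> "1 / fact \<alpha>"] this] show ?thesis
    by (simp add: tpos_def[abs_def] field_simps)
qed

section \<open>Homogeneity and the degree operator\<close>

lemma deg_tilde_eq:
  assumes "f differentiable (at X)"
  shows "deg_tilde f X = f X + frechet_derivative f (at X) X"
proof -
  have lin: "linear (frechet_derivative f (at X))" using linear_frechet_derivative[OF assms] .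
  have X: "(\<Sum>i\<in>UNIV. X$i *\<^sub>R axis i (1::real)) = X"
    by (simp add: vec_eq_iff axis_def if_distrib[of "\<lambda>x. _ * x"] cong: if_cong)
  have "frechet_derivative f (at X) X = frechet_derivative f (at X) (\<Sum>i\<in>UNIV. X$i *\<^sub>R axis i 1)" by (simp only: X)
  also have "\<dots> = (\<Sum>i\<in>UNIV. of_real (X$i) * partial i f X)"
    by (simp add: linear_sum[OF lin] linear_scale[OF lin] partial_def scaleR_conv_of_real[where 'a=complex])
  finally show ?thesis by (simp add: deg_tilde_def)
qed

text \<open>Euler's identity, by differentiating along the ray through \<open>X\<close> at
  \<open>c = 1\<close>; the extra 1 is the constant term of the operator.\<close>

lemma deg_tilde_homogeneous:
  assumes f: "f differentiable (at X)" and hom: "\<And>c. c > 0 \<Longrightarrow> f (c *\<^sub>R X) = of_real (c powi d) * f X"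
  shows "deg_tilde f X = of_int (1 + d) * f X"
proof -
  have "(f has_derivative frechet_derivative f (at X)) (at (1 *\<^sub>R X))" using f by (simp add: frechet_derivative_works)
  moreover have "((\<lambda>c::real. c *\<^sub>R X) has_derivative (\<lambda>h. h *\<^sub>R X)) (at 1)"
    by (auto intro!: derivative_eq_intros)
  ultimately have "((\<lambda>c. f (c *\<^sub>R X)) has_derivative (\<lambda>h. frechet_derivative f (at X) (h *\<^sub>R X))) (at 1)"
    using has_derivative_compose[of "\<lambda>c::real. c *\<^sub>R X" "\<lambda>h. h *\<^sub>R X" 1 UNIV f "frechet_derivative f (at X)"] by simp
  hence 1: "((\<lambda>c. of_real (c powi d) * f X) has_derivative (\<lambda>h. frechet_derivative f (at X) (h *\<^sub>R X))) (at 1)"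
    by (rule has_derivative_transform_within_open[of _ _ _ _ "{0<..}"]) (auto simp: hom)
  have "((\<lambda>c::real. c powi d) has_real_derivative of_int d) (at 1)"
    by (auto intro!: derivative_eq_intros)
  hence "((\<lambda>c::real. c powi d) has_derivative (\<lambda>h. of_int d * h)) (at 1)" by (simp add: has_field_derivative_def)
  hence 2: "((\<lambda>c. of_real (c powi d) * f X) has_derivative (\<lambda>h. of_real (of_int d * h) * f X)) (at 1)"
    by (intro has_derivative_mult_left has_derivative_of_real)
  have "(\<lambda>h. frechet_derivative f (at X) (h *\<^sub>R X)) = (\<lambda>h. of_real (of_int d * h) * f X)"
    by (rule has_derivative_unique[OF 1 2])
  from fun_cong[OF this, of 1] have "frechet_derivative f (at X) X = of_int d * f X" by simp
  thus ?thesis by (simp add: deg_tilde_eq[OF f] algebra_simps)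
qed

text \<open>Read off from the Cauchy integral, since \<open>hgen\<close> is homogeneous of degree
  \<open>\<beta> - (k + \<beta>)\<close>.\<close>

lemma tpos_homogeneous:
  assumes X: "X \<in> HRplus" and c: "c > 0"
  shows "tpos k \<alpha> \<beta> (c *\<^sub>R X) = of_real (c powi (- int k)) * tpos k \<alpha> \<beta> X"
proof -
  have cX: "c *\<^sub>R X \<in> HRplus" using X c by (simp add: HRplus_iff norm_mult)
  have h: "hgen k \<beta> \<eta> (c *\<^sub>R X) = of_real (c powi (- int k)) * hgen k \<beta> \<eta> X" for \<eta>
  proof -
    have e: "za (c *\<^sub>R X) + \<eta> * cnj (zb (c *\<^sub>R X)) = of_real c * (za X + \<eta> * cnj (zb X))"
       "zb (c *\<^sub>R X) + \<eta> * cnj (za (c *\<^sub>R X)) = of_real c * (zb X + \<eta> * cnj (za X))"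
      by (simp_all add: algebra_simps)
    have "(of_real c * Q) ^ \<beta> / (of_real c * P) ^ (k + \<beta>) = of_real (c powi (- int k)) * (Q ^ \<beta> / P ^ (k + \<beta>))" for P Q :: complex
      using c by (simp add: power_mult_distrib power_add power_int_minus field_simps)
    thus ?thesis unfolding hgen_def e .
  qed
  have "((\<lambda>t. of_real (c powi (- int k)) * (hgen k \<beta> (of_real 1 * cis t) X / cis t ^ \<alpha>)) has_integral of_real (c powi (- int k)) * (2 * of_real pi * of_real 1 ^ \<alpha> * tpos k \<alpha> \<beta> X)) {0..2*pi}"
    by (intro has_integral_mult_right tpos_integral[OF X]) auto
  moreover have "((\<lambda>t. hgen k \<beta> (of_real 1 * cis t) (c *\<^sub>R X) / cis t ^ \<alpha>) has_integral (2 * of_real pi * of_real 1 ^ \<alpha> * tpos k \<alpha> \<beta> (c *\<^sub>R X))) {0..2*pi}"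
    by (intro tpos_integral[OF cX]) auto
  ultimately have "of_real (c powi (- int k)) * (2 * of_real pi * of_real 1 ^ \<alpha> * tpos k \<alpha> \<beta> X) = 2 * of_real pi * of_real 1 ^ \<alpha> * tpos k \<alpha> \<beta> (c *\<^sub>R X)"
    unfolding h by (intro has_integral_unique) (auto simp: mult_ac)
  from sym[OF this] have "2 * of_real pi * tpos k \<alpha> \<beta> (c *\<^sub>R X) = 2 * of_real pi * (of_real (c powi (- int k)) * tpos k \<alpha> \<beta> X)"
    by (simp only: of_real_1 power_one mult_1_right mult_1_left mult_ac)
  thus ?thesis by (simp only: mult_cancel_left) simp
qed

text \<open>\<open>f\<close> stands for a Borel function that agrees with
  \<open>deg_tilde \<phi>\<close> on the hyperboloid; off the cone \<open>deg_tilde \<phi>\<close>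
  may take arbitrary values. The norm in the integrand cancels the density of \<open>dS\<close>
  against \<open>Mh\<close>.\<close>

lemma I_eps_ker:
  assumes R: "R > 0" and [measurable]: "f \<in> borel_measurable borel" and f: "\<And>X. qN X = R\<^sup>2 \<Longrightarrow> deg_tilde \<phi> X = f X"
  shows "set_integrable (dS R) (hyperboloid R) (I_integrand \<sigma> \<epsilon> \<phi> W) \<longleftrightarrow> integrable (Mh R) (\<lambda>X. f X / ker \<sigma> \<epsilon> W X)"
    and "I_eps \<sigma> R \<phi> W \<epsilon> = 1 / (2 * of_real pi ^ 2) * (\<integral>X. f X / ker \<sigma> \<epsilon> W X \<partial>Mh R)"
proof -
  define G where "G X = indicator (hyperboloid R) X *\<^sub>R (f X / ker \<sigma> \<epsilon> W X / of_real (norm X))" for X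
  have [measurable]: "hyperboloid R \<in> sets borel" unfolding hyperboloid_def by measurable
  have [measurable]: "G \<in> borel_measurable borel" unfolding G_def by measurable
  have eq: "(\<lambda>X. indicator (hyperboloid R) X *\<^sub>R I_integrand \<sigma> \<epsilon> \<phi> W X) = G"
  proof
    fix X
    have "complex_of_real (qN (X - W)) + of_real \<sigma> * \<i> * of_real \<epsilon> = ker \<sigma> \<epsilon> W X"
      by (simp add: ker_def complex_eq_iff)
    thus "indicator (hyperboloid R) X *\<^sub>R I_integrand \<sigma> \<epsilon> \<phi> W X = G X"
      using f[of X] by (cases "X \<in> hyperboloid R") (simp_all add: G_def I_integrand_def hyperboloid_def)
  qed
  have ae: "AE X in Mh R. norm X *\<^sub>R G X = f X / ker \<sigma> \<epsilon> W X"
  proof (rule AE_Mh_qN)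
    fix X assume X: "qN X = R\<^sup>2"
    have "norm X \<noteq> 0" using X R by (auto simp: qN_eq)
    thus "norm X *\<^sub>R G X = f X / ker \<sigma> \<epsilon> W X" using X by (simp add: G_def hyperboloid_def scaleR_conv_of_real[where 'a=complex])
  qed measurable
  have "set_integrable (dS R) (hyperboloid R) (I_integrand \<sigma> \<epsilon> \<phi> W) \<longleftrightarrow> integrable (density (Mh R) (\<lambda>X. ennreal (norm X))) G"
    unfolding set_integrable_def eq dS_eq_density[OF R] ..
  also have "\<dots> \<longleftrightarrow> integrable (Mh R) (\<lambda>X. norm X *\<^sub>R G X)"
    by (rule integrable_density) auto
  also have "\<dots> \<longleftrightarrow> integrable (Mh R) (\<lambda>X. f X / ker \<sigma> \<epsilon> W X)"
    by (rule integrable_cong_AE[OF _ _ ae]) auto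
  finally show "set_integrable (dS R) (hyperboloid R) (I_integrand \<sigma> \<epsilon> \<phi> W) \<longleftrightarrow> \<dots>" .
  have "(LINT X:hyperboloid R|dS R. I_integrand \<sigma> \<epsilon> \<phi> W X) = (\<integral>X. G X \<partial>density (Mh R) (\<lambda>X. ennreal (norm X)))"
    unfolding set_lebesgue_integral_def eq dS_eq_density[OF R] ..
  also have "\<dots> = (\<integral>X. norm X *\<^sub>R G X \<partial>Mh R)" by (rule integral_density) auto
  also have "\<dots> = (\<integral>X. f X / ker \<sigma> \<epsilon> W X \<partial>Mh R)" by (rule integral_cong_AE[OF _ _ ae]) auto
  finally show "I_eps \<sigma> R \<phi> W \<epsilon> = 1 / (2 * of_real pi ^ 2) * (\<integral>X. f X / ker \<sigma> \<epsilon> W X \<partial>Mh R)"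
    by (simp add: I_eps_def)
qed

section \<open>The generators as Taylor coefficients and as eigenfunctions of the degree\<close>

lemma ds_index_cases:
  assumes "ds_index l m n"
  obtains k \<alpha> \<beta> :: nat where "k \<ge> 2" "l = - real k / 2" "m = real \<beta> - l \<and> n = real \<alpha> - l \<or> m = l - real \<beta> \<and> n = l - real \<alpha>"
proof -
  obtain j :: nat where j: "l = - 1 - real j / 2" and ints: "m - l \<in> \<int>" "n - l \<in> \<int>"
    and s: "m \<ge> - l \<and> n \<ge> - l \<or> m \<le> l \<and> n \<le> l"
    using assms by (auto simp: ds_index_def)
  have l: "l = - real (j + 2) / 2" using j by simp
  have nat: "\<exists>b::nat. x = real b" if "x \<in> \<int>" "x \<ge> 0" for x :: real
    using that by (metis Ints_cases of_int_0_le_iff zero_le_imp_eq_int of_int_of_nat_eq)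
  have "2 * l = of_int (- int (j + 2))" using l by simp
  hence two: "2 * l \<in> \<int>" by (metis Ints_of_int)
  show ?thesis
  proof (rule disjE[OF s])
    assume *: "m \<ge> - l \<and> n \<ge> - l"
    have "m + l = (m - l) + 2 * l" "n + l = (n - l) + 2 * l" by simp_all
    hence "m + l \<in> \<int>" "n + l \<in> \<int>" using ints two by (metis Ints_add)+
    then obtain \<beta> \<alpha> :: nat where "m + l = real \<beta>" "n + l = real \<alpha>" using nat[of "m + l"] nat[of "n + l"] * by auto
    thus ?thesis using that[of "j + 2" \<beta> \<alpha>] l by auto
  next
    assume *: "m \<le> l \<and> n \<le> l"
    have "l - m \<in> \<int>" "l - n \<in> \<int>" using ints by (metis Ints_minus minus_diff_eq)+
    then obtain \<beta> \<alpha> :: nat where "l - m = real \<beta>" "l - n = real \<alpha>" using nat[of "l - m"] nat[of "l - n"] * by auto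
    thus ?thesis using that[of "j + 2" \<beta> \<alpha>] l by (auto simp: algebra_simps)
  qed
qed

text \<open>The conjugates account for the indices \<open>m, n \<le> l\<close>.\<close>

definition is_tpos :: "nat \<Rightarrow> (real^4 \<Rightarrow> complex) \<Rightarrow> bool" where
  "is_tpos k \<tau> \<longleftrightarrow> (\<exists>\<alpha> \<beta>. \<tau> = tpos k \<alpha> \<beta> \<or> \<tau> = (\<lambda>X. cnj (tpos k \<alpha> \<beta> X)))"

lemma t_fun_is_tpos:
  assumes "ds_index l m n"
  obtains k \<tau> where "k \<ge> 2" "l = - real k / 2" "is_tpos k \<tau>" "\<forall>X\<in>HRplus. t_fun l n m X = \<tau> X"
proof -
  obtain k \<alpha> \<beta> where k: "k \<ge> 2" "l = - real k / 2" and mn: "m = real \<beta> - l \<and> n = real \<alpha> - l \<or> m = l - real \<beta> \<and> n = l - real \<alpha>"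
    using ds_index_cases[OF assms] by blast
  from mn show ?thesis
  proof
    assume "m = real \<beta> - l \<and> n = real \<alpha> - l"
    thus ?thesis using that[OF k, of "tpos k \<alpha> \<beta>"] t_fun_eq_tpos[OF _ k(2)] by (auto simp: is_tpos_def)
  next
    assume *: "m = l - real \<beta> \<and> n = l - real \<alpha>"
    have "t_fun l n m X = cnj (tpos k \<alpha> \<beta> X)" if "X \<in> HRplus" for X
    proof -
      have "t_fun l n m X = cnj (t_fun l (-n) (-m) X)"
        by (rule t_fun_cnj[of _ _ "int \<beta>" "- int (k + \<beta>)" _ "- int \<alpha>"]) (use * k in auto)
      also have "t_fun l (-n) (-m) X = tpos k \<alpha> \<beta> X"
        by (rule t_fun_eq_tpos[OF that k(2)]) (use * in auto)
      finally show ?thesis .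
    qed
    thus ?thesis using that[OF k, of "\<lambda>X. cnj (tpos k \<alpha> \<beta> X)"] by (auto simp: is_tpos_def)
  qed
qed

lemma tame_is_tpos: "is_tpos k \<tau> \<Longrightarrow> tame \<rho> (- int k) \<tau>"
  by (auto simp: is_tpos_def intro: tame_tpos tame_cnj)

lemma borel_measurable_is_tpos: "is_tpos k \<tau> \<Longrightarrow> \<tau> \<in> borel_measurable borel"
  by (auto simp: is_tpos_def)

lemma is_tpos_homogeneous:
  "is_tpos k \<tau> \<Longrightarrow> X \<in> HRplus \<Longrightarrow> c > 0 \<Longrightarrow> \<tau> (c *\<^sub>R X) = of_real (c powi (- int k)) * \<tau> X"
  by (auto simp: is_tpos_def tpos_homogeneous)

lemma HRplus_scaleR: "X \<in> HRplus \<Longrightarrow> c > 0 \<Longrightarrow> c *\<^sub>R X \<in> HRplus"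
  by (simp add: HRplus_def qN_scaleR)

text \<open>With \<open>k = -2l\<close>, the exponent \<open>-2l - 1\<close> is
  \<open>k - 1\<close>. The degrees of homogeneity are \<open>- k\<close> and
  \<open>2 (k - 1) - k = k - 2\<close>, so the degree operator has the opposite eigenvalues
  \<open>1 - k\<close> and \<open>k - 1\<close>.\<close>

lemma generator_properties:
  assumes k: "k \<ge> 2" "l = - real k / 2" and \<tau>: "is_tpos k \<tau>" and t0: "\<forall>X\<in>HRplus. t_fun l n m X = \<tau> X"
  shows "X \<in> HRplus \<Longrightarrow> N_t_fun l n m X = of_real (qN X) ^ (k - 1) * \<tau> X"
    and "tame \<rho> (- int k) (t_fun l n m)" "tame \<rho> (- int k) (N_t_fun l n m)"
    and "X \<in> HRplus \<Longrightarrow> deg_tilde (t_fun l n m) X = of_int (1 - int k) * t_fun l n m X"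
    and "X \<in> HRplus \<Longrightarrow> deg_tilde (N_t_fun l n m) X = of_int (int k - 1) * N_t_fun l n m X"
proof -
  note t = bspec[OF t0]
  have N: "N_t_fun l n m X = of_real (qN X) ^ (k - 1) * \<tau> X" if "X \<in> HRplus" for X
  proof -
    have "- 2 * l - 1 = real (k - 1)" using k by (simp add: of_nat_diff)
    moreover have "qN X > 0" using that by (simp add: HRplus_def)
    ultimately show ?thesis by (simp add: N_t_fun_def t[OF that] powr_realpow)
  qed
  thus "X \<in> HRplus \<Longrightarrow> N_t_fun l n m X = of_real (qN X) ^ (k - 1) * \<tau> X" .
  show tt: "tame \<rho> (- int k) (t_fun l n m)" for \<rho>
    by (rule tame_cong[OF tame_is_tpos[OF \<tau>]]) (simp add: t)
  show tN: "tame \<rho> (- int k) (N_t_fun l n m)" for \<rho>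
  proof (rule tame_cong)
    have "tame \<rho> (0 * int (k - 1) + (- int k)) (\<lambda>X. of_real (qN X) ^ (k - 1) * \<tau> X)"
      by (intro tame_mult tame_power tame_qN tame_is_tpos \<tau>)
    thus "tame \<rho> (- int k) (\<lambda>X. of_real (qN X) ^ (k - 1) * \<tau> X)" by simp
  qed (simp add: N)
  show "deg_tilde (t_fun l n m) X = of_int (1 - int k) * t_fun l n m X" if X: "X \<in> HRplus"
  proof -
    have "deg_tilde (t_fun l n m) X = of_int (1 + (- int k)) * t_fun l n m X"
    proof (rule deg_tilde_homogeneous)
      show "t_fun l n m differentiable (at X)" using tt[of 1] X by (auto simp: tame_def)
    qed (simp add: t HRplus_scaleR X is_tpos_homogeneous[OF \<tau>])
    thus ?thesis by simp
  qed
  show "deg_tilde (N_t_fun l n m) X = of_int (int k - 1) * N_t_fun l n m X" if X: "X \<in> HRplus"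
  proof -
    have "deg_tilde (N_t_fun l n m) X = of_int (1 + (int k - 2)) * N_t_fun l n m X"
    proof (rule deg_tilde_homogeneous)
      show "N_t_fun l n m differentiable (at X)" using tN[of 1] X by (auto simp: tame_def)
      fix c :: real assume c: "c > 0"
      have "(c\<^sup>2) ^ (k - 1) * c powi (- int k) = c powi (2 * int (k - 1) + (- int k))"
      proof -
        have "(c\<^sup>2) ^ (k - 1) = c powi int (2 * (k - 1))" by (simp only: power_int_of_nat power_mult)
        moreover have "c powi int (2 * (k - 1)) * c powi (- int k) = c powi (int (2 * (k - 1)) + (- int k))"
          using c by (intro power_int_add[symmetric]) simp
        ultimately show ?thesis by simp
      qed
      also have "2 * int (k - 1) + (- int k) = int k - 2" using k by simp
      finally have "complex_of_real ((c\<^sup>2) ^ (k - 1) * c powi (- int k)) = of_real (c powi (int k - 2))" by (rule arg_cong)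
      thus "N_t_fun l n m (c *\<^sub>R X) = of_real (c powi (int k - 2)) * N_t_fun l n m X"
        using c by (simp add: N HRplus_scaleR X is_tpos_homogeneous[OF \<tau>] qN_scaleR power_mult_distrib mult_ac)
    qed
    thus ?thesis by simp
  qed
qed

lemma hyperboloid_shell:
  assumes R: "R > 0" obtains \<rho> where "\<rho> > 1" "\<And>X. qN X = R\<^sup>2 \<Longrightarrow> X \<in> shell \<rho>"
proof
  define \<rho> where "\<rho> = 1 + R + 1 / R"
  show "\<rho> > 1" using R by (simp add: \<rho>_def add_pos_pos)
  fix X assume X: "qN X = R\<^sup>2"
  have "R \<le> \<rho>" "1 / R \<le> \<rho>" using R by (simp_all add: \<rho>_def)
  hence "R\<^sup>2 \<le> \<rho>\<^sup>2" "(1 / R)\<^sup>2 \<le> \<rho>\<^sup>2" using R by (auto intro!: power_mono)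
  moreover have "1 / \<rho>\<^sup>2 \<le> R\<^sup>2" using calculation(2) R \<open>\<rho> > 1\<close> by (simp add: power_divide field_simps)
  ultimately show "X \<in> shell \<rho>" using X R by (simp add: shell_def HRplus_def)
qed

lemma wbounded_tame:
  assumes R: "R > 0" and k: "k \<ge> 2" and f: "\<And>\<rho>. tame \<rho> (- int k) f"
  shows "\<exists>S. wbounded R S f"
proof -
  obtain \<rho> where \<rho>: "\<rho> > 1" "\<And>X. qN X = R\<^sup>2 \<Longrightarrow> X \<in> shell \<rho>" using hyperboloid_shell[OF R] by blast
  obtain C where C: "C \<ge> 0" "\<And>X. X \<in> shell \<rho> \<Longrightarrow> cmod (f X) \<le> C * cmod (za X) powi (- int k)" using tameD(2)[OF f] by blast
  obtain S0 where S0: "S0 \<ge> 0" "\<And>f C. C \<ge> 0 \<Longrightarrow> (\<And>X. qN X = R\<^sup>2 \<Longrightarrow> cmod (f X) \<le> C / cmod (za X) ^ k) \<Longrightarrow> wbounded R (C * S0) f"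
    using wbounded_za_power[OF R k] by metis
  have "wbounded R (C * S0) f"
    by (rule S0(2)[OF C(1)]) (use C(2)[OF \<rho>(2)] in \<open>simp add: power_int_minus divide_inverse\<close>)
  thus ?thesis ..
qed

section \<open>Limits on the generators\<close>

text \<open>The limit of \<open>(w * y)^(k - 1)\<close> for the kernel root \<open>y\<close>, which
  tends to \<open>1 / w\<close> or to \<open>w / R^2\<close>.\<close>

definition jump_const :: "real \<Rightarrow> nat \<Rightarrow> real \<Rightarrow> real" where
  "jump_const R k w = (if w \<ge> R then 1 else (w\<^sup>2 / R\<^sup>2) ^ (k - 1))"

text \<open>The eigenvalue \<open>1 - k\<close> and the normalization \<open>1 / (2 * pi^2)\<close>
  cancel the constants of \<open>kernel_const\<close>, and one factor \<open>w\<close> of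
  \<open>w^k\<close> cancels its denominator.\<close>

lemma tendsto_kernel_const:
  assumes R: "R > 0" and w: "w > 0" and k: "k \<ge> 2"
  shows "((\<lambda>\<epsilon>. of_int (1 - int k) / (2 * of_real pi ^ 2) * (kernel_const R \<sigma> \<epsilon> k w * of_real w ^ k)) \<longlongrightarrow> of_real (jump_const R k w)) (at_right 0)"
proof -
  have eq: "of_int (1 - int k) / (2 * of_real pi ^ 2) * (kernel_const R \<sigma> \<epsilon> k w * of_real w ^ k) =
     kernel_root w (Complex (R\<^sup>2 + w\<^sup>2) (\<sigma> * \<epsilon>)) (R\<^sup>2) ^ (k - 1) * of_real w ^ (k - 1)" for \<epsilon>
  proof -
    have k1: "of_int (1 - int k) = - (of_nat (k - 1) :: complex)" using k by (simp add: of_nat_diff)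
    have wk: "complex_of_real w ^ k = of_real w * of_real w ^ (k - 1)" using k by (simp flip: power_Suc)
    have "- c / (2 * p) * (- (2 * p * y / (of_real w * c)) * (of_real w * z)) = y * z" if "c \<noteq> 0" "p \<noteq> 0" for c p y z :: complex
      using that w by (simp add: field_simps)
    from this[of "of_nat (k - 1)" "of_real pi ^ 2"] show ?thesis using k
      unfolding kernel_const_def k1 wk by simp
  qed
  have "((\<lambda>\<epsilon>. kernel_root w (Complex (R\<^sup>2 + w\<^sup>2) (\<sigma> * \<epsilon>)) (R\<^sup>2) ^ (k - 1) * of_real w ^ (k - 1)) \<longlongrightarrow>
     of_real (if w \<ge> R then 1 / w else w / R\<^sup>2) ^ (k - 1) * of_real w ^ (k - 1)) (at_right 0)"
    by (intro tendsto_intros tendsto_kernel_root R w)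
  moreover have "complex_of_real (if w \<ge> R then 1 / w else w / R\<^sup>2) ^ (k - 1) * of_real w ^ (k - 1) = of_real (jump_const R k w)"
  proof -
    have "(if w \<ge> R then 1 / w else w / R\<^sup>2) ^ (k - 1) * w ^ (k - 1) = jump_const R k w"
      using w by (simp add: jump_const_def power2_eq_square flip: power_mult_distrib)
    thus ?thesis by (metis of_real_mult of_real_power)
  qed
  ultimately show ?thesis unfolding eq by simp
qed

text \<open>Conjugation of the integral changes the sign of \<open>\<sigma>\<close>. As the limit
  for \<open>tpos\<close> is known for both signs and \<open>jump_const\<close> is real, the
  conjugate functions need no separate computation.\<close>

lemma tendsto_kernel_integral:
  assumes R: "R > 0" and W: "W \<in> HRplus" and k: "k \<ge> 2" and \<sigma>: "\<bar>\<sigma>\<bar> = (1::real)" and \<tau>: "is_tpos k \<tau>"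
  shows "((\<lambda>\<epsilon>. of_int (1 - int k) / (2 * of_real pi ^ 2) * (\<integral>X. \<tau> X / ker \<sigma> \<epsilon> W X \<partial>Mh R)) \<longlongrightarrow>
     of_real (jump_const R k (sqrt (qN W))) * \<tau> W) (at_right 0)"
proof -
  have pos: "((\<lambda>\<epsilon>. of_int (1 - int k) / (2 * of_real pi ^ 2) * (\<integral>X. tpos k \<alpha> \<beta> X / ker \<sigma> \<epsilon> W X \<partial>Mh R)) \<longlongrightarrow>
     of_real (jump_const R k (sqrt (qN W))) * tpos k \<alpha> \<beta> W) (at_right 0)" if \<sigma>: "\<bar>\<sigma>\<bar> = (1::real)" for \<sigma> \<alpha> \<beta>
  proof -
    have w: "sqrt (qN W) > 0" using W by (simp add: HRplus_def)
    have "((\<lambda>\<epsilon>. of_int (1 - int k) / (2 * of_real pi ^ 2) * (kernel_const R \<sigma> \<epsilon> k (sqrt (qN W)) * of_real (sqrt (qN W)) ^ k) * tpos k \<alpha> \<beta> W) \<longlongrightarrow>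
      of_real (jump_const R k (sqrt (qN W))) * tpos k \<alpha> \<beta> W) (at_right 0)"
      by (intro tendsto_mult tendsto_const tendsto_kernel_const R w k)
    moreover have "\<forall>\<^sub>F \<epsilon> in at_right 0. of_int (1 - int k) / (2 * of_real pi ^ 2) * (kernel_const R \<sigma> \<epsilon> k (sqrt (qN W)) * of_real (sqrt (qN W)) ^ k) * tpos k \<alpha> \<beta> W
       = of_int (1 - int k) / (2 * of_real pi ^ 2) * (\<integral>X. tpos k \<alpha> \<beta> X / ker \<sigma> \<epsilon> W X \<partial>Mh R)"
      using eventually_at_right_less[of "0::real"]
    proof eventually_elim
      case (elim \<epsilon>)
      have "(\<integral>X. tpos k \<alpha> \<beta> X / ker \<sigma> \<epsilon> W X \<partial>Mh R) = kernel_const R \<sigma> \<epsilon> k (sqrt (qN W)) * of_real (sqrt (qN W)) ^ k * tpos k \<alpha> \<beta> W"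
        using tpos_reproduced[OF R elim \<sigma> k] W unfolding reproduced_def by blast
      thus ?case by simp
    qed
    ultimately show ?thesis by (rule Lim_transform_eventually)
  qed
  obtain \<alpha> \<beta> where "\<tau> = tpos k \<alpha> \<beta> \<or> \<tau> = (\<lambda>X. cnj (tpos k \<alpha> \<beta> X))" using \<tau> by (auto simp: is_tpos_def)
  thus ?thesis
  proof
    assume "\<tau> = tpos k \<alpha> \<beta>" thus ?thesis using pos[OF \<sigma>] by simp
  next
    assume \<tau>: "\<tau> = (\<lambda>X. cnj (tpos k \<alpha> \<beta> X))"
    have "(\<integral>X. \<tau> X / ker \<sigma> \<epsilon> W X \<partial>Mh R) = cnj (\<integral>X. tpos k \<alpha> \<beta> X / ker (- \<sigma>) \<epsilon> W X \<partial>Mh R)" for \<epsilon>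
    proof -
      have "\<tau> X / ker \<sigma> \<epsilon> W X = cnj (tpos k \<alpha> \<beta> X / ker (- \<sigma>) \<epsilon> W X)" for X
      proof -
        have "cnj (ker (- \<sigma>) \<epsilon> W X) = ker \<sigma> \<epsilon> W X" by (simp add: ker_def complex_eq_iff)
        thus ?thesis by (simp add: \<tau>)
      qed
      thus ?thesis by (simp add: Bochner_Integration.integral_cnj[symmetric])
    qed
    moreover have "((\<lambda>\<epsilon>. cnj (of_int (1 - int k) / (2 * of_real pi ^ 2) * (\<integral>X. tpos k \<alpha> \<beta> X / ker (- \<sigma>) \<epsilon> W X \<partial>Mh R))) \<longlongrightarrow>
      cnj (of_real (jump_const R k (sqrt (qN W))) * tpos k \<alpha> \<beta> W)) (at_right 0)"
      by (intro tendsto_cnj pos) (use \<sigma> in simp)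
    ultimately show ?thesis by (simp add: \<tau>)
  qed
qed

lemma tendsto_I_eps_generators:
  assumes R: "R > 0" and W: "W \<in> HRplus" and k: "k \<ge> 2" "l = - real k / 2" and \<sigma>: "\<bar>\<sigma>\<bar> = (1::real)"
    and \<tau>: "is_tpos k \<tau>" and t0: "\<forall>X\<in>HRplus. t_fun l n m X = \<tau> X"
  shows "\<epsilon> > 0 \<Longrightarrow> set_integrable (dS R) (hyperboloid R) (I_integrand \<sigma> \<epsilon> (t_fun l n m) W)"
    and "\<epsilon> > 0 \<Longrightarrow> set_integrable (dS R) (hyperboloid R) (I_integrand \<sigma> \<epsilon> (N_t_fun l n m) W)"
    and "(I_eps \<sigma> R (t_fun l n m) W \<longlongrightarrow> of_real (jump_const R k (sqrt (qN W))) * \<tau> W) (at_right 0)"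
    and "(I_eps \<sigma> R (N_t_fun l n m) W \<longlongrightarrow> of_real (- (R ^ (2 * (k - 1)) * jump_const R k (sqrt (qN W)))) * \<tau> W) (at_right 0)"
proof -
  note t = bspec[OF t0]
  note gf = generator_properties[OF k \<tau> t0]
  note [measurable] = borel_measurable_is_tpos[OF \<tau>]
  have dt: "deg_tilde (t_fun l n m) X = of_int (1 - int k) * \<tau> X" if "qN X = R\<^sup>2" for X
    using that R gf(4)[of X] t[of X] by (simp add: HRplus_def)
  have dN: "deg_tilde (N_t_fun l n m) X = - (of_real (R ^ (2 * (k - 1)))) * (of_int (1 - int k) * \<tau> X)" if "qN X = R\<^sup>2" for X
  proof -
    have X: "X \<in> HRplus" using that R by (simp add: HRplus_def)
    have "complex_of_real (qN X) ^ (k - 1) = of_real (R ^ (2 * (k - 1)))" using that by (simp add: power_mult)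
    hence "deg_tilde (N_t_fun l n m) X = of_int (int k - 1) * (of_real (R ^ (2 * (k - 1))) * \<tau> X)"
      using gf(5)[OF X] gf(1)[OF X] by simp
    moreover have "of_int (int k - 1) * (a * b) = - a * (of_int (1 - int k) * b)" for a b :: complex
      by (simp add: algebra_simps)
    ultimately show ?thesis by simp
  qed
  obtain S where S: "wbounded R S \<tau>" using wbounded_tame[OF R k(1) tame_is_tpos[OF \<tau>]] by blast
  have int: "integrable (Mh R) (\<lambda>X. \<tau> X / ker \<sigma> \<epsilon> W X)" if "\<epsilon> > 0" for \<epsilon>
    by (rule ker_integrable[OF R W that \<sigma> _ S]) simp
  have c: "integrable (Mh R) (\<lambda>X. c * \<tau> X / ker \<sigma> \<epsilon> W X)" if "\<epsilon> > 0" for \<epsilon> c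
    using integrable_mult_right[OF int[OF that], of c] by simp
  have ci: "(\<integral>X. c * \<tau> X / ker \<sigma> \<epsilon> W X \<partial>Mh R) = c * (\<integral>X. \<tau> X / ker \<sigma> \<epsilon> W X \<partial>Mh R)" for \<epsilon> c
    using integral_mult_right_zero[of "Mh R" c "\<lambda>X. \<tau> X / ker \<sigma> \<epsilon> W X"] by simp
  note It = I_eps_ker[OF R _ dt, where \<sigma> = \<sigma> and W = W]
  note IN = I_eps_ker[OF R _ dN, where \<sigma> = \<sigma> and W = W]
  show "\<epsilon> > 0 \<Longrightarrow> set_integrable (dS R) (hyperboloid R) (I_integrand \<sigma> \<epsilon> (t_fun l n m) W)"
    by (subst It(1)) (use c in auto)
  show "\<epsilon> > 0 \<Longrightarrow> set_integrable (dS R) (hyperboloid R) (I_integrand \<sigma> \<epsilon> (N_t_fun l n m) W)"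
    by (subst IN(1)) (use c[of _ "- (of_real (R ^ (2 * (k - 1)))) * of_int (1 - int k)"] in \<open>auto simp: mult.assoc\<close>)
  have e: "I_eps \<sigma> R (t_fun l n m) W = (\<lambda>\<epsilon>. of_int (1 - int k) / (2 * of_real pi ^ 2) * (\<integral>X. \<tau> X / ker \<sigma> \<epsilon> W X \<partial>Mh R))"
    by (rule ext, subst It(2)) (simp_all add: ci)
  show "(I_eps \<sigma> R (t_fun l n m) W \<longlongrightarrow> of_real (jump_const R k (sqrt (qN W))) * \<tau> W) (at_right 0)"
    unfolding e by (rule tendsto_kernel_integral[OF R W k(1) \<sigma> \<tau>])
  have eN: "I_eps \<sigma> R (N_t_fun l n m) W = (\<lambda>\<epsilon>. - (of_real (R ^ (2 * (k - 1)))) * (of_int (1 - int k) / (2 * of_real pi ^ 2) * (\<integral>X. \<tau> X / ker \<sigma> \<epsilon> W X \<partial>Mh R)))"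
  proof
    fix \<epsilon>
    have "I_eps \<sigma> R (N_t_fun l n m) W \<epsilon> = 1 / (2 * of_real pi ^ 2) * (\<integral>X. - (of_real (R ^ (2 * (k - 1)))) * (of_int (1 - int k) * \<tau> X) / ker \<sigma> \<epsilon> W X \<partial>Mh R)"
      by (rule IN(2)) simp
    also have "(\<integral>X. - (of_real (R ^ (2 * (k - 1)))) * (of_int (1 - int k) * \<tau> X) / ker \<sigma> \<epsilon> W X \<partial>Mh R) = - (of_real (R ^ (2 * (k - 1)))) * of_int (1 - int k) * (\<integral>X. \<tau> X / ker \<sigma> \<epsilon> W X \<partial>Mh R)"
      unfolding mult.assoc[symmetric] by (rule ci)
    finally show "I_eps \<sigma> R (N_t_fun l n m) W \<epsilon> = - (of_real (R ^ (2 * (k - 1)))) * (of_int (1 - int k) / (2 * of_real pi ^ 2) * (\<integral>X. \<tau> X / ker \<sigma> \<epsilon> W X \<partial>Mh R))"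
      by (simp only: times_divide_eq_left times_divide_eq_right mult_ac mult_1_left)
  qed
  have "((\<lambda>\<epsilon>. - (of_real (R ^ (2 * (k - 1)))) * (of_int (1 - int k) / (2 * of_real pi ^ 2) * (\<integral>X. \<tau> X / ker \<sigma> \<epsilon> W X \<partial>Mh R))) \<longlongrightarrow>
     - (of_real (R ^ (2 * (k - 1)))) * (of_real (jump_const R k (sqrt (qN W))) * \<tau> W)) (at_right 0)"
    by (intro tendsto_mult tendsto_const tendsto_kernel_integral[OF R W k(1) \<sigma> \<tau>])
  thus "(I_eps \<sigma> R (N_t_fun l n m) W \<longlongrightarrow> of_real (- (R ^ (2 * (k - 1)) * jump_const R k (sqrt (qN W)))) * \<tau> W) (at_right 0)"
    unfolding eN by (simp add: mult.assoc)
qed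

lemma I_op_generators:
  assumes R: "R > 0" and W: "W \<in> HRplus" and \<sigma>: "\<bar>\<sigma>\<bar> = (1::real)" and ds: "ds_index l m n"
  shows "I_converges \<sigma> R (N_t_fun l n m) W \<and>
        (qN W \<le> R\<^sup>2 \<longrightarrow> I_op \<sigma> R (N_t_fun l n m) W = - N_t_fun l n m W) \<and>
        (qN W \<ge> R\<^sup>2 \<longrightarrow> I_op \<sigma> R (N_t_fun l n m) W = - complex_of_real (R powr (- 2 * (2 * l + 1))) * t_fun l n m W) \<and>
        I_converges \<sigma> R (t_fun l n m) W \<and>
        (qN W \<le> R\<^sup>2 \<longrightarrow> I_op \<sigma> R (t_fun l n m) W = complex_of_real (R powr (2 * (2 * l + 1))) * N_t_fun l n m W) \<and>
        (qN W \<ge> R\<^sup>2 \<longrightarrow> I_op \<sigma> R (t_fun l n m) W = t_fun l n m W)"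
proof -
  obtain k \<tau> where k: "k \<ge> 2" "l = - real k / 2" and \<tau>: "is_tpos k \<tau>" and t0: "\<forall>X\<in>HRplus. t_fun l n m X = \<tau> X"
    by (rule t_fun_is_tpos[OF ds])
  note t = bspec[OF t0]
  note lim = tendsto_I_eps_generators[OF R W k \<sigma> \<tau> t0]
  define w where "w = sqrt (qN W)"
  have w: "w > 0" "qN W = w\<^sup>2" using W by (auto simp: w_def HRplus_def)
  have le: "qN W \<le> R\<^sup>2 \<longleftrightarrow> w \<le> R" "qN W \<ge> R\<^sup>2 \<longleftrightarrow> R \<le> w"
    unfolding w(2) using w(1) R by (simp_all add: power_mono_iff)
  have jge: "jump_const R k w = 1" if "R \<le> w" using that by (simp add: jump_const_def)
  \<comment> \<open>At \<open>w = R\<close> the quotient is 1, so both formulas hold there, as the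
    overlapping cases of the theorem require.\<close>
  have jle: "jump_const R k w = (w\<^sup>2 / R\<^sup>2) ^ (k - 1)" if "w \<le> R" using that R by (auto simp: jump_const_def)
  have p1: "R powr (- 2 * (2 * l + 1)) = R ^ (2 * (k - 1))"
  proof -
    have "- 2 * (2 * l + 1) = real (2 * (k - 1))" using k by (simp add: of_nat_diff)
    thus ?thesis using R by (simp only: powr_realpow)
  qed
  have p2: "R powr (2 * (2 * l + 1)) = 1 / R ^ (2 * (k - 1))"
  proof -
    have "2 * (2 * l + 1) = - real (2 * (k - 1))" using k by (simp add: of_nat_diff)
    thus ?thesis using R by (simp only: powr_minus powr_realpow inverse_eq_divide)
  qed
  have NW: "N_t_fun l n m W = of_real (w ^ (2 * (k - 1))) * \<tau> W"
    using generator_properties(1)[OF k \<tau> t0 W] by (simp add: w(2) power_mult)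
  have conv: "I_converges \<sigma> R (N_t_fun l n m) W" "I_converges \<sigma> R (t_fun l n m) W"
    unfolding I_converges_def using lim by blast+
  have opt: "I_op \<sigma> R (t_fun l n m) W = of_real (jump_const R k w) * \<tau> W"
    unfolding I_op_def w_def by (rule tendsto_Lim[OF _ lim(3)]) simp
  have opN: "I_op \<sigma> R (N_t_fun l n m) W = of_real (- (R ^ (2 * (k - 1)) * jump_const R k w)) * \<tau> W"
    unfolding I_op_def w_def by (rule tendsto_Lim[OF _ lim(4)]) simp
  have jR: "R ^ (2 * (k - 1)) * (w\<^sup>2 / R\<^sup>2) ^ (k - 1) = w ^ (2 * (k - 1))"
    using R by (simp add: power_mult power_divide)
  have jR2: "(w\<^sup>2 / R\<^sup>2) ^ (k - 1) = 1 / R ^ (2 * (k - 1)) * w ^ (2 * (k - 1))"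
    using R by (simp add: power_mult power_divide)
  show ?thesis unfolding le p1 p2 NW
  proof (intro conjI impI conv)
    assume "w \<le> R"
    thus "I_op \<sigma> R (N_t_fun l n m) W = - (of_real (w ^ (2 * (k - 1))) * \<tau> W)"
      unfolding opN jle[OF \<open>w \<le> R\<close>] jR by simp
    show "I_op \<sigma> R (t_fun l n m) W = of_real (1 / R ^ (2 * (k - 1))) * (of_real (w ^ (2 * (k - 1))) * \<tau> W)"
      unfolding opt jle[OF \<open>w \<le> R\<close>] jR2 by simp
  next
    assume "R \<le> w"
    show "I_op \<sigma> R (N_t_fun l n m) W = - of_real (R ^ (2 * (k - 1))) * t_fun l n m W"
      unfolding opN jge[OF \<open>R \<le> w\<close>] t[OF W] by simp
    show "I_op \<sigma> R (t_fun l n m) W = t_fun l n m W"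
      unfolding opt jge[OF \<open>R \<le> w\<close>] t[OF W] by simp
  qed
qed

section \<open>Passage to the closure\<close>

text \<open>The degree operator written inside the enveloping algebra: the right action of the
  identity differentiates along \<open>X\<close> itself. In this form it is controlled by the
  seminorms.\<close>

definition D_deg :: "(real^4 \<Rightarrow> complex) \<Rightarrow> real^4 \<Rightarrow> complex" where
  "D_deg f X = f X + right_action qone f X"

lemma D_deg_enveloping: "D_deg \<in> enveloping_ops"
  using enveloping_ops.add[OF enveloping_ops.one enveloping_ops.right[of qone]] by (simp add: D_deg_def[abs_def])

lemma deg_tilde_D_deg: "f differentiable (at X) \<Longrightarrow> deg_tilde f X = D_deg f X"
  by (simp add: deg_tilde_eq D_deg_def right_action_def)

text \<open>\<open>qrot\<close> generates the rotations of \<open>za\<close>, written as the sum of a left and a right multiplication.\<close>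

definition qrot :: "real^4" where "qrot = quat (- \<i> / 2) 0"
text \<open>After transport by \<open>p = qunit W\<close>, left multiplication by
  \<open>qrot\<close> becomes left multiplication by its conjugate under \<open>p\<close>. The right
  multiplication commutes with the transport, so only \<open>D_left\<close> depends on
  \<open>W\<close>.\<close>

definition Lrot :: "real^4 \<Rightarrow> real^4" where "Lrot W = qmult (qunit W) (qmult qrot (qconj (qunit W)))"

definition D_left :: "real^4 \<Rightarrow> (real^4 \<Rightarrow> complex) \<Rightarrow> real^4 \<Rightarrow> complex" where
  "D_left W f = left_action (Lrot W) (D_deg f)"
definition D_right :: "(real^4 \<Rightarrow> complex) \<Rightarrow> real^4 \<Rightarrow> complex" where
  "D_right f = right_action qrot (D_deg f)"

lemma D_left_enveloping: "D_left W \<in> enveloping_ops"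
  using enveloping_ops.mult[OF enveloping_ops.left D_deg_enveloping] by (simp add: D_left_def[abs_def])
lemma D_right_enveloping: "D_right \<in> enveloping_ops"
  using enveloping_ops.mult[OF enveloping_ops.right D_deg_enveloping] by (simp add: D_right_def[abs_def])

definition twice_diff :: "(real^4 \<Rightarrow> complex) \<Rightarrow> bool" where
  "twice_diff f \<longleftrightarrow> (\<forall>X\<in>HRplus. f differentiable (at X) \<and> D_deg f differentiable (at X))"

text \<open>Set to 0 off \<open>HRplus\<close>, where \<open>D_deg f\<close> is unspecified, so that
  continuity on the open cone gives Borel measurability.\<close>

definition Fdeg :: "(real^4 \<Rightarrow> complex) \<Rightarrow> real^4 \<Rightarrow> complex" where
  "Fdeg f X = indicator HRplus X *\<^sub>R D_deg f X"

lemma borel_measurable_Fdeg: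
  assumes "twice_diff f" shows "Fdeg f \<in> borel_measurable borel"
proof -
  have "continuous_on HRplus (D_deg f)"
    using assms by (intro continuous_at_imp_continuous_on ballI differentiable_imp_continuous_within) (auto simp: twice_diff_def)
  thus ?thesis unfolding Fdeg_def[abs_def]
    using open_HRplus by (intro borel_measurable_continuous_on_indicator) auto
qed

lemma deg_tilde_Fdeg:
  assumes R: "R > 0" and f: "twice_diff f" and X: "qN X = R\<^sup>2"
  shows "deg_tilde f X = Fdeg f X"
proof -
  have "X \<in> HRplus" using R X by (simp add: HRplus_def)
  thus ?thesis using f by (simp add: Fdeg_def deg_tilde_D_deg twice_diff_def)
qed

lemma wt_norm_za:
  assumes X: "X \<in> HRplus"
  shows "wt (norm X) \<le> 2 * (1 + ln 2) ^ 4 * wt (cmod (za X))" "wt (cmod (za X)) \<le> 2 * (1 + ln 2) ^ 4 * wt (norm X)" "norm X > 0"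
proof -
  have zb: "cmod (zb X) \<le> cmod (za X)" using X by (simp add: HRplus_iff)
  have za: "cmod (za X) > 0" using HRplus_za_nz[OF X] by simp
  show n: "norm X > 0" using za by auto
  have "cmod (za X) \<le> norm X" by (rule power2_le_imp_le) (auto simp: norm_za_zb)
  moreover have "norm X \<le> 2 * cmod (za X)"
  proof (rule power2_le_imp_le)
    have "(cmod (zb X))\<^sup>2 \<le> (cmod (za X))\<^sup>2" using zb by (simp add: power_mono)
    moreover have "(2 * cmod (za X))\<^sup>2 = 4 * (cmod (za X))\<^sup>2" by (simp add: power_mult_distrib)
    ultimately show "(norm X)\<^sup>2 \<le> (2 * cmod (za X))\<^sup>2" unfolding norm_za_zb using zero_le_power2[of "cmod (za X)"] by linarith
  qed simp
  ultimately show "wt (norm X) \<le> 2 * (1 + ln 2) ^ 4 * wt (cmod (za X))" "wt (cmod (za X)) \<le> 2 * (1 + ln 2) ^ 4 * wt (norm X)"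
    using n za by (auto intro!: wt_compare)
qed

lemma hypc_has_vector_derivative:
  "((\<lambda>\<theta>. qmult p (hypc R v \<theta>)) has_vector_derivative qmult p (quat (- \<i> * za (hypc R v \<theta>)) 0)) (at \<theta>)"
proof -
  have bl: "bounded_linear (\<lambda>q. quat (fst q) (snd q))"
    by (rule linear_conv_bounded_linear[THEN iffD1], rule linearI; intro quat_eqI; simp add: scaleR_conv_of_real[where 'a=complex])
  have bp: "bounded_linear (qmult p)" using linear_qmult_left by (simp add: linear_conv_bounded_linear)
  define r where "r = complex_of_real (sqrt (R\<^sup>2 + (cmod v)\<^sup>2))"
  have "((\<lambda>\<theta>. (r * cis (-\<theta>), v)) has_vector_derivative (- \<i> * (r * cis (-\<theta>)), 0)) (at \<theta>)"
  proof (intro has_vector_derivative_Pair has_vector_derivative_const)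
    have "((\<lambda>z. r * exp (- \<i> * z)) has_field_derivative (r * (exp (- \<i> * of_real \<theta>) * (- \<i>)))) (at (of_real \<theta>))"
      by (auto intro!: derivative_eq_intros)
    from has_vector_derivative_real_field[OF this]
    show "((\<lambda>\<theta>. r * cis (-\<theta>)) has_vector_derivative - \<i> * (r * cis (-\<theta>))) (at \<theta>)"
      by (simp add: cis_conv_exp mult_ac)
  qed
  from bounded_linear.has_vector_derivative[OF bp bounded_linear.has_vector_derivative[OF bl this]]
  show ?thesis by (simp add: hypc_def r_def)
qed

text \<open>\<open>qrot\<close> commutes with the \<open>za\<close>-part, so the two products add up
  to \<open>- i * za\<close>. Moving it past the \<open>zb\<close>-part conjugates its entry, which
  changes the sign of the imaginary number, so there the two products cancel.\<close>

lemma rot_direction: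
  assumes p: "qN p = 1"
  shows "qmult p (quat (- \<i> * za Y) 0) = qmult (qmult p (qmult qrot (qconj p))) (qmult p Y) + qmult (qmult p Y) qrot"
proof -
  have "qmult (qmult p (qmult qrot (qconj p))) (qmult p Y) = qmult p (qmult qrot Y)"
    by (simp only: qmult_assoc qmult_qconj_left p scaleR_one)
  moreover have "qmult (qmult p Y) qrot = qmult p (qmult Y qrot)" by (rule qmult_assoc)
  moreover have "quat (- \<i> * za Y) 0 = qmult qrot Y + qmult Y qrot"
    by (intro quat_eqI) (simp_all add: qrot_def za_qmult zb_qmult)
  ultimately show ?thesis by (simp add: linear_add[OF linear_qmult_left])
qed

text \<open>Moving \<open>W\<close> to a real multiple of the identity turns the angle into a
  rotation of \<open>za\<close>, and the derivative of \<open>D_deg \<xi>\<close> along it is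
  \<open>D_right \<xi> - D_left W \<xi>\<close>. Bounds on these three operators thus give the size
  and the Lipschitz constant required by \<open>uniform_bound\<close>. The constant depends on
  \<open>R\<close> and \<open>W\<close> only.\<close>

lemma I_eps_bound:
  assumes R: "R > 0" and W: "W \<in> HRplus"
  shows "\<exists>K\<ge>0. \<forall>\<xi> S \<sigma> \<epsilon>. \<bar>\<sigma>\<bar> = 1 \<longrightarrow> \<epsilon> > 0 \<longrightarrow> S \<ge> 0 \<longrightarrow> twice_diff \<xi> \<longrightarrow>
    (\<forall>X. qN X = R\<^sup>2 \<longrightarrow> cmod (D_deg \<xi> X) \<le> S * wt (norm X) \<and> cmod (D_left W \<xi> X) \<le> S * wt (norm X) \<and> cmod (D_right \<xi> X) \<le> S * wt (norm X)) \<longrightarrow>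
    cmod (I_eps \<sigma> R \<xi> W \<epsilon>) \<le> K * S"
proof -
  define w where "w = sqrt (qN W)"
  define p where "p = qunit W"
  note q = qunit_facts[OF W, folded w_def p_def]
  have Cpos: "R\<^sup>2 + w\<^sup>2 > 0" using R by (simp add: add_pos_nonneg)
  obtain K0 where K0: "K0 \<ge> 0" and UB: "\<forall>f S \<sigma> \<epsilon>. f \<in> borel_measurable borel \<longrightarrow> S \<ge> 0 \<longrightarrow>
     (\<forall>v \<theta>. cmod (f (hypc R v \<theta>)) \<le> S * wt (sqrt (R\<^sup>2 + (cmod v)\<^sup>2))) \<longrightarrow>
     (\<forall>v \<theta> \<phi>. cmod (f (hypc R v \<theta>) - f (hypc R v \<phi>)) \<le> S * wt (sqrt (R\<^sup>2 + (cmod v)\<^sup>2)) * \<bar>\<theta> - \<phi>\<bar>) \<longrightarrow>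
     \<bar>\<sigma>\<bar> = 1 \<longrightarrow> \<epsilon> > 0 \<longrightarrow>
     cmod (\<integral>X. f X / Complex (R\<^sup>2 + w\<^sup>2 - 2*w*Re (za X)) (\<sigma> * \<epsilon>) \<partial>Mh R) \<le> K0 * S"
    using uniform_bound[OF R q(2) Cpos] by (elim exE conjE) (rule that, assumption+)
  \<comment> \<open>The first factor pays for the passage from the norm to \<open>|za|\<close>, the
    second for the transport by \<open>p\<close>. The 2 in front of \<open>c\<close> further down
    comes from adding the two derivatives.\<close>
  define c where "c = 2 * (1 + ln 2) ^ 4 * (qnorm1 p * (1 + ln (qnorm1 p)) ^ 4)"
  have qb: "qnorm1 p \<ge> 1" using qmult_compare(5)[OF q(1), of qone] by (simp add: qN_za_zb)
  have c0: "c \<ge> 0" using qb by (simp add: c_def)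
  have wtc: "wt (norm (qmult p Y)) \<le> c * wt (cmod (za Y))" if Y: "qN Y = R\<^sup>2" for Y
  proof -
    have Y0: "qN Y > 0" using R Y by simp
    have pY: "qmult p Y \<in> HRplus" using Y0 by (simp add: HRplus_def qN_qmult q(1))
    have z: "za Y \<noteq> 0" "za (qmult p Y) \<noteq> 0" using HRplus_za_nz[of Y] HRplus_za_nz[OF pY] Y0 by (auto simp: HRplus_def)
    have "wt (norm (qmult p Y)) \<le> 2 * (1 + ln 2) ^ 4 * wt (cmod (za (qmult p Y)))" by (rule wt_norm_za(1)[OF pY])
    also have "\<dots> \<le> 2 * (1 + ln 2) ^ 4 * (qnorm1 p * (1 + ln (qnorm1 p)) ^ 4 * wt (cmod (za Y)))"
      using qmult_compare[OF q(1) Y0] z by (intro mult_left_mono wt_compare) auto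
    finally show ?thesis by (simp add: c_def mult_ac)
  qed
  show ?thesis
  proof (intro exI[of _ "1 / (2 * pi\<^sup>2) * (K0 * (2 * c))"] conjI allI impI)
    show "0 \<le> 1 / (2 * pi\<^sup>2) * (K0 * (2 * c))" using K0 c0 by simp
    fix \<xi> :: "real^4 \<Rightarrow> complex" and S \<sigma> \<epsilon> :: real
    assume \<sigma>: "\<bar>\<sigma>\<bar> = 1" and \<epsilon>: "\<epsilon> > 0" and S: "S \<ge> 0" and td: "twice_diff \<xi>"
      and b: "\<forall>X. qN X = R\<^sup>2 \<longrightarrow> cmod (D_deg \<xi> X) \<le> S * wt (norm X) \<and> cmod (D_left W \<xi> X) \<le> S * wt (norm X) \<and> cmod (D_right \<xi> X) \<le> S * wt (norm X)"
    define f where "f = Fdeg \<xi>"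
    have [measurable]: "f \<in> borel_measurable borel" using borel_measurable_Fdeg[OF td] by (simp add: f_def)
    have [measurable]: "qmult p \<in> borel_measurable borel"
      using linear_qmult_left by (simp add: borel_measurable_continuous_onI linear_continuous_on linear_conv_bounded_linear)
    have I: "I_eps \<sigma> R \<xi> W \<epsilon> = 1 / (2 * of_real pi ^ 2) * (\<integral>X. f X / ker \<sigma> \<epsilon> W X \<partial>Mh R)"
      unfolding f_def by (rule I_eps_ker(2)[OF R borel_measurable_Fdeg[OF td] deg_tilde_Fdeg[OF R td]])
    have T: "(\<integral>X. f X / ker \<sigma> \<epsilon> W X \<partial>Mh R) = (\<integral>X. f (qmult p X) / Complex (R\<^sup>2 + w\<^sup>2 - 2 * w * Re (za X)) (\<sigma> * \<epsilon>) \<partial>Mh R)"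
      by (rule ker_transport(2)[OF R linear_qmult_left _ q(3)]) (auto simp: qN_qmult q(1))
    have pY: "qmult p (hypc R v \<theta>) \<in> HRplus" "qN (qmult p (hypc R v \<theta>)) = R\<^sup>2" for v \<theta>
      using R by (simp_all add: HRplus_def qN_qmult q(1))
    have zh: "cmod (za (hypc R v \<theta>)) = sqrt (R\<^sup>2 + (cmod v)\<^sup>2)" for v \<theta>
      by (simp add: za_hypc norm_mult)
    have fp: "f (qmult p (hypc R v \<theta>)) = D_deg \<xi> (qmult p (hypc R v \<theta>))" for v \<theta>
      using pY[of v \<theta>] by (simp add: f_def Fdeg_def)
    have wb: "S * wt (norm (qmult p (hypc R v \<theta>))) \<le> S * c * wt (sqrt (R\<^sup>2 + (cmod v)\<^sup>2))" for v \<theta>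
      using mult_left_mono[OF wtc[of "hypc R v \<theta>"] S] by (simp add: zh mult_ac)
    have wn: "wt (sqrt (R\<^sup>2 + (cmod v)\<^sup>2)) \<ge> 0" for v by (simp add: wt_nonneg)
    have "cmod (\<integral>X. f (qmult p X) / Complex (R\<^sup>2 + w\<^sup>2 - 2 * w * Re (za X)) (\<sigma> * \<epsilon>) \<partial>Mh R) \<le> K0 * (2 * (S * c))"
    proof (rule UB[rule_format])
      show "cmod (f (qmult p (hypc R v \<theta>))) \<le> 2 * (S * c) * wt (sqrt (R\<^sup>2 + (cmod v)\<^sup>2))" for v \<theta>
      proof -
        have "cmod (f (qmult p (hypc R v \<theta>))) \<le> S * wt (norm (qmult p (hypc R v \<theta>)))" using b pY(2) by (simp add: fp)
        also have "\<dots> \<le> S * c * wt (sqrt (R\<^sup>2 + (cmod v)\<^sup>2))" by (rule wb)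
        also have "\<dots> \<le> 2 * (S * c) * wt (sqrt (R\<^sup>2 + (cmod v)\<^sup>2))" using S c0 wn by (intro mult_right_mono) auto
        finally show ?thesis .
      qed
      fix v and \<theta> \<phi> :: real
      define X where "X t = qmult p (hypc R v t)" for t
      have "norm ((\<lambda>t. D_deg \<xi> (X t)) \<theta> - (\<lambda>t. D_deg \<xi> (X t)) \<phi>) \<le> 2 * (S * c) * wt (sqrt (R\<^sup>2 + (cmod v)\<^sup>2)) * norm (\<theta> - \<phi>)"
      proof (rule differentiable_bound[where S = UNIV and f' = "\<lambda>t h. h *\<^sub>R (D_right \<xi> (X t) - D_left W \<xi> (X t))"])
        fix t :: real
        have XH: "X t \<in> HRplus" using pY by (simp add: X_def)
        hence "(D_deg \<xi> has_derivative frechet_derivative (D_deg \<xi>) (at (X t))) (at (X t))"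
          using td by (simp add: twice_diff_def frechet_derivative_works)
        moreover have "(X has_derivative (\<lambda>h. h *\<^sub>R (qmult (Lrot W) (X t) + qmult (X t) qrot))) (at t)"
          using hypc_has_vector_derivative[of p R v t] unfolding X_def has_vector_derivative_def Lrot_def p_def[symmetric] rot_direction[OF q(1)] .
        ultimately have "((\<lambda>t. D_deg \<xi> (X t)) has_derivative (\<lambda>h. frechet_derivative (D_deg \<xi>) (at (X t)) (h *\<^sub>R (qmult (Lrot W) (X t) + qmult (X t) qrot)))) (at t)"
          using has_derivative_compose[of X _ t UNIV "D_deg \<xi>"] by blast
        \<comment> \<open>\<open>left_action\<close> differentiates along \<open>- A X\<close>,
          hence the minus sign of the left term.\<close>
        moreover have "frechet_derivative (D_deg \<xi>) (at (X t)) (h *\<^sub>R (qmult (Lrot W) (X t) + qmult (X t) qrot)) = h *\<^sub>R (D_right \<xi> (X t) - D_left W \<xi> (X t))" for h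
        proof -
          have lin: "linear (frechet_derivative (D_deg \<xi>) (at (X t)))"
            using td XH by (intro linear_frechet_derivative) (simp add: twice_diff_def)
          show ?thesis
            by (simp add: linear_scale[OF lin] linear_add[OF lin] linear_neg[OF lin] D_right_def D_left_def right_action_def left_action_def)
        qed
        ultimately show "((\<lambda>t. D_deg \<xi> (X t)) has_derivative (\<lambda>h. h *\<^sub>R (D_right \<xi> (X t) - D_left W \<xi> (X t)))) (at t within UNIV)" by simp
        have bd: "cmod (D_right \<xi> (X t) - D_left W \<xi> (X t)) \<le> 2 * (S * c) * wt (sqrt (R\<^sup>2 + (cmod v)\<^sup>2))"
        proof -
          have "cmod (D_right \<xi> (X t) - D_left W \<xi> (X t)) \<le> S * wt (norm (X t)) + S * wt (norm (X t))"
            using b pY(2) by (intro norm_triangle_le_diff add_mono) (auto simp: X_def)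
          also have "\<dots> \<le> 2 * (S * c) * wt (sqrt (R\<^sup>2 + (cmod v)\<^sup>2))" using wb[of v t] by (simp add: X_def)
          finally show ?thesis .
        qed
        show "onorm (\<lambda>h. h *\<^sub>R (D_right \<xi> (X t) - D_left W \<xi> (X t))) \<le> 2 * (S * c) * wt (sqrt (R\<^sup>2 + (cmod v)\<^sup>2))"
          by (rule onorm_le) (use bd in \<open>simp add: mult.commute mult_left_mono\<close>)
      qed auto
      thus "cmod (f (qmult p (hypc R v \<theta>)) - f (qmult p (hypc R v \<phi>))) \<le> 2 * (S * c) * wt (sqrt (R\<^sup>2 + (cmod v)\<^sup>2)) * \<bar>\<theta> - \<phi>\<bar>"
        by (simp add: fp X_def)
    qed (use S c0 \<sigma> \<epsilon> in auto)
    hence "cmod (I_eps \<sigma> R \<xi> W \<epsilon>) \<le> 1 / (2 * pi\<^sup>2) * (K0 * (2 * (S * c)))"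
      unfolding I T norm_mult by (intro mult_mono) (auto simp: norm_divide norm_power norm_mult)
    thus "cmod (I_eps \<sigma> R \<xi> W \<epsilon>) \<le> 1 / (2 * pi\<^sup>2) * (K0 * (2 * c)) * S" by (simp add: mult_ac)
  qed
qed

section \<open>A class of functions on which the integrals exist and are linear\<close>

definition shell_bounded :: "real \<Rightarrow> (real^4 \<Rightarrow> complex) \<Rightarrow> bool" where
  "shell_bounded \<rho> g \<longleftrightarrow> (\<exists>C. \<forall>X\<in>shell \<rho>. cmod (g X) \<le> C * wt (norm X))"

text \<open>Contains both the generators and \<open>S_space\<close> and is closed under linear
  combinations, so differences \<open>\<phi> - \<psi>\<close> can be estimated by the three
  seminorms of \<open>I_eps_bound\<close>.\<close>

definition kernel_regular :: "real \<Rightarrow> real^4 \<Rightarrow> (real^4 \<Rightarrow> complex) \<Rightarrow> bool" where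
  "kernel_regular \<rho> W f \<longleftrightarrow> twice_diff f \<and> shell_bounded \<rho> (D_deg f) \<and> shell_bounded \<rho> (D_left W f) \<and> shell_bounded \<rho> (D_right f)"

lemma frechet_derivative_lincomb:
  fixes a b :: complex
  assumes f: "f differentiable (at X)" and g: "g differentiable (at X)" and X: "X \<in> HRplus"
    and h: "\<And>Y. Y \<in> HRplus \<Longrightarrow> h Y = a * f Y + b * g Y"
  shows "h differentiable (at X)" "frechet_derivative h (at X) v = a * frechet_derivative f (at X) v + b * frechet_derivative g (at X) v"
proof -
  have "((\<lambda>Y. a * f Y + b * g Y) has_derivative (\<lambda>v. a * frechet_derivative f (at X) v + b * frechet_derivative g (at X) v)) (at X)"
    using f g by (intro has_derivative_add has_derivative_mult_right) (auto simp: frechet_derivative_works)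
  hence d: "(h has_derivative (\<lambda>v. a * frechet_derivative f (at X) v + b * frechet_derivative g (at X) v)) (at X)"
    by (rule has_derivative_transform_within_open[OF _ open_HRplus X]) (simp add: h)
  thus "h differentiable (at X)" by (auto simp: differentiable_def)
  show "frechet_derivative h (at X) v = a * frechet_derivative f (at X) v + b * frechet_derivative g (at X) v"
    using frechet_derivative_at[OF d] by metis
qed

lemma deg_ops_lincomb:
  fixes a b :: complex
  assumes f: "twice_diff f" and g: "twice_diff g"
  shows "X \<in> HRplus \<Longrightarrow> D_deg (\<lambda>Y. a * f Y + b * g Y) X = a * D_deg f X + b * D_deg g X"
    "X \<in> HRplus \<Longrightarrow> D_left W (\<lambda>Y. a * f Y + b * g Y) X = a * D_left W f X + b * D_left W g X"
    "X \<in> HRplus \<Longrightarrow> D_right (\<lambda>Y. a * f Y + b * g Y) X = a * D_right f X + b * D_right g X"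
    "twice_diff (\<lambda>Y. a * f Y + b * g Y)"
proof -
  let ?h = "\<lambda>Y. a * f Y + b * g Y"
  have df: "f differentiable (at X)" "g differentiable (at X)" "D_deg f differentiable (at X)" "D_deg g differentiable (at X)" if "X \<in> HRplus" for X
    using that f g by (auto simp: twice_diff_def)
  show D: "D_deg ?h X = a * D_deg f X + b * D_deg g X" if X: "X \<in> HRplus" for X
    by (simp add: D_deg_def right_action_def frechet_derivative_lincomb(2)[OF df(1,2)[OF X] X, where h = ?h] algebra_simps)
  note fd = frechet_derivative_lincomb[OF df(3,4), where h = "D_deg ?h" and a = a and b = b]
  show "D_left W ?h X = a * D_left W f X + b * D_left W g X" if X: "X \<in> HRplus"
    by (simp add: D_left_def left_action_def fd(2)[OF X X X D])
  show "D_right ?h X = a * D_right f X + b * D_right g X" if X: "X \<in> HRplus"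
    by (simp add: D_right_def right_action_def fd(2)[OF X X X D])
  show "twice_diff ?h" unfolding twice_diff_def
    using frechet_derivative_lincomb(1)[OF df(1,2), where h = ?h and a = a and b = b] fd(1)[OF _ _ _ D] by blast
qed

lemma shell_bounded_lincomb:
  assumes "shell_bounded \<rho> f" "shell_bounded \<rho> g" and h: "\<And>X. X \<in> HRplus \<Longrightarrow> h X = a * f X + b * g X"
  shows "shell_bounded \<rho> h"
proof -
  obtain C E where C: "\<forall>X\<in>shell \<rho>. cmod (f X) \<le> C * wt (norm X)" and E: "\<forall>X\<in>shell \<rho>. cmod (g X) \<le> E * wt (norm X)"
    using assms by (auto simp: shell_bounded_def)
  show ?thesis unfolding shell_bounded_def
  proof (intro exI ballI)
    fix X assume X: "X \<in> shell \<rho>"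
    have "cmod (h X) \<le> cmod a * cmod (f X) + cmod b * cmod (g X)"
      using norm_triangle_ineq[of "a * f X" "b * g X"] h[OF shell_HRplus[OF X]] by (simp add: norm_mult)
    also have "\<dots> \<le> cmod a * (C * wt (norm X)) + cmod b * (E * wt (norm X))"
      using C E X by (intro add_mono mult_left_mono) auto
    finally show "cmod (h X) \<le> (cmod a * C + cmod b * E) * wt (norm X)" by (simp add: algebra_simps)
  qed
qed

lemma kernel_regular_lincomb:
  assumes f: "kernel_regular \<rho> W f" and g: "kernel_regular \<rho> W g"
  shows "kernel_regular \<rho> W (\<lambda>Y. a * f Y + b * g Y)"
proof -
  have t: "twice_diff f" "twice_diff g" using f g by (auto simp: kernel_regular_def)
  note D = deg_ops_lincomb[OF t, where a = a and b = b]
  show ?thesis unfolding kernel_regular_def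
  proof (intro conjI D(4))
    show "shell_bounded \<rho> (D_deg (\<lambda>Y. a * f Y + b * g Y))"
      using f g by (intro shell_bounded_lincomb[OF _ _ D(1)]) (auto simp: kernel_regular_def)
    show "shell_bounded \<rho> (D_left W (\<lambda>Y. a * f Y + b * g Y))"
      using f g by (intro shell_bounded_lincomb[OF _ _ D(2)]) (auto simp: kernel_regular_def)
    show "shell_bounded \<rho> (D_right (\<lambda>Y. a * f Y + b * g Y))"
      using f g by (intro shell_bounded_lincomb[OF _ _ D(3)]) (auto simp: kernel_regular_def)
  qed
qed

text \<open>For an eigenfunction \<open>D_deg f\<close> is \<open>c * f\<close> on the open cone, so
  \<open>D_left\<close> and \<open>D_right\<close> are first derivatives of \<open>f\<close> up to a
  constant. The single derivative recorded in \<open>tame\<close> therefore gives all three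
  bounds.\<close>

lemma kernel_regular_eigen:
  assumes \<rho>: "\<rho> > 1" and k: "k \<ge> 2" and f: "tame \<rho> (- int k) f" and deg: "\<And>X. X \<in> HRplus \<Longrightarrow> deg_tilde f X = c * f X"
  shows "kernel_regular \<rho> W f"
proof -
  have d: "f differentiable (at X)" if "X \<in> HRplus" for X using f that by (simp add: tame_def)
  have D: "D_deg f X = c * f X + 0 * f X" if "X \<in> HRplus" for X
    using deg_tilde_D_deg[OF d[OF that]] deg[OF that] by simp
  note fd = frechet_derivative_lincomb[OF d d, where h = "D_deg f" and a = c and b = 0]
  have td: "twice_diff f" unfolding twice_diff_def using d fd(1)[OF _ _ _ D] by blast
  obtain S0 where S0: "S0 \<ge> 0" "\<forall>r\<ge>1/\<rho>. 1 / r ^ k \<le> S0 * wt r" using inverse_power_le_wt[of "1/\<rho>" k] \<rho> k by auto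
  have conv: "shell_bounded \<rho> g" if g: "\<exists>C\<ge>0. \<forall>X\<in>shell \<rho>. cmod (g X) \<le> C * cmod (za X) powi (- int k)" for g
  proof -
    obtain C where C: "C \<ge> 0" "\<forall>X\<in>shell \<rho>. cmod (g X) \<le> C * cmod (za X) powi (- int k)" using g by blast
    show ?thesis unfolding shell_bounded_def
    proof (intro exI ballI)
      fix X assume X: "X \<in> shell \<rho>"
      have "(1/\<rho>)\<^sup>2 \<le> (cmod (za X))\<^sup>2"
      proof -
        have "1 / \<rho>\<^sup>2 \<le> (cmod (za X))\<^sup>2 - (cmod (zb X))\<^sup>2" using X by (simp add: shell_def qN_za_zb)
        thus ?thesis using zero_le_power2[of "cmod (zb X)"] unfolding power_divide power_one by linarith
      qed
      hence r: "1/\<rho> \<le> cmod (za X)" by (rule power2_le_imp_le) simp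
      have "cmod (g X) \<le> C * (1 / cmod (za X) ^ k)" using C(2) X by (simp add: power_int_minus divide_inverse)
      also have "\<dots> \<le> C * (S0 * wt (cmod (za X)))" using S0(2) r C(1) by (intro mult_left_mono) auto
      also have "\<dots> \<le> C * (S0 * (2 * (1 + ln 2) ^ 4 * wt (norm X)))"
        using C(1) S0(1) wt_norm_za(2)[OF shell_HRplus[OF X]] by (intro mult_left_mono) auto
      finally show "cmod (g X) \<le> C * S0 * (2 * (1 + ln 2) ^ 4) * wt (norm X)" by (simp add: mult_ac)
    qed
  qed
  have w0: "shell_bounded \<rho> f" by (rule conv[OF tameD(2)[OF f]])
  have w1: "shell_bounded \<rho> (\<lambda>X. frechet_derivative f (at X) (V X))" if "invariant_field V" for V
    by (rule conv[OF tameD(3)[OF f that]])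
  show ?thesis unfolding kernel_regular_def
  proof (intro conjI td)
    show "shell_bounded \<rho> (D_deg f)" by (rule shell_bounded_lincomb[OF w0 w0 D])
    have "shell_bounded \<rho> (\<lambda>X. frechet_derivative f (at X) (qmult (Lrot W) X))" by (rule w1) (auto simp: invariant_field_def)
    moreover have "D_left W f X = - c * frechet_derivative f (at X) (qmult (Lrot W) X) + 0 * frechet_derivative f (at X) (qmult (Lrot W) X)" if X: "X \<in> HRplus" for X
    proof -
      have "frechet_derivative f (at X) (- qmult (Lrot W) X) = - frechet_derivative f (at X) (qmult (Lrot W) X)"
        by (rule linear_neg[OF linear_frechet_derivative[OF d[OF X]]])
      thus ?thesis
        by (simp add: D_left_def left_action_def fd(2)[OF X X X D])
    qed
    ultimately show "shell_bounded \<rho> (D_left W f)" using shell_bounded_lincomb by blast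
    have "shell_bounded \<rho> (\<lambda>X. frechet_derivative f (at X) (qmult X qrot))" by (rule w1) (auto simp: invariant_field_def)
    from shell_bounded_lincomb[OF this this, of "D_right f" c 0]
    show "shell_bounded \<rho> (D_right f)"
      by (simp add: D_right_def right_action_def fd(2)[OF _ _ _ D])
  qed
qed

text \<open>On the open cone \<open>D_deg f\<close> is a combination of \<open>f\<close> and its
  partial derivatives with coordinates as coefficients, hence differentiable. The bounds are the
  defining ones of \<open>S_space\<close> with \<open>n = 4\<close>.\<close>

lemma kernel_regular_S_space:
  assumes \<rho>: "\<rho> > 1" and f: "f \<in> S_space"
  shows "kernel_regular \<rho> W f"
proof -
  have sm: "foldr partial is f differentiable (at X)" if "X \<in> HRplus" for "is" X
    using f that by (auto simp: S_space_def smooth_on_def)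
  have d: "f differentiable (at X)" if "X \<in> HRplus" for X using sm[OF that, of "[]"] by simp
  have dp: "partial i f differentiable (at X)" if "X \<in> HRplus" for i X using sm[OF that, of "[i]"] by simp
  have td: "twice_diff f" unfolding twice_diff_def
  proof (intro ballI conjI d)
    fix X assume X: "X \<in> HRplus"
    have "(\<lambda>X. f X + (\<Sum>i\<in>UNIV. complex_of_real (X$i) * partial i f X)) differentiable (at X)"
    proof -
      have "(\<lambda>X::real^4. complex_of_real (X$i)) differentiable (at X)" for i
        by (intro bounded_linear_imp_differentiable bounded_linear_compose[OF bounded_linear_of_real] bounded_linear_vec_nth)
      thus ?thesis
        by (intro differentiable_add d X differentiable_sum differentiable_mult dp ballI) auto
    qed
    then obtain f' where "((\<lambda>X. f X + (\<Sum>i\<in>UNIV. complex_of_real (X$i) * partial i f X)) has_derivative f') (at X)"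
      by (auto simp: differentiable_def)
    hence "(D_deg f has_derivative f') (at X)"
      by (rule has_derivative_transform_within_open[OF _ open_HRplus X])
        (simp add: d deg_tilde_D_deg[symmetric] deg_tilde_def)
    thus "D_deg f differentiable (at X)" by (auto simp: differentiable_def)
  qed
  have w: "shell_bounded \<rho> (D f)" if DE: "D \<in> enveloping_ops" for D
  proof -
    obtain C where "\<forall>X\<in>shell \<rho>. cmod (D f X) \<le> C / ((1 + \<bar>ln (norm X)\<bar>) ^ 4 * norm X)"
      using conjunct2[OF f[unfolded S_space_def mem_Collect_eq], rule_format, OF DE \<rho>, of 4] by (rule exE)
    thus ?thesis unfolding shell_bounded_def by (intro exI[of _ C]) (simp add: wt_def)
  qed
  show ?thesis unfolding kernel_regular_def by (intro conjI td w D_deg_enveloping D_left_enveloping D_right_enveloping)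
qed

text \<open>A real supremum over an unbounded set is unspecified, so a small value of
  \<open>S_seminorm\<close> alone says nothing; \<open>shell_bounded\<close> makes it a genuine
  upper bound.\<close>

lemma seminorm_pointwise:
  assumes w: "shell_bounded \<rho> (D f)" and s: "S_seminorm D 4 \<rho> f < e" and X: "X \<in> shell \<rho>"
  shows "cmod (D f X) \<le> e * wt (norm X)"
proof -
  obtain C where C: "\<forall>X\<in>shell \<rho>. cmod (D f X) \<le> C * wt (norm X)" using w by (auto simp: shell_bounded_def)
  have eq: "(1 + \<bar>ln (norm X)\<bar>) ^ 4 * norm X * x \<le> c \<longleftrightarrow> x \<le> c * wt (norm X)" if "X \<in> shell \<rho>" for X x c
  proof -
    have "(1 + \<bar>ln (norm X)\<bar>) ^ 4 * norm X > 0" using wt_norm_za(3)[OF shell_HRplus[OF that]] by simp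
    thus ?thesis unfolding wt_def by (simp add: pos_le_divide_eq mult.commute)
  qed
  have "(1 + \<bar>ln (norm X)\<bar>) ^ 4 * norm X * cmod (D f X) \<le> S_seminorm D 4 \<rho> f"
    unfolding S_seminorm_def
  proof (rule cSUP_upper[OF X])
    show "bdd_above ((\<lambda>X. (1 + \<bar>ln (norm X)\<bar>) ^ 4 * norm X * cmod (D f X)) ` shell \<rho>)"
      by (rule bdd_aboveI2[of _ _ C]) (use C eq in auto)
  qed
  hence "(1 + \<bar>ln (norm X)\<bar>) ^ 4 * norm X * cmod (D f X) \<le> e" using s by simp
  thus ?thesis using eq[OF X] by simp
qed

lemma kernel_regular_wbounded:
  assumes R: "R > 0" and \<rho>: "\<And>X. qN X = R\<^sup>2 \<Longrightarrow> X \<in> shell \<rho>" and f: "kernel_regular \<rho> W f"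
  shows "\<exists>S. wbounded R S (Fdeg f)"
proof -
  obtain C where C: "\<forall>X\<in>shell \<rho>. cmod (D_deg f X) \<le> C * wt (norm X)" using f by (auto simp: kernel_regular_def shell_bounded_def)
  have "wbounded R (\<bar>C\<bar> * (2 * (1 + ln 2) ^ 4)) (Fdeg f)"
    unfolding wbounded_def
  proof (intro conjI allI impI)
    fix X assume X: "qN X = R\<^sup>2"
    note H = shell_HRplus[OF \<rho>[OF X]]
    have "cmod (Fdeg f X) \<le> C * wt (norm X)" using C \<rho>[OF X] H by (simp add: Fdeg_def)
    also have "\<dots> \<le> \<bar>C\<bar> * wt (norm X)" by (intro mult_right_mono) (auto simp: wt_nonneg)
    also have "\<dots> \<le> \<bar>C\<bar> * (2 * (1 + ln 2) ^ 4 * wt (cmod (za X)))" by (intro mult_left_mono wt_norm_za(1)[OF H]) simp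
    finally show "cmod (Fdeg f X) \<le> \<bar>C\<bar> * (2 * (1 + ln 2) ^ 4) * wt (cmod (za X))" by (simp add: mult_ac)
  qed simp
  thus ?thesis ..
qed

lemma I_eps_lincomb:
  assumes R: "R > 0" and W: "W \<in> HRplus" and \<rho>: "\<And>X. qN X = R\<^sup>2 \<Longrightarrow> X \<in> shell \<rho>"
    and f: "kernel_regular \<rho> W f" and g: "kernel_regular \<rho> W g" and \<epsilon>: "\<epsilon> > 0" "\<bar>\<sigma>\<bar> = (1::real)"
  shows "set_integrable (dS R) (hyperboloid R) (I_integrand \<sigma> \<epsilon> f W)"
    and "I_eps \<sigma> R (\<lambda>X. a * f X + b * g X) W \<epsilon> = a * I_eps \<sigma> R f W \<epsilon> + b * I_eps \<sigma> R g W \<epsilon>"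
proof -
  have t: "twice_diff f" "twice_diff g" using f g by (auto simp: kernel_regular_def)
  note D = deg_ops_lincomb[OF t, where a = a and b = b]
  have int: "integrable (Mh R) (\<lambda>X. Fdeg h X / ker \<sigma> \<epsilon> W X)" if h: "kernel_regular \<rho> W h" for h
  proof -
    obtain S where "wbounded R S (Fdeg h)" using kernel_regular_wbounded[OF R \<rho> h] by blast
    moreover have "twice_diff h" using h by (simp add: kernel_regular_def)
    ultimately show ?thesis using ker_integrable[OF R W \<epsilon> borel_measurable_Fdeg] by blast
  qed
  note Ik = I_eps_ker[OF R borel_measurable_Fdeg deg_tilde_Fdeg[OF R]]
  show "set_integrable (dS R) (hyperboloid R) (I_integrand \<sigma> \<epsilon> f W)"
    using Ik(1)[OF t(1) t(1)] int[OF f] by blast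
  have e: "I_eps \<sigma> R h W \<epsilon> = 1 / (2 * of_real pi ^ 2) * (\<integral>X. Fdeg h X / ker \<sigma> \<epsilon> W X \<partial>Mh R)" if "twice_diff h" for h
    by (rule Ik(2)[OF that that])
  have F: "Fdeg (\<lambda>X. a * f X + b * g X) X = a * Fdeg f X + b * Fdeg g X" for X
    using D(1)[of X] by (cases "X \<in> HRplus") (simp_all add: Fdeg_def)
  have "(\<integral>X. Fdeg (\<lambda>X. a * f X + b * g X) X / ker \<sigma> \<epsilon> W X \<partial>Mh R) = (\<integral>X. a * (Fdeg f X / ker \<sigma> \<epsilon> W X) + b * (Fdeg g X / ker \<sigma> \<epsilon> W X) \<partial>Mh R)"
    by (simp add: F add_divide_distrib)
  also have "\<dots> = a * (\<integral>X. Fdeg f X / ker \<sigma> \<epsilon> W X \<partial>Mh R) + b * (\<integral>X. Fdeg g X / ker \<sigma> \<epsilon> W X \<partial>Mh R)"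
    using int[OF f] int[OF g] by (subst Bochner_Integration.integral_add) (auto simp del: times_divide_eq_right)
  finally show "I_eps \<sigma> R (\<lambda>X. a * f X + b * g X) W \<epsilon> = a * I_eps \<sigma> R f W \<epsilon> + b * I_eps \<sigma> R g W \<epsilon>"
    by (simp only: e[OF t(1)] e[OF t(2)] e[OF D(4)] ring_distribs mult.left_commute)
qed

section \<open>Equality of the two limits on the span and on its closure\<close>

definition limits_agree :: "real \<Rightarrow> real \<Rightarrow> real^4 \<Rightarrow> (real^4 \<Rightarrow> complex) \<Rightarrow> bool" where
  "limits_agree R \<rho> W f \<longleftrightarrow> kernel_regular \<rho> W f \<and> (\<exists>L. \<forall>\<sigma>\<in>{1, -1}. (I_eps \<sigma> R f W \<longlongrightarrow> L) (at_right 0))"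

lemma limits_agree_lincomb:
  assumes R: "R > 0" and W: "W \<in> HRplus" and \<rho>: "\<And>X. qN X = R\<^sup>2 \<Longrightarrow> X \<in> shell \<rho>"
    and f: "limits_agree R \<rho> W f" and g: "limits_agree R \<rho> W g"
  shows "limits_agree R \<rho> W (\<lambda>X. a * f X + b * g X)"
proof -
  obtain L M where L: "\<forall>\<sigma>\<in>{1, -1}. (I_eps \<sigma> R f W \<longlongrightarrow> L) (at_right 0)" and M: "\<forall>\<sigma>\<in>{1, -1}. (I_eps \<sigma> R g W \<longlongrightarrow> M) (at_right 0)"
    using f g by (auto simp: limits_agree_def)
  have r: "kernel_regular \<rho> W f" "kernel_regular \<rho> W g" using f g by (auto simp: limits_agree_def)
  have "(I_eps \<sigma> R (\<lambda>X. a * f X + b * g X) W \<longlongrightarrow> a * L + b * M) (at_right 0)" if \<sigma>: "\<sigma> \<in> {1, -1}" for \<sigma>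
  proof (rule Lim_transform_eventually)
    show "((\<lambda>\<epsilon>. a * I_eps \<sigma> R f W \<epsilon> + b * I_eps \<sigma> R g W \<epsilon>) \<longlongrightarrow> a * L + b * M) (at_right 0)"
      using L M \<sigma> by (intro tendsto_intros) auto
    show "\<forall>\<^sub>F \<epsilon> in at_right 0. a * I_eps \<sigma> R f W \<epsilon> + b * I_eps \<sigma> R g W \<epsilon> = I_eps \<sigma> R (\<lambda>X. a * f X + b * g X) W \<epsilon>"
      using eventually_at_right_less[of "0::real"]
    proof eventually_elim
      case (elim \<epsilon>)
      have "\<bar>\<sigma>\<bar> = 1" using \<sigma> by auto
      from I_eps_lincomb(2)[OF R W \<rho> r elim this] show ?case by simp
    qed
  qed
  thus ?thesis unfolding limits_agree_def using kernel_regular_lincomb[OF r] by blast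
qed

lemma limits_agree_generators:
  assumes R: "R > 0" and W: "W \<in> HRplus" and \<rho>: "\<rho> > 1" and ds: "ds_index l m n"
  shows "limits_agree R \<rho> W (t_fun l n m)" "limits_agree R \<rho> W (N_t_fun l n m)"
proof -
  obtain k \<tau> where k: "k \<ge> 2" "l = - real k / 2" and \<tau>: "is_tpos k \<tau>" and t0: "\<forall>X\<in>HRplus. t_fun l n m X = \<tau> X"
    by (rule t_fun_is_tpos[OF ds])
  note gf = generator_properties[OF k \<tau> t0]
  note lim = tendsto_I_eps_generators[OF R W k _ \<tau> t0]
  have "kernel_regular \<rho> W (t_fun l n m)" by (rule kernel_regular_eigen[OF \<rho> k(1) gf(2) gf(4)])
  thus "limits_agree R \<rho> W (t_fun l n m)" unfolding limits_agree_def using lim(3) by (metis abs_1 abs_minus_cancel insertE singletonD)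
  have "kernel_regular \<rho> W (N_t_fun l n m)" by (rule kernel_regular_eigen[OF \<rho> k(1) gf(3) gf(5)])
  thus "limits_agree R \<rho> W (N_t_fun l n m)" unfolding limits_agree_def using lim(4) by (metis abs_1 abs_minus_cancel insertE singletonD)
qed

lemma limits_agree_span:
  assumes R: "R > 0" and W: "W \<in> HRplus" and \<rho>: "\<rho> > 1" "\<And>X. qN X = R\<^sup>2 \<Longrightarrow> X \<in> shell \<rho>"
    and G: "\<And>g. g \<in> G \<Longrightarrow> limits_agree R \<rho> W g" and \<psi>: "\<psi> \<in> complex_span G"
  shows "limits_agree R \<rho> W \<psi>"
proof -
  obtain T c where T: "finite T" "T \<subseteq> G" "\<psi> = (\<lambda>X. \<Sum>g\<in>T. c g * g X)" using \<psi> by (auto simp: complex_span_def)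
  \<comment> \<open>The empty sum, which starts the induction over the finite set of
    generators.\<close>
  have zero: "limits_agree R \<rho> W (\<lambda>X. 0)"
  proof -
    have d0: "deg_tilde (\<lambda>X. 0) X = 0 * 0" for X by (simp add: deg_tilde_eq)
    have "I_eps \<sigma> R (\<lambda>X. 0) W \<epsilon> = 0" for \<sigma> \<epsilon>
      by (subst I_eps_ker(2)[OF R, where f = "\<lambda>X. 0"]) (auto simp: d0)
    hence "(I_eps \<sigma> R (\<lambda>X. 0) W \<longlongrightarrow> 0) (at_right 0)" for \<sigma> by (simp add: tendsto_eventually)
    moreover have "kernel_regular \<rho> W (\<lambda>X. 0)" by (rule kernel_regular_eigen[OF \<rho>(1) order_refl tame_zero d0])
    ultimately show ?thesis by (auto simp: limits_agree_def)
  qed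
  have "limits_agree R \<rho> W (\<lambda>X. \<Sum>g\<in>T. c g * g X)" using T(1,2)
  proof (induction T rule: finite_induct)
    case (insert g T)
    have "limits_agree R \<rho> W (\<lambda>X. c g * g X + 1 * (\<Sum>g\<in>T. c g * g X))"
      using insert by (intro limits_agree_lincomb[OF R W \<rho>(2)] G[of g]) auto
    thus ?case using insert by simp
  qed (simp add: zero)
  thus ?thesis using T(3) by simp
qed

text \<open>The approximation by elements of the span is uniform in \<open>\<epsilon>\<close> and in
  the sign, so the limits in \<open>\<epsilon>\<close> and in the approximation may be exchanged.
  Each approximant has one limit for both signs, and this passes to \<open>\<phi>\<close>.\<close>

lemma I_op_discrete_series:
  assumes R: "R > 0" and W: "W \<in> HRplus" and \<phi>: "\<phi> \<in> discrete_series"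
  shows "I_converges 1 R \<phi> W \<and> I_converges (-1) R \<phi> W \<and> I_plus R \<phi> W = I_minus R \<phi> W"
proof -
  obtain \<rho> where \<rho>: "\<rho> > 1" "\<And>X. qN X = R\<^sup>2 \<Longrightarrow> X \<in> shell \<rho>" using hyperboloid_shell[OF R] by blast
  let ?G = "{t_fun l n m | l n m. ds_index l m n} \<union> {N_t_fun l n m | l n m. ds_index l m n}"
  have \<phi>H: "\<phi> \<in> H_space" using \<phi> by (auto simp: discrete_series_def H_closure_def)
  have cl: "\<forall>F. finite F \<and> F \<subseteq> enveloping_ops \<times> UNIV \<times> {1<..} \<longrightarrow>
     (\<forall>e>0. \<exists>\<psi>\<in>complex_span ?G. \<forall>(D, n, \<rho>)\<in>F. S_seminorm D n \<rho> (\<lambda>X. \<phi> X - \<psi> X) < e)"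
    by (rule conjunct2[OF \<phi>[unfolded discrete_series_def H_closure_def mem_Collect_eq]])
  have r\<phi>: "kernel_regular \<rho> W \<phi>" using \<phi>H by (intro kernel_regular_S_space[OF \<rho>(1)]) (auto simp: H_space_def)
  obtain K where K: "K \<ge> 0" and KB: "\<forall>\<xi> S \<sigma> \<epsilon>. \<bar>\<sigma>\<bar> = 1 \<longrightarrow> \<epsilon> > 0 \<longrightarrow> S \<ge> 0 \<longrightarrow> twice_diff \<xi> \<longrightarrow>
    (\<forall>X. qN X = R\<^sup>2 \<longrightarrow> cmod (D_deg \<xi> X) \<le> S * wt (norm X) \<and> cmod (D_left W \<xi> X) \<le> S * wt (norm X) \<and> cmod (D_right \<xi> X) \<le> S * wt (norm X)) \<longrightarrow>
    cmod (I_eps \<sigma> R \<xi> W \<epsilon>) \<le> K * S"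
    using I_eps_bound[OF R W] by (elim exE conjE) (rule that, assumption+)
  have approx: "\<exists>\<psi> L. (\<forall>\<sigma>\<in>{1, -1}. (I_eps \<sigma> R \<psi> W \<longlongrightarrow> L) (at_right 0)) \<and>
     (\<forall>\<sigma>\<in>{1, -1}. \<forall>\<epsilon>>0. cmod (I_eps \<sigma> R \<phi> W \<epsilon> - I_eps \<sigma> R \<psi> W \<epsilon>) \<le> K * e)" if e: "e > 0" for e
  proof -
    \<comment> \<open>The three seminorms that \<open>I_eps_bound\<close> asks for, with the
      exponent 4 of \<open>wt\<close>.\<close>
    let ?F = "{(D_deg, 4::nat, \<rho>), (D_left W, 4, \<rho>), (D_right, 4, \<rho>)}"
    have "?F \<subseteq> enveloping_ops \<times> UNIV \<times> {1<..}"
      using \<rho>(1) by (simp add: D_deg_enveloping D_left_enveloping D_right_enveloping)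
    moreover have "finite ?F" by simp
    ultimately have "\<exists>\<psi>\<in>complex_span ?G. \<forall>(D, n, \<rho>)\<in>?F. S_seminorm D n \<rho> (\<lambda>X. \<phi> X - \<psi> X) < e"
      by (intro cl[rule_format] conjI e)
    then obtain \<psi> where \<psi>: "\<psi> \<in> complex_span ?G" and s: "\<forall>(D, n, \<rho>)\<in>?F. S_seminorm D n \<rho> (\<lambda>X. \<phi> X - \<psi> X) < e"
      by (rule bexE)
    have g: "limits_agree R \<rho> W \<psi>"
      by (rule limits_agree_span[OF R W \<rho> _ \<psi>]) (auto intro: limits_agree_generators[OF R W \<rho>(1)])
    hence r\<psi>: "kernel_regular \<rho> W \<psi>" by (simp add: limits_agree_def)
    have eq: "(\<lambda>X. \<phi> X - \<psi> X) = (\<lambda>X. 1 * \<phi> X + (-1) * \<psi> X)" by auto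
    have r: "kernel_regular \<rho> W (\<lambda>X. \<phi> X - \<psi> X)" unfolding eq by (rule kernel_regular_lincomb[OF r\<phi> r\<psi>])
    have "cmod (I_eps \<sigma> R \<phi> W \<epsilon> - I_eps \<sigma> R \<psi> W \<epsilon>) \<le> K * e" if \<sigma>: "\<sigma> \<in> {1, -1}" and \<epsilon>: "\<epsilon> > 0" for \<sigma> \<epsilon>
    proof -
      have \<sigma>1: "\<bar>\<sigma>\<bar> = 1" using \<sigma> by auto
      have "I_eps \<sigma> R \<phi> W \<epsilon> - I_eps \<sigma> R \<psi> W \<epsilon> = I_eps \<sigma> R (\<lambda>X. \<phi> X - \<psi> X) W \<epsilon>"
        unfolding eq using I_eps_lincomb(2)[OF R W \<rho>(2) r\<phi> r\<psi> \<epsilon> \<sigma>1, of 1 "-1"] by simp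
      also have "cmod \<dots> \<le> K * e"
      proof (rule KB[rule_format])
        show "twice_diff (\<lambda>X. \<phi> X - \<psi> X)" using r by (simp add: kernel_regular_def)
        fix X assume "qN X = R\<^sup>2"
        hence X: "X \<in> shell \<rho>" by (rule \<rho>(2))
        show "cmod (D_deg (\<lambda>X. \<phi> X - \<psi> X) X) \<le> e * wt (norm X) \<and> cmod (D_left W (\<lambda>X. \<phi> X - \<psi> X) X) \<le> e * wt (norm X) \<and> cmod (D_right (\<lambda>X. \<phi> X - \<psi> X) X) \<le> e * wt (norm X)"
        proof (intro conjI)
          show "cmod (D_deg (\<lambda>X. \<phi> X - \<psi> X) X) \<le> e * wt (norm X)"
            by (rule seminorm_pointwise[where D = D_deg, OF _ _ X]) (use r s in \<open>auto simp: kernel_regular_def\<close>)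
          show "cmod (D_left W (\<lambda>X. \<phi> X - \<psi> X) X) \<le> e * wt (norm X)"
            by (rule seminorm_pointwise[where D = "D_left W", OF _ _ X]) (use r s in \<open>auto simp: kernel_regular_def\<close>)
          show "cmod (D_right (\<lambda>X. \<phi> X - \<psi> X) X) \<le> e * wt (norm X)"
            by (rule seminorm_pointwise[where D = D_right, OF _ _ X]) (use r s in \<open>auto simp: kernel_regular_def\<close>)
        qed
      qed (use \<sigma>1 \<epsilon> e in auto)
      finally show ?thesis .
    qed
    thus ?thesis using g unfolding limits_agree_def by blast
  qed
  define P where "P j \<psi> L \<longleftrightarrow> (\<forall>\<sigma>\<in>{1, -1}. (I_eps \<sigma> R \<psi> W \<longlongrightarrow> L) (at_right 0)) \<and>
     (\<forall>\<sigma>\<in>{1, -1}. \<forall>\<epsilon>>0. cmod (I_eps \<sigma> R \<phi> W \<epsilon> - I_eps \<sigma> R \<psi> W \<epsilon>) \<le> K * (1 / real (Suc j)))" for j \<psi> L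
  have "\<forall>j. \<exists>\<psi> L. P j \<psi> L" unfolding P_def by (intro allI approx) simp
  then obtain \<psi> L where P: "\<And>j. P j (\<psi> j) (L j)" by metis
  have L: "\<And>j \<sigma>. \<sigma> \<in> {1, -1} \<Longrightarrow> (I_eps \<sigma> R (\<psi> j) W \<longlongrightarrow> L j) (at_right 0)"
    and close: "\<And>j \<sigma> \<epsilon>. \<sigma> \<in> {1, -1} \<Longrightarrow> \<epsilon> > 0 \<Longrightarrow> cmod (I_eps \<sigma> R \<phi> W \<epsilon> - I_eps \<sigma> R (\<psi> j) W \<epsilon>) \<le> K * (1 / real (Suc j))"
    using P unfolding P_def by blast+
  have near: "\<forall>\<^sub>F \<epsilon> in at_right 0. cmod (I_eps \<sigma> R \<phi> W \<epsilon> - L j) < K * (1 / real (Suc j)) + d" if \<sigma>: "\<sigma> \<in> {1, -1}" and "d > 0" for \<sigma> j d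
    using tendstoD[OF L[OF \<sigma>, of j] \<open>d > 0\<close>] eventually_at_right_less[of "0::real"]
  proof eventually_elim
    case (elim \<epsilon>)
    have "cmod (I_eps \<sigma> R \<phi> W \<epsilon> - L j) \<le> cmod (I_eps \<sigma> R \<phi> W \<epsilon> - I_eps \<sigma> R (\<psi> j) W \<epsilon>) + cmod (I_eps \<sigma> R (\<psi> j) W \<epsilon> - L j)"
      using norm_triangle_ineq[of "I_eps \<sigma> R \<phi> W \<epsilon> - I_eps \<sigma> R (\<psi> j) W \<epsilon>" "I_eps \<sigma> R (\<psi> j) W \<epsilon> - L j"] by simp
    thus ?case using close[OF \<sigma> elim(2), of j] elim(1) by (simp add: dist_norm)
  qed
  \<comment> \<open>The limits of two approximants are compared through
    \<open>I_eps 1 R \<phi> W \<epsilon>\<close> at one small \<open>\<epsilon>\<close>; a single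
    sign suffices, because \<open>L\<close> is common to both.\<close>
  have LL: "cmod (L i - L j) \<le> K * (1 / real (Suc i)) + K * (1 / real (Suc j))" for i j
  proof (rule field_le_epsilon)
    fix d :: real assume "d > 0"
    hence d: "d / 2 > 0" by simp
    have one: "(1::real) \<in> {1, -1}" by simp
    have "\<forall>\<^sub>F \<epsilon> in at_right (0::real). cmod (L i - L j) \<le> K * (1 / real (Suc i)) + K * (1 / real (Suc j)) + d"
      using near[OF one d, of i] near[OF one d, of j]
    proof eventually_elim
      case (elim \<epsilon>)
      have "cmod (L i - L j) \<le> cmod (I_eps 1 R \<phi> W \<epsilon> - L i) + cmod (I_eps 1 R \<phi> W \<epsilon> - L j)"
        using norm_triangle_ineq4[of "I_eps 1 R \<phi> W \<epsilon> - L j" "I_eps 1 R \<phi> W \<epsilon> - L i"] by simp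
      thus ?case using elim by simp
    qed
    thus "cmod (L i - L j) \<le> K * (1 / real (Suc i)) + K * (1 / real (Suc j)) + d"
      using eventually_happens' trivial_limit_at_right_real by blast
  qed
  have K0: "(\<lambda>j. K * (1 / real (Suc j))) \<longlonglongrightarrow> 0"
    using tendsto_mult_right_zero[OF LIMSEQ_inverse_real_of_nat, of K] by (simp add: inverse_eq_divide)
  have "Cauchy L"
  proof (rule metric_CauchyI)
    fix e :: real assume "e > 0"
    hence "\<forall>\<^sub>F j in sequentially. K * (1 / real (Suc j)) < e / 2" by (intro order_tendstoD(2)[OF K0]) simp
    then obtain M where M: "\<And>j. j \<ge> M \<Longrightarrow> K * (1 / real (Suc j)) < e / 2" by (auto simp: eventually_sequentially)
    have "dist (L i) (L j) < e" if "i \<ge> M" "j \<ge> M" for i j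
      using LL[of i j] M[OF that(1)] M[OF that(2)] unfolding dist_norm by linarith
    thus "\<exists>M. \<forall>m\<ge>M. \<forall>n\<ge>M. dist (L m) (L n) < e" by blast
  qed
  then obtain l where l: "L \<longlonglongrightarrow> l" using Cauchy_convergent convergent_def by blast
  have lim: "(I_eps \<sigma> R \<phi> W \<longlongrightarrow> l) (at_right 0)" if \<sigma>: "\<sigma> \<in> {1, -1}" for \<sigma>
  proof (rule tendstoI)
    fix e :: real assume e: "e > 0"
    have "\<forall>\<^sub>F j in sequentially. K * (1 / real (Suc j)) < e / 3 \<and> dist (L j) l < e / 3"
      using e by (intro eventually_conj order_tendstoD(2)[OF K0] tendstoD[OF l]) auto
    then obtain j where j: "K * (1 / real (Suc j)) < e / 3" "dist (L j) l < e / 3"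
      using eventually_happens' sequentially_bot by blast
    have "e / 3 > 0" using e by simp
    from near[OF \<sigma> this, of j] show "\<forall>\<^sub>F \<epsilon> in at_right 0. dist (I_eps \<sigma> R \<phi> W \<epsilon>) l < e"
    proof eventually_elim
      case (elim \<epsilon>)
      have "dist (I_eps \<sigma> R \<phi> W \<epsilon>) l \<le> dist (I_eps \<sigma> R \<phi> W \<epsilon>) (L j) + dist (L j) l" by (rule dist_triangle)
      thus ?case using elim j unfolding dist_norm by linarith
    qed
  qed
  have "I_converges \<sigma> R \<phi> W" if \<sigma>: "\<sigma> \<in> {1, -1}" for \<sigma>
  proof -
    have "\<bar>\<sigma>\<bar> = 1" using \<sigma> by auto
    thus ?thesis unfolding I_converges_def using I_eps_lincomb(1)[OF R W \<rho>(2) r\<phi> r\<phi>] lim[OF \<sigma>] by blast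
  qed
  moreover have "I_op \<sigma> R \<phi> W = l" if "\<sigma> \<in> {1, -1}" for \<sigma>
    unfolding I_op_def by (rule tendsto_Lim[OF _ lim[OF that]]) simp
  ultimately show ?thesis by simp
qed

theorem theorem89:
  fixes R :: real
  assumes "R > 0"
  shows
    "(\<forall>\<phi>\<in>discrete_series. \<forall>W\<in>HRplus.
        I_converges 1 R \<phi> W \<and> I_converges (- 1) R \<phi> W \<and> I_plus R \<phi> W = I_minus R \<phi> W) \<and>
     (\<forall>l m n :: real. ds_index l m n \<longrightarrow> (\<forall>\<sigma>\<in>{1, - 1}. \<forall>W\<in>HRplus.
        I_converges \<sigma> R (N_t_fun l n m) W \<and>
        (qN W \<le> R\<^sup>2 \<longrightarrow>
           I_op \<sigma> R (N_t_fun l n m) W = - N_t_fun l n m W) \<and>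
        (qN W \<ge> R\<^sup>2 \<longrightarrow>
           I_op \<sigma> R (N_t_fun l n m) W
             = - complex_of_real (R powr (- 2 * (2 * l + 1))) * t_fun l n m W) \<and>
        I_converges \<sigma> R (t_fun l n m) W \<and>
        (qN W \<le> R\<^sup>2 \<longrightarrow>
           I_op \<sigma> R (t_fun l n m) W
             = complex_of_real (R powr (2 * (2 * l + 1))) * N_t_fun l n m W) \<and>
        (qN W \<ge> R\<^sup>2 \<longrightarrow>
           I_op \<sigma> R (t_fun l n m) W = t_fun l n m W)))"
proof (intro conjI ballI allI impI)
  show "I_converges 1 R \<phi> W" "I_converges (- 1) R \<phi> W" "I_plus R \<phi> W = I_minus R \<phi> W"
    if "\<phi> \<in> discrete_series" "W \<in> HRplus" for \<phi> W
    using I_op_discrete_series[OF assms that(2,1)] by blast+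
qed (use I_op_generators[OF assms] in auto)

end
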